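(* Let $p_0\in(2,\infty]$, let $\omega_0\in L^{p_0}_c(\mathbb{R}^2)$ and let $\mu\in\mathcal{BM}_c(\mathbb{R}^2)$. Then there exists a global weak solution $(u,\omega)$, with $\omega\in L^\infty(\mathbb{R}_+;L^1\cap L^{p_0}(\mathbb{R}^2))$ and $u=K_{\mathbb{R}^2}[\omega+\mu]\in L^p_{\mathrm{loc}}(\mathbb{R}_+\times\mathbb{R}^2)$ for every $p\in[1,2)$, of the system $$\begin{cases}\partial_t\omega+u\cdot\nabla\omega=0&\text{in }(0,\infty)\times\mathbb{R}^2,\\ \operatorname{div}u=0&\text{in }[0,\infty)\times\mathbb{R}^2,\\ \operatorname{curl}u=\omega+\mu&\text{in }[0,\infty)\times\mathbb{R}^2,\\ \lim_{|x|\to\infty}|u|=0&\text{for }t\in[0,\infty),\\ \omega(0,x)=\omega_0(x)&\text{in }\mathbb{R}^2.\end{cases}$$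
   Context: Notation. $\mathbb{R}_+=[0,\infty)$; $(a,b)^\perp=(-b,a)$; $\operatorname{curl}u=\partial_1u_2-\partial_2u_1$. $L^{p}_c(\mathbb{R}^2)$ is the set of compactly supported functions in $L^p(\mathbb{R}^2)$, and $\mathcal{BM}_c(\mathbb{R}^2)$ is the set of compactly supported bounded real Radon measures on $\mathbb{R}^2$. For a function or bounded measure $\nu$, $K_{\mathbb{R}^2}[\nu]=\frac1{2\pi}\frac{x^\perp}{|x|^2}*\nu$ is the Biot–Savart law of the plane (applied at each fixed time $t$). Weak solution means: for every $\varphi\in C_c^\infty([0,\infty)\times\mathbb{R}^2)$, $$\int_0^\infty\!\int_{\mathbb{R}^2}\partial_t\varphi\,\omega\,dx\,dt+\int_0^\infty\!\int_{\mathbb{R}^2}\nabla\varphi\cdot u\,\omega\,dx\,dt+\int_{\mathbb{R}^2}\varphi(0,x)\omega_0(x)\,dx=0,$$ and $\operatorname{div}u=0$, $\operatorname{curl}u=\omega+\mu$ in the sense of distributions on $\mathbb{R}^2$, with $|u|\to0$ at infinity. *)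

theory Defs
  imports "HOL-Analysis.Analysis" "HOL-Probability.Essential_Supremum"
begin

type_synonym plane = "real ^ 2"

definition perp :: "plane \<Rightarrow> plane" where
  "perp x = vector [- (x $ 2), x $ 1]"


text \<open>Lebesgue spaces. The exponent ranges over \<open>(0, \<infinity>]\<close>; functions are representatives of
  classes modulo null sets, so a compact support means vanishing almost everywhere outside a
  compact set.\<close>

definition Lp_norm :: "ennreal \<Rightarrow> 'a measure \<Rightarrow> ('a \<Rightarrow> 'b::real_normed_vector) \<Rightarrow> ennreal" where
  "Lp_norm p M f =
     (if p = \<infinity> then esssup M (\<lambda>x. ennreal (norm (f x)))
      else let I = (\<integral>\<^sup>+ x. ennreal (norm (f x) powr enn2real p) \<partial>M)
           in if I = \<infinity> then \<infinity> else ennreal (enn2real I powr (1 / enn2real p)))"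

definition Lp :: "ennreal \<Rightarrow> 'a measure \<Rightarrow> ('a \<Rightarrow> 'b::real_normed_vector) set" where
  "Lp p M = {f. f \<in> borel_measurable M \<and> Lp_norm p M f < \<infinity>}"

definition Lp_compact :: "ennreal \<Rightarrow> ('a::euclidean_space \<Rightarrow> real) set" where
  "Lp_compact p = {f \<in> Lp p lebesgue. \<exists>K. compact K \<and> (AE x in lebesgue. x \<notin> K \<longrightarrow> f x = 0)}"

definition Lp_loc :: "ennreal \<Rightarrow> 'a::euclidean_space set \<Rightarrow> ('a \<Rightarrow> 'b::real_normed_vector) set" where
  "Lp_loc p S = {f. \<forall>K. compact K \<and> K \<subseteq> S \<longrightarrow> f \<in> Lp p (lebesgue_on K)}"

definition locally_integrable_on ::
    "('a::euclidean_space \<Rightarrow> 'b::euclidean_space) \<Rightarrow> 'a set \<Rightarrow> bool" where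
  "locally_integrable_on f S \<longleftrightarrow> (\<forall>K. compact K \<and> K \<subseteq> S \<longrightarrow> set_integrable lebesgue K f)"

abbreviation spacetime :: "(real \<times> plane) set" where
  "spacetime \<equiv> {0..} \<times> UNIV"

text \<open>Measurability is joint in time and space; for \<open>p = \<infinity>\<close> this is the usual (weak-star) reading
  of \<open>L\<^sup>\<infinity>(\<real>\<^sub>+; L\<^sup>\<infinity>)\<close>.\<close>

definition Linf_time_Lp :: "ennreal \<Rightarrow> (real \<Rightarrow> plane \<Rightarrow> real) set" where
  "Linf_time_Lp p = {w. (\<lambda>(t, x). w t x) \<in> borel_measurable (lebesgue_on spacetime) \<and>
     (\<exists>C<\<infinity>. AE t in lebesgue. 0 \<le> t \<longrightarrow> w t \<in> Lp p lebesgue \<and> Lp_norm p lebesgue (w t) \<le> C)}"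


text \<open>A bounded real Radon measure is a countably additive real-valued function on the Borel sets
  (on a Euclidean space, finite total variation and regularity are then automatic); values at
  non-Borel sets are irrelevant. Integrals against it are defined by the Jordan decomposition.
  In the next definition, \<^term>\<open>ennreal\<close> sends negative numbers to 0.\<close>

definition bounded_measures :: "('a::euclidean_space set \<Rightarrow> real) set" where
  "bounded_measures = {\<nu>. \<forall>A::nat \<Rightarrow> 'a set. range A \<subseteq> sets borel \<and> disjoint_family A
     \<longrightarrow> (\<lambda>n. \<nu> (A n)) sums \<nu> (\<Union>n. A n)}"

definition pos_part :: "('a::euclidean_space set \<Rightarrow> real) \<Rightarrow> 'a measure" where
  "pos_part \<nu> = measure_of UNIV (sets borel) (\<lambda>A. SUP B\<in>{B \<in> sets borel. B \<subseteq> A}. ennreal (\<nu> B))"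

text \<open>The set function above is a measure, so \<open>measure_of\<close> does not degenerate to the null
  measure.\<close>

lemma bounded_measures_sums:
  assumes "\<nu> \<in> bounded_measures" "range A \<subseteq> sets borel" "disjoint_family (A :: nat \<Rightarrow> _)"
  shows "(\<lambda>n. \<nu> (A n)) sums \<nu> (\<Union>n. A n)"
  using assms unfolding bounded_measures_def by blast

lemma bounded_measures_empty:
  assumes "\<nu> \<in> bounded_measures"
  shows "\<nu> {} = 0"
proof -
  have "(\<lambda>n::nat. \<nu> {}) sums \<nu> (\<Union>n::nat. {})"
    by (rule bounded_measures_sums[OF assms]) (auto simp: disjoint_family_on_def)
  then have "summable (\<lambda>n::nat. \<nu> {})"
    by (rule sums_summable)
  then show ?thesis
    by (simp add: summable_const_iff)
qed

lemma emeasure_pos_part: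
  assumes \<nu>: "\<nu> \<in> bounded_measures" and A: "A \<in> sets borel"
  shows "emeasure (pos_part \<nu>) A = (SUP B\<in>{B \<in> sets borel. B \<subseteq> A}. ennreal (\<nu> B))"
proof -
  let ?m = "\<lambda>A. SUP B\<in>{B \<in> sets borel. B \<subseteq> A}. ennreal (\<nu> B)"
  have S: "sets (pos_part \<nu>) = sets borel"
    unfolding pos_part_def using sets.sigma_sets_eq[of "borel :: 'a measure"]
    by (simp add: sets_measure_of)
  have P: "positive (sets borel) ?m"
    using bounded_measures_empty[OF \<nu>] by (auto simp: positive_def bot_ennreal cong: conj_cong)
  have C: "countably_additive (sets borel) ?m"
  proof (rule countably_additiveI)
    fix A :: "nat \<Rightarrow> 'a set"
    assume A: "range A \<subseteq> sets borel" and dis: "disjoint_family A"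
    define U where "U = (\<Union>i. A i)"
    let ?I = "{B \<in> sets borel. B \<subseteq> U}"
    have An: "A n \<in> sets borel" "A n \<subseteq> U" for n
      using A by (auto simp: U_def)
    have disj: "m = n" if "x \<in> A m" "x \<in> A n" for m n x
      using dis that unfolding disjoint_family_on_def by blast
    have split: "(\<lambda>n. \<nu> (C \<inter> A n)) sums \<nu> C" if "C \<in> ?I" for C
    proof -
      have "(\<lambda>n. \<nu> (C \<inter> A n)) sums \<nu> (\<Union>n. C \<inter> A n)"
        using that An by (intro bounded_measures_sums[OF \<nu>])
          (auto simp: disjoint_family_on_def dest: disj)
      moreover have "(\<Union>n. C \<inter> A n) = C"
        using that by (auto simp: U_def)
      ultimately show ?thesis by simp
    qed
    have cut: "(\<Union>i\<in>N. E i \<inter> A i) \<inter> A n = (if n \<in> N then E n \<inter> A n else {})" for N E n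
      by (auto dest: disj)
    have local: "?m (A n) = (SUP C\<in>?I. ennreal (\<nu> (C \<inter> A n)))" for n
    proof (rule antisym)
      show "?m (A n) \<le> (SUP C\<in>?I. ennreal (\<nu> (C \<inter> A n)))"
      proof (rule SUP_least)
        fix B assume "B \<in> {B \<in> sets borel. B \<subseteq> A n}"
        then have "B \<in> ?I" "B \<inter> A n = B" using An[of n] by auto
        then show "ennreal (\<nu> B) \<le> (SUP C\<in>?I. ennreal (\<nu> (C \<inter> A n)))"
          by (intro SUP_upper2[of B]) auto
      qed
      show "(SUP C\<in>?I. ennreal (\<nu> (C \<inter> A n))) \<le> ?m (A n)"
        using An[of n] by (intro SUP_least SUP_upper) auto
    qed
    have "(\<Sum>n. ?m (A n)) = (\<Sum>n. SUP C\<in>?I. ennreal (\<nu> (C \<inter> A n)))"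
      by (simp only: local)
    also have "\<dots> = (SUP C\<in>?I. \<Sum>n. ennreal (\<nu> (C \<inter> A n)))"
    proof (rule ennreal_suminf_SUP_eq_directed)
      fix N :: "nat set" and C D assume CD: "C \<in> ?I" "D \<in> ?I"
      define E where "E n = (if \<nu> (D \<inter> A n) \<le> \<nu> (C \<inter> A n) then C else D)" for n
      have "(\<Union>i. E i \<inter> A i) \<in> ?I"
        using CD An unfolding E_def by (auto intro!: sets.countable_UN)
      moreover have "\<nu> (C \<inter> A n) \<le> \<nu> (E n \<inter> A n) \<and> \<nu> (D \<inter> A n) \<le> \<nu> (E n \<inter> A n)" for n
        by (auto simp: E_def)
      ultimately show "\<exists>K\<in>?I. \<forall>n\<in>N. ennreal (\<nu> (C \<inter> A n)) \<le> ennreal (\<nu> (K \<inter> A n)) \<and>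
          ennreal (\<nu> (D \<inter> A n)) \<le> ennreal (\<nu> (K \<inter> A n))"
        by (intro bexI[of _ "\<Union>i. E i \<inter> A i"]) (simp_all add: cut ennreal_leI)
    qed
    also have "\<dots> = ?m U"
    proof (rule antisym)
      show "(SUP C\<in>?I. \<Sum>n. ennreal (\<nu> (C \<inter> A n))) \<le> ?m U"
      proof (rule SUP_least)
        fix C assume C: "C \<in> ?I"
        define N where "N = {n. 0 \<le> \<nu> (C \<inter> A n)}"
        define D where "D = (\<Union>i\<in>N. C \<inter> A i)"
        have D: "D \<in> ?I"
          using C An unfolding D_def by (auto intro!: sets.countable_UN')
        have *: "D \<inter> A n = (if n \<in> N then C \<inter> A n else {})" for n
          unfolding D_def by (rule cut)
        have nn: "0 \<le> \<nu> (D \<inter> A n)" for n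
          by (simp add: * N_def bounded_measures_empty[OF \<nu>])
        have "(\<Sum>n. ennreal (\<nu> (C \<inter> A n))) = (\<Sum>n. ennreal (\<nu> (D \<inter> A n)))"
          by (intro suminf_cong) (simp add: * N_def bounded_measures_empty[OF \<nu>] ennreal_neg)
        also have "\<dots> = ennreal (\<nu> D)"
          by (rule suminf_ennreal_eq[OF nn split[OF D]])
        also have "\<dots> \<le> ?m U"
          using D by (rule SUP_upper)
        finally show "(\<Sum>n. ennreal (\<nu> (C \<inter> A n))) \<le> ?m U" .
      qed
      show "?m U \<le> (SUP C\<in>?I. \<Sum>n. ennreal (\<nu> (C \<inter> A n)))"
      proof (rule SUP_mono)
        fix C assume C: "C \<in> ?I"
        have "ennreal (\<nu> C) \<le> (\<Sum>n. ennreal (\<nu> (C \<inter> A n)))"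
        proof (rule LIMSEQ_le)
          show "(\<lambda>n. ennreal (\<Sum>i<n. \<nu> (C \<inter> A i))) \<longlonglongrightarrow> ennreal (\<nu> C)"
            using split[OF C] unfolding sums_def by (intro tendsto_ennrealI)
          show "(\<lambda>n. \<Sum>i<n. ennreal (\<nu> (C \<inter> A i))) \<longlonglongrightarrow> (\<Sum>n. ennreal (\<nu> (C \<inter> A n)))"
            by (intro summable_LIMSEQ) simp
          have "ennreal (\<Sum>i<n. \<nu> (C \<inter> A i)) \<le> (\<Sum>i<n. ennreal (\<nu> (C \<inter> A i)))" for n
          proof -
            have "ennreal (\<Sum>i<n. \<nu> (C \<inter> A i)) \<le> ennreal (\<Sum>i<n. max 0 (\<nu> (C \<inter> A i)))"
              by (intro ennreal_leI sum_mono) simp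
            also have "\<dots> = (\<Sum>i<n. ennreal (max 0 (\<nu> (C \<inter> A i))))"
              by (rule sum_ennreal[symmetric]) simp
            also have "\<dots> = (\<Sum>i<n. ennreal (\<nu> (C \<inter> A i)))"
              by (intro sum.cong) (auto simp: max_def ennreal_neg)
            finally show ?thesis .
          qed
          then show "\<exists>N. \<forall>n\<ge>N. ennreal (\<Sum>i<n. \<nu> (C \<inter> A i)) \<le> (\<Sum>i<n. ennreal (\<nu> (C \<inter> A i)))"
            by blast
        qed
        with C show "\<exists>D\<in>?I. ennreal (\<nu> C) \<le> (\<Sum>n. ennreal (\<nu> (D \<inter> A n)))"
          by blast
      qed
    qed
    finally show "(\<Sum>n. ?m (A n)) = ?m (\<Union>i. A i)"
      by (simp add: U_def)
  qed
  show ?thesis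
    by (rule emeasure_measure_of[OF pos_part_def]) (use P C A S in auto)
qed

definition neg_part :: "('a::euclidean_space set \<Rightarrow> real) \<Rightarrow> 'a measure" where
  "neg_part \<nu> = pos_part (\<lambda>A. - \<nu> A)"

definition signed_integrable ::
    "('a::euclidean_space set \<Rightarrow> real) \<Rightarrow> ('a \<Rightarrow> 'b::euclidean_space) \<Rightarrow> bool" where
  "signed_integrable \<nu> f \<longleftrightarrow> integrable (pos_part \<nu>) f \<and> integrable (neg_part \<nu>) f"

definition signed_integral ::
    "('a::euclidean_space set \<Rightarrow> real) \<Rightarrow> ('a \<Rightarrow> 'b::euclidean_space) \<Rightarrow> 'b" where
  "signed_integral \<nu> f = (LINT x|pos_part \<nu>. f x) - (LINT x|neg_part \<nu>. f x)"

definition bounded_measures_compact :: "('a::euclidean_space set \<Rightarrow> real) set" where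
  "bounded_measures_compact =
     {\<nu> \<in> bounded_measures. \<exists>K. compact K \<and> (\<forall>A\<in>sets borel. A \<inter> K = {} \<longrightarrow> \<nu> A = 0)}"

text \<open>The bounded measure \<open>f dx + \<nu>\<close>, for integrable \<open>f\<close>.\<close>

definition density_plus ::
    "('a::euclidean_space \<Rightarrow> real) \<Rightarrow> ('a set \<Rightarrow> real) \<Rightarrow> ('a set \<Rightarrow> real)" where
  "density_plus f \<nu> = (\<lambda>A. (LINT x:A|lebesgue. f x) + \<nu> A)"


text \<open>The Biot--Savart law of the plane. At the points where the integral does not converge
  absolutely the value of \<open>biot_savart\<close> is meaningless, so \<open>is_biot_savart\<close> includes absolute
  convergence almost everywhere.\<close>

definition biot_savart_kernel :: "plane \<Rightarrow> plane" where
  "biot_savart_kernel z = (1 / (2 * pi)) *\<^sub>R (perp z /\<^sub>R (norm z)\<^sup>2)"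

definition biot_savart :: "(plane set \<Rightarrow> real) \<Rightarrow> plane \<Rightarrow> plane" where
  "biot_savart \<nu> x = signed_integral \<nu> (\<lambda>y. biot_savart_kernel (x - y))"

definition is_biot_savart :: "(plane \<Rightarrow> plane) \<Rightarrow> (plane set \<Rightarrow> real) \<Rightarrow> bool" where
  "is_biot_savart v \<nu> \<longleftrightarrow>
     (AE x in lebesgue. signed_integrable \<nu> (\<lambda>y. biot_savart_kernel (x - y)) \<and> v x = biot_savart \<nu> x)"


text \<open>Smoothness on a set \<open>S\<close> is meant up to the boundary; it is used only for convex \<open>S\<close> with
  nonempty interior, where derivatives within \<open>S\<close> are unique. The functions \<open>f' b\<close> are the
  partial derivatives.\<close>

primrec Ck_on :: "nat \<Rightarrow> 'a::euclidean_space set \<Rightarrow> ('a \<Rightarrow> real) \<Rightarrow> bool" where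
  "Ck_on 0 S f \<longleftrightarrow> continuous_on S f"
| "Ck_on (Suc k) S f \<longleftrightarrow> (\<exists>f' :: 'a \<Rightarrow> 'a \<Rightarrow> real.
     (\<forall>x\<in>S. (f has_derivative (\<lambda>h. \<Sum>b\<in>Basis. (h \<bullet> b) * f' b x)) (at x within S)) \<and>
     (\<forall>b\<in>Basis. Ck_on k S (f' b)))"

definition test_functions :: "'a::euclidean_space set \<Rightarrow> ('a \<Rightarrow> real) set" where
  "test_functions S = {\<phi>. (\<forall>k. Ck_on k S \<phi>) \<and> (\<exists>K. compact K \<and> K \<subseteq> S \<and> (\<forall>x\<in>S - K. \<phi> x = 0))}"

definition grad :: "(plane \<Rightarrow> real) \<Rightarrow> plane \<Rightarrow> plane" where
  "grad \<psi> x = (\<chi> i. deriv (\<lambda>s. \<psi> (x + s *\<^sub>R axis i 1)) 0)"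

definition distr_div_free :: "(plane \<Rightarrow> plane) \<Rightarrow> bool" where
  "distr_div_free v \<longleftrightarrow> locally_integrable_on v UNIV \<and>
     (\<forall>\<psi>\<in>test_functions UNIV. (LINT x|lebesgue. v x \<bullet> grad \<psi> x) = 0)"

definition distr_curl_eq :: "(plane \<Rightarrow> plane) \<Rightarrow> (plane set \<Rightarrow> real) \<Rightarrow> bool" where
  "distr_curl_eq v \<nu> \<longleftrightarrow> locally_integrable_on v UNIV \<and>
     (\<forall>\<psi>\<in>test_functions UNIV.
        - (LINT x|lebesgue. v x $ 2 * grad \<psi> x $ 1 - v x $ 1 * grad \<psi> x $ 2) = signed_integral \<nu> \<psi>)"

definition weak_transport ::
    "(plane \<Rightarrow> real) \<Rightarrow> (real \<Rightarrow> plane \<Rightarrow> plane) \<Rightarrow> (real \<Rightarrow> plane \<Rightarrow> real) \<Rightarrow> bool" where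
  "weak_transport \<omega>0 u \<omega> \<longleftrightarrow>
     locally_integrable_on (\<lambda>(t, x). \<omega> t x) spacetime \<and>
     locally_integrable_on (\<lambda>(t, x). \<omega> t x *\<^sub>R u t x) spacetime \<and>
     (\<forall>\<phi>\<in>test_functions spacetime.
        (LINT t:{0..}|lebesgue. LINT x|lebesgue. deriv (\<lambda>s. \<phi> (s, x)) t * \<omega> t x) +
        (LINT t:{0..}|lebesgue. LINT x|lebesgue. (grad (\<lambda>y. \<phi> (t, y)) x \<bullet> u t x) * \<omega> t x) +
        (LINT x|lebesgue. \<phi> (0, x) * \<omega>0 x) = 0)"

text \<open>The integrability of \<open>\<omega> t\<close> for every \<open>t\<close> makes \<open>\<omega> t dx + \<mu>\<close> a bounded measure at every
  time.\<close>

definition weak_solution ::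
    "(plane \<Rightarrow> real) \<Rightarrow> (plane set \<Rightarrow> real) \<Rightarrow>
     (real \<Rightarrow> plane \<Rightarrow> plane) \<Rightarrow> (real \<Rightarrow> plane \<Rightarrow> real) \<Rightarrow> bool" where
  "weak_solution \<omega>0 \<mu> u \<omega> \<longleftrightarrow>
     weak_transport \<omega>0 u \<omega> \<and>
     (\<forall>t\<ge>0. integrable lebesgue (\<omega> t) \<and>
        distr_div_free (u t) \<and>
        distr_curl_eq (u t) (density_plus (\<omega> t) \<mu>) \<and>
        ((\<lambda>x. norm (u t x)) \<longlongrightarrow> 0) at_infinity)"

end

theory Submission
 imports Defs "HOL-Complex_Analysis.Great_Picard" "HOL-Probability.Distributions" "HOL-Real_Asymp.Real_Asymp"
begin

text \<open>The solution is the limit of a finite difference scheme. In one step of a Lax--Friedrichs scheme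
 the new vorticity at a point is a convex combination of the old vorticity at the four neighbours,
 and because the discrete velocity is exactly divergence free the weights are doubly stochastic.
 Hence every \<open>L\<^sup>r\<close> norm of the initial vorticity, including the supremum, bounds all later ones
 (\<open>doubly_stochastic_powr\<close>, \<open>step_powr\<close>, \<open>step_sup\<close>). The advecting velocity is the Biot--Savart
 velocity of vorticity plus \<open>\<mu>\<close>, with a kernel \<open>Ke e\<close> regularised at scale \<open>e\<close>; the mesh, the time
 step and the numerical viscosity vanish with \<open>e\<close>.

 Write the velocity as \<open>V + P\<close>, where \<open>V\<close> comes from the vorticity and \<open>P\<close> from \<open>\<mu>\<close>. Since \<open>p > 2\<close>,
 the potential of \<open>|\<omega>|\<close> with kernel \<open>1/|z|\<close> is bounded uniformly (\<open>potential_bound\<close>). By Tonelli the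
 product \<open>\<omega> P\<close> is then integrable with a bound that does not see how singular \<open>\<mu>\<close> is
 (\<open>pairing_le\<close>, \<open>pair_vel\<close>), although \<open>P\<close> alone lies only in \<open>L\<^sup>q\<^sub>l\<^sub>o\<^sub>c\<close> with \<open>q < 2\<close>. These bounds control
 the time variation of the vorticity against smooth functions, so the approximate \<open>V\<close> are
 asymptotically equicontinuous and converge locally uniformly along a subsequence
 (\<open>U_subsequence\<close>). The part \<open>P\<close> does not depend on time.

 Once \<open>V\<close> is replaced by its limit the weak formulation is affine in the vorticity. Convex
 combinations of the approximate vorticities therefore still satisfy it in the limit, and they can
 be chosen to converge strongly in \<open>L\<^sup>2\<close> (\<open>convex_combinations_Cauchy\<close>, \<open>om_limit\<close>). The limit
 vorticity has velocity \<open>V\<close> (\<open>limit_velocity\<close>) and solves the transport equation (\<open>weak_limit\<close>).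

 The linear constraints hold at each time separately. The divergence and the curl of the kernel are
 computed from its regularisations (\<open>kernel_div_curl\<close>) and integrated against the vorticity and
 against \<open>\<mu>\<close>, which is split by the Jordan decomposition (\<open>vel_constraints\<close>). Decay at infinity
 uses the integrability of the vorticity and the compact support of \<open>\<mu>\<close>.\<close>

section \<open>Translations, reflections and radial integrals in the plane\<close>

lemma nn_integral_shift:
 fixes f :: "'a::euclidean_space \<Rightarrow> ennreal"
 assumes [measurable]: "f \<in> borel_measurable borel"
 shows "(\<integral>\<^sup>+x. f (x + a) \<partial>lborel) = (\<integral>\<^sup>+x. f x \<partial>lborel)"
 by (subst (2) lborel_distr_plus[of a, symmetric]) (simp add: nn_integral_distr add.commute)

lemma integrable_shift:
 fixes f :: "'a::euclidean_space \<Rightarrow> 'b::euclidean_space"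
 assumes "integrable lborel f"
 shows "integrable lborel (\<lambda>x. f (x + a))"
proof -
 have [measurable]: "f \<in> borel_measurable borel"
  using borel_measurable_integrable[OF assms] by simp
 show ?thesis
  using assms unfolding integrable_iff_bounded
  using nn_integral_shift[of "\<lambda>x. ennreal (norm (f x))" a] by simp
qed

lemma integral_shift:
 fixes f :: "'a::euclidean_space \<Rightarrow> 'b::euclidean_space"
 assumes [measurable]: "f \<in> borel_measurable borel"
 shows "(LINT x|lborel. f (x + a)) = (LINT x|lborel. f x)"
 by (subst (2) lborel_distr_plus[of a, symmetric]) (simp add: integral_distr add.commute)

lemma nn_integral_reflect:
 fixes f :: "'a::euclidean_space \<Rightarrow> ennreal"
 assumes [measurable]: "f \<in> borel_measurable borel"
 shows "(\<integral>\<^sup>+y. f (x - y) \<partial>lborel) = (\<integral>\<^sup>+y. f y \<partial>lborel)"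
proof -
 have "(\<integral>\<^sup>+y. f y \<partial>lborel) = (\<integral>\<^sup>+y. f y \<partial>(density (distr lborel borel (\<lambda>y. x + (-1) *\<^sub>R y)) (\<lambda>_. ennreal (\<bar>-1\<bar>^DIM('a)))))"
  using lborel_affine[of "-1" x] by simp
 also have "\<dots> = (\<integral>\<^sup>+y. f (x - y) \<partial>lborel)"
  by (simp add: density_1 nn_integral_distr)
 finally show ?thesis by simp
qed

lemma norm_plane: "(norm (z::plane))\<^sup>2 = (z $ 1)\<^sup>2 + (z $ 2)\<^sup>2"
 by (simp add: norm_vec_def L2_set_def UNIV_2)

lemma perp_nth [simp]: "perp z $ 1 = - (z $ 2)" "perp z $ 2 = z $ 1"
 by (simp_all add: perp_def)

lemma norm_perp [simp]: "norm (perp z) = norm z"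
proof -
 have "(norm (perp z))\<^sup>2 = (norm z)\<^sup>2" by (simp add: norm_plane)
 then show ?thesis by simp
qed

lemma inner_plane: "(x::plane) \<bullet> y = x $ 1 * y $ 1 + x $ 2 * y $ 2"
 by (simp add: inner_vec_def UNIV_2)

lemma plane_eq_iff: "(x::plane) = y \<longleftrightarrow> x $ 1 = y $ 1 \<and> x $ 2 = y $ 2"
 by (simp add: vec_eq_iff forall_2)

lemma perp_diff: "perp x - perp y = perp (x - y)"
 by (simp add: plane_eq_iff)

lemma continuous_on_perp [continuous_intros]:
 assumes "continuous_on S f" shows "continuous_on S (\<lambda>x. perp (f x))"
proof -
 have "perp z = - (z $ 2) *\<^sub>R axis 1 1 + (z $ 1) *\<^sub>R axis 2 1" for z
  by (simp add: plane_eq_iff axis_def)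
 then show ?thesis using assms by (simp only:) (intro continuous_intros)
qed

text \<open>The area of a disc is proportional to its squared radius, so \<open>|z|\<^sup>2\<close> is distributed like a multiple
 of Lebesgue measure on the half-line. This takes the place of polar coordinates.\<close>

lemma distr_norm_sq:
 "distr lborel borel (\<lambda>z::plane. (norm z)\<^sup>2) = density lborel (\<lambda>s. ennreal pi * indicator {0..} s)"
proof (rule measure_eqI_generator_eq[where E="range atMost" and \<Omega>=UNIV and A="\<lambda>n. {..real n}"])
 show "Int_stable (range atMost :: real set set)"
  by (auto simp: Int_stable_def)
 fix X :: "real set" assume "X \<in> range atMost"
 then obtain s where X: "X = {..s}" by auto
 have V: "(\<lambda>z::plane. (norm z)\<^sup>2) -` X = (if s \<ge> 0 then cball 0 (sqrt s) else {})"
  by (auto simp: X real_le_rsqrt sqrt_ge_absD intro: order_trans[of 0])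
   (smt (verit) real_le_rsqrt real_sqrt_le_iff real_sqrt_pow2 real_sqrt_unique zero_le_power2 norm_ge_zero)+
 have "emeasure (distr lborel borel (\<lambda>z::plane. (norm z)\<^sup>2)) X = emeasure lborel (if s \<ge> 0 then cball 0 (sqrt s) else {} :: plane set)"
  by (subst emeasure_distr) (auto simp: V, auto simp: X)
 also have "\<dots> = ennreal (if s \<ge> 0 then pi * s else 0)"
  by (simp add: emeasure_cball unit_ball_vol_2)
 also have "\<dots> = emeasure (density lborel (\<lambda>s. ennreal pi * indicator {0..} s)) X"
 proof -
  have "emeasure (density lborel (\<lambda>s. ennreal pi * indicator {0..} s)) X = (\<integral>\<^sup>+x. ennreal pi * indicator {0..s} x \<partial>lborel)"
   unfolding X by (subst emeasure_density) (auto intro!: nn_integral_cong split: split_indicator)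
  also have "\<dots> = ennreal pi * emeasure lborel {0..s}"
   by (subst nn_integral_cmult_indicator) auto
  finally show ?thesis by (auto simp: ennreal_mult)
 qed
 finally show "emeasure (distr lborel borel (\<lambda>z::plane. (norm z)\<^sup>2)) X = emeasure (density lborel (\<lambda>s. ennreal pi * indicator {0..} s)) X" .
next
 fix i :: nat
 have V: "(\<lambda>z::plane. (norm z)\<^sup>2) -` {..real i} \<subseteq> cball 0 (sqrt (real i))"
  by (auto simp: real_le_rsqrt)
 have "emeasure (distr lborel borel (\<lambda>z::plane. (norm z)\<^sup>2)) {..real i} \<le> emeasure lborel (cball 0 (sqrt (real i)) :: plane set)"
  by (subst emeasure_distr) (use V in \<open>auto intro!: emeasure_mono\<close>)
 also have "\<dots> < \<infinity>" by (rule emeasure_lborel_cball_finite)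
 finally show "emeasure (distr lborel borel (\<lambda>z::plane. (norm z)\<^sup>2)) {..real i} \<noteq> \<infinity>" by simp
next
 show "(\<Union>i. {..real i}) = UNIV" using real_arch_simple by auto
qed (auto simp: borel_eq_atMost)

lemma nn_integral_radial:
 fixes f :: "real \<Rightarrow> ennreal"
 assumes [measurable]: "f \<in> borel_measurable borel"
 shows "(\<integral>\<^sup>+z. f ((norm (z::plane))\<^sup>2) \<partial>lborel) = ennreal pi * (\<integral>\<^sup>+s. f s * indicator {0..} s \<partial>lborel)"
proof -
 have "(\<integral>\<^sup>+z. f ((norm (z::plane))\<^sup>2) \<partial>lborel) = (\<integral>\<^sup>+s. f s \<partial>distr lborel borel (\<lambda>z::plane. (norm z)\<^sup>2))"
  by (subst nn_integral_distr) auto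
 also have "\<dots> = (\<integral>\<^sup>+s. ennreal pi * (f s * indicator {0..} s) \<partial>lborel)"
  unfolding distr_norm_sq by (subst nn_integral_density) (auto simp: mult_ac)
 finally show ?thesis by (simp add: nn_integral_cmult)
qed

lemma nn_integral_inverse_power_cball:
 assumes q: "0 < q" "q < 2" and r: "0 < r"
 shows "(\<integral>\<^sup>+z. ennreal (norm (z::plane) powr (- q)) * indicator (cball 0 r) z \<partial>lborel) =
  ennreal (pi * (r powr (2 - q) / (1 - q / 2)))"
proof -
 have *: "ennreal (norm (z::plane) powr (- q)) * indicator (cball 0 r) z =
  (\<lambda>s. ennreal (s powr (- q / 2)) * indicator {0..r\<^sup>2} s) ((norm z)\<^sup>2)" for z
 proof -
  have "norm z powr (-q) = ((norm z)\<^sup>2) powr (- q / 2)"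
  proof (cases "z = 0")
   case False
   then have "((norm z)\<^sup>2) powr (- q / 2) = (norm z powr 2) powr (- q / 2)" by (simp add: powr_numeral)
   also have "\<dots> = norm z powr (-q)" by (subst powr_powr) simp
   finally show ?thesis by simp
  qed simp
  moreover have "norm z \<le> r \<longleftrightarrow> (norm z)\<^sup>2 \<le> r\<^sup>2" using r by (simp add: abs_le_square_iff[symmetric])
  ultimately show ?thesis by (auto split: split_indicator)
 qed
 have "(\<integral>\<^sup>+z. ennreal (norm (z::plane) powr (- q)) * indicator (cball 0 r) z \<partial>lborel)
   = ennreal pi * (\<integral>\<^sup>+s. ennreal (s powr (- q / 2)) * indicator {0..r\<^sup>2} s * indicator {0..} s \<partial>lborel)"
  unfolding * by (subst nn_integral_radial) auto
 also have "(\<integral>\<^sup>+s. ennreal (s powr (- q / 2)) * indicator {0..r\<^sup>2} s * indicator {0..} s \<partial>lborel)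
  = (\<integral>\<^sup>+s. indicator {0..r\<^sup>2} s * ennreal (s powr (- q / 2)) \<partial>lborel)"
  by (intro nn_integral_cong) (auto split: split_indicator)
 also have "\<dots> = (\<integral>\<^sup>+s. ennreal (indicator {0..r\<^sup>2} s * s powr (- q / 2)) \<partial>lborel)"
  by (intro nn_integral_cong) (auto split: split_indicator)
 also have "\<dots> = ennreal ((r\<^sup>2) powr (- q / 2 + 1) / (- q / 2 + 1))"
  by (rule nn_integral_has_integral_lebesgue) (use q has_integral_powr_from_0[of "-q/2" "r\<^sup>2"] in auto)
 also have "(r\<^sup>2) powr (- q / 2 + 1) = r powr (2 - q)"
 proof -
  have "(r\<^sup>2) powr (- q / 2 + 1) = (r powr 2) powr (-q/2 + 1)" using r by (simp add: powr_numeral)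
  also have "\<dots> = r powr (2 - q)" by (subst powr_powr) (simp add: algebra_simps)
  finally show ?thesis .
 qed
 finally show ?thesis using q by (simp add: ennreal_mult[symmetric] add.commute)
qed

section \<open>The regularised kernel\<close>

text \<open>Adding \<open>e\<^sup>2\<close> to the denominator keeps the kernel a rotated gradient, and hence divergence free,
 and keeps it below \<open>1/|z|\<close> uniformly in \<open>e\<close>.\<close>

definition Ke :: "real \<Rightarrow> plane \<Rightarrow> plane" where
 "Ke e z = (1 / (2 * pi)) *\<^sub>R (perp z /\<^sub>R ((norm z)\<^sup>2 + e\<^sup>2))"

lemma Ke_0: "Ke 0 = biot_savart_kernel"
 by (simp add: Ke_def biot_savart_kernel_def fun_eq_iff)

lemma Ke_alt: "Ke e z = (1 / (2 * pi) * (1 / ((norm z)\<^sup>2 + e\<^sup>2))) *\<^sub>R perp z"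
 unfolding Ke_def scaleR_scaleR by (simp only: inverse_eq_divide)

lemma Ke_zero [simp]: "Ke e 0 = 0"
proof -
 have "perp 0 = 0" by (simp add: plane_eq_iff)
 then show ?thesis by (simp add: Ke_def)
qed

lemma Ke_diff_alt: "Ke e z - Ke e' z = (1 / (2 * pi) * (1 / ((norm z)\<^sup>2 + e\<^sup>2) - 1 / ((norm z)\<^sup>2 + e'\<^sup>2))) *\<^sub>R perp z"
 unfolding Ke_alt by (simp only: scaleR_left_diff_distrib[symmetric] right_diff_distrib)

lemma borel_measurable_perp [measurable]: "perp \<in> borel_measurable borel"
 by (intro borel_measurable_continuous_onI continuous_intros)

lemma borel_measurable_Ke [measurable]: "Ke e \<in> borel_measurable borel"
 unfolding Ke_def by measurable

lemma two_pi_ge: "2 * pi \<ge> 6"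
 using pi_gt3 by simp

lemma norm_Ke: "norm (Ke e z) = norm z / (2 * pi * ((norm z)\<^sup>2 + e\<^sup>2))"
 by (simp add: Ke_alt abs_mult)

lemma norm_Ke_le: "norm (Ke e z) \<le> 1 / norm z"
proof (cases "z = 0")
 case False
 have "norm z * norm z \<le> 2 * pi * ((norm z)\<^sup>2 + e\<^sup>2)"
 proof -
  have "norm z * norm z \<le> 1 * ((norm z)\<^sup>2 + e\<^sup>2)" by (simp add: power2_eq_square)
  also have "\<dots> \<le> 2 * pi * ((norm z)\<^sup>2 + e\<^sup>2)" using two_pi_ge by (intro mult_right_mono) auto
  finally show ?thesis .
 qed
 moreover have "0 < 2 * pi * ((norm z)\<^sup>2 + e\<^sup>2)" using False by (simp add: add_pos_nonneg)
 ultimately show ?thesis unfolding norm_Ke using False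
  by (subst divide_le_eq) (auto simp: field_simps)
qed (simp add: norm_Ke)

lemma norm_Ke_bound:
 assumes "e > 0" shows "norm (Ke e z) \<le> 1 / e"
proof -
 have "2 * norm z * e \<le> (norm z)\<^sup>2 + e\<^sup>2" using sum_squares_bound[of "norm z" e] by simp
 then have "norm z * e \<le> 1 * ((norm z)\<^sup>2 + e\<^sup>2)"
  using mult_nonneg_nonneg[OF norm_ge_zero less_imp_le[OF assms], of z] by (simp only: mult.assoc mult_2 mult_1 ring_distribs)
 also have "\<dots> \<le> 2 * pi * ((norm z)\<^sup>2 + e\<^sup>2)" using two_pi_ge by (intro mult_right_mono) auto
 finally have "norm z * e \<le> 2 * pi * ((norm z)\<^sup>2 + e\<^sup>2)" .
 moreover have "0 < 2 * pi * ((norm z)\<^sup>2 + e\<^sup>2)" using assms by (simp add: add_nonneg_pos)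
 ultimately show ?thesis unfolding norm_Ke using assms
  by (subst divide_le_eq) (auto simp: field_simps)
qed

lemma norm_Ke_diff:
 shows "norm (Ke 0 z - Ke e z) \<le> e\<^sup>2 / (norm z)^3" "norm (Ke 0 z - Ke e z) \<le> 1 / norm z"
proof -
 show "norm (Ke 0 z - Ke e z) \<le> e\<^sup>2 / (norm z)^3"
 proof (cases "z = 0")
  case False
  then have p: "0 < (norm z)\<^sup>2" "0 < (norm z)\<^sup>2 + e\<^sup>2" by (auto simp: add_pos_nonneg)
  have "Ke 0 z - Ke e z = (1 / (2 * pi) * (1 / (norm z)\<^sup>2 - 1 / ((norm z)\<^sup>2 + e\<^sup>2))) *\<^sub>R perp z"
   using Ke_diff_alt[of 0 z e] by simp
  also have "1 / (norm z)\<^sup>2 - 1 / ((norm z)\<^sup>2 + e\<^sup>2) = e\<^sup>2 / ((norm z)\<^sup>2 * ((norm z)\<^sup>2 + e\<^sup>2))"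
   using p by (simp add: field_simps)
  finally have "norm (Ke 0 z - Ke e z) = 1 / (2 * pi) * (e\<^sup>2 / ((norm z)\<^sup>2 * ((norm z)\<^sup>2 + e\<^sup>2))) * norm z"
   by simp
  also have "\<dots> \<le> 1 * (e\<^sup>2 / ((norm z)\<^sup>2 * (norm z)\<^sup>2)) * norm z"
   using p two_pi_ge by (intro mult_right_mono mult_mono divide_left_mono) (auto simp: divide_simps)
  also have "\<dots> = e\<^sup>2 / (norm z)^3" using False by (simp add: field_simps power2_eq_square power3_eq_cube)
  finally show ?thesis .
 qed simp
 have "norm (Ke 0 z - Ke e z) \<le> norm (Ke 0 z)"
 proof (cases "z = 0")
  case False
  then have p: "0 < (norm z)\<^sup>2" "0 < (norm z)\<^sup>2 + e\<^sup>2" by (auto simp: add_pos_nonneg)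
  have "Ke 0 z - Ke e z = (e\<^sup>2 / ((norm z)\<^sup>2 + e\<^sup>2)) *\<^sub>R Ke 0 z"
  proof -
   have "1 / (norm z)\<^sup>2 - 1 / ((norm z)\<^sup>2 + e\<^sup>2) = e\<^sup>2 / ((norm z)\<^sup>2 + e\<^sup>2) * (1 / (norm z)\<^sup>2)"
    using p by (simp add: field_simps)
   moreover have "Ke 0 z - Ke e z = (1 / (2 * pi) * (1 / (norm z)\<^sup>2 - 1 / ((norm z)\<^sup>2 + e\<^sup>2))) *\<^sub>R perp z"
    using Ke_diff_alt[of 0 z e] by simp
   ultimately show ?thesis by (simp only: Ke_alt) simp
  qed
  then have "norm (Ke 0 z - Ke e z) = (e\<^sup>2 / ((norm z)\<^sup>2 + e\<^sup>2)) * norm (Ke 0 z)" by simp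
  also have "\<dots> \<le> 1 * norm (Ke 0 z)" using p by (intro mult_right_mono) (auto simp: divide_le_eq)
  finally show ?thesis by simp
 qed simp
 with norm_Ke_le[of 0 z] show "norm (Ke 0 z - Ke e z) \<le> 1 / norm z" by linarith
qed

lemma norm_Ke_lipschitz:
 assumes e: "e > 0" shows "norm (Ke e z - Ke e z') \<le> norm (z - z') / e\<^sup>2"
proof -
 define A where "A = (norm z)\<^sup>2 + e\<^sup>2"
 define B where "B = (norm z')\<^sup>2 + e\<^sup>2"
 have AB: "A > 0" "B > 0" "e\<^sup>2 \<le> A" "(norm z')\<^sup>2 \<le> B" "e\<^sup>2 > 0" using e by (auto simp: A_def B_def add_nonneg_pos)
 have gen: "(c * (1 / A)) *\<^sub>R u - (c * (1 / B)) *\<^sub>R v = c *\<^sub>R ((1 / A) *\<^sub>R (u - v) + (1 / A - 1 / B) *\<^sub>R v)"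
  for c and u v :: plane
  by (simp add: scaleR_diff_right scaleR_add_right scaleR_diff_left right_diff_distrib)
 have "Ke e z - Ke e z' = (1 / (2*pi)) *\<^sub>R ((1/A) *\<^sub>R perp (z - z') + (1/A - 1/B) *\<^sub>R perp z')"
  unfolding Ke_alt A_def[symmetric] B_def[symmetric]
  by (simp only: perp_diff[symmetric] gen)
 also have "1/A - 1/B = (norm z' - norm z) * (norm z + norm z') / (A * B)"
 proof -
  have "B - A = (norm z' - norm z) * (norm z + norm z')"
   by (simp add: A_def B_def algebra_simps power2_eq_square)
  moreover have "1/A - 1/B = (B - A) / (A * B)" using AB(1,2) by (simp add: field_simps)
  ultimately show ?thesis by simp
 qed
 finally have K: "Ke e z - Ke e z' = (1 / (2*pi)) *\<^sub>R ((1/A) *\<^sub>R perp (z - z') + ((norm z' - norm z) * (norm z + norm z') / (A * B)) *\<^sub>R perp z')" .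
 define T where "T = norm ((1/A) *\<^sub>R perp (z - z') + ((norm z' - norm z) * (norm z + norm z') / (A * B)) *\<^sub>R perp z')"
 have h0: "norm (Ke e z - Ke e z') = 1 / (2 * pi) * T" unfolding K T_def by simp
 have h1: "T
  \<le> (1/A) * norm (z - z') + (\<bar>norm z' - norm z\<bar> * (norm z + norm z') / (A * B)) * norm z'"
  unfolding T_def using AB(1,2) by (intro order_trans[OF norm_triangle_ineq]) (simp add: abs_mult)
 have h2: "(\<bar>norm z' - norm z\<bar> * (norm z + norm z') / (A * B)) * norm z' \<le> norm (z - z') * ((norm z + norm z') * norm z' / (A * B))"
  using norm_triangle_ineq3[of z' z] AB(1,2)
  by (simp add: norm_minus_commute divide_simps mult.assoc) (intro mult_right_mono mult_nonneg_nonneg, auto)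
 have h3: "(norm z + norm z') * norm z' / (A * B) \<le> 2 / e\<^sup>2"
 proof -
  have "norm z * norm z' \<le> A * B / e\<^sup>2"
  proof -
   have "norm z * e \<le> A" using sum_squares_bound[of "norm z" e] e mult_nonneg_nonneg[OF norm_ge_zero less_imp_le[OF e], of z] unfolding A_def by linarith
   moreover have "norm z' * e \<le> B" using sum_squares_bound[of "norm z'" e] e mult_nonneg_nonneg[OF norm_ge_zero less_imp_le[OF e], of z'] unfolding B_def by linarith
   ultimately have "(norm z * e) * (norm z' * e) \<le> A * B" using e AB(1,2) by (intro mult_mono) auto
   then show ?thesis using AB by (simp add: pos_le_divide_eq power2_eq_square mult_ac)
  qed
  moreover have "norm z' * norm z' \<le> A * B / e\<^sup>2"
  proof -
   have "e\<^sup>2 * (norm z')\<^sup>2 \<le> A * B" using AB(1,3,4) by (intro mult_mono) auto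
   then show ?thesis using AB(5) by (simp add: pos_le_divide_eq power2_eq_square mult_ac)
  qed
  ultimately have "(norm z + norm z') * norm z' \<le> 2 * (A * B / e\<^sup>2)" by (simp add: ring_distribs)
  then show ?thesis using AB(1,2) by (simp add: pos_divide_le_eq mult_ac)
 qed
 have "norm (z - z') * ((norm z + norm z') * norm z' / (A * B)) \<le> norm (z - z') * (2 / e\<^sup>2)"
  by (rule mult_left_mono[OF h3]) simp
 with h1 h2 have "T \<le> 1 / A * norm (z - z') + norm (z - z') * (2 / e\<^sup>2)" by linarith
 then have "norm (Ke e z - Ke e z') \<le> 1 / (2 * pi) * (1 / A * norm (z - z') + norm (z - z') * (2 / e\<^sup>2))"
  unfolding h0 by (intro mult_left_mono) auto
 also have "\<dots> \<le> 1 / 3 * (1 / e\<^sup>2 * norm (z - z') + norm (z - z') * (2 / e\<^sup>2))"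
 proof (rule mult_mono)
  show "1 / (2 * pi) \<le> 1 / 3" using two_pi_ge by (intro divide_left_mono) auto
  have "1 / A \<le> 1 / e\<^sup>2" by (rule frac_le[OF zero_le_one order_refl AB(5) AB(3)])
  then show "1 / A * norm (z - z') + norm (z - z') * (2 / e\<^sup>2) \<le> 1 / e\<^sup>2 * norm (z - z') + norm (z - z') * (2 / e\<^sup>2)"
   by (intro add_right_mono mult_right_mono norm_ge_zero)
  show "0 \<le> 1 / A * norm (z - z') + norm (z - z') * (2 / e\<^sup>2)"
   using AB(1) by (intro add_nonneg_nonneg mult_nonneg_nonneg) (auto simp: less_imp_le)
 qed simp
 also have "\<dots> = norm (z - z') / e\<^sup>2" by (simp add: field_simps)
 finally show ?thesis .
qed

lemma continuous_on_Ke: "e > 0 \<Longrightarrow> continuous_on S (Ke e)"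
 unfolding Ke_def by (intro continuous_intros) (auto simp: add_nonneg_eq_0_iff)

section \<open>Uniform estimates for potentials\<close>

lemma cball_borel [measurable]: "cball (c::'a::euclidean_space) r \<in> sets borel"
 by simp

text \<open>The exponent conjugate to \<open>p > 2\<close> is below \<open>2\<close>, so the corresponding power of \<open>1/|z|\<close> is locally
 integrable in the plane. The smallness on small discs is uniform in the vorticity, which makes all
 potentials of the class equicontinuous.\<close>

lemma potential_small:
 fixes p A e :: real
 assumes p: "p > 2" and e: "e > 0"
 shows "\<exists>r>0. \<forall>(w :: plane \<Rightarrow> real) x. w \<in> borel_measurable borel \<longrightarrow>
  (\<integral>\<^sup>+y. ennreal (\<bar>w y\<bar> powr p) \<partial>lborel) \<le> ennreal A \<longrightarrow>
  (\<integral>\<^sup>+y. ennreal (\<bar>w y\<bar> / norm (x - y)) * indicator (cball x r) y \<partial>lborel) \<le> ennreal e" (is "\<exists>r>0. ?P r")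
proof -
 define q where "q = p / (p - 1)"
 have q: "1 < q" "q < 2" "1 / p + 1 / q = 1" using p by (auto simp: q_def field_simps)
 define l where "l = (e / (2 * (\<bar>A\<bar> + 1))) powr (1 / p)"
 have l: "l > 0" "l powr p = e / (2 * (\<bar>A\<bar> + 1))" using p e by (auto simp: l_def powr_powr)
 define r where "r = (e * (1 - q / 2) / (2 * pi * l powr (- q))) powr (1 / (2 - q))"
 have r: "r > 0" "r powr (2 - q) = e * (1 - q / 2) / (2 * pi * l powr (- q))"
  using q e l by (auto simp: r_def powr_powr intro!: mult_pos_pos divide_pos_pos)
 have "?P r"
 proof (intro allI impI)
  fix w :: "plane \<Rightarrow> real" and x
  assume [measurable]: "w \<in> borel_measurable borel" and w: "(\<integral>\<^sup>+y. ennreal (\<bar>w y\<bar> powr p) \<partial>lborel) \<le> ennreal A"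
  have pw: "\<bar>w y\<bar> / norm (x - y) \<le> l powr p * \<bar>w y\<bar> powr p + l powr (- q) * norm (x - y) powr (- q)" for y
  proof (cases "x = y")
   case False
   then have s: "norm (x - y) > 0" by simp
   have "\<bar>w y\<bar> / norm (x - y) = (l * \<bar>w y\<bar>) * (1 / (l * norm (x - y)))" using l by simp
   also have "\<dots> \<le> (l * \<bar>w y\<bar>) powr p / p + (1 / (l * norm (x - y))) powr q / q"
    using p q l by (intro Youngs_inequality) auto
   also have "\<dots> \<le> (l * \<bar>w y\<bar>) powr p + (1 / (l * norm (x - y))) powr q"
    using p q by (intro add_mono) (auto simp: divide_le_eq mult_le_cancel_left1)
   also have "\<dots> = l powr p * \<bar>w y\<bar> powr p + l powr (- q) * norm (x - y) powr (- q)"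
    using l s by (simp add: powr_mult powr_minus powr_divide field_simps)
   finally show ?thesis .
  qed simp
  define a where "a z = ennreal (norm z powr (- q)) * indicator (cball 0 r) z" for z :: plane
  have am [measurable]: "a \<in> borel_measurable borel" unfolding a_def by measurable
  have m1: "(\<lambda>y. ennreal (\<bar>w y\<bar> powr p)) \<in> borel_measurable lborel" by measurable
  have m2: "(\<lambda>y. a (x - y)) \<in> borel_measurable lborel" by measurable
  have "(\<integral>\<^sup>+y. ennreal (\<bar>w y\<bar> / norm (x - y)) * indicator (cball x r) y \<partial>lborel)
   \<le> (\<integral>\<^sup>+y. ennreal (l powr p) * ennreal (\<bar>w y\<bar> powr p) + ennreal (l powr (- q)) * (ennreal (norm (x - y) powr (- q)) * indicator (cball 0 r) (x - y)) \<partial>lborel)"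
  proof (intro nn_integral_mono)
   fix y
   show "ennreal (\<bar>w y\<bar> / norm (x - y)) * indicator (cball x r) y \<le> ennreal (l powr p) * ennreal (\<bar>w y\<bar> powr p) + ennreal (l powr (- q)) * (ennreal (norm (x - y) powr (- q)) * indicator (cball 0 r) (x - y))"
   proof (cases "y \<in> cball x r")
    case True
    then have "x - y \<in> cball 0 r" by (simp only: mem_cball_0) (simp only: mem_cball dist_norm)
    then show ?thesis using True ennreal_leI[OF pw[of y]] by (simp add: ennreal_plus ennreal_mult)
   qed simp
  qed
  also have "\<dots> = ennreal (l powr p) * (\<integral>\<^sup>+y. ennreal (\<bar>w y\<bar> powr p) \<partial>lborel) + ennreal (l powr (- q)) * (\<integral>\<^sup>+y. a (x - y) \<partial>lborel)"
   unfolding a_def[symmetric] by (subst nn_integral_add, measurable, simp only: nn_integral_cmult[OF m1] nn_integral_cmult[OF m2])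
  also have "(\<integral>\<^sup>+y. a (x - y) \<partial>lborel) = ennreal (pi * (r powr (2 - q) / (1 - q / 2)))"
   unfolding nn_integral_reflect[OF am] unfolding a_def by (rule nn_integral_inverse_power_cball) (use q r in auto)
  also have "ennreal (l powr p) * (\<integral>\<^sup>+y. ennreal (\<bar>w y\<bar> powr p) \<partial>lborel) \<le> ennreal (l powr p) * ennreal (\<bar>A\<bar> + 1)"
   using w by (intro mult_left_mono order_trans[OF w] ennreal_leI) auto
  also have "ennreal (l powr p) * ennreal (\<bar>A\<bar> + 1) = ennreal (e / 2)"
  proof -
   have "l powr p * (\<bar>A\<bar> + 1) = e / 2" unfolding l(2) by (simp add: divide_simps)
   then show ?thesis by (subst ennreal_mult[symmetric]) auto
  qed
  also have "ennreal (l powr (- q)) * ennreal (pi * (r powr (2 - q) / (1 - q / 2))) = ennreal (e / 2)"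
  proof -
   have "L * (pi * (e * c / (2 * pi * L) / c)) = e / 2" if "c > 0" "L > 0" for c L :: real
    using that by (simp add: field_simps)
   note gen = this
   have "l powr (- q) * (pi * (r powr (2 - q) / (1 - q / 2))) = e / 2"
    unfolding r(2) by (rule gen) (use q l(1) in auto)
   moreover have nn: "0 \<le> pi * (r powr (2 - q) / (1 - q / 2))" using q by simp
   ultimately show ?thesis unfolding ennreal_mult[OF powr_ge_zero nn, symmetric] by (simp only:)
  qed
  also have "ennreal (e / 2) + ennreal (e / 2) = ennreal e"
   using e by (subst ennreal_plus[symmetric]) auto
  finally show "(\<integral>\<^sup>+y. ennreal (\<bar>w y\<bar> / norm (x - y)) * indicator (cball x r) y \<partial>lborel) \<le> ennreal e"
   by (simp add: add_mono)
 qed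
 with r show ?thesis by blast
qed

text \<open>The class of vorticities that the scheme leaves invariant.\<close>

definition vort :: "real \<Rightarrow> real \<Rightarrow> (plane \<Rightarrow> real) \<Rightarrow> bool" where
 "vort p A w \<longleftrightarrow> w \<in> borel_measurable borel \<and> (\<integral>\<^sup>+x. ennreal \<bar>w x\<bar> \<partial>lborel) \<le> ennreal A \<and>
  (\<integral>\<^sup>+x. ennreal (\<bar>w x\<bar> powr p) \<partial>lborel) \<le> ennreal A"

lemma vortD:
 assumes "vort p A w"
 shows "w \<in> borel_measurable borel" "(\<integral>\<^sup>+x. ennreal \<bar>w x\<bar> \<partial>lborel) \<le> ennreal A"
  "(\<integral>\<^sup>+x. ennreal (\<bar>w x\<bar> powr p) \<partial>lborel) \<le> ennreal A"
 using assms by (auto simp: vort_def)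

lemma vort_integrable:
 assumes "vort p A w" shows "integrable lborel w"
 using vortD(1,2)[OF assms] by (intro integrableI_bounded) (auto intro: le_less_trans)

lemma vort_integral:
 assumes "vort p A w" "A \<ge> 0" shows "(LINT x|lborel. \<bar>w x\<bar>) \<le> A"
proof -
 have "ennreal (LINT x|lborel. \<bar>w x\<bar>) = (\<integral>\<^sup>+x. ennreal \<bar>w x\<bar> \<partial>lborel)"
  using vort_integrable[OF assms(1)] by (subst nn_integral_eq_integral) auto
 with vortD(2)[OF assms(1)] have "ennreal (LINT x|lborel. \<bar>w x\<bar>) \<le> ennreal A" by simp
 then show ?thesis using assms(2) by (simp add: ennreal_le_iff)
qed

text \<open>Near \<open>x\<close> the previous lemma applies; at a distance the kernel is bounded and the mass suffices.\<close>

lemma potential_bound: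
 fixes p A :: real
 assumes p: "p > 2" and A: "A \<ge> 0"
 shows "\<exists>C\<ge>0. \<forall>w x. vort p A w \<longrightarrow> (\<integral>\<^sup>+y. ennreal (\<bar>w y\<bar> / norm (x - y)) \<partial>lborel) \<le> ennreal C"
proof -
 from potential_small[OF p, of 1 A] obtain r where r: "r > 0" and
  *: "\<And>(w :: plane \<Rightarrow> real) x. w \<in> borel_measurable borel \<Longrightarrow> (\<integral>\<^sup>+y. ennreal (\<bar>w y\<bar> powr p) \<partial>lborel) \<le> ennreal A \<Longrightarrow>
  (\<integral>\<^sup>+y. ennreal (\<bar>w y\<bar> / norm (x - y)) * indicator (cball x r) y \<partial>lborel) \<le> ennreal 1" by auto
 have "(\<integral>\<^sup>+y. ennreal (\<bar>w y\<bar> / norm (x - y)) \<partial>lborel) \<le> ennreal (1 + A / r)" if w: "vort p A w" for w x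
 proof -
  note [measurable] = vortD(1)[OF w]
  have "(\<integral>\<^sup>+y. ennreal (\<bar>w y\<bar> / norm (x - y)) \<partial>lborel) \<le>
   (\<integral>\<^sup>+y. ennreal (\<bar>w y\<bar> / norm (x - y)) * indicator (cball x r) y + ennreal (1 / r) * ennreal \<bar>w y\<bar> \<partial>lborel)"
  proof (intro nn_integral_mono)
   fix y
   show "ennreal (\<bar>w y\<bar> / norm (x - y)) \<le> ennreal (\<bar>w y\<bar> / norm (x - y)) * indicator (cball x r) y + ennreal (1 / r) * ennreal \<bar>w y\<bar>"
   proof (cases "y \<in> cball x r")
    case False
    then have "\<bar>w y\<bar> / norm (x - y) \<le> 1 / r * \<bar>w y\<bar>" using frac_le[OF abs_ge_zero order_refl r, of "norm (x - y)" "w y"] by (simp add: dist_norm)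
    then show ?thesis using False r by (simp add: ennreal_mult[symmetric] ennreal_leI)
   qed simp
  qed
  also have "\<dots> = (\<integral>\<^sup>+y. ennreal (\<bar>w y\<bar> / norm (x - y)) * indicator (cball x r) y \<partial>lborel) + ennreal (1 / r) * (\<integral>\<^sup>+y. ennreal \<bar>w y\<bar> \<partial>lborel)"
   by (subst nn_integral_add) (auto simp: nn_integral_cmult)
  also have "\<dots> \<le> ennreal 1 + ennreal (1 / r) * ennreal A"
   by (intro add_mono mult_left_mono vortD[OF w] *[OF vortD(1)[OF w] vortD(3)[OF w]]) simp_all
  also have "\<dots> = ennreal (1 + A / r)" using r A by (simp add: ennreal_mult[symmetric] ennreal_plus)
  finally show ?thesis .
 qed
 then show ?thesis using r A by (intro exI[of _ "1 + A / r"]) auto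
qed

lemma kernel_diff_small:
 fixes p A e :: real
 assumes p: "p > 2" and A: "A \<ge> 0" and e: "e > 0"
 shows "\<exists>d>0. \<forall>c w x. 0 < c \<longrightarrow> c \<le> d \<longrightarrow> vort p A w \<longrightarrow>
  (\<integral>\<^sup>+y. ennreal (\<bar>w y\<bar> * norm (Ke 0 (x - y) - Ke c (x - y))) \<partial>lborel) \<le> ennreal e"
proof -
 from potential_small[OF p, of "e/2" A] e obtain r where r: "r > 0" and
  *: "\<And>(w :: plane \<Rightarrow> real) x. w \<in> borel_measurable borel \<Longrightarrow> (\<integral>\<^sup>+y. ennreal (\<bar>w y\<bar> powr p) \<partial>lborel) \<le> ennreal A \<Longrightarrow>
  (\<integral>\<^sup>+y. ennreal (\<bar>w y\<bar> / norm (x - y)) * indicator (cball x r) y \<partial>lborel) \<le> ennreal (e / 2)" by auto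
 define d where "d = sqrt (e * r^3 / (2 * (A + 1)))"
 have d: "d > 0" "d\<^sup>2 = e * r^3 / (2 * (A + 1))" using r e A by (auto simp: d_def)
 have "(\<integral>\<^sup>+y. ennreal (\<bar>w y\<bar> * norm (Ke 0 (x - y) - Ke c (x - y))) \<partial>lborel) \<le> ennreal e"
  if w: "vort p A w" and c: "0 < c" "c \<le> d" for c w x
 proof -
  note [measurable] = vortD(1)[OF w]
  have c2: "c\<^sup>2 / r^3 * A \<le> e / 2"
  proof -
   have "c\<^sup>2 \<le> e * r^3 / (2 * (A + 1))" using d c by (metis less_imp_le power_mono)
   then have "c\<^sup>2 / r^3 * A \<le> (e * r^3 / (2 * (A + 1))) / r^3 * A"
    using r A by (intro mult_right_mono divide_right_mono) auto
   also have "\<dots> = e / 2 * (A / (A + 1))" using r A by simp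
   also have "\<dots> \<le> e / 2 * 1" using A e by (intro mult_left_mono) auto
   finally have "c\<^sup>2 / r^3 * A \<le> e / 2 * 1" .
   then have "c\<^sup>2 / r^3 * A \<le> e / 2" by simp
   then show ?thesis .
  qed
  have "(\<integral>\<^sup>+y. ennreal (\<bar>w y\<bar> * norm (Ke 0 (x - y) - Ke c (x - y))) \<partial>lborel) \<le>
   (\<integral>\<^sup>+y. ennreal (\<bar>w y\<bar> / norm (x - y)) * indicator (cball x r) y + ennreal (c\<^sup>2 / r^3) * ennreal \<bar>w y\<bar> \<partial>lborel)"
  proof (intro nn_integral_mono)
   fix y
   show "ennreal (\<bar>w y\<bar> * norm (Ke 0 (x - y) - Ke c (x - y))) \<le> ennreal (\<bar>w y\<bar> / norm (x - y)) * indicator (cball x r) y + ennreal (c\<^sup>2 / r^3) * ennreal \<bar>w y\<bar>"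
   proof (cases "y \<in> cball x r")
    case False
    have "norm (Ke 0 (x - y) - Ke c (x - y)) \<le> c\<^sup>2 / norm (x - y) ^ 3" by (rule norm_Ke_diff)
    also have "\<dots> \<le> c\<^sup>2 / r ^ 3" using False r by (intro divide_left_mono power_mono mult_pos_pos) (auto simp: dist_norm)
    finally have "\<bar>w y\<bar> * norm (Ke 0 (x - y) - Ke c (x - y)) \<le> \<bar>w y\<bar> * (c\<^sup>2 / r^3)" by (rule mult_left_mono) simp
    then show ?thesis using False r by (simp add: ennreal_mult[symmetric] ennreal_leI mult.commute)
   next
    case True
    have "\<bar>w y\<bar> * norm (Ke 0 (x - y) - Ke c (x - y)) \<le> \<bar>w y\<bar> * (1 / norm (x - y))"
     by (intro mult_left_mono norm_Ke_diff) simp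
    then show ?thesis using True by (simp add: add_increasing2 ennreal_leI)
   qed
  qed
  also have "\<dots> = (\<integral>\<^sup>+y. ennreal (\<bar>w y\<bar> / norm (x - y)) * indicator (cball x r) y \<partial>lborel) + ennreal (c\<^sup>2 / r^3) * (\<integral>\<^sup>+y. ennreal \<bar>w y\<bar> \<partial>lborel)"
   by (subst nn_integral_add, measurable, simp add: nn_integral_cmult)
  also have "\<dots> \<le> ennreal (e / 2) + ennreal (c\<^sup>2 / r^3) * ennreal A"
   by (intro add_mono mult_left_mono vortD[OF w] *[OF vortD(1)[OF w] vortD(3)[OF w]]) simp_all
  also have "\<dots> = ennreal (e / 2 + c\<^sup>2 / r^3 * A)" using r A e by (simp add: ennreal_mult[symmetric] ennreal_plus)
  also have "\<dots> \<le> ennreal e" using c2 by (intro ennreal_leI) linarith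
  finally show ?thesis .
 qed
 with d show ?thesis by blast
qed

section \<open>Potentials of a charge\<close>

definition pot :: "'b measure \<Rightarrow> ('b \<Rightarrow> real) \<Rightarrow> ('b \<Rightarrow> plane) \<Rightarrow> (plane \<Rightarrow> 'v::euclidean_space) \<Rightarrow> plane \<Rightarrow> 'v" where
 "pot L g Y k x = (LINT b|L. g b *\<^sub>R k (x - Y b))"

text \<open>A signed source \<open>g dL\<close> placed in the plane by \<open>Y\<close>. With Lebesgue measure and the identity it is a
 vorticity; a singular signed measure is another instance.\<close>

locale charge = sigma_finite_measure L for L :: "'b measure" +
 fixes g :: "'b \<Rightarrow> real" and Y :: "'b \<Rightarrow> plane"
 assumes g_int: "integrable L g" and Y_meas [measurable]: "Y \<in> L \<rightarrow>\<^sub>M borel"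
begin

abbreviation mass :: real where "mass \<equiv> (LINT b|L. \<bar>g b\<bar>)"

lemma g_meas [measurable]: "g \<in> borel_measurable L"
 using g_int by auto

lemma mass_nn: "(\<integral>\<^sup>+b. ennreal \<bar>g b\<bar> \<partial>L) = ennreal mass"
 using g_int by (subst nn_integral_eq_integral) auto

lemma pot_measurable [measurable]:
 fixes k :: "plane \<Rightarrow> 'v::euclidean_space"
 assumes [measurable]: "k \<in> borel_measurable borel"
 shows "pot L g Y k \<in> borel_measurable borel"
 unfolding pot_def by measurable

lemma pot_integrable:
 fixes k :: "plane \<Rightarrow> 'v::euclidean_space"
 assumes [measurable]: "k \<in> borel_measurable borel" and k: "\<And>z. norm (k z) \<le> c"
 shows "integrable L (\<lambda>b. g b *\<^sub>R k (x - Y b))"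
proof (rule Bochner_Integration.integrable_bound)
 show "integrable L (\<lambda>b. c * g b)" using g_int by simp
 show "AE b in L. norm (g b *\<^sub>R k (x - Y b)) \<le> norm (c * g b)"
  using k order_trans[OF norm_ge_zero k] by (auto simp: abs_mult mult.commute[of c] intro!: mult_left_mono AE_I2)
qed measurable

lemma norm_pot_le:
 fixes k :: "plane \<Rightarrow> 'v::euclidean_space"
 assumes [measurable]: "k \<in> borel_measurable borel" and k: "\<And>z. norm (k z) \<le> c"
 shows "norm (pot L g Y k x) \<le> c * mass"
proof -
 have "norm (pot L g Y k x) \<le> (LINT b|L. norm (g b *\<^sub>R k (x - Y b)))"
  unfolding pot_def by (rule integral_norm_bound)
 also have "\<dots> \<le> (LINT b|L. c * \<bar>g b\<bar>)"
 proof (rule integral_mono)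
  show "integrable L (\<lambda>b. norm (g b *\<^sub>R k (x - Y b)))"
   by (rule integrable_norm) (rule pot_integrable[OF assms])
  show "integrable L (\<lambda>b. c * \<bar>g b\<bar>)" using g_int by auto
  show "norm (g b *\<^sub>R k (x - Y b)) \<le> c * \<bar>g b\<bar>" for b
   using mult_right_mono[OF k, of "\<bar>g b\<bar>"] by (simp add: mult.commute)
 qed
 finally show ?thesis by simp
qed

lemma pot_diff_le:
 fixes k k' :: "plane \<Rightarrow> 'v::euclidean_space"
 assumes [measurable]: "k \<in> borel_measurable borel" "k' \<in> borel_measurable borel"
  and i: "integrable L (\<lambda>b. g b *\<^sub>R k (x - Y b))" "integrable L (\<lambda>b. g b *\<^sub>R k' (x' - Y b))"
  and k: "\<And>b. norm (k (x - Y b) - k' (x' - Y b)) \<le> c"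
 shows "norm (pot L g Y k x - pot L g Y k' x') \<le> c * mass"
proof -
 have "pot L g Y k x - pot L g Y k' x' = (LINT b|L. g b *\<^sub>R (k (x - Y b) - k' (x' - Y b)))"
  unfolding pot_def using i by (simp add: scaleR_diff_right)
 also have "norm \<dots> \<le> (LINT b|L. norm (g b *\<^sub>R (k (x - Y b) - k' (x' - Y b))))"
  by (rule integral_norm_bound)
 also have "\<dots> \<le> (LINT b|L. c * \<bar>g b\<bar>)"
 proof (rule integral_mono)
  show "integrable L (\<lambda>b. norm (g b *\<^sub>R (k (x - Y b) - k' (x' - Y b))))"
   unfolding scaleR_diff_right by (intro integrable_norm Bochner_Integration.integrable_diff i)
  show "integrable L (\<lambda>b. c * \<bar>g b\<bar>)" using g_int by auto
  show "norm (g b *\<^sub>R (k (x - Y b) - k' (x' - Y b))) \<le> c * \<bar>g b\<bar>" for b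
   using mult_right_mono[OF k, of "\<bar>g b\<bar>"] by (simp add: mult.commute)
 qed
 finally show ?thesis by simp
qed

text \<open>Tonelli turns a bound on the potential of \<open>|w|\<close> at every point into a bound on the pairing of
 \<open>|w|\<close> with the potential of any charge of finite mass.\<close>

lemma pairing_le:
 fixes w :: "plane \<Rightarrow> real" and a :: "plane \<Rightarrow> real"
 assumes [measurable]: "w \<in> borel_measurable borel" "a \<in> borel_measurable borel"
  and a: "\<And>z. a z \<ge> 0"
  and C: "\<And>y. (\<integral>\<^sup>+x. ennreal (\<bar>w x\<bar> * a (x - y)) \<partial>lborel) \<le> ennreal C"
 shows "(\<integral>\<^sup>+x. ennreal \<bar>w x\<bar> * (\<integral>\<^sup>+b. ennreal (\<bar>g b\<bar> * a (x - Y b)) \<partial>L) \<partial>lborel) \<le> ennreal C * ennreal mass"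
proof -
 interpret P: pair_sigma_finite lborel L ..
 have "(\<integral>\<^sup>+x. ennreal \<bar>w x\<bar> * (\<integral>\<^sup>+b. ennreal (\<bar>g b\<bar> * a (x - Y b)) \<partial>L) \<partial>lborel) =
  (\<integral>\<^sup>+x. (\<integral>\<^sup>+b. ennreal \<bar>w x\<bar> * ennreal (\<bar>g b\<bar> * a (x - Y b)) \<partial>L) \<partial>lborel)"
  by (simp add: nn_integral_cmult)
 also have "\<dots> = (\<integral>\<^sup>+b. (\<integral>\<^sup>+x. ennreal \<bar>w x\<bar> * ennreal (\<bar>g b\<bar> * a (x - Y b)) \<partial>lborel) \<partial>L)"
  by (rule P.Fubini'[symmetric]) measurable
 also have "\<dots> = (\<integral>\<^sup>+b. ennreal \<bar>g b\<bar> * (\<integral>\<^sup>+x. ennreal (\<bar>w x\<bar> * a (x - Y b)) \<partial>lborel) \<partial>L)"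
  using a by (intro nn_integral_cong) (subst nn_integral_cmult[symmetric], auto simp: ennreal_mult mult_ac intro!: nn_integral_cong)
 also have "\<dots> \<le> (\<integral>\<^sup>+b. ennreal \<bar>g b\<bar> * ennreal C \<partial>L)"
  by (intro nn_integral_mono mult_left_mono C) auto
 also have "\<dots> = ennreal C * ennreal mass"
  by (subst nn_integral_multc) (auto simp: mass_nn mult.commute)
 finally show ?thesis .
qed

lemma norm_pot_le_nn:
 fixes k :: "plane \<Rightarrow> 'v::euclidean_space"
 assumes [measurable]: "k \<in> borel_measurable borel"
 shows "ennreal (norm (pot L g Y k x)) \<le> (\<integral>\<^sup>+b. ennreal (\<bar>g b\<bar> * norm (k (x - Y b))) \<partial>L)"
proof (cases "integrable L (\<lambda>b. g b *\<^sub>R k (x - Y b))")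
 case True
 have "ennreal (norm (pot L g Y k x)) \<le> ennreal (LINT b|L. norm (g b *\<^sub>R k (x - Y b)))"
  unfolding pot_def by (intro ennreal_leI integral_norm_bound)
 also have "\<dots> = (\<integral>\<^sup>+b. ennreal (norm (g b *\<^sub>R k (x - Y b))) \<partial>L)"
  using integrable_norm[OF True] by (subst nn_integral_eq_integral) simp_all
 finally show ?thesis by simp
qed (simp add: pot_def not_integrable_integral_eq)

end

section \<open>Averaging with doubly stochastic weights\<close>

lemma convex_on_powr_nonneg:
 fixes r :: real assumes r: "r \<ge> 1" shows "convex_on {0..} (\<lambda>x. x powr r)"
proof (rule convex_onI)
 fix t x y :: real
 assume t: "0 < t" "t < 1" and xy: "x \<in> {0..}" "y \<in> {0..}"
 have tt: "s powr r \<le> s" if "0 \<le> s" "s \<le> 1" for s :: real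
  using powr_mono'[of 1 r s] that r by simp
 show "((1 - t) *\<^sub>R x + t *\<^sub>R y) powr r \<le> (1 - t) * x powr r + t * y powr r"
 proof (cases "x = 0 \<or> y = 0")
  case True
  then show ?thesis
   using t xy tt[of t] tt[of "1 - t"] by (auto simp: powr_mult intro!: mult_right_mono)
 next
  case False
  with t xy convex_onD[OF powr_convex[OF r], of t x y] show ?thesis by auto
 qed
qed simp

lemma sum_powr_le:
 fixes r :: real
 assumes "finite J" "r \<ge> 1" "\<And>j. j \<in> J \<Longrightarrow> c j \<ge> 0" "(\<Sum>j\<in>J. c j) = 1"
 shows "\<bar>\<Sum>j\<in>J. c j * a j\<bar> powr r \<le> (\<Sum>j\<in>J. c j * \<bar>a j\<bar> powr r)"
proof -
 have "J \<noteq> {}" using assms(4) by auto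
 have "\<bar>\<Sum>j\<in>J. c j * a j\<bar> \<le> (\<Sum>j\<in>J. c j * \<bar>a j\<bar>)"
  using assms(3) by (intro order_trans[OF sum_abs] sum_mono) (simp add: abs_mult)
 then have "\<bar>\<Sum>j\<in>J. c j * a j\<bar> powr r \<le> (\<Sum>j\<in>J. c j *\<^sub>R \<bar>a j\<bar>) powr r"
  using assms(2) by (intro powr_mono2) auto
 also have "\<dots> \<le> (\<Sum>j\<in>J. c j * \<bar>a j\<bar> powr r)"
  using assms \<open>J \<noteq> {}\<close> by (intro convex_on_sum[OF _ _ convex_on_powr_nonneg]) auto
 finally show ?thesis .
qed

text \<open>Row sums equal to one give a maximum principle, column sums equal to one make the total mass
 invariant; Jensen's inequality then bounds all \<open>L\<^sup>r\<close> norms.\<close>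

lemma doubly_stochastic_powr:
 fixes c :: "'j \<Rightarrow> 'a::euclidean_space \<Rightarrow> real" and s :: "'j \<Rightarrow> 'a"
 assumes J: "finite J" and r: "r \<ge> 1"
  and [measurable]: "\<And>j. c j \<in> borel_measurable borel" "w \<in> borel_measurable borel"
  and c: "\<And>j x. j \<in> J \<Longrightarrow> c j x \<ge> 0" "\<And>x. (\<Sum>j\<in>J. c j x) = 1" "\<And>x. (\<Sum>j\<in>J. c j (x - s j)) = 1"
 shows "(\<integral>\<^sup>+x. ennreal (\<bar>\<Sum>j\<in>J. c j x * w (x + s j)\<bar> powr r) \<partial>lborel) \<le> (\<integral>\<^sup>+x. ennreal (\<bar>w x\<bar> powr r) \<partial>lborel)"
proof -
 have "(\<integral>\<^sup>+x. ennreal (\<bar>\<Sum>j\<in>J. c j x * w (x + s j)\<bar> powr r) \<partial>lborel) \<le>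
  (\<integral>\<^sup>+x. (\<Sum>j\<in>J. ennreal (c j (x + s j - s j) * \<bar>w (x + s j)\<bar> powr r)) \<partial>lborel)"
  using c sum_powr_le[OF J r] by (intro nn_integral_mono) (simp add: sum_ennreal ennreal_leI)
 also have "\<dots> = (\<Sum>j\<in>J. (\<integral>\<^sup>+x. ennreal (c j (x + s j - s j) * \<bar>w (x + s j)\<bar> powr r) \<partial>lborel))"
  by (rule nn_integral_sum) measurable
 also have "\<dots> = (\<Sum>j\<in>J. (\<integral>\<^sup>+x. ennreal (c j (x - s j) * \<bar>w x\<bar> powr r) \<partial>lborel))"
  by (intro sum.cong refl nn_integral_shift[where f="\<lambda>x. ennreal (c j (x - s j) * \<bar>w x\<bar> powr r)" for j]) measurable
 also have "\<dots> = (\<integral>\<^sup>+x. (\<Sum>j\<in>J. ennreal (c j (x - s j) * \<bar>w x\<bar> powr r)) \<partial>lborel)"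
  by (rule nn_integral_sum[symmetric]) measurable
 also have "\<dots> = (\<integral>\<^sup>+x. ennreal (\<bar>w x\<bar> powr r) \<partial>lborel)"
  using c by (intro nn_integral_cong) (simp add: sum_ennreal sum_distrib_right[symmetric])
 finally show ?thesis .
qed

abbreviation ax :: "2 \<Rightarrow> plane" where "ax i \<equiv> axis i 1"

text \<open>One time step of the Lax--Friedrichs scheme of mesh size \<open>h\<close>. The flux \<open>f i x\<close> crosses the
 edge from \<open>x\<close> to \<open>x + h *\<^sub>R ax i\<close>, and the time step is \<open>h / (2 * M)\<close>.\<close>

definition step :: "real \<Rightarrow> real \<Rightarrow> (2 \<Rightarrow> plane \<Rightarrow> real) \<Rightarrow> (plane \<Rightarrow> real) \<Rightarrow> plane \<Rightarrow> real" where
 "step M h f w x = (\<Sum>i\<in>UNIV. (M - f i x) / (4 * M) * w (x + h *\<^sub>R ax i) +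
  (M + f i (x - h *\<^sub>R ax i)) / (4 * M) * w (x - h *\<^sub>R ax i))"

locale flux =
 fixes M h :: real and f :: "2 \<Rightarrow> plane \<Rightarrow> real"
 assumes M: "M > 0" and f_le: "\<And>i x. \<bar>f i x\<bar> \<le> M"
  and f_meas [measurable]: "\<And>i. f i \<in> borel_measurable borel"
  and divfree: "\<And>x. (\<Sum>i\<in>UNIV. f i x) = (\<Sum>i\<in>UNIV. f i (x - h *\<^sub>R ax i))"
begin

definition wt :: "2 \<times> bool \<Rightarrow> plane \<Rightarrow> real" where
 "wt j x = (if snd j then (M - f (fst j) x) / (4 * M) else (M + f (fst j) (x - h *\<^sub>R ax (fst j))) / (4 * M))"

definition sh :: "2 \<times> bool \<Rightarrow> plane" where
 "sh j = (if snd j then h *\<^sub>R ax (fst j) else - (h *\<^sub>R ax (fst j)))"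

lemma sum_UNIV_pair: "(\<Sum>j\<in>UNIV. F j) = (\<Sum>i\<in>(UNIV::2 set). F (i, True) + F (i, False))" for F :: "2 \<times> bool \<Rightarrow> real"
proof -
 have "(\<Sum>j\<in>UNIV. F j) = (\<Sum>j\<in>UNIV \<times> UNIV. F j)" by (simp only: UNIV_Times_UNIV)
 also have "\<dots> = (\<Sum>i\<in>UNIV. \<Sum>b\<in>UNIV. F (i, b))" by (subst sum.cartesian_product) simp
 finally show ?thesis by (simp add: UNIV_bool add.commute)
qed

lemma step_eq: "step M h f w x = (\<Sum>j\<in>UNIV. wt j x * w (x + sh j))"
 by (simp add: step_def sum_UNIV_pair wt_def sh_def)

lemma wt_meas [measurable]: "wt j \<in> borel_measurable borel"
 unfolding wt_def by (cases "snd j") simp_all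

lemma wt_nonneg: "wt j x \<ge> 0"
 using M f_le[of "fst j" x] f_le[of "fst j" "x - h *\<^sub>R ax (fst j)"] by (auto simp: wt_def)

lemma wt_sum: "(\<Sum>j\<in>UNIV. wt j x) = 1"
proof -
 have "(M - f 1 x) / (4 * M) + (M + f 1 (x - h *\<^sub>R ax 1)) / (4 * M) + ((M - f 2 x) / (4 * M) + (M + f 2 (x - h *\<^sub>R ax 2)) / (4 * M)) = (4 * M) / (4 * M)"
  unfolding add_divide_distrib[symmetric] using divfree[of x] by (intro arg_cong2[where f="(/)"]) (auto simp: sum_2)
 then show ?thesis using M by (simp add: sum_UNIV_pair wt_def sum_2)
qed

lemma wt_sum': "(\<Sum>j\<in>UNIV. wt j (x - sh j)) = 1"
proof -
 have "(M - f 1 (x - h *\<^sub>R ax 1)) / (4 * M) + (M + f 1 x) / (4 * M) + ((M - f 2 (x - h *\<^sub>R ax 2)) / (4 * M) + (M + f 2 x) / (4 * M)) = (4 * M) / (4 * M)"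
  unfolding add_divide_distrib[symmetric] using divfree[of x] by (intro arg_cong2[where f="(/)"]) (auto simp: sum_2)
 then show ?thesis using M by (simp add: sum_UNIV_pair wt_def sh_def sum_2)
qed

lemma step_meas [measurable]:
 assumes [measurable]: "w \<in> borel_measurable borel"
 shows "step M h f w \<in> borel_measurable borel"
 unfolding step_def[abs_def] by measurable

lemma step_powr:
 assumes [measurable]: "w \<in> borel_measurable borel" and r: "r \<ge> 1"
 shows "(\<integral>\<^sup>+x. ennreal (\<bar>step M h f w x\<bar> powr r) \<partial>lborel) \<le> (\<integral>\<^sup>+x. ennreal (\<bar>w x\<bar> powr r) \<partial>lborel)"
 unfolding step_eq by (rule doubly_stochastic_powr) (auto simp: r wt_nonneg wt_sum wt_sum')

lemma step_sup:
 assumes "\<And>x. \<bar>w x\<bar> \<le> B" shows "\<bar>step M h f w x\<bar> \<le> B"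
proof -
 have "\<bar>step M h f w x\<bar> \<le> (\<Sum>j\<in>UNIV. wt j x * B)"
  unfolding step_eq using wt_nonneg assms
  by (intro order_trans[OF sum_abs] sum_mono) (simp add: abs_mult mult_left_mono)
 also have "\<dots> = B" by (simp add: sum_distrib_right[symmetric] wt_sum)
 finally show ?thesis .
qed

definition gen :: "(plane \<Rightarrow> real) \<Rightarrow> plane \<Rightarrow> real" where
 "gen \<phi> x = (\<Sum>i\<in>UNIV. (\<phi> (x + h *\<^sub>R ax i) + \<phi> (x - h *\<^sub>R ax i) - 2 * \<phi> x) / 4) +
  (\<Sum>i\<in>UNIV. f i x * (\<phi> (x + h *\<^sub>R ax i) - \<phi> x) + f i (x - h *\<^sub>R ax i) * (\<phi> x - \<phi> (x - h *\<^sub>R ax i))) / (4 * M)"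

lemma gen_eq: "(\<Sum>j\<in>UNIV. wt j (x - sh j) * \<phi> (x - sh j)) - \<phi> x = gen \<phi> x"
proof -
 have d: "f 1 x + f 2 x = f 1 (x - h *\<^sub>R ax 1) + f 2 (x - h *\<^sub>R ax 2)"
  using divfree[of x] by (simp add: sum_2)
 have *: "(M - b1) / (4 * M) * m1 + (M + a1) / (4 * M) * p1 + ((M - b2) / (4 * M) * m2 + (M + a2) / (4 * M) * p2) - z
  = (p1 + m1 - 2 * z) / 4 + (p2 + m2 - 2 * z) / 4 + (a1 * (p1 - z) + b1 * (z - m1) + (a2 * (p2 - z) + b2 * (z - m2))) / (4 * M)"
  if "a1 + a2 = b1 + b2" for a1 a2 b1 b2 m1 m2 p1 p2 z :: real
 proof -
  have "a1 = b1 + b2 - a2" using that by simp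
  moreover define c where "c = 1 / (4 * M)"
  moreover have "(M - b) / (4 * M) = 1 / 4 - b * c" "(M + b) / (4 * M) = 1 / 4 + b * c" "b / (4 * M) = b * c" for b
   using M by (simp_all add: c_def diff_divide_distrib add_divide_distrib)
  ultimately show ?thesis by (simp only:) (simp add: algebra_simps add_divide_distrib diff_divide_distrib)
 qed
 show ?thesis
  unfolding gen_def sum_UNIV_pair wt_def sh_def sum_2 using *[OF d] by simp
qed

text \<open>Translation invariance of the integral moves the averaging onto the test function.\<close>

lemma step_weak:
 assumes [measurable]: "\<phi> \<in> borel_measurable borel" and \<phi>: "\<And>x. \<bar>\<phi> x\<bar> \<le> B" and w: "integrable lborel w"
 shows "integrable lborel (\<lambda>x. w x * gen \<phi> x)" "integrable lborel (\<lambda>x. \<phi> x * w x)"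
  "integrable lborel (\<lambda>x. \<phi> x * step M h f w x)"
  "(LINT x|lborel. \<phi> x * step M h f w x) - (LINT x|lborel. \<phi> x * w x) = (LINT x|lborel. w x * gen \<phi> x)"
proof -
 have wm [measurable]: "w \<in> borel_measurable borel" using w by auto
 show iw: "integrable lborel (\<lambda>x. \<phi> x * w x)"
  by (rule Bochner_Integration.integrable_bound[OF integrable_mult_right[OF w, of B]])
   (auto simp: abs_mult intro!: mult_mono \<phi> order_trans[OF \<phi>] AE_I2)
 have wt1: "wt j x \<le> 1" for j x
  using member_le_sum[of j UNIV "\<lambda>j. wt j x"] wt_nonneg wt_sum[of x] by auto
 have i1: "integrable lborel (\<lambda>x. wt j (x - sh j) * \<phi> (x - sh j) * w x)" for j
 proof (rule Bochner_Integration.integrable_bound[OF integrable_mult_right[OF w, of B]])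
  show "AE x in lborel. norm (wt j (x - sh j) * \<phi> (x - sh j) * w x) \<le> norm (B * w x)"
  proof (rule AE_I2)
   fix x
   have "wt j (x - sh j) * \<bar>\<phi> (x - sh j)\<bar> \<le> 1 * B"
    using wt1 wt_nonneg \<phi> by (intro mult_mono) auto
   moreover have "B \<ge> 0" using \<phi>[of 0] by simp
   ultimately show "norm (wt j (x - sh j) * \<phi> (x - sh j) * w x) \<le> norm (B * w x)"
    using wt_nonneg[of j "x - sh j"] by (simp add: abs_mult mult_right_mono)
  qed
 qed measurable
 have i2: "integrable lborel (\<lambda>x. \<phi> x * (wt j x * w (x + sh j)))" for j
  using integrable_shift[OF i1[of j], of "sh j"] by (simp add: mult_ac)
 have e2: "(LINT x|lborel. \<phi> x * (wt j x * w (x + sh j))) = (LINT x|lborel. wt j (x - sh j) * \<phi> (x - sh j) * w x)" for j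
  by (subst integral_shift[symmetric, where a="sh j"]) (auto simp: mult_ac intro!: Bochner_Integration.integral_cong)
 have eq: "\<phi> x * step M h f w x = (\<Sum>j\<in>UNIV. \<phi> x * (wt j x * w (x + sh j)))" for x
  by (simp add: step_eq sum_distrib_left)
 show "integrable lborel (\<lambda>x. \<phi> x * step M h f w x)"
  unfolding eq by (intro Bochner_Integration.integrable_sum i2)
 have g: "w x * gen \<phi> x = (\<Sum>j\<in>UNIV. wt j (x - sh j) * \<phi> (x - sh j) * w x) - \<phi> x * w x" for x
  by (simp add: gen_eq[symmetric] sum_distrib_right sum_distrib_left algebra_simps)
 show "integrable lborel (\<lambda>x. w x * gen \<phi> x)"
  unfolding g by (intro Bochner_Integration.integrable_diff Bochner_Integration.integrable_sum i1 iw)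
 show "(LINT x|lborel. \<phi> x * step M h f w x) - (LINT x|lborel. \<phi> x * w x) = (LINT x|lborel. w x * gen \<phi> x)"
  unfolding g eq using i1 i2 iw by (simp add: e2 Bochner_Integration.integral_sum)
qed

end

section \<open>The discrete Biot--Savart kernel\<close>

text \<open>The flux kernel is the discrete curl of a regularised logarithm, so every superposition of its
 translates is exactly divergence free on the mesh.\<close>

definition Ge :: "real \<Rightarrow> plane \<Rightarrow> real" where
 "Ge e z = ln ((norm z)\<^sup>2 + e\<^sup>2) / (4 * pi)"

definition kd :: "real \<Rightarrow> real \<Rightarrow> 2 \<Rightarrow> plane \<Rightarrow> real" where
 "kd e h i z = (if i = 1 then (Ge e (z - h *\<^sub>R ax 2) - Ge e z) / h else (Ge e z - Ge e (z - h *\<^sub>R ax 1)) / h)"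

lemma kd_div: "(\<Sum>i\<in>UNIV. kd e h i z) = (\<Sum>i\<in>UNIV. kd e h i (z - h *\<^sub>R ax i))"
proof -
 have c: "z - h *\<^sub>R ax 2 - h *\<^sub>R ax 1 = z - h *\<^sub>R ax 1 - h *\<^sub>R ax 2" by simp
 show ?thesis
  unfolding sum_2 kd_def c by (simp add: diff_divide_distrib)
qed

lemma kd_meas [measurable]: "kd e h i \<in> borel_measurable borel"
 unfolding kd_def Ge_def by (cases "i = 1") simp_all

lemma ax_nth: "ax i $ j = (if i = j then 1 else 0)"
 by (auto simp: axis_def)

lemma norm_ax [simp]: "norm (ax i) = 1"
 by (rule norm_axis_1)

lemma kd_mvt:
 assumes e: "e > 0" and h: "h > 0"
 shows "\<exists>\<xi>. norm (\<xi> - z) \<le> h \<and> kd e h i z = Ke e \<xi> $ i"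
proof -
 define j :: 2 where "j = (if i = 1 then 2 else 1)"
 define F where "F s = Ge e (z - s *\<^sub>R ax j)" for s
 have pos: "(norm \<xi>)\<^sup>2 + e\<^sup>2 > 0" for \<xi> :: plane using e by (simp add: add_nonneg_pos)
 have D: "(F has_real_derivative (- (z - s *\<^sub>R ax j) $ j / (2 * pi * ((norm (z - s *\<^sub>R ax j))\<^sup>2 + e\<^sup>2)))) (at s)" for s
 proof -
  define P where "P s = (z $ 1 - s * (ax j $ 1))\<^sup>2 + (z $ 2 - s * (ax j $ 2))\<^sup>2 + e\<^sup>2" for s
  define N where "N = 2 * (z $ 1 - s * (ax j $ 1)) * (- (ax j $ 1)) + 2 * (z $ 2 - s * (ax j $ 2)) * (- (ax j $ 2))"
  have P: "P s = (norm (z - s *\<^sub>R ax j))\<^sup>2 + e\<^sup>2" for s by (simp add: P_def norm_plane)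
  have "F = (\<lambda>s. ln (P s) / (4 * pi))"
   by (simp add: fun_eq_iff F_def Ge_def P)
  moreover have Ps: "P s > 0" unfolding P by (rule pos)
  moreover have dP: "(P has_real_derivative N) (at s)"
   unfolding P_def N_def by (auto intro!: derivative_eq_intros simp: algebra_simps)
  moreover have "((\<lambda>s. ln (P s) / (4 * pi)) has_real_derivative (1 / P s * N) / (4 * pi)) (at s)"
   by (rule DERIV_cdivide[OF DERIV_chain2[OF DERIV_ln_divide[OF Ps] dP]])
  moreover have "(1 / P s * N) / (4 * pi) = - (z - s *\<^sub>R ax j) $ j / (2 * pi * ((norm (z - s *\<^sub>R ax j))\<^sup>2 + e\<^sup>2))"
  proof -
   have "N = - 2 * (z - s *\<^sub>R ax j) $ j"
    by (cases "i = 1") (simp_all add: N_def j_def ax_nth)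
   moreover have "(1 / D * (- 2 * c)) / (4 * pi) = - c / (2 * pi * D)" if "D > 0" for D c :: real
    using that by (simp add: divide_simps)
   ultimately show ?thesis using pos[of "z - s *\<^sub>R ax j"] unfolding P[symmetric] by metis
  qed
  ultimately show ?thesis by simp
 qed
 obtain t where t: "0 < t" "t < h" "F h - F 0 = (h - 0) * (- (z - t *\<^sub>R ax j) $ j / (2 * pi * ((norm (z - t *\<^sub>R ax j))\<^sup>2 + e\<^sup>2)))"
  using MVT2[OF h D] by blast
 have K: "Ke e \<xi> $ i = (if i = 1 then - (\<xi> $ j) else \<xi> $ j) / (2 * pi * ((norm \<xi>)\<^sup>2 + e\<^sup>2))" for \<xi>
 proof -
  have "i = 1 \<or> i = 2" by (rule exhaust_2)
  then show ?thesis by (auto simp: Ke_alt j_def)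
 qed
 have "kd e h i z = (if i = 1 then 1 else - 1) * ((F h - F 0) / h)"
  by (auto simp: kd_def F_def j_def diff_divide_distrib)
 also have "\<dots> = Ke e (z - t *\<^sub>R ax j) $ i"
  unfolding t(3) K using h by simp
 finally have "kd e h i z = Ke e (z - t *\<^sub>R ax j) $ i" .
 moreover have "norm (z - t *\<^sub>R ax j - z) \<le> h" using t by simp
 ultimately show ?thesis by blast
qed

lemma kd_bound:
 assumes e: "e > 0" and h: "h > 0" shows "\<bar>kd e h i z\<bar> \<le> 1 / e"
proof -
 obtain \<xi> where "kd e h i z = Ke e \<xi> $ i" using kd_mvt[OF e h] by blast
 then show ?thesis using component_le_norm_cart[of "Ke e \<xi>" i] norm_Ke_bound[OF e, of \<xi>] by simp
qed

lemma kd_close: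
 assumes e: "e > 0" and h: "h > 0" shows "\<bar>kd e h i z - Ke e z' $ i\<bar> \<le> (h + norm (z - z')) / e\<^sup>2"
proof -
 obtain \<xi> where x: "norm (\<xi> - z) \<le> h" "kd e h i z = Ke e \<xi> $ i" using kd_mvt[OF e h] by blast
 have "\<bar>kd e h i z - Ke e z' $ i\<bar> \<le> norm (Ke e \<xi> - Ke e z')"
  unfolding x(2) using component_le_norm_cart[of "Ke e \<xi> - Ke e z'" i] by simp
 also have "\<dots> \<le> norm (\<xi> - z') / e\<^sup>2" by (rule norm_Ke_lipschitz[OF e])
 also have "\<dots> \<le> (h + norm (z - z')) / e\<^sup>2"
  using x(1) norm_triangle_ineq[of "\<xi> - z" "z - z'"] by (intro divide_right_mono) auto
 finally show ?thesis .
qed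

section \<open>Velocities and the consistency of one step\<close>

lemma borel_measurable_plane_nth [measurable (raw)]:
 fixes f :: "'c \<Rightarrow> plane"
 assumes "f \<in> borel_measurable M" shows "(\<lambda>x. f x $ i) \<in> borel_measurable M"
 by (rule borel_measurable_continuous_on[OF _ assms]) (intro continuous_intros)

lemma charge_lborel: "integrable lborel w \<Longrightarrow> charge lborel w (\<lambda>y::plane. y)"
 by unfold_locales auto

lemma consistency_component:
 fixes d u f g p q S B M m e h \<delta> :: real
 assumes e: "0 < e" "e \<le> 1" and m: "m > 0" and B: "B \<ge> 0"
  and h: "h = e^3" and M: "M = m / e" and \<delta>: "\<delta> = h / (2 * M)"
  and d: "\<bar>d\<bar> \<le> B" and f: "\<bar>f\<bar> \<le> M" "\<bar>g\<bar> \<le> M"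
  and fu: "\<bar>f - u\<bar> \<le> m * e" "\<bar>g - u\<bar> \<le> 2 * (m * e)"
  and p: "\<bar>p - h * d\<bar> \<le> B * h\<^sup>2" "\<bar>q - h * d\<bar> \<le> B * h\<^sup>2"
 shows "\<bar>(p - q) / 4 + (f * p + g * q) / (4 * M) - \<delta> * (d * u)\<bar> \<le> \<delta> * (7 / 2 * (m * B * e))"
proof -
 have pos: "M > 0" "h > 0" "\<delta> > 0" using e m by (simp_all add: M h \<delta>)
 have hh: "h\<^sup>2 = 2 * m * \<delta> * e\<^sup>2"
 proof -
  have "2 * m * \<delta> * e\<^sup>2 = h * (e * e\<^sup>2)" using e m by (simp add: \<delta> M)
  also have "e * e\<^sup>2 = h" by (simp add: h power2_eq_square power3_eq_cube)
  finally show ?thesis by (simp add: power2_eq_square)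
 qed
 have eq: "(p - q) / 4 + (f * p + g * q) / (4 * M) - \<delta> * (d * u) =
  ((p - h * d) - (q - h * d)) / 4 + (f * (p - h * d) + g * (q - h * d)) / (4 * M) + \<delta> / 2 * (d * ((f - u) + (g - u)))"
 proof -
  have hd: "h * d * (f + g) / (4 * M) = \<delta> / 2 * (d * (f + g))"
   using pos by (simp add: \<delta>)
  have "(f * p + g * q) / (4 * M) = (f * (p - h * d) + g * (q - h * d)) / (4 * M) + h * d * (f + g) / (4 * M)"
   unfolding add_divide_distrib[symmetric] by (rule arg_cong2[where f="(/)"]) (simp_all add: algebra_simps)
  then show ?thesis unfolding hd by (simp add: algebra_simps)
 qed
 have 1: "\<bar>((p - h * d) - (q - h * d)) / 4\<bar> \<le> B * h\<^sup>2 / 2" using p by simp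
 have 2: "\<bar>(f * (p - h * d) + g * (q - h * d)) / (4 * M)\<bar> \<le> B * h\<^sup>2 / 2"
 proof -
  have "\<bar>f * (p - h * d)\<bar> \<le> M * (B * h\<^sup>2)" "\<bar>g * (q - h * d)\<bar> \<le> M * (B * h\<^sup>2)"
   unfolding abs_mult using f p pos by (intro mult_mono; simp)+
  then have "\<bar>f * (p - h * d) + g * (q - h * d)\<bar> \<le> 2 * M * (B * h\<^sup>2)" by simp
  then have "\<bar>f * (p - h * d) + g * (q - h * d)\<bar> / (4 * M) \<le> 2 * M * (B * h\<^sup>2) / (4 * M)"
   using pos by (intro divide_right_mono) auto
  also have "\<dots> = B * h\<^sup>2 / 2" using pos by simp
  finally show ?thesis using pos by simp
 qed
 have 3: "\<bar>\<delta> / 2 * (d * ((f - u) + (g - u)))\<bar> \<le> \<delta> / 2 * (B * (3 * (m * e)))"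
 proof -
  have "\<bar>(f - u) + (g - u)\<bar> \<le> 3 * (m * e)" using fu by linarith
  then have "\<bar>d\<bar> * \<bar>(f - u) + (g - u)\<bar> \<le> B * (3 * (m * e))" using d B by (intro mult_mono) auto
  then have "\<delta> / 2 * (\<bar>d\<bar> * \<bar>(f - u) + (g - u)\<bar>) \<le> \<delta> / 2 * (B * (3 * (m * e)))"
   using pos by (intro mult_left_mono) auto
  then show ?thesis using pos by (simp add: abs_mult)
 qed
 have "B * h\<^sup>2 = \<delta> * (2 * (m * B) * e\<^sup>2)" unfolding hh by simp
 also have "\<dots> \<le> \<delta> * (2 * (m * B) * e)"
  using e m B pos by (intro mult_left_mono) (auto simp: power2_eq_square mult_left_le)
 finally have "B * h\<^sup>2 \<le> \<delta> * (2 * (m * B) * e)" .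
 moreover have "\<delta> / 2 * (B * (3 * (m * e))) = 3 / 2 * (\<delta> * (m * B * e))" by simp
 moreover have "\<delta> * (2 * (m * B) * e) = 2 * (\<delta> * (m * B * e))" by simp
 moreover have "\<delta> * (7 / 2 * (m * B * e)) = 7 / 2 * (\<delta> * (m * B * e))" by simp
 ultimately show ?thesis unfolding eq using 1 2 3 by linarith
qed

lemma bound_component:
 fixes u f g p q S B M m e h \<delta> :: real
 assumes e: "0 < e" "e \<le> 1" and m: "m > 0" and B: "B \<ge> 0"
  and h: "h = e^3" and M: "M = m / e" and \<delta>: "\<delta> = h / (2 * M)"
  and fu: "\<bar>f - u\<bar> \<le> m * e" "\<bar>g - u\<bar> \<le> 2 * (m * e)"
  and p: "\<bar>p\<bar> \<le> B * h" "\<bar>q\<bar> \<le> B * h" "\<bar>p - q\<bar> \<le> B * h\<^sup>2"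
 shows "\<bar>(p - q) / 4 + (f * p + g * q) / (4 * M)\<bar> \<le> \<delta> * B * (2 * m + \<bar>u\<bar>)"
proof -
 have pos: "M > 0" "h > 0" "\<delta> > 0" using e m by (simp_all add: M h \<delta>)
 have hh: "h\<^sup>2 = 2 * m * \<delta> * e\<^sup>2"
 proof -
  have "2 * m * \<delta> * e\<^sup>2 = h * (e * e\<^sup>2)" using e m by (simp add: \<delta> M)
  also have "e * e\<^sup>2 = h" by (simp add: h power2_eq_square power3_eq_cube)
  finally show ?thesis by (simp add: power2_eq_square)
 qed
 have e2: "e\<^sup>2 \<le> 1" using e by (simp add: power_le_one)
 have "\<bar>f * p + g * q\<bar> \<le> \<bar>f\<bar> * \<bar>p\<bar> + \<bar>g\<bar> * \<bar>q\<bar>"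
  by (rule order_trans[OF abs_triangle_ineq]) (simp add: abs_mult)
 also have "\<dots> \<le> (\<bar>u\<bar> + m * e) * (B * h) + (\<bar>u\<bar> + 2 * (m * e)) * (B * h)"
  using p fu m e by (intro add_mono mult_mono) auto
 also have "\<dots> = (2 * \<bar>u\<bar> + 3 * (m * e)) * (B * h)" by (simp add: algebra_simps)
 also have "\<dots> \<le> (2 * \<bar>u\<bar> + 3 * m) * (B * h)"
  using e m B pos by (intro mult_right_mono) (auto simp: mult_left_le)
 finally have "\<bar>f * p + g * q\<bar> / (4 * M) \<le> (2 * \<bar>u\<bar> + 3 * m) * (B * h) / (4 * M)"
  using pos by (intro divide_right_mono) auto
 also have "\<dots> = \<delta> * B * (\<bar>u\<bar> + 3 / 2 * m)" using pos by (simp add: \<delta> field_simps)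
 finally have 1: "\<bar>(f * p + g * q) / (4 * M)\<bar> \<le> \<delta> * B * (\<bar>u\<bar> + 3 / 2 * m)" using pos by simp
 have "\<bar>(p - q) / 4\<bar> \<le> B * h\<^sup>2 / 4" using p by simp
 also have "\<dots> = \<delta> * B * (m / 2) * e\<^sup>2" unfolding hh by simp
 also have "\<dots> \<le> \<delta> * B * (m / 2) * 1" using e2 pos B m by (intro mult_left_mono) auto
 finally have 2: "\<bar>(p - q) / 4\<bar> \<le> \<delta> * B * (m / 2)" by simp
 have "\<delta> * B * (2 * m + \<bar>u\<bar>) = \<delta> * B * (\<bar>u\<bar> + 3 / 2 * m) + \<delta> * B * (m / 2)" by (simp add: algebra_simps)
 with 1 2 show ?thesis by linarith
qed

context charge
begin

definition vel :: "(plane \<Rightarrow> 'v::euclidean_space) \<Rightarrow> (plane \<Rightarrow> real) \<Rightarrow> plane \<Rightarrow> 'v" where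
 "vel k w x = pot lborel w (\<lambda>y. y) k x + pot L g Y k x"

lemma mass_nonneg: "mass \<ge> 0"
 by simp

lemma vel_meas [measurable]:
 fixes k :: "plane \<Rightarrow> 'v::euclidean_space"
 assumes [measurable]: "k \<in> borel_measurable borel" and w: "integrable lborel w"
 shows "vel k w \<in> borel_measurable borel"
 unfolding vel_def[abs_def] using charge.pot_measurable[OF charge_lborel[OF w], of k] by simp

lemma vel_bound:
 fixes k :: "plane \<Rightarrow> 'v::euclidean_space"
 assumes k: "k \<in> borel_measurable borel" "\<And>z. norm (k z) \<le> c"
  and w: "integrable lborel w" "(LINT y|lborel. \<bar>w y\<bar>) + mass \<le> m"
 shows "norm (vel k w x) \<le> c * m"
proof -
 have c: "c \<ge> 0" using order_trans[OF norm_ge_zero k(2)] .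
 have "norm (vel k w x) \<le> c * (LINT y|lborel. \<bar>w y\<bar>) + c * mass"
  unfolding vel_def
  by (rule order_trans[OF norm_triangle_ineq add_mono[OF charge.norm_pot_le[OF charge_lborel[OF w(1)] k] norm_pot_le[OF k]]])
 also have "\<dots> \<le> c * m" using mult_left_mono[OF w(2) c] by (simp add: algebra_simps)
 finally show ?thesis .
qed

lemma vel_diff:
 fixes k k' :: "plane \<Rightarrow> 'v::euclidean_space"
 assumes k: "k \<in> borel_measurable borel" "\<And>z. norm (k z) \<le> c1" "k' \<in> borel_measurable borel" "\<And>z. norm (k' z) \<le> c2"
  and w: "integrable lborel w" "(LINT y|lborel. \<bar>w y\<bar>) + mass \<le> m"
  and d: "\<And>y. norm (k (x - y) - k' (x' - y)) \<le> c"
 shows "norm (vel k w x - vel k' w x') \<le> c * m"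
proof -
 have c: "c \<ge> 0" using order_trans[OF norm_ge_zero d] .
 note W = charge_lborel[OF w(1)]
 have "vel k w x - vel k' w x' = (pot lborel w (\<lambda>y. y) k x - pot lborel w (\<lambda>y. y) k' x') + (pot L g Y k x - pot L g Y k' x')"
  unfolding vel_def by (simp only: add_diff_add)
 also have "norm \<dots> \<le> c * (LINT y|lborel. \<bar>w y\<bar>) + c * mass"
  by (rule order_trans[OF norm_triangle_ineq add_mono[OF
    charge.pot_diff_le[OF W k(1,3) charge.pot_integrable[OF W k(1,2)] charge.pot_integrable[OF W k(3,4)] d]
    pot_diff_le[OF k(1,3) pot_integrable[OF k(1,2)] pot_integrable[OF k(3,4)] d]]])
 also have "\<dots> \<le> c * m" using mult_left_mono[OF w(2) c] by (simp add: algebra_simps)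
 finally show ?thesis .
qed

lemma pot_add:
 fixes k k' :: "plane \<Rightarrow> 'v::euclidean_space"
 assumes k: "k \<in> borel_measurable borel" "\<And>z. norm (k z) \<le> c1" "k' \<in> borel_measurable borel" "\<And>z. norm (k' z) \<le> c2"
 shows "pot L g Y (\<lambda>z. k z + k' z) x = pot L g Y k x + pot L g Y k' x"
 unfolding pot_def scaleR_add_right
 by (rule Bochner_Integration.integral_add[OF pot_integrable[OF k(1,2)] pot_integrable[OF k(3,4)]])

lemma pot_nth:
 fixes k :: "plane \<Rightarrow> plane"
 assumes k: "k \<in> borel_measurable borel" "\<And>z. norm (k z) \<le> c1"
 shows "pot L g Y (\<lambda>z. k z $ i) x = pot L g Y k x $ i"
 using integral_bounded_linear[OF bounded_linear_vec_nth pot_integrable[OF k, of x], of i] by (simp add: pot_def)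

lemma vel_add:
 fixes k k' :: "plane \<Rightarrow> 'v::euclidean_space"
 assumes k: "k \<in> borel_measurable borel" "\<And>z. norm (k z) \<le> c1" "k' \<in> borel_measurable borel" "\<And>z. norm (k' z) \<le> c2"
  and w: "integrable lborel w"
 shows "vel (\<lambda>z. k z + k' z) w x = vel k w x + vel k' w x"
 by (simp add: vel_def pot_add[OF k] charge.pot_add[OF charge_lborel[OF w] k])

lemma vel_nth:
 fixes k :: "plane \<Rightarrow> plane"
 assumes k: "k \<in> borel_measurable borel" "\<And>z. norm (k z) \<le> c1" and w: "integrable lborel w"
 shows "vel (\<lambda>z. k z $ i) w x = vel k w x $ i"
 by (simp add: vel_def pot_nth[OF k] charge.pot_nth[OF charge_lborel[OF w] k])

lemma pot_shift: "pot L g Y k (x - a) = pot L g Y (\<lambda>z. k (z - a)) x"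
proof -
 have "x - a - Y b = x - Y b - a" for b by simp
 then show ?thesis unfolding pot_def by (simp only:)
qed

lemma vel_shift: "integrable lborel w \<Longrightarrow> vel k w (x - a) = vel (\<lambda>z. k (z - a)) w x"
 by (simp add: vel_def pot_shift charge.pot_shift[OF charge_lborel])

lemma flux_vel:
 assumes e: "e > 0" and h: "h > 0" and m: "m > 0"
  and w: "integrable lborel w" "(LINT y|lborel. \<bar>w y\<bar>) + mass \<le> m"
 shows "flux (m / e) h (\<lambda>i. vel (kd e h i) w)"
proof
 note b = kd_meas kd_bound[OF e h, unfolded real_norm_def[symmetric]]
 show "m / e > 0" using e m by simp
 show "\<bar>vel (kd e h i) w x\<bar> \<le> m / e" for i x
  using vel_bound[OF b w, of i x] by simp
 show "vel (kd e h i) w \<in> borel_measurable borel" for i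
  using w(1) by measurable
 fix x
 have m': "(\<lambda>z. kd e h i (z - a)) \<in> borel_measurable borel" for i a by measurable
 have "(\<Sum>i\<in>UNIV. vel (kd e h i) w x) = vel (\<lambda>z. \<Sum>i\<in>UNIV. kd e h i z) w x"
  unfolding sum_2 by (rule vel_add[symmetric, OF b b w(1)])
 also have "\<dots> = vel (\<lambda>z. kd e h 1 (z - h *\<^sub>R ax 1) + kd e h 2 (z - h *\<^sub>R ax 2)) w x"
  unfolding kd_div by (simp add: sum_2)
 also have "\<dots> = (\<Sum>i\<in>UNIV. vel (kd e h i) w (x - h *\<^sub>R ax i))"
  unfolding sum_2 vel_shift[OF w(1)] by (rule vel_add[OF m' b(2) m' b(2) w(1)])
 finally show "(\<Sum>i\<in>UNIV. vel (kd e h i) w x) = (\<Sum>i\<in>UNIV. vel (kd e h i) w (x - h *\<^sub>R ax i))" .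
qed

lemma flux_close:
 assumes e: "e > 0" and h: "h = e^3"
  and w: "integrable lborel w" "(LINT y|lborel. \<bar>w y\<bar>) + mass \<le> m"
 shows "\<bar>vel (kd e h i) w x - vel (Ke e) w x $ i\<bar> \<le> m * e"
  "\<bar>vel (kd e h i) w (x - h *\<^sub>R ax i) - vel (Ke e) w x $ i\<bar> \<le> 2 * (m * e)"
proof -
 have h0: "h > 0" using e h by simp
 have he: "h / e\<^sup>2 = e" using e by (simp add: h power2_eq_square power3_eq_cube)
 note b = kd_meas kd_bound[OF e h0, unfolded real_norm_def[symmetric]]
 have k: "(\<lambda>z. Ke e z $ i) \<in> borel_measurable borel" by measurable
 have k': "norm (Ke e z $ i) \<le> 1 / e" for z
  using component_le_norm_cart[of "Ke e z" i] norm_Ke_bound[OF e, of z] by simp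
 have "norm (vel (kd e h i) w x - vel (\<lambda>z. Ke e z $ i) w x) \<le> e * m"
 proof (rule vel_diff[OF b k k' w])
  show "norm (kd e h i (x - y) - Ke e (x - y) $ i) \<le> e" for y
   using kd_close[OF e h0, of i "x - y" "x - y"] he by simp
 qed
 then show "\<bar>vel (kd e h i) w x - vel (Ke e) w x $ i\<bar> \<le> m * e"
  unfolding vel_nth[OF borel_measurable_Ke norm_Ke_bound[OF e] w(1)] by (simp add: mult.commute)
 have "norm (vel (kd e h i) w (x - h *\<^sub>R ax i) - vel (\<lambda>z. Ke e z $ i) w x) \<le> (2 * e) * m"
 proof (rule vel_diff[OF b k k' w])
  fix y
  have "norm (x - h *\<^sub>R ax i - y - (x - y)) = h" using h0 by simp
  then show "norm (kd e h i (x - h *\<^sub>R ax i - y) - Ke e (x - y) $ i) \<le> 2 * e"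
   using kd_close[OF e h0, of i "x - h *\<^sub>R ax i - y" "x - y"] he by (simp add: add_divide_distrib)
 qed
 then show "\<bar>vel (kd e h i) w (x - h *\<^sub>R ax i) - vel (Ke e) w x $ i\<bar> \<le> 2 * (m * e)"
  unfolding vel_nth[OF borel_measurable_Ke norm_Ke_bound[OF e] w(1)] by (simp add: mult_ac)
qed

text \<open>The pairing of a vorticity with a velocity never sees the singularity of the kernel.\<close>

lemma pair_vel:
 fixes k :: "plane \<Rightarrow> plane"
 assumes [measurable]: "k \<in> borel_measurable borel" "a \<in> borel_measurable borel" "w \<in> borel_measurable borel"
  and a: "\<And>z. norm (k z) \<le> a z"
  and C: "\<And>y. (\<integral>\<^sup>+x. ennreal (\<bar>w x\<bar> * a (x - y)) \<partial>lborel) \<le> ennreal C"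
  and v: "integrable lborel v" "(LINT y|lborel. \<bar>v y\<bar>) + mass \<le> m" and C0: "C \<ge> 0"
 shows "(\<integral>\<^sup>+x. ennreal (\<bar>w x\<bar> * norm (vel k v x)) \<partial>lborel) \<le> ennreal (C * m)"
proof -
 have a0: "a z \<ge> 0" for z using order_trans[OF norm_ge_zero a] .
 interpret V: charge lborel v "\<lambda>y. y" by (rule charge_lborel[OF v(1)])
 have [measurable]: "v \<in> borel_measurable borel" using V.g_meas by simp
 have "(\<integral>\<^sup>+x. ennreal (\<bar>w x\<bar> * norm (vel k v x)) \<partial>lborel) \<le>
  (\<integral>\<^sup>+x. ennreal \<bar>w x\<bar> * (\<integral>\<^sup>+y. ennreal (\<bar>v y\<bar> * a (x - y)) \<partial>lborel) + ennreal \<bar>w x\<bar> * (\<integral>\<^sup>+b. ennreal (\<bar>g b\<bar> * a (x - Y b)) \<partial>L) \<partial>lborel)"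
 proof (rule nn_integral_mono)
  fix x
  have "ennreal (norm (vel k v x)) \<le> ennreal (norm (pot lborel v (\<lambda>y. y) k x)) + ennreal (norm (pot L g Y k x))"
   unfolding vel_def ennreal_plus[OF norm_ge_zero norm_ge_zero, symmetric] by (intro ennreal_leI norm_triangle_ineq)
  also have "\<dots> \<le> (\<integral>\<^sup>+y. ennreal (\<bar>v y\<bar> * norm (k (x - y))) \<partial>lborel) + (\<integral>\<^sup>+b. ennreal (\<bar>g b\<bar> * norm (k (x - Y b))) \<partial>L)"
   by (intro add_mono norm_pot_le_nn V.norm_pot_le_nn) measurable
  also have "\<dots> \<le> (\<integral>\<^sup>+y. ennreal (\<bar>v y\<bar> * a (x - y)) \<partial>lborel) + (\<integral>\<^sup>+b. ennreal (\<bar>g b\<bar> * a (x - Y b)) \<partial>L)"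
   by (intro add_mono nn_integral_mono ennreal_leI mult_left_mono a) auto
  finally show "ennreal (\<bar>w x\<bar> * norm (vel k v x)) \<le> ennreal \<bar>w x\<bar> * (\<integral>\<^sup>+y. ennreal (\<bar>v y\<bar> * a (x - y)) \<partial>lborel) + ennreal \<bar>w x\<bar> * (\<integral>\<^sup>+b. ennreal (\<bar>g b\<bar> * a (x - Y b)) \<partial>L)"
   unfolding ennreal_mult[OF abs_ge_zero norm_ge_zero] distrib_left[symmetric] by (rule mult_left_mono) simp
 qed
 also have "\<dots> = (\<integral>\<^sup>+x. ennreal \<bar>w x\<bar> * (\<integral>\<^sup>+y. ennreal (\<bar>v y\<bar> * a (x - y)) \<partial>lborel) \<partial>lborel) + (\<integral>\<^sup>+x. ennreal \<bar>w x\<bar> * (\<integral>\<^sup>+b. ennreal (\<bar>g b\<bar> * a (x - Y b)) \<partial>L) \<partial>lborel)"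
  by (rule nn_integral_add) measurable
 also have "\<dots> \<le> ennreal C * ennreal V.mass + ennreal C * ennreal mass"
  by (intro add_mono pairing_le V.pairing_le a0 C) measurable
 also have "\<dots> = ennreal (C * (V.mass + mass))"
  using C0 by (simp add: ennreal_mult ennreal_plus distrib_left[symmetric])
 also have "\<dots> \<le> ennreal (C * m)" using v(2) C0 by (intro ennreal_leI mult_left_mono)
 finally show ?thesis .
qed

text \<open>Summation by parts moves the differences to the test function, and Taylor expansion compares them
 with its gradient. The second-order terms are the numerical viscosity.\<close>

lemma step_consistency:
 assumes e: "0 < e" "e \<le> 1" and m: "m > 0"
  and w: "integrable lborel w" "(LINT y|lborel. \<bar>w y\<bar>) + mass \<le> m"
  and h: "h = e^3" and M: "M = m / e" and \<delta>: "\<delta> = h / (2 * M)"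
  and \<phi>: "\<phi> \<in> borel_measurable borel" "\<And>x. \<bar>\<phi> x\<bar> \<le> B'"
  and d [measurable]: "\<And>i. d i \<in> borel_measurable borel" and dB: "\<And>i x. \<bar>d i x\<bar> \<le> B"
  and T: "\<And>i x. \<bar>\<phi> (x + h *\<^sub>R ax i) - \<phi> x - h * d i x\<bar> \<le> B * h\<^sup>2"
   "\<And>i x. \<bar>\<phi> x - \<phi> (x - h *\<^sub>R ax i) - h * d i x\<bar> \<le> B * h\<^sup>2"
 shows "\<bar>(LINT x|lborel. \<phi> x * step M h (\<lambda>i. vel (kd e h i) w) w x) - (LINT x|lborel. \<phi> x * w x)
  - \<delta> * (LINT x|lborel. w x * (\<Sum>i\<in>UNIV. d i x * vel (Ke e) w x $ i))\<bar> \<le> \<delta> * (7 * (m * B * e)) * (LINT y|lborel. \<bar>w y\<bar>)"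
proof -
 have h0: "h > 0" using e h by simp
 have B: "B \<ge> 0" using dB[of 1 0] by simp
 interpret F: flux M h "\<lambda>i. vel (kd e h i) w" unfolding M by (rule flux_vel[OF e(1) h0 m w])
 let ?u = "\<lambda>x. vel (Ke e) w x"
 have [measurable]: "w \<in> borel_measurable borel" "?u \<in> borel_measurable borel" using w(1) by auto
 have pw: "\<bar>F.gen \<phi> x - \<delta> * (\<Sum>i\<in>UNIV. d i x * ?u x $ i)\<bar> \<le> \<delta> * (7 * (m * B * e))" for x
 proof -
  have c: "\<bar>((\<phi> (x + h *\<^sub>R ax i) - \<phi> x) - (\<phi> x - \<phi> (x - h *\<^sub>R ax i))) / 4 +
   (vel (kd e h i) w x * (\<phi> (x + h *\<^sub>R ax i) - \<phi> x) + vel (kd e h i) w (x - h *\<^sub>R ax i) * (\<phi> x - \<phi> (x - h *\<^sub>R ax i))) / (4 * M)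
   - \<delta> * (d i x * ?u x $ i)\<bar> \<le> \<delta> * (7 / 2 * (m * B * e))" for i
   by (rule consistency_component[OF e m B h M \<delta> dB F.f_le F.f_le flux_close[OF e(1) h w] T])
  have eq: "F.gen \<phi> x - \<delta> * (\<Sum>i\<in>UNIV. d i x * ?u x $ i) =
   (\<Sum>i\<in>UNIV. ((\<phi> (x + h *\<^sub>R ax i) - \<phi> x) - (\<phi> x - \<phi> (x - h *\<^sub>R ax i))) / 4 +
   (vel (kd e h i) w x * (\<phi> (x + h *\<^sub>R ax i) - \<phi> x) + vel (kd e h i) w (x - h *\<^sub>R ax i) * (\<phi> x - \<phi> (x - h *\<^sub>R ax i))) / (4 * M)
   - \<delta> * (d i x * ?u x $ i))"
   unfolding F.gen_def sum_2 by (simp add: add_divide_distrib diff_divide_distrib distrib_left)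
  have "\<bar>F.gen \<phi> x - \<delta> * (\<Sum>i\<in>UNIV. d i x * ?u x $ i)\<bar> \<le> (\<Sum>i\<in>(UNIV::2 set). \<delta> * (7 / 2 * (m * B * e)))"
   unfolding eq by (intro order_trans[OF sum_abs] sum_mono c)
  also have "\<dots> = \<delta> * (7 * (m * B * e))" by (simp add: sum_2)
  finally show ?thesis .
 qed
 have ub: "norm (?u x) \<le> 1 / e * m" for x
  by (rule vel_bound[OF borel_measurable_Ke norm_Ke_bound[OF e(1)] w])
 have i2: "integrable lborel (\<lambda>x. w x * (\<Sum>i\<in>UNIV. d i x * ?u x $ i))"
 proof (rule Bochner_Integration.integrable_bound[OF integrable_mult_right[OF w(1), of "2 * (B * (1 / e * m))"]])
  show "AE x in lborel. norm (w x * (\<Sum>i\<in>UNIV. d i x * ?u x $ i)) \<le> norm (2 * (B * (1 / e * m)) * w x)"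
  proof (rule AE_I2)
   fix x
   have "\<bar>\<Sum>i\<in>UNIV. d i x * ?u x $ i\<bar> \<le> (\<Sum>i\<in>(UNIV::2 set). B * (1 / e * m))"
   proof (rule order_trans[OF sum_abs sum_mono])
    show "\<bar>d i x * ?u x $ i\<bar> \<le> B * (1 / e * m)" for i
     unfolding abs_mult using B by (intro mult_mono dB order_trans[OF component_le_norm_cart ub]) auto
   qed
   then have "\<bar>\<Sum>i\<in>UNIV. d i x * ?u x $ i\<bar> \<le> 2 * (B * (1 / e * m))" by (simp add: sum_2)
   moreover have "2 * (B * (1 / e * m)) \<ge> 0" using B e m by simp
   ultimately show "norm (w x * (\<Sum>i\<in>UNIV. d i x * ?u x $ i)) \<le> norm (2 * (B * (1 / e * m)) * w x)"
    unfolding real_norm_def abs_mult[of "w x"] abs_mult[of _ "w x"]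
    by (subst mult.commute) (rule mult_right_mono[OF order_trans[OF _ abs_ge_self] abs_ge_zero])
  qed
 qed measurable
 note S = F.step_weak[OF \<phi> w(1)]
 have eq: "(LINT x|lborel. \<phi> x * step M h (\<lambda>i. vel (kd e h i) w) w x) - (LINT x|lborel. \<phi> x * w x)
  - \<delta> * (LINT x|lborel. w x * (\<Sum>i\<in>UNIV. d i x * ?u x $ i)) =
  (LINT x|lborel. w x * (F.gen \<phi> x - \<delta> * (\<Sum>i\<in>UNIV. d i x * ?u x $ i)))"
  unfolding S(4) right_diff_distrib mult.left_commute[of _ \<delta>] using S(1) i2
  by (subst Bochner_Integration.integral_diff) simp_all
 have "\<bar>LINT x|lborel. w x * (F.gen \<phi> x - \<delta> * (\<Sum>i\<in>UNIV. d i x * ?u x $ i))\<bar> \<le> (LINT x|lborel. \<delta> * (7 * (m * B * e)) * \<bar>w x\<bar>)"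
 proof (rule order_trans[OF integral_abs_bound integral_mono])
  show "integrable lborel (\<lambda>x. \<bar>w x * (F.gen \<phi> x - \<delta> * (\<Sum>i\<in>UNIV. d i x * ?u x $ i))\<bar>)"
   unfolding right_diff_distrib mult.left_commute[of _ \<delta>] using S(1) i2 by (intro integrable_abs Bochner_Integration.integrable_diff) simp_all
  show "integrable lborel (\<lambda>x. \<delta> * (7 * (m * B * e)) * \<bar>w x\<bar>)" using w(1) by auto
  show "\<bar>w x * (F.gen \<phi> x - \<delta> * (\<Sum>i\<in>UNIV. d i x * ?u x $ i))\<bar> \<le> \<delta> * (7 * (m * B * e)) * \<bar>w x\<bar>" for x
   unfolding abs_mult using mult_right_mono[OF pw[of x], of "\<bar>w x\<bar>"] by (simp add: mult.commute)
 qed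
 then show ?thesis unfolding eq by simp
qed

text \<open>The first differences of the test function are paired with the flux, whose pairing with the
 vorticity is bounded uniformly in the mesh; the second differences carry the factor \<open>M * h\<close>.\<close>

lemma step_equicontinuous:
 assumes e: "0 < e" "e \<le> 1" and m: "m > 0"
  and w: "integrable lborel w" "(LINT y|lborel. \<bar>w y\<bar>) + mass \<le> m"
  and h: "h = e^3" and M: "M = m / e" and \<delta>: "\<delta> = h / (2 * M)"
  and \<phi>: "\<phi> \<in> borel_measurable borel" "\<And>x. \<bar>\<phi> x\<bar> \<le> B'"
  and B: "B \<ge> 0"
  and T: "\<And>i x s. \<bar>\<phi> (x + s *\<^sub>R ax i) - \<phi> x\<bar> \<le> B * \<bar>s\<bar>"
   "\<And>i x s. \<bar>\<phi> (x + s *\<^sub>R ax i) + \<phi> (x - s *\<^sub>R ax i) - 2 * \<phi> x\<bar> \<le> B * s\<^sup>2"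
  and C: "C \<ge> 0" "\<And>y. (\<integral>\<^sup>+x. ennreal (\<bar>w x\<bar> / norm (x - y)) \<partial>lborel) \<le> ennreal C"
 shows "\<bar>(LINT x|lborel. \<phi> x * step M h (\<lambda>i. vel (kd e h i) w) w x) - (LINT x|lborel. \<phi> x * w x)\<bar> \<le> \<delta> * (B * (4 * m * m + 2 * (C * m)))"
proof -
 have h0: "h > 0" using e h by simp
 have \<delta>0: "\<delta> > 0" using h0 m e by (simp add: \<delta> M)
 interpret F: flux M h "\<lambda>i. vel (kd e h i) w" unfolding M by (rule flux_vel[OF e(1) h0 m w])
 let ?u = "\<lambda>x. vel (Ke e) w x"
 have [measurable]: "w \<in> borel_measurable borel" "?u \<in> borel_measurable borel" using w(1) by auto
 have pw: "\<bar>F.gen \<phi> x\<bar> \<le> \<delta> * B * (4 * m + 2 * norm (?u x))" for x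
 proof -
  have c: "\<bar>((\<phi> (x + h *\<^sub>R ax i) - \<phi> x) - (\<phi> x - \<phi> (x - h *\<^sub>R ax i))) / 4 +
   (vel (kd e h i) w x * (\<phi> (x + h *\<^sub>R ax i) - \<phi> x) + vel (kd e h i) w (x - h *\<^sub>R ax i) * (\<phi> x - \<phi> (x - h *\<^sub>R ax i))) / (4 * M)\<bar>
   \<le> \<delta> * B * (2 * m + \<bar>?u x $ i\<bar>)" for i
   using T(1)[of x h i] T(1)[of x "-h" i] T(2)[of x h i] h0
   by (intro bound_component[OF e m B h M \<delta> flux_close[OF e(1) h w]]) (simp_all add: abs_minus_commute)
  have eq: "F.gen \<phi> x =
   (\<Sum>i\<in>UNIV. ((\<phi> (x + h *\<^sub>R ax i) - \<phi> x) - (\<phi> x - \<phi> (x - h *\<^sub>R ax i))) / 4 +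
   (vel (kd e h i) w x * (\<phi> (x + h *\<^sub>R ax i) - \<phi> x) + vel (kd e h i) w (x - h *\<^sub>R ax i) * (\<phi> x - \<phi> (x - h *\<^sub>R ax i))) / (4 * M))"
   unfolding F.gen_def sum_2 by (simp add: add_divide_distrib diff_divide_distrib distrib_left)
  have "\<bar>F.gen \<phi> x\<bar> \<le> (\<Sum>i\<in>(UNIV::2 set). \<delta> * B * (2 * m + norm (?u x)))"
   unfolding eq using \<delta>0 B by (intro order_trans[OF sum_abs sum_mono] order_trans[OF c] mult_left_mono add_left_mono component_le_norm_cart) auto
  also have "\<dots> = \<delta> * B * (4 * m + 2 * norm (?u x))" by (simp add: sum_2 algebra_simps)
  finally show ?thesis .
 qed
 note S = F.step_weak[OF \<phi> w(1)]
 have P: "(\<integral>\<^sup>+x. ennreal (\<bar>w x\<bar> * norm (?u x)) \<partial>lborel) \<le> ennreal (C * m)"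
  by (rule pair_vel[where a="\<lambda>z. 1 / norm z"]) (use C w norm_Ke_le in auto)
 have i: "integrable lborel (\<lambda>x. \<bar>w x\<bar> * norm (?u x))"
  using P by (intro integrableI_bounded) (auto intro: le_less_trans)
 have Pi: "(LINT x|lborel. \<bar>w x\<bar> * norm (?u x)) \<le> C * m"
 proof -
  have "ennreal (LINT x|lborel. \<bar>w x\<bar> * norm (?u x)) \<le> ennreal (C * m)"
   using P i by (subst (asm) nn_integral_eq_integral) auto
  then show ?thesis using C m by (simp add: ennreal_le_iff)
 qed
 have wm: "(LINT y|lborel. \<bar>w y\<bar>) \<le> m" using w(2) mass_nonneg by linarith
 have "\<bar>LINT x|lborel. w x * F.gen \<phi> x\<bar> \<le> (LINT x|lborel. \<delta> * B * (4 * m * \<bar>w x\<bar> + 2 * (\<bar>w x\<bar> * norm (?u x))))"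
 proof (rule order_trans[OF integral_abs_bound integral_mono])
  show "integrable lborel (\<lambda>x. \<bar>w x * F.gen \<phi> x\<bar>)" using S(1) by (rule integrable_abs)
  show "integrable lborel (\<lambda>x. \<delta> * B * (4 * m * \<bar>w x\<bar> + 2 * (\<bar>w x\<bar> * norm (?u x))))"
   using w(1) i by auto
  show "\<bar>w x * F.gen \<phi> x\<bar> \<le> \<delta> * B * (4 * m * \<bar>w x\<bar> + 2 * (\<bar>w x\<bar> * norm (?u x)))" for x
   unfolding abs_mult using mult_left_mono[OF pw[of x], of "\<bar>w x\<bar>"] by (simp add: algebra_simps)
 qed
 also have "\<dots> = \<delta> * B * (4 * m * (LINT x|lborel. \<bar>w x\<bar>) + 2 * (LINT x|lborel. \<bar>w x\<bar> * norm (?u x)))"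
  using w(1) i by (subst integral_mult_right_zero, subst Bochner_Integration.integral_add) auto
 also have "\<dots> \<le> \<delta> * B * (4 * m * m + 2 * (C * m))"
  using Pi wm m \<delta>0 B by (intro mult_left_mono add_mono) auto
 finally show ?thesis unfolding S(4) by (simp add: mult.assoc)
qed

end

section \<open>Compactness of asymptotically equicontinuous families\<close>

text \<open>The family need only be equicontinuous up to an error that vanishes along the sequence: a diagonal
 subsequence converges on a countable dense set, and the modulus transfers this to all points.\<close>

lemma equicontinuous_subsequence:
 fixes U :: "nat \<Rightarrow> 'a::{metric_space, second_countable_topology} \<Rightarrow> 'v::euclidean_space"
 assumes bound: "\<And>n p. norm (U n p) \<le> C"
  and equi: "\<And>e. e > 0 \<Longrightarrow> \<exists>d>0. \<exists>N. \<forall>n\<ge>N. \<forall>p q. dist p q \<le> d \<longrightarrow> norm (U n p - U n q) \<le> e"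
 obtains r V where "strict_mono (r :: nat \<Rightarrow> nat)" "\<And>p. (\<lambda>n. U (r n) p) \<longlonglongrightarrow> V p"
proof -
 obtain D :: "'a set" where D: "countable D" "\<And>X. open X \<Longrightarrow> X \<noteq> {} \<Longrightarrow> \<exists>d\<in>D. d \<in> X"
  using countable_dense_exists by blast
 obtain r where r: "strict_mono (r :: nat \<Rightarrow> nat)" "\<And>p. p \<in> D \<Longrightarrow> \<exists>l. (\<lambda>n. U (r n) p) \<longlonglongrightarrow> l"
  using function_convergent_subsequence[OF D(1), of U C] bound by metis
 have "convergent (\<lambda>n. U (r n) p)" for p
 proof (rule Cauchy_convergent, rule metric_CauchyI)
  fix e :: real assume e: "e > 0"
  obtain d N where d: "d > 0" "\<And>n p q. n \<ge> N \<Longrightarrow> dist p q \<le> d \<Longrightarrow> norm (U n p - U n q) \<le> e / 4"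
   using equi[of "e / 4"] e by (metis zero_less_divide_iff zero_less_numeral)
  obtain q where q: "q \<in> D" "q \<in> ball p d"
   using D(2)[of "ball p d"] d(1) by (metis centre_in_ball empty_iff open_ball)
  then have pq: "dist p q \<le> d" by simp
  have "Cauchy (\<lambda>n. U (r n) q)" using r(2)[OF q(1)] LIMSEQ_imp_Cauchy by blast
  then obtain M where M: "\<And>i j. i \<ge> M \<Longrightarrow> j \<ge> M \<Longrightarrow> dist (U (r i) q) (U (r j) q) < e / 4"
   using metric_CauchyD[of "\<lambda>n. U (r n) q" "e / 4"] e by auto
  have "dist (U (r i) p) (U (r j) p) < e" if ij: "i \<ge> max M N" "j \<ge> max M N" for i j
  proof -
   have "r i \<ge> N" "r j \<ge> N" using ij seq_suble[OF r(1), of i] seq_suble[OF r(1), of j] by auto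
   then have "dist (U (r i) p) (U (r i) q) \<le> e / 4" "dist (U (r j) p) (U (r j) q) \<le> e / 4"
    using d(2)[OF _ pq] by (auto simp: dist_norm)
   moreover have "dist (U (r i) q) (U (r j) q) < e / 4" using M ij by simp
   ultimately have "dist (U (r i) p) (U (r i) q) + dist (U (r i) q) (U (r j) q) + dist (U (r j) q) (U (r j) p) < e"
    using e by (simp add: dist_commute)
   moreover have "dist (U (r i) p) (U (r j) p) \<le> dist (U (r i) p) (U (r i) q) + dist (U (r i) q) (U (r j) q) + dist (U (r j) q) (U (r j) p)"
    using dist_triangle[of "U (r i) p" "U (r j) p" "U (r i) q"] dist_triangle[of "U (r i) q" "U (r j) p" "U (r j) q"] by linarith
   ultimately show ?thesis by linarith
  qed
  then show "\<exists>M. \<forall>m\<ge>M. \<forall>n\<ge>M. dist (U (r m) p) (U (r n) p) < e" by blast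
 qed
 then have "(\<lambda>n. U (r n) p) \<longlonglongrightarrow> lim (\<lambda>n. U (r n) p)" for p
  by (simp add: convergent_LIMSEQ_iff)
 then show ?thesis using that[OF r(1), of "\<lambda>p. lim (\<lambda>n. U (r n) p)"] by blast
qed

section \<open>Second differences of the regularised kernel\<close>

lemma second_difference_quotient:
 fixes n v D c s k :: real
 assumes k: "k > 0" and D: "D * k\<^sup>2 \<ge> 1"
  and Ep: "(D + 2 * s * c + s\<^sup>2) * k\<^sup>2 \<ge> 1" "D + 2 * s * c + s\<^sup>2 \<ge> (c + s)\<^sup>2"
  and Em: "(D - 2 * s * c + s\<^sup>2) * k\<^sup>2 \<ge> 1" "D - 2 * s * c + s\<^sup>2 \<ge> (c - s)\<^sup>2"
  and n: "\<bar>n\<bar> \<le> k * D" and v: "\<bar>v\<bar> \<le> 1"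
 shows "\<bar>(n + s * v) / (D + 2 * s * c + s\<^sup>2) + (n - s * v) / (D - 2 * s * c + s\<^sup>2) - 2 * (n / D)\<bar> \<le> (16 * k^3 + 4 * (k^4 + k\<^sup>2)) * s\<^sup>2"
proof -
 define P where "P = D + 2 * s * c + s\<^sup>2"
 define N where "N = D - 2 * s * c + s\<^sup>2"
 have k2: "k\<^sup>2 > 0" using k by simp
 have pos: "D > 0" "P > 0" "N > 0"
  using D Ep(1) Em(1) k2 unfolding P_def[symmetric] N_def[symmetric]
  by (metis less_le_trans zero_less_mult_pos2 zero_less_one)+
 define x where "x = 1 / P"
 define z where "z = 1 / N"
 define y where "y = 1 / D"
 have xyz: "x > 0" "z > 0" "y > 0" "P * x = 1" "N * z = 1" "D * y = 1" using pos by (simp_all add: x_def y_def z_def)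
 have xk: "x \<le> k\<^sup>2" using Ep(1) pos unfolding P_def[symmetric] by (simp add: x_def divide_le_eq mult.commute)
 have zk: "z \<le> k\<^sup>2" using Em(1) pos unfolding N_def[symmetric] by (simp add: z_def divide_le_eq mult.commute)
 have ny: "\<bar>n\<bar> * y \<le> k" using n pos by (simp add: y_def divide_le_eq)
 have c2: "c\<^sup>2 \<le> P + N"
 proof -
  have "(c + s)\<^sup>2 + (c - s)\<^sup>2 \<le> P + N" using Ep(2) Em(2) unfolding P_def[symmetric] N_def[symmetric] by linarith
  moreover have "(c + s)\<^sup>2 + (c - s)\<^sup>2 = 2 * c\<^sup>2 + 2 * s\<^sup>2" by (simp add: power2_eq_square algebra_simps)
  moreover have "0 \<le> c\<^sup>2" "0 \<le> s\<^sup>2" by simp_all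
  ultimately show ?thesis by linarith
 qed
 have PNxz: "(P + N) * (x * z) = z + x"
 proof -
  have "(P + N) * (x * z) = (P * x) * z + (N * z) * x" by (simp add: algebra_simps)
  then show ?thesis using xyz by simp
 qed
 have c2xz: "c\<^sup>2 * (x * z) \<le> 2 * k\<^sup>2"
 proof -
  have "c\<^sup>2 * (x * z) \<le> (P + N) * (x * z)" using c2 xyz by (intro mult_right_mono) auto
  then show ?thesis using PNxz xk zk by linarith
 qed
 have cxz: "\<bar>c\<bar> * (x * z) \<le> k^4 + k\<^sup>2"
 proof -
  have "2 * \<bar>c\<bar> \<le> 1 + c\<^sup>2" using sum_squares_bound[of 1 "\<bar>c\<bar>"] by simp
  then have "2 * \<bar>c\<bar> * (x * z) \<le> (1 + c\<^sup>2) * (x * z)" using xyz by (intro mult_right_mono) auto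
  moreover have "x * z \<le> k\<^sup>2 * k\<^sup>2" using xk zk xyz by (intro mult_mono) auto
  moreover have "k\<^sup>2 * k\<^sup>2 = k^4" by (simp add: power2_eq_square power4_eq_xxxx)
  moreover have "(1 + c\<^sup>2) * (x * z) = x * z + c\<^sup>2 * (x * z)" by (simp add: algebra_simps)
  moreover have "0 \<le> k^4" using k by simp
  ultimately show ?thesis using c2xz by linarith
 qed
 have d1: "x - z = - 4 * s * c * (x * z)"
 proof -
  have "x - z = (N - P) * (x * z)" using pos by (simp add: x_def z_def field_simps)
  also have "N - P = - 4 * s * c" by (simp add: N_def P_def)
  finally show ?thesis .
 qed
 have d2: "x - y = - (2 * s * c + s\<^sup>2) * (x * y)"
 proof -
  have "x - y = (D - P) * (x * y)" using pos by (simp add: x_def y_def field_simps)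
  then show ?thesis by (simp add: P_def algebra_simps)
 qed
 have d3: "z - y = (2 * s * c - s\<^sup>2) * (z * y)"
 proof -
  have "z - y = (D - N) * (z * y)" using pos by (simp add: z_def y_def field_simps)
  then show ?thesis by (simp add: N_def algebra_simps)
 qed
 have "(x - y) + (z - y) = y * (- (2 * s * c) * (x - z) - s\<^sup>2 * (x + z))"
  unfolding d2 d3 by (simp add: algebra_simps)
 also have "\<dots> = s\<^sup>2 * (y * (8 * (c\<^sup>2 * (x * z)) - (x + z)))"
  unfolding d1 by (simp add: power2_eq_square algebra_simps)
 finally have e1: "x + z - 2 * y = s\<^sup>2 * (y * (8 * (c\<^sup>2 * (x * z)) - (x + z)))" by simp
 have "(n + s * v) / P + (n - s * v) / N - 2 * (n / D) = n * (x + z - 2 * y) + s * v * (x - z)"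
  by (simp add: x_def y_def z_def add_divide_distrib diff_divide_distrib algebra_simps)
 also have "\<dots> = s\<^sup>2 * ((n * y) * (8 * (c\<^sup>2 * (x * z)) - (x + z)) - 4 * v * (c * (x * z)))"
  unfolding e1 d1 by (simp add: power2_eq_square algebra_simps)
 finally have eq: "(n + s * v) / P + (n - s * v) / N - 2 * (n / D) = s\<^sup>2 * ((n * y) * (8 * (c\<^sup>2 * (x * z)) - (x + z)) - 4 * v * (c * (x * z)))" .
 have "\<bar>(n * y) * (8 * (c\<^sup>2 * (x * z)) - (x + z))\<bar> \<le> k * (16 * k\<^sup>2)"
 proof -
  have "0 \<le> c\<^sup>2 * (x * z)" using xyz by simp
  then have "\<bar>8 * (c\<^sup>2 * (x * z)) - (x + z)\<bar> \<le> 16 * k\<^sup>2" using c2xz xk zk xyz by linarith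
  moreover have "\<bar>n * y\<bar> \<le> k" using ny xyz by (simp add: abs_mult)
  ultimately show ?thesis unfolding abs_mult using k by (intro mult_mono) auto
 qed
 moreover have "\<bar>4 * v * (c * (x * z))\<bar> \<le> 4 * (k^4 + k\<^sup>2)"
 proof -
  have "\<bar>v\<bar> * (\<bar>c\<bar> * (x * z)) \<le> 1 * (k^4 + k\<^sup>2)" using v cxz xyz by (intro mult_mono) auto
  then show ?thesis using xyz by (simp add: abs_mult)
 qed
 ultimately have "\<bar>(n * y) * (8 * (c\<^sup>2 * (x * z)) - (x + z)) - 4 * v * (c * (x * z))\<bar> \<le> 16 * k^3 + 4 * (k^4 + k\<^sup>2)"
  by (simp add: power2_eq_square power3_eq_cube)
 then have "s\<^sup>2 * \<bar>(n * y) * (8 * (c\<^sup>2 * (x * z)) - (x + z)) - 4 * v * (c * (x * z))\<bar> \<le> s\<^sup>2 * (16 * k^3 + 4 * (k^4 + k\<^sup>2))"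
  by (intro mult_left_mono) auto
 then show ?thesis unfolding P_def[symmetric] N_def[symmetric] eq by (simp add: abs_mult mult.commute)
qed

text \<open>The kernel itself is the test function when the vorticity is tested for the variation of its
 potential in time, and the viscosity of the scheme acts on it by second differences.\<close>

lemma Ke_second_difference:
 assumes e: "e > 0"
 shows "\<exists>B\<ge>0. \<forall>z i j s. \<bar>Ke e (z + s *\<^sub>R ax j) $ i + Ke e (z - s *\<^sub>R ax j) $ i - 2 * Ke e z $ i\<bar> \<le> B * s\<^sup>2"
proof -
 define k where "k = 1 / e"
 have k: "k > 0" "k * e = 1" using e by (simp_all add: k_def)
 have ke: "k\<^sup>2 * e\<^sup>2 = 1" using k(2) by (metis power_mult_distrib power_one)
 define B where "B = 16 * k^3 + 4 * (k^4 + k\<^sup>2)"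
 have "\<bar>Ke e (z + s *\<^sub>R ax j) $ i + Ke e (z - s *\<^sub>R ax j) $ i - 2 * Ke e z $ i\<bar> \<le> B * s\<^sup>2" for z i j s
 proof -
  define n where "n = perp z $ i / (2 * pi)"
  define v where "v = perp (ax j) $ i / (2 * pi)"
  define D where "D = (norm z)\<^sup>2 + e\<^sup>2"
  define c where "c = z $ j"
  have E: "(norm (z + t *\<^sub>R ax j))\<^sup>2 + e\<^sup>2 = D + 2 * t * c + t\<^sup>2" for t
  proof -
   have "j = 1 \<or> j = 2" by (rule exhaust_2)
   then show ?thesis unfolding D_def norm_plane by (auto simp: c_def ax_nth power2_eq_square algebra_simps)
  qed
  have P: "perp (z + t *\<^sub>R ax j) $ i / (2 * pi) = n + t * v" for t
  proof -
   have "i = 1 \<or> i = 2" by (rule exhaust_2)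
   then show ?thesis by (auto simp: n_def v_def add_divide_distrib diff_divide_distrib)
  qed
  have K: "Ke e (z + t *\<^sub>R ax j) $ i = (n + t * v) / (D + 2 * t * c + t\<^sup>2)" for t
   unfolding Ke_alt E[symmetric] P[symmetric] by simp
  have low: "(c + t)\<^sup>2 + e\<^sup>2 \<le> D + 2 * t * c + t\<^sup>2" for t
  proof -
   have "\<bar>(z + t *\<^sub>R ax j) $ j\<bar> \<le> norm (z + t *\<^sub>R ax j)" by (rule component_le_norm_cart)
   then have "((z + t *\<^sub>R ax j) $ j)\<^sup>2 \<le> (norm (z + t *\<^sub>R ax j))\<^sup>2" by (metis abs_ge_zero power2_abs power_mono)
   then show ?thesis unfolding E[symmetric] by (simp add: c_def ax_nth)
  qed
  have low1: "1 \<le> (D + 2 * t * c + t\<^sup>2) * k\<^sup>2" for t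
  proof -
   have "e\<^sup>2 \<le> D + 2 * t * c + t\<^sup>2" using low[of t] zero_le_power2[of "c + t"] by linarith
   then have "e\<^sup>2 * k\<^sup>2 \<le> (D + 2 * t * c + t\<^sup>2) * k\<^sup>2" by (rule mult_right_mono) simp
   then show ?thesis using ke by (simp add: mult.commute)
  qed
  have low2: "(c + t)\<^sup>2 \<le> D + 2 * t * c + t\<^sup>2" for t using low[of t] zero_le_power2[of e] by linarith
  have small: "\<bar>r / (2 * pi)\<bar> \<le> \<bar>r\<bar>" for r :: real
  proof -
   have "\<bar>r\<bar> / (2 * pi) \<le> \<bar>r\<bar> / 1" using two_pi_ge by (intro divide_left_mono) auto
   then show ?thesis by simp
  qed
  have nn: "\<bar>n\<bar> \<le> k * D"
  proof -
   have "\<bar>n\<bar> \<le> norm z"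
    using component_le_norm_cart[of "perp z" i] small[of "perp z $ i"] by (simp add: n_def)
   moreover have "norm z \<le> k * D"
   proof -
    have "2 * norm z * e \<le> D" unfolding D_def by (rule sum_squares_bound)
    moreover have "0 \<le> norm z * e" using e by simp
    ultimately have "norm z * e \<le> D" by linarith
    then have "k * (norm z * e) \<le> k * D" using k by (intro mult_left_mono) auto
    moreover have "k * (norm z * e) = norm z * (k * e)" by (simp only: mult_ac)
    ultimately show ?thesis using k(2) by simp
   qed
   ultimately show ?thesis by linarith
  qed
  have vv: "\<bar>v\<bar> \<le> 1"
   using component_le_norm_cart[of "perp (ax j)" i] small[of "perp (ax j) $ i"] unfolding v_def norm_perp norm_ax by linarith
  have Kp: "Ke e (z + s *\<^sub>R ax j) $ i = (n + s * v) / (D + 2 * s * c + s\<^sup>2)" by (rule K)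
  have Km: "Ke e (z - s *\<^sub>R ax j) $ i = (n - s * v) / (D - 2 * s * c + s\<^sup>2)" using K[of "-s"] by simp
  have K0: "Ke e z $ i = n / D" using K[of 0] by simp
  show ?thesis unfolding Kp Km K0 B_def
   using second_difference_quotient[OF k(1), of D s c n v] low1[of 0] low1[of s] low1[of "-s"] low2[of s] low2[of "-s"] nn vv by simp
 qed
 moreover have "B \<ge> 0" using k by (simp add: B_def)
 ultimately show ?thesis by blast
qed

section \<open>The approximate solutions\<close>

locale scheme = charge L g Y for L :: "'b measure" and g :: "'b \<Rightarrow> real" and Y :: "'b \<Rightarrow> plane" +
 fixes p A C m :: real and w0 :: "plane \<Rightarrow> real"
 assumes p: "p > 2" and A: "A \<ge> 0" and w0: "vort p A w0"
  and m: "m > 0" and Am: "A + mass \<le> m" and C0: "C \<ge> 0"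
  and C: "\<And>w x. vort p A w \<Longrightarrow> (\<integral>\<^sup>+y. ennreal (\<bar>w y\<bar> / norm (x - y)) \<partial>lborel) \<le> ennreal C"
begin

text \<open>The regularised velocity is at most \<open>m / eps n\<close>, so this value of \<open>Mn\<close> makes the weights
 nonnegative. The numerical viscosity is of the order \<open>Mn * hn\<close>, that is \<open>(eps n)\<^sup>2\<close>.\<close>

definition eps :: "nat \<Rightarrow> real" where "eps n = 1 / (real n + 1)"
definition hn :: "nat \<Rightarrow> real" where "hn n = (eps n)^3"
definition Mn :: "nat \<Rightarrow> real" where "Mn n = m / eps n"
definition dt :: "nat \<Rightarrow> real" where "dt n = hn n / (2 * Mn n)"

primrec W :: "nat \<Rightarrow> nat \<Rightarrow> plane \<Rightarrow> real" where
 "W n 0 = w0"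
| "W n (Suc k) = step (Mn n) (hn n) (\<lambda>i. vel (kd (eps n) (hn n) i) (W n k)) (W n k)"

definition om :: "nat \<Rightarrow> real \<Rightarrow> plane \<Rightarrow> real" where
 "om n t = W n (nat \<lfloor>t / dt n\<rfloor>)"

definition U :: "nat \<Rightarrow> real \<Rightarrow> plane \<Rightarrow> plane" where
 "U n t x = pot lborel (om n t) (\<lambda>y. y) (Ke (eps n)) x"

lemma eps: "0 < eps n" "eps n \<le> 1" by (simp_all add: eps_def)

lemma eps_tendsto: "eps \<longlonglongrightarrow> 0"
 unfolding eps_def using LIMSEQ_inverse_real_of_nat by (simp add: inverse_eq_divide add.commute)

lemma hn: "hn n > 0" using eps by (simp add: hn_def)

lemma dt_eq: "dt n = (eps n)^4 / (2 * m)"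
 using eps[of n] by (simp add: dt_def hn_def Mn_def power3_eq_cube power4_eq_xxxx)

lemma dt: "dt n > 0" using eps[of n] m by (simp add: dt_eq)

lemma dt_tendsto: "dt \<longlonglongrightarrow> 0"
proof -
 have "(\<lambda>n. (eps n)^4 / (2 * m)) \<longlonglongrightarrow> 0^4 / (2 * m)"
  using m by (intro tendsto_intros eps_tendsto) auto
 then show ?thesis by (simp add: dt_eq[abs_def])
qed

lemma vort_mass:
 assumes "vort p A w" shows "(LINT y|lborel. \<bar>w y\<bar>) + mass \<le> m"
 using vort_integral[OF assms A] Am by linarith

lemma W_flux:
 assumes "vort p A w" shows "flux (Mn n) (hn n) (\<lambda>i. vel (kd (eps n) (hn n) i) w)"
 unfolding Mn_def by (rule flux_vel[OF eps(1) hn m vort_integrable[OF assms] vort_mass[OF assms]])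

lemma W_vort: "vort p A (W n k)"
proof (induction k)
 case (Suc k)
 interpret F: flux "Mn n" "hn n" "\<lambda>i. vel (kd (eps n) (hn n) i) (W n k)" by (rule W_flux[OF Suc])
 note [measurable] = vortD(1)[OF Suc]
 show ?case unfolding vort_def
 proof (intro conjI)
  show "W n (Suc k) \<in> borel_measurable borel" by simp
  show "(\<integral>\<^sup>+x. ennreal \<bar>W n (Suc k) x\<bar> \<partial>lborel) \<le> ennreal A"
   using order_trans[OF F.step_powr[of "W n k" 1] ] vortD(2)[OF Suc] by simp
  show "(\<integral>\<^sup>+x. ennreal (\<bar>W n (Suc k) x\<bar> powr p) \<partial>lborel) \<le> ennreal A"
   using order_trans[OF F.step_powr[of "W n k" p] vortD(3)[OF Suc]] p by simp
 qed
qed (use w0 in simp)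

lemma W_sup:
 assumes "\<And>x. \<bar>w0 x\<bar> \<le> B" shows "\<bar>W n k x\<bar> \<le> B"
proof (induction k arbitrary: x)
 case (Suc k)
 interpret F: flux "Mn n" "hn n" "\<lambda>i. vel (kd (eps n) (hn n) i) (W n k)" by (rule W_flux[OF W_vort])
 show ?case using F.step_sup[OF Suc] by simp
qed (use assms in simp)

lemma om_vort: "vort p A (om n t)"
 unfolding om_def by (rule W_vort)

lemmas om_int = vort_integrable[OF om_vort]
lemmas om_mass = vort_mass[OF om_vort]

lemma om_meas [measurable]: "(\<lambda>(t, x). om n t x) \<in> borel_measurable (borel \<Otimes>\<^sub>M borel)"
proof -
 note [measurable] = vortD(1)[OF W_vort]
 have "(\<lambda>z. (\<lambda>k z. W n k (snd z)) (nat \<lfloor>fst z / dt n\<rfloor>) z) \<in> borel_measurable (borel \<Otimes>\<^sub>M borel)"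
  by (rule measurable_compose_countable) measurable
 then show ?thesis by (simp add: om_def case_prod_beta')
qed

lemma om_meas' [measurable (raw)]:
 assumes "f \<in> M \<rightarrow>\<^sub>M borel" "h \<in> M \<rightarrow>\<^sub>M borel"
 shows "(\<lambda>z. om n (f z) (h z)) \<in> borel_measurable M"
 using measurable_compose[OF measurable_Pair[OF assms] om_meas] by simp

lemma vel_om: "vel (Ke (eps n)) (om n t) x = U n t x + pot L g Y (Ke (eps n)) x"
 by (simp add: vel_def U_def)

lemma pot_le_C:
 assumes w: "vort p A w" and k: "k \<in> borel_measurable borel" "\<And>z. norm (k z) \<le> 1 / norm z"
 shows "norm (pot lborel w (\<lambda>y. y) k x :: plane) \<le> C"
proof -
 interpret V: charge lborel w "\<lambda>y. y" by (rule charge_lborel[OF vort_integrable[OF w]])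
 have "ennreal (norm (pot lborel w (\<lambda>y. y) k x)) \<le> (\<integral>\<^sup>+y. ennreal (\<bar>w y\<bar> * norm (k (x - y))) \<partial>lborel)"
  by (rule V.norm_pot_le_nn[OF k(1)])
 also have "\<dots> \<le> (\<integral>\<^sup>+y. ennreal (\<bar>w y\<bar> / norm (x - y)) \<partial>lborel)"
  using mult_left_mono[OF k(2) abs_ge_zero] by (intro nn_integral_mono ennreal_leI) simp
 also have "\<dots> \<le> ennreal C" by (rule C[OF w])
 finally show ?thesis using C0 by (simp add: ennreal_le_iff)
qed

lemma U_bound: "norm (U n t x) \<le> C"
 unfolding U_def by (rule pot_le_C[OF om_vort borel_measurable_Ke norm_Ke_le])

lemma U_meas: "(\<lambda>(t, x). U n t x) \<in> borel_measurable (borel \<Otimes>\<^sub>M borel)"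
 unfolding U_def pot_def by measurable

text \<open>The potentials of a fixed vorticity class depend continuously on the regularisation, uniformly
 in the class and in space.\<close>

lemma pot_Ke_close:
 assumes e: "e > 0"
 shows "\<exists>d>0. \<forall>a b w x. 0 \<le> a \<longrightarrow> a \<le> d \<longrightarrow> 0 \<le> b \<longrightarrow> b \<le> d \<longrightarrow> vort p A w \<longrightarrow>
  norm (pot lborel w (\<lambda>y. y) (Ke a) x - pot lborel w (\<lambda>y. y) (Ke b) x) \<le> e"
proof -
 obtain d where d: "d > 0" and D: "\<And>c w x. 0 < c \<Longrightarrow> c \<le> d \<Longrightarrow> vort p A w \<Longrightarrow>
  (\<integral>\<^sup>+y. ennreal (\<bar>w y\<bar> * norm (Ke 0 (x - y) - Ke c (x - y))) \<partial>lborel) \<le> ennreal (e / 2)"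
  using kernel_diff_small[OF p A, of "e / 2"] e by auto
 have "norm (pot lborel w (\<lambda>y. y) (Ke 0) x - pot lborel w (\<lambda>y. y) (Ke a) x) \<le> e / 2"
  if a: "0 \<le> a" "a \<le> d" and w: "vort p A w" for a w x
 proof (cases "a = 0")
  case False
  note wm [measurable] = vortD(1)[OF w]
  have i: "integrable lborel (\<lambda>y. w y *\<^sub>R Ke c (x - y))" for c
  proof (rule integrableI_bounded)
   have "(\<integral>\<^sup>+y. ennreal (norm (w y *\<^sub>R Ke c (x - y))) \<partial>lborel) \<le> (\<integral>\<^sup>+y. ennreal (\<bar>w y\<bar> / norm (x - y)) \<partial>lborel)"
    using mult_left_mono[OF norm_Ke_le abs_ge_zero] by (intro nn_integral_mono ennreal_leI) simp
   also have "\<dots> \<le> ennreal C" by (rule C[OF w])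
   finally show "(\<integral>\<^sup>+y. ennreal (norm (w y *\<^sub>R Ke c (x - y))) \<partial>lborel) < \<infinity>"
    by (simp add: le_less_trans)
  qed measurable
  have "ennreal (norm (LINT y|lborel. w y *\<^sub>R (Ke 0 (x - y) - Ke a (x - y)))) \<le> ennreal (LINT y|lborel. norm (w y *\<^sub>R (Ke 0 (x - y) - Ke a (x - y))))"
   by (intro ennreal_leI integral_norm_bound)
  also have "\<dots> = (\<integral>\<^sup>+y. ennreal (norm (w y *\<^sub>R (Ke 0 (x - y) - Ke a (x - y)))) \<partial>lborel)"
   unfolding scaleR_diff_right
   by (rule nn_integral_eq_integral[symmetric]) (intro integrable_norm Bochner_Integration.integrable_diff i, simp)
  also have "\<dots> \<le> ennreal (e / 2)" using D[of a w x] False a w by simp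
  finally have "norm (LINT y|lborel. w y *\<^sub>R (Ke 0 (x - y) - Ke a (x - y))) \<le> e / 2" using e by (simp add: ennreal_le_iff)
  then show ?thesis unfolding pot_def scaleR_diff_right using i by simp
 qed (use e in simp)
 note * = this
 have "norm (pot lborel w (\<lambda>y. y) (Ke a) x - pot lborel w (\<lambda>y. y) (Ke b) x) \<le> e"
  if "0 \<le> a" "a \<le> d" "0 \<le> b" "b \<le> d" "vort p A w" for a b w x
  using *[of a w x] *[of b w x] that norm_triangle_ineq4[of "pot lborel w (\<lambda>y. y) (Ke 0) x - pot lborel w (\<lambda>y. y) (Ke b) x" "pot lborel w (\<lambda>y. y) (Ke 0) x - pot lborel w (\<lambda>y. y) (Ke a) x"]
  by simp
 with d show ?thesis by blast
qed

lemma W_time: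
 assumes \<phi>: "\<phi> \<in> borel_measurable borel" "\<And>x. \<bar>\<phi> x\<bar> \<le> B'" and B: "B \<ge> 0"
  and T: "\<And>i x s. \<bar>\<phi> (x + s *\<^sub>R ax i) - \<phi> x\<bar> \<le> B * \<bar>s\<bar>"
   "\<And>i x s. \<bar>\<phi> (x + s *\<^sub>R ax i) + \<phi> (x - s *\<^sub>R ax i) - 2 * \<phi> x\<bar> \<le> B * s\<^sup>2"
 shows "\<bar>(LINT x|lborel. \<phi> x * W n (k + j) x) - (LINT x|lborel. \<phi> x * W n k x)\<bar> \<le> real j * dt n * (B * (4 * m * m + 2 * (C * m)))"
proof (induction j)
 case (Suc j)
 let ?w = "W n (k + j)"
 have "\<bar>(LINT x|lborel. \<phi> x * W n (Suc (k + j)) x) - (LINT x|lborel. \<phi> x * ?w x)\<bar> \<le> dt n * (B * (4 * m * m + 2 * (C * m)))"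
  unfolding W.simps
 proof (rule step_equicontinuous[OF eps m _ _ hn_def Mn_def dt_def \<phi> B T C0])
  show "integrable lborel ?w" "(LINT y|lborel. \<bar>?w y\<bar>) + mass \<le> m"
   by (rule vort_integrable[OF W_vort] vort_mass[OF W_vort])+
  show "(\<integral>\<^sup>+x. ennreal (\<bar>?w x\<bar> / norm (x - y)) \<partial>lborel) \<le> ennreal C" for y
   using C[OF W_vort, where x=y] by (simp add: norm_minus_commute)
 qed
 with Suc show ?case by (simp add: algebra_simps)
qed simp

lemma om_time:
 assumes \<phi>: "\<phi> \<in> borel_measurable borel" "\<And>x. \<bar>\<phi> x\<bar> \<le> B'" and B: "B \<ge> 0"
  and T: "\<And>i x s. \<bar>\<phi> (x + s *\<^sub>R ax i) - \<phi> x\<bar> \<le> B * \<bar>s\<bar>"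
   "\<And>i x s. \<bar>\<phi> (x + s *\<^sub>R ax i) + \<phi> (x - s *\<^sub>R ax i) - 2 * \<phi> x\<bar> \<le> B * s\<^sup>2"
 shows "\<bar>(LINT x|lborel. \<phi> x * om n t x) - (LINT x|lborel. \<phi> x * om n s x)\<bar> \<le> (\<bar>t - s\<bar> + dt n) * (B * (4 * m * m + 2 * (C * m)))"
proof -
 let ?c = "B * (4 * m * m + 2 * (C * m))"
 have c: "?c \<ge> 0" using B m C0 by simp
 have *: "\<bar>(LINT x|lborel. \<phi> x * om n t x) - (LINT x|lborel. \<phi> x * om n s x)\<bar> \<le> (\<bar>t - s\<bar> + dt n) * ?c" if st: "s \<le> t" for s t
 proof -
  define k where "k = nat \<lfloor>s / dt n\<rfloor>"
  define j where "j = nat \<lfloor>t / dt n\<rfloor> - k"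
  have st': "s / dt n \<le> t / dt n" using st dt[of n] by (simp add: divide_right_mono)
  have kj: "nat \<lfloor>t / dt n\<rfloor> = k + j"
   using nat_mono[OF floor_mono[OF st']] by (simp add: k_def j_def)
  have "real j * dt n \<le> (t - s) + dt n"
  proof -
   have "real j \<le> t / dt n - s / dt n + 1"
   proof (cases "\<lfloor>t / dt n\<rfloor> \<ge> 0")
    case True
    have "real j \<le> real_of_int \<lfloor>t / dt n\<rfloor> - real_of_int \<lfloor>s / dt n\<rfloor>"
     using True st' floor_mono[OF st'] by (simp add: j_def k_def)
    then show ?thesis using floor_correct[of "s / dt n"] floor_correct[of "t / dt n"] by linarith
   next
    case False
    then show ?thesis using st' by (simp add: j_def)
   qed
   then have "real j * dt n \<le> (t / dt n - s / dt n + 1) * dt n" using dt[of n] by (intro mult_right_mono) auto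
   also have "\<dots> = (t - s) + dt n" using dt[of n] by (simp add: field_simps)
   finally show ?thesis .
  qed
  then have "real j * dt n * ?c \<le> (\<bar>t - s\<bar> + dt n) * ?c" using c st by (intro mult_right_mono) auto
  with W_time[OF \<phi> B T, of n k j] show ?thesis unfolding om_def kj k_def[symmetric] by linarith
 qed
 show ?thesis using *[of s t] *[of t s] by (cases "s \<le> t") (auto simp: abs_minus_commute)
qed

lemma Ke_lip_component:
 assumes e: "e > 0"
 shows "\<bar>Ke e z $ i - Ke e z' $ i\<bar> \<le> norm (z - z') / e\<^sup>2"
 using component_le_norm_cart[of "Ke e z - Ke e z'" i] norm_Ke_lipschitz[OF e, of z z'] by simp

lemma pot_Ke_time:
 assumes e: "e > 0"
 shows "\<exists>B\<ge>0. \<forall>n t s x. norm (pot lborel (om n t) (\<lambda>y. y) (Ke e) x - pot lborel (om n s) (\<lambda>y. y) (Ke e) x) \<le> (\<bar>t - s\<bar> + dt n) * B"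
proof -
 obtain B1 where B1: "B1 \<ge> 0" "\<And>z i j s. \<bar>Ke e (z + s *\<^sub>R ax j) $ i + Ke e (z - s *\<^sub>R ax j) $ i - 2 * Ke e z $ i\<bar> \<le> B1 * s\<^sup>2"
  using Ke_second_difference[OF e] by auto
 define B where "B = B1 + 1 / e\<^sup>2"
 have B: "B \<ge> 0" "B1 \<le> B" "1 / e\<^sup>2 \<le> B" using B1 by (auto simp: B_def)
 let ?c = "B * (4 * m * m + 2 * (C * m))"
 have comp: "\<bar>pot lborel (om n t) (\<lambda>y. y) (Ke e) x $ i - pot lborel (om n s) (\<lambda>y. y) (Ke e) x $ i\<bar> \<le> (\<bar>t - s\<bar> + dt n) * ?c" for n t s x i
 proof -
  have eq: "pot lborel (om n t) (\<lambda>y. y) (Ke e) x $ i = (LINT y|lborel. Ke e (x - y) $ i * om n t y)" for t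
   unfolding charge.pot_nth[OF charge_lborel[OF om_int] borel_measurable_Ke norm_Ke_bound[OF e], symmetric]
   by (simp add: pot_def mult.commute)
  show ?thesis unfolding eq
  proof (rule om_time[OF _ _ B(1)])
   show "(\<lambda>y. Ke e (x - y) $ i) \<in> borel_measurable borel" by measurable
   show "\<bar>Ke e (x - y) $ i\<bar> \<le> 1 / e" for y
    using component_le_norm_cart[of "Ke e (x - y)" i] norm_Ke_bound[OF e, of "x - y"] by simp
   fix j y s
   have "\<bar>Ke e (x - (y + s *\<^sub>R ax j)) $ i - Ke e (x - y) $ i\<bar> \<le> norm (x - (y + s *\<^sub>R ax j) - (x - y)) / e\<^sup>2"
    by (rule Ke_lip_component[OF e])
   also have "\<dots> = 1 / e\<^sup>2 * \<bar>s\<bar>" by simp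
   also have "\<dots> \<le> B * \<bar>s\<bar>" using B by (intro mult_right_mono) auto
   finally show "\<bar>Ke e (x - (y + s *\<^sub>R ax j)) $ i - Ke e (x - y) $ i\<bar> \<le> B * \<bar>s\<bar>" .
   have a: "x - (y + s *\<^sub>R ax j) = (x - y) - s *\<^sub>R ax j" "x - (y - s *\<^sub>R ax j) = (x - y) + s *\<^sub>R ax j" by simp_all
   have "\<bar>Ke e (x - (y + s *\<^sub>R ax j)) $ i + Ke e (x - (y - s *\<^sub>R ax j)) $ i - 2 * Ke e (x - y) $ i\<bar> \<le> B1 * s\<^sup>2"
    unfolding a using B1(2)[of "x - y" s j i] by (simp add: add.commute)
   also have "\<dots> \<le> B * s\<^sup>2" using B by (intro mult_right_mono) auto
   finally show "\<bar>Ke e (x - (y + s *\<^sub>R ax j)) $ i + Ke e (x - (y - s *\<^sub>R ax j)) $ i - 2 * Ke e (x - y) $ i\<bar> \<le> B * s\<^sup>2" .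
  qed
 qed
 have "norm (pot lborel (om n t) (\<lambda>y. y) (Ke e) x - pot lborel (om n s) (\<lambda>y. y) (Ke e) x) \<le> (\<bar>t - s\<bar> + dt n) * (2 * ?c)" for n t s x
 proof -
  let ?d = "pot lborel (om n t) (\<lambda>y. y) (Ke e) x - pot lborel (om n s) (\<lambda>y. y) (Ke e) x"
  have "norm ?d \<le> \<bar>?d $ 1\<bar> + \<bar>?d $ 2\<bar>" using norm_le_l1_cart[of ?d] by (simp add: sum_2)
  then show ?thesis using comp[of n t x 1 s] comp[of n t x 2 s] by simp
 qed
 moreover have "2 * ?c \<ge> 0" using B m C0 by simp
 ultimately show ?thesis by blast
qed

text \<open>Replacing the kernel by a fixed regularisation costs little, and for a fixed regularisation the
 potential is Lipschitz in space and almost Lipschitz in time.\<close>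

text \<open>The approximations jump at the time steps, which leaves the error terms that vanish with \<open>n\<close>.\<close>

lemma U_equicontinuous:
 assumes e: "e > 0"
 shows "\<exists>d>0. \<exists>N. \<forall>n\<ge>N. \<forall>q q'. dist q q' \<le> d \<longrightarrow> norm ((\<lambda>(t, x). U n t x) q - (\<lambda>(t, x). U n t x) q') \<le> e"
proof -
 obtain c where c: "c > 0" and cc: "\<And>a b w x. 0 \<le> a \<Longrightarrow> a \<le> c \<Longrightarrow> 0 \<le> b \<Longrightarrow> b \<le> c \<Longrightarrow> vort p A w \<Longrightarrow>
  norm (pot lborel w (\<lambda>y. y) (Ke a) x - pot lborel w (\<lambda>y. y) (Ke b) x) \<le> e / 6"
  using pot_Ke_close[of "e / 6"] e by auto
 obtain B where B: "B \<ge> 0" "\<And>n t s x. norm (pot lborel (om n t) (\<lambda>y. y) (Ke c) x - pot lborel (om n s) (\<lambda>y. y) (Ke c) x) \<le> (\<bar>t - s\<bar> + dt n) * B"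
  using pot_Ke_time[OF c] by auto
 define d where "d = min (e / (6 * (B + 1))) (e * c\<^sup>2 / (6 * (A + 1)))"
 have d: "d > 0" "d * B \<le> e / 6" "d / c\<^sup>2 * A \<le> e / 6"
 proof -
  show "d > 0" using e B A c by (simp add: d_def)
  have "d * B \<le> e / (6 * (B + 1)) * B" using B by (intro mult_right_mono) (auto simp: d_def)
  also have "\<dots> = e / 6 * (B / (B + 1))" by simp
  also have "\<dots> \<le> e / 6 * 1" using B e by (intro mult_left_mono) auto
  finally show "d * B \<le> e / 6" by simp
  have "d / c\<^sup>2 * A \<le> e * c\<^sup>2 / (6 * (A + 1)) / c\<^sup>2 * A" using A c by (intro mult_right_mono divide_right_mono) (auto simp: d_def)
  also have "\<dots> = e / 6 * (A / (A + 1))" using c by simp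
  also have "\<dots> \<le> e / 6 * 1" using A e by (intro mult_left_mono) auto
  finally show "d / c\<^sup>2 * A \<le> e / 6" by simp
 qed
 have "eventually (\<lambda>n. dt n < d) sequentially" "eventually (\<lambda>n. eps n < c) sequentially"
  using order_tendstoD(2)[OF dt_tendsto] order_tendstoD(2)[OF eps_tendsto] d(1) c by auto
 then have "eventually (\<lambda>n. dt n < d \<and> eps n < c) sequentially" by (rule eventually_conj)
 then obtain N where N: "\<And>n. n \<ge> N \<Longrightarrow> dt n < d \<and> eps n < c" unfolding eventually_sequentially by blast
 have "norm (U n t x - U n s y) \<le> e" if n: "n \<ge> N" and ts: "\<bar>t - s\<bar> \<le> d" and xy: "norm (x - y) \<le> d" for n t s x y
 proof -
  let ?V = "\<lambda>t x. pot lborel (om n t) (\<lambda>y. y) (Ke c) x"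
  have UV: "norm (U n t x - ?V t x) \<le> e / 6" for t x
   unfolding U_def using N[OF n] eps[of n] c by (intro cc om_vort) auto
  have "norm (?V t x - ?V t y) \<le> d / c\<^sup>2 * (LINT y|lborel. \<bar>om n t y\<bar>)"
  proof (rule charge.pot_diff_le[OF charge_lborel[OF om_int]])
   note pi = charge.pot_integrable[OF charge_lborel[OF om_int] borel_measurable_Ke norm_Ke_bound[OF c]]
   show "integrable lborel (\<lambda>b. om n t b *\<^sub>R Ke c (x - b))" "integrable lborel (\<lambda>b. om n t b *\<^sub>R Ke c (y - b))" by (rule pi)+
   fix b
   have "norm (Ke c (x - b) - Ke c (y - b)) \<le> norm (x - b - (y - b)) / c\<^sup>2" by (rule norm_Ke_lipschitz[OF c])
   also have "\<dots> \<le> d / c\<^sup>2" using xy by (intro divide_right_mono) auto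
   finally show "norm (Ke c (x - b) - Ke c (y - b)) \<le> d / c\<^sup>2" .
  qed measurable
  also have "\<dots> \<le> d / c\<^sup>2 * A" using vort_integral[OF om_vort A, of n t] d(1) by (intro mult_left_mono) auto
  finally have 1: "norm (?V t x - ?V t y) \<le> e / 6" using d(3) by linarith
  have "(\<bar>t - s\<bar> + dt n) * B \<le> (d + d) * B" using N[OF n] ts B(1) by (intro mult_right_mono) auto
  then have 2: "norm (?V t y - ?V s y) \<le> e / 3" using B(2)[of n t y s] d(2) by (simp add: algebra_simps)
  have "U n t x - U n s y = (U n t x - ?V t x) + ((?V t x - ?V t y) + ((?V t y - ?V s y) + (?V s y - U n s y)))" by simp
  then have "norm (U n t x - U n s y) \<le> norm (U n t x - ?V t x) + (norm (?V t x - ?V t y) + (norm (?V t y - ?V s y) + norm (?V s y - U n s y)))"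
   by (metis (no_types, lifting) norm_triangle_mono norm_triangle_ineq order_refl)
  then show ?thesis using UV[of t x] UV[of s y] 1 2 norm_minus_commute[of "?V s y" "U n s y"] e by linarith
 qed
 note main = this
 have "norm ((\<lambda>(t, x). U n t x) q - (\<lambda>(t, x). U n t x) q') \<le> e" if "n \<ge> N" "dist q q' \<le> d" for n q q'
 proof -
  obtain t x s y where q: "q = (t, x)" "q' = (s, y)" by (metis surj_pair)
  have "dist t s \<le> d" "dist x y \<le> d"
   using that(2) dist_fst_le[of q q'] dist_snd_le[of q q'] by (auto simp: q)
  then show ?thesis using main[OF that(1)] by (simp add: q dist_norm)
 qed
 with d(1) show ?thesis by blast
qed

lemma U_subsequence:
 obtains r V where "strict_mono (r :: nat \<Rightarrow> nat)" "\<And>t x. (\<lambda>n. U (r n) t x) \<longlonglongrightarrow> V t x"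
proof -
 obtain r V where r: "strict_mono (r :: nat \<Rightarrow> nat)" "\<And>q. (\<lambda>n. (\<lambda>(t, x). U (r n) t x) q) \<longlonglongrightarrow> V q"
  by (rule equicontinuous_subsequence[of "\<lambda>n (t, x). U n t x" C, OF _ U_equicontinuous])
   (auto simp: U_bound)
 show ?thesis using that[OF r(1), of "\<lambda>t x. V (t, x)"] r(2)[of "(_, _)"] by simp
qed

end

section \<open>Strong limits of convex combinations\<close>

text \<open>Weights of a convex combination of the functions with indices in \<open>{n..<N}\<close>.\<close>

definition cvx :: "nat \<Rightarrow> nat \<Rightarrow> (nat \<Rightarrow> real) \<Rightarrow> bool" where
 "cvx n N c \<longleftrightarrow> (\<forall>k. 0 \<le> c k) \<and> (\<forall>k<n. c k = 0) \<and> (\<forall>k\<ge>N. c k = 0) \<and> (\<Sum>k<N. c k) = 1"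

lemma cvxD:
 assumes "cvx n N c"
 shows "0 \<le> c k" "k < n \<Longrightarrow> c k = 0" "k \<ge> N \<Longrightarrow> c k = 0" "(\<Sum>k<N. c k) = 1"
 using assms by (auto simp: cvx_def)

lemma cvx_sum_extend:
 assumes "cvx n N c" "N \<le> N'"
 shows "(\<Sum>k<N'. c k * F k) = (\<Sum>k<N. c k * F k)"
 by (rule sum.mono_neutral_right) (use assms in \<open>auto simp: cvx_def\<close>)

lemma cvx_mid:
 assumes 1: "cvx n N c" and 2: "cvx n' N' c'" and le: "n0 \<le> n" "n0 \<le> n'"
 shows "cvx n0 (max N N') (\<lambda>k. (c k + c' k) / 2)"
 unfolding cvx_def
proof (intro conjI allI impI)
 have "(\<Sum>k<max N N'. c k * 1) = 1" "(\<Sum>k<max N N'. c' k * 1) = 1"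
  using cvx_sum_extend[OF 1, of "max N N'" "\<lambda>_. 1"] cvx_sum_extend[OF 2, of "max N N'" "\<lambda>_. 1"] cvxD(4)[OF 1] cvxD(4)[OF 2] by auto
 then show "(\<Sum>k<max N N'. (c k + c' k) / 2) = 1"
  by (simp add: sum_divide_distrib[symmetric] sum.distrib)
qed (use cvxD[OF 1] cvxD[OF 2] le in auto)

lemma cvx_square_le:
 assumes c: "cvx n N c" shows "(\<Sum>k<N. c k * F k)\<^sup>2 \<le> (\<Sum>k<N. c k * (F k)\<^sup>2)"
proof -
 have "\<bar>\<Sum>k<N. c k * F k\<bar> powr 2 \<le> (\<Sum>k<N. c k * \<bar>F k\<bar> powr 2)"
  by (rule sum_powr_le) (use cvxD[OF c] in auto)
 then show ?thesis by (simp add: powr_numeral)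
qed

text \<open>Minimising the norm over the convex hulls of the tails produces, by the parallelogram law, a
 Cauchy sequence. This replaces weak compactness of bounded sets in \<open>L\<^sup>2\<close>.\<close>

lemma convex_combinations_Cauchy:
 fixes F :: "nat \<Rightarrow> 'a \<Rightarrow> real"
 assumes [measurable]: "\<And>k. F k \<in> borel_measurable M"
  and B: "\<And>k. (\<integral>\<^sup>+x. ennreal ((F k x)\<^sup>2) \<partial>M) \<le> ennreal B"
 obtains N c where "\<And>j. cvx j (N j) (c j)"
  "\<And>i j. j \<le> i \<Longrightarrow> (\<integral>\<^sup>+x. ennreal (((\<Sum>k<N i. c i k * F k x) - (\<Sum>k<N j. c j k * F k x))\<^sup>2) \<partial>M) \<le> ennreal ((1/4)^j)"
proof -
 have iF: "integrable M (\<lambda>x. (F k x)\<^sup>2)" for k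
  by (rule integrableI_bounded) (use B[of k] in \<open>auto intro: le_less_trans\<close>)
 define B' where "B' = max B 0"
 have IF: "(LINT x|M. (F k x)\<^sup>2) \<le> B'" for k
 proof -
  have "ennreal (LINT x|M. (F k x)\<^sup>2) \<le> ennreal B"
   using B[of k] iF[of k] by (subst (asm) nn_integral_eq_integral) auto
  also have "\<dots> \<le> ennreal B'" by (intro ennreal_leI) (simp add: B'_def)
  finally show ?thesis by (simp add: ennreal_le_iff B'_def)
 qed
 define G where "G N c x = (\<Sum>k<N. c k * F k x)" for N :: nat and c :: "nat \<Rightarrow> real" and x
 define I where "I N c = (LINT x|M. (G N c x)\<^sup>2)" for N c
 have [measurable]: "G N c \<in> borel_measurable M" for N c unfolding G_def by measurable
 have iG: "integrable M (\<lambda>x. (G N c x)\<^sup>2)" and IG: "I N c \<le> B'" if c: "cvx n N c" for n N c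
 proof -
  have i: "integrable M (\<lambda>x. (\<Sum>k<N. c k * (F k x)\<^sup>2))" using iF by auto
  show iG: "integrable M (\<lambda>x. (G N c x)\<^sup>2)"
   by (rule Bochner_Integration.integrable_bound[OF i])
    (auto simp: G_def intro!: AE_I2 order_trans[OF cvx_square_le[OF c] abs_ge_self])
  have "I N c \<le> (LINT x|M. (\<Sum>k<N. c k * (F k x)\<^sup>2))"
   unfolding I_def using i iG cvx_square_le[OF c] by (intro integral_mono) (auto simp: G_def)
  also have "\<dots> = (\<Sum>k<N. c k * (LINT x|M. (F k x)\<^sup>2))" using iF by (subst Bochner_Integration.integral_sum) auto
  also have "\<dots> \<le> (\<Sum>k<N. c k * B')" using cvxD[OF c] IF by (intro sum_mono mult_left_mono) auto
  also have "\<dots> = B'" using cvxD(4)[OF c] by (simp add: sum_distrib_right[symmetric])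
  finally show "I N c \<le> B'" .
 qed
 have I0: "I N c \<ge> 0" for N c by (simp add: I_def)
 define S where "S n = {I N c | N c. cvx n N c}" for n
 have Sne: "S n \<noteq> {}" for n
 proof -
  have "cvx n (Suc n) (\<lambda>k. if k = n then 1 else 0)" by (auto simp: cvx_def)
  then show ?thesis unfolding S_def by blast
 qed
 have Sb: "bdd_below (S n)" for n unfolding S_def using I0 by (intro bdd_belowI[of _ 0]) auto
 define d where "d n = Inf (S n)" for n
 have dle: "d n \<le> I N c" if "cvx n N c" for n N c
  unfolding d_def using that by (intro cInf_lower Sb) (auto simp: S_def)
 have dmono: "d n \<le> d n'" if "n \<le> n'" for n n'
  unfolding d_def
 proof (rule cInf_superset_mono[OF Sne Sb])
  have "cvx n N c" if "cvx n' N c" for N c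
   unfolding cvx_def using cvxD[OF that] \<open>n \<le> n'\<close> by simp
  then show "S n' \<subseteq> S n" unfolding S_def by blast
 qed
 have dB: "d n \<le> B'" for n
 proof -
  obtain N c where c: "cvx n N c" using Sne[of n] by (auto simp: S_def)
  show ?thesis using dle[OF c] IG[OF c] by linarith
 qed
 define D where "D = (SUP n. d n)"
 have bdd: "bdd_above (range d)" using dB by (intro bdd_aboveI[of _ B']) auto
 have dD: "d n \<le> D" for n unfolding D_def by (rule cSUP_upper[OF _ bdd]) simp
 define s :: "nat \<Rightarrow> real" where "s j = (1/4)^j / 8" for j
 have s: "s j > 0" for j by (simp add: s_def)
 have smono: "s i \<le> s j" if "j \<le> i" for i j
  unfolding s_def using that by (intro divide_right_mono power_decreasing) auto
 have "\<exists>n. D - s j < d n" for j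
  using less_cSUP_iff[OF _ bdd, of "D - s j"] s[of j] by (auto simp: D_def)
 then obtain n0 where n0: "\<And>j. D - s j < d (n0 j)" by metis
 define n where "n j = max j (n0 j)" for j
 have n: "D - s j < d (n j)" for j using n0[of j] dmono[of "n0 j" "n j"] by (simp add: n_def)
 have "\<exists>N c. cvx (n j) N c \<and> I N c < d (n j) + s j" for j
  using cInf_lessD[OF Sne, of "n j" "d (n j) + s j"] s[of j] by (auto simp: d_def S_def)
 then obtain N c where Nc: "\<And>j. cvx (n j) (N j) (c j)" "\<And>j. I (N j) (c j) < d (n j) + s j" by metis
 have "(\<integral>\<^sup>+x. ennreal ((G (N i) (c i) x - G (N j) (c j) x)\<^sup>2) \<partial>M) \<le> ennreal ((1/4)^j)" if ij: "j \<le> i" for i j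
 proof -
  define h where "h k = (c i k + c j k) / 2" for k
  define K where "K = max (N i) (N j)"
  have hc: "cvx (min (n i) (n j)) K h"
   unfolding h_def K_def by (rule cvx_mid[OF Nc(1) Nc(1)]) auto
  have Gh: "G K h x = (G (N i) (c i) x + G (N j) (c j) x) / 2" for x
  proof -
   have "G K h x = (\<Sum>k<K. c i k * F k x / 2 + c j k * F k x / 2)"
    unfolding G_def h_def by (intro sum.cong) (auto simp: algebra_simps add_divide_distrib)
   also have "\<dots> = (\<Sum>k<K. c i k * F k x) / 2 + (\<Sum>k<K. c j k * F k x) / 2"
    by (simp add: sum.distrib sum_divide_distrib)
   also have "(\<Sum>k<K. c i k * F k x) = G (N i) (c i) x" unfolding G_def K_def by (rule cvx_sum_extend[OF Nc(1)]) simp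
   also have "(\<Sum>k<K. c j k * F k x) = G (N j) (c j) x" unfolding G_def K_def by (rule cvx_sum_extend[OF Nc(1)]) simp
   finally show ?thesis by (simp add: add_divide_distrib)
  qed
  have eq: "(G (N i) (c i) x - G (N j) (c j) x)\<^sup>2 = 2 * (G (N i) (c i) x)\<^sup>2 + 2 * (G (N j) (c j) x)\<^sup>2 - 4 * (G K h x)\<^sup>2" for x
   unfolding Gh by (simp add: power2_eq_square field_simps)
  have ii: "integrable M (\<lambda>x. (G (N i) (c i) x - G (N j) (c j) x)\<^sup>2)"
   unfolding eq using iG[OF Nc(1)] iG[OF hc] by auto
  have "(LINT x|M. (G (N i) (c i) x - G (N j) (c j) x)\<^sup>2) = 2 * I (N i) (c i) + 2 * I (N j) (c j) - 4 * I K h"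
   unfolding eq I_def using iG[OF Nc(1)] iG[OF hc] by simp
  moreover have "I K h > D - s j"
  proof -
   have "d (min (n i) (n j)) > D - s j"
    using n[of i] n[of j] smono[OF ij] by (auto simp: min_def)
   with dle[OF hc] show ?thesis by linarith
  qed
  moreover have "I (N i) (c i) < D + s j" "I (N j) (c j) < D + s j"
   using Nc(2)[of i] Nc(2)[of j] dD[of "n i"] dD[of "n j"] smono[OF ij] by linarith+
  ultimately have "(LINT x|M. (G (N i) (c i) x - G (N j) (c j) x)\<^sup>2) \<le> 8 * s j" by linarith
  then have "(LINT x|M. (G (N i) (c i) x - G (N j) (c j) x)\<^sup>2) \<le> (1/4)^j" by (simp add: s_def)
  then show ?thesis using ii by (subst nn_integral_eq_integral) (auto intro!: ennreal_leI)
 qed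
 moreover have "cvx j (N j) (c j)" for j
  using Nc(1)[of j] by (auto simp: cvx_def n_def)
 ultimately show ?thesis using that[of N c] unfolding G_def by blast
qed

lemma fast_Cauchy_limit:
 fixes g :: "nat \<Rightarrow> 'a \<Rightarrow> real"
 assumes [measurable]: "\<And>j. g j \<in> borel_measurable M"
  and C: "\<And>i j. j \<le> i \<Longrightarrow> (\<integral>\<^sup>+x. ennreal ((g i x - g j x)\<^sup>2) \<partial>M) \<le> ennreal ((1/4)^j)"
 obtains f where "f \<in> borel_measurable M" "AE x in M. (\<lambda>j. g j x) \<longlonglongrightarrow> f x"
  "\<And>j. (\<integral>\<^sup>+x. ennreal ((f x - g j x)\<^sup>2) \<partial>M) \<le> ennreal ((1/4)^j)"
proof -
 define f where "f x = lim (\<lambda>j. g j x)" for x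
 have [measurable]: "f \<in> borel_measurable M" unfolding f_def by measurable
 have "(\<integral>\<^sup>+x. (\<Sum>j. ennreal ((4/3)^j * (g (Suc j) x - g j x)\<^sup>2)) \<partial>M) = (\<Sum>j. \<integral>\<^sup>+x. ennreal ((4/3)^j * (g (Suc j) x - g j x)\<^sup>2) \<partial>M)"
  by (rule nn_integral_suminf) measurable
 also have "\<dots> \<le> (\<Sum>j. ennreal ((1/3)^j))"
 proof (intro suminf_le)
  fix j :: nat
  have "(\<integral>\<^sup>+x. ennreal ((4/3)^j * (g (Suc j) x - g j x)\<^sup>2) \<partial>M) = ennreal ((4/3)^j) * (\<integral>\<^sup>+x. ennreal ((g (Suc j) x - g j x)\<^sup>2) \<partial>M)"
   by (subst nn_integral_cmult[symmetric]) (auto simp: ennreal_mult)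
  also have "\<dots> \<le> ennreal ((4/3)^j) * ennreal ((1/4)^j)" by (intro mult_left_mono C) auto
  also have "\<dots> = ennreal ((1/3)^j)" by (simp add: ennreal_mult[symmetric] power_mult_distrib[symmetric])
  finally show "(\<integral>\<^sup>+x. ennreal ((4/3)^j * (g (Suc j) x - g j x)\<^sup>2) \<partial>M) \<le> ennreal ((1/3)^j)" .
 qed auto
 also have "\<dots> < \<infinity>" by (subst suminf_ennreal2) (auto intro!: summable_geometric)
 finally have fin: "(\<integral>\<^sup>+x. (\<Sum>j. ennreal ((4/3)^j * (g (Suc j) x - g j x)\<^sup>2)) \<partial>M) \<noteq> \<infinity>" by simp
 have "AE x in M. (\<Sum>j. ennreal ((4/3)^j * (g (Suc j) x - g j x)\<^sup>2)) \<noteq> \<infinity>"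
  by (rule nn_integral_PInf_AE[OF _ fin]) measurable
 then have lim: "AE x in M. (\<lambda>j. g j x) \<longlonglongrightarrow> f x"
 proof eventually_elim
  case (elim x)
  have s: "summable (\<lambda>j. (4/3)^j * (g (Suc j) x - g j x)\<^sup>2)"
   by (rule summable_suminf_not_top) (use elim in auto)
  have "summable (\<lambda>j. g (Suc j) x - g j x)"
  proof (rule summable_comparison_test)
   show "summable (\<lambda>j. (3/4 :: real)^j + (4/3)^j * (g (Suc j) x - g j x)\<^sup>2)"
    by (intro summable_add s summable_geometric) simp
   have "\<bar>D\<bar> \<le> (3/4)^j + (4/3)^j * D\<^sup>2" for D :: real and j :: nat
   proof -
    define a :: real where "a = (3/4)^j"
    have a: "a > 0" "(4/3)^j = 1 / a" by (simp_all add: a_def power_divide)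
    have "2 * a * \<bar>D\<bar> \<le> a\<^sup>2 + D\<^sup>2" using sum_squares_bound[of a "\<bar>D\<bar>"] by simp
    moreover have "0 \<le> a * \<bar>D\<bar>" using a by simp
    ultimately have "a * \<bar>D\<bar> \<le> a\<^sup>2 + D\<^sup>2" by linarith
    then have "\<bar>D\<bar> \<le> (a\<^sup>2 + D\<^sup>2) / a" using a by (simp add: pos_le_divide_eq mult.commute)
    also have "\<dots> = a + 1 / a * D\<^sup>2" using a by (simp add: add_divide_distrib power2_eq_square)
    finally show ?thesis unfolding a(2)[symmetric] by (simp add: a_def)
   qed
   then show "\<exists>N. \<forall>j\<ge>N. norm (g (Suc j) x - g j x) \<le> (3/4)^j + (4/3)^j * (g (Suc j) x - g j x)\<^sup>2"
    by auto
  qed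
  then have "convergent (\<lambda>n. \<Sum>j<n. g (Suc j) x - g j x)" by (simp add: summable_iff_convergent)
  then have "convergent (\<lambda>n. g n x - g 0 x)" using sum_lessThan_telescope[of "\<lambda>i. g i x"] by simp
  then have "convergent (\<lambda>n. (g n x - g 0 x) + g 0 x)" by (intro convergent_add convergent_const)
  then show ?case unfolding f_def by (simp add: convergent_LIMSEQ_iff)
 qed
 have "(\<integral>\<^sup>+x. ennreal ((f x - g j x)\<^sup>2) \<partial>M) \<le> ennreal ((1/4)^j)" for j
 proof -
  have "(\<integral>\<^sup>+x. ennreal ((f x - g j x)\<^sup>2) \<partial>M) = (\<integral>\<^sup>+x. liminf (\<lambda>i. ennreal ((g i x - g j x)\<^sup>2)) \<partial>M)"
  proof (rule nn_integral_cong_AE)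
   show "AE x in M. ennreal ((f x - g j x)\<^sup>2) = liminf (\<lambda>i. ennreal ((g i x - g j x)\<^sup>2))"
    using lim
   proof eventually_elim
    case (elim x)
    have "(\<lambda>i. ennreal ((g i x - g j x)\<^sup>2)) \<longlonglongrightarrow> ennreal ((f x - g j x)\<^sup>2)"
     by (intro tendsto_ennrealI tendsto_intros elim)
    then show ?case by (rule lim_imp_Liminf[OF trivial_limit_sequentially, symmetric])
   qed
  qed
  also have "\<dots> \<le> liminf (\<lambda>i. \<integral>\<^sup>+x. ennreal ((g i x - g j x)\<^sup>2) \<partial>M)"
   by (rule nn_integral_liminf) measurable
  also have "\<dots> \<le> limsup (\<lambda>i. \<integral>\<^sup>+x. ennreal ((g i x - g j x)\<^sup>2) \<partial>M)"
   by (rule Liminf_le_Limsup) simp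
  also have "\<dots> \<le> ennreal ((1/4)^j)"
   by (rule Limsup_bounded) (use C in \<open>auto simp: eventually_sequentially\<close>)
  finally show ?thesis .
 qed
 with lim show ?thesis using that[of f] by simp
qed

text \<open>The exponent \<open>2\<close> lies between \<open>1\<close> and \<open>p\<close>.\<close>

lemma vort_square:
 assumes p: "p \<ge> 2" and A: "A \<ge> 0" and w: "vort p A w"
 shows "(\<integral>\<^sup>+x. ennreal ((w x)\<^sup>2) \<partial>lborel) \<le> ennreal (2 * A)"
proof -
 note [measurable] = vortD(1)[OF w]
 have "a\<^sup>2 \<le> \<bar>a\<bar> + \<bar>a\<bar> powr p" for a :: real
 proof (cases "\<bar>a\<bar> \<le> 1")
  case True
  have "a\<^sup>2 = \<bar>a\<bar> * \<bar>a\<bar>" by (simp add: power2_eq_square)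
  also have "\<dots> \<le> \<bar>a\<bar> * 1" using True by (intro mult_left_mono) auto
  finally show ?thesis by (simp add: add_increasing2)
 next
  case False
  have "a\<^sup>2 = \<bar>a\<bar> powr 2" using False by (simp add: powr_numeral)
  also have "\<dots> \<le> \<bar>a\<bar> powr p" using False p by (intro powr_mono) auto
  finally show ?thesis by simp
 qed
 then have "(\<integral>\<^sup>+x. ennreal ((w x)\<^sup>2) \<partial>lborel) \<le> (\<integral>\<^sup>+x. ennreal \<bar>w x\<bar> + ennreal (\<bar>w x\<bar> powr p) \<partial>lborel)"
  by (intro nn_integral_mono) (simp add: ennreal_plus[symmetric] ennreal_leI del: ennreal_plus)
 also have "\<dots> = (\<integral>\<^sup>+x. ennreal \<bar>w x\<bar> \<partial>lborel) + (\<integral>\<^sup>+x. ennreal (\<bar>w x\<bar> powr p) \<partial>lborel)"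
  by (rule nn_integral_add) measurable
 also have "\<dots> \<le> ennreal A + ennreal A" by (intro add_mono vortD[OF w])
 also have "\<dots> = ennreal (2 * A)" using A by (simp add: ennreal_plus[symmetric] del: ennreal_plus)
 finally show ?thesis .
qed

context scheme
begin

text \<open>A Gaussian weight in time makes the space-time \<open>L\<^sup>2\<close> norms finite without changing null sets.\<close>

text \<open>Strong convergence in space-time gives, along fast combinations, convergence at almost every time
 separately, which is the form in which the velocity of the limit is computed.\<close>

lemma om_limit:
 fixes r :: "nat \<Rightarrow> nat"
 obtains N c w where "\<And>j. cvx j (N j) (c j)" "w \<in> borel_measurable (borel \<Otimes>\<^sub>M borel)"
  "AE t in lborel. (\<lambda>j. \<integral>\<^sup>+x. ennreal ((w (t, x) - (\<Sum>k<N j. c j k * om (r k) t x))\<^sup>2) \<partial>lborel) \<longlonglongrightarrow> 0"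
  "AE t in lborel. AE x in lborel. (\<lambda>j. \<Sum>k<N j. c j k * om (r k) t x) \<longlonglongrightarrow> w (t, x)"
proof -
 define T where "T = density lborel (\<lambda>t. ennreal (std_normal_density t))"
 interpret T: prob_space T unfolding T_def by (rule prob_space_normal_density) simp
 interpret TX: pair_sigma_finite T "lborel :: plane measure" ..
 have setsT [measurable_cong]: "sets T = sets borel" by (simp add: T_def)
 have ae: "(AE t in T. P t) \<Longrightarrow> (AE t in lborel. P t)" for P
  unfolding T_def by (subst (asm) AE_density) (auto simp: normal_density_pos)
 define F where "F k z = om (r k) (fst z) (snd z)" for k and z :: "real \<times> plane"
 have F [measurable]: "F k \<in> borel_measurable (T \<Otimes>\<^sub>M lborel)" for k
  unfolding F_def by measurable
 have FB: "(\<integral>\<^sup>+z. ennreal ((F k z)\<^sup>2) \<partial>(T \<Otimes>\<^sub>M lborel)) \<le> ennreal (2 * A)" for k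
 proof -
  have "(\<integral>\<^sup>+z. ennreal ((F k z)\<^sup>2) \<partial>(T \<Otimes>\<^sub>M lborel)) = (\<integral>\<^sup>+t. \<integral>\<^sup>+x. ennreal ((F k (t, x))\<^sup>2) \<partial>lborel \<partial>T)"
   by (rule lborel.nn_integral_fst[symmetric]) measurable
  also have "\<dots> \<le> (\<integral>\<^sup>+t. ennreal (2 * A) \<partial>T)"
   unfolding F_def using p A by (intro nn_integral_mono) (simp add: vort_square[OF _ A om_vort])
  also have "\<dots> = ennreal (2 * A)" by (simp add: T.emeasure_space_1)
  finally show ?thesis .
 qed
 obtain N c where Nc: "\<And>j. cvx j (N j) (c j)"
  "\<And>i j. j \<le> i \<Longrightarrow> (\<integral>\<^sup>+x. ennreal (((\<Sum>k<N i. c i k * F k x) - (\<Sum>k<N j. c j k * F k x))\<^sup>2) \<partial>(T \<Otimes>\<^sub>M lborel)) \<le> ennreal ((1/4)^j)"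
 proof (rule convex_combinations_Cauchy[where F=F, OF F FB])
  fix N c
  assume a: "\<And>j. cvx j (N j) (c j)" and b: "\<And>i j. j \<le> i \<Longrightarrow> (\<integral>\<^sup>+x. ennreal (((\<Sum>k<N i. c i k * F k x) - (\<Sum>k<N j. c j k * F k x))\<^sup>2) \<partial>(T \<Otimes>\<^sub>M lborel)) \<le> ennreal ((1/4)^j)"
  show thesis by (rule that[OF a b])
 qed
 define G where "G j z = (\<Sum>k<N j. c j k * F k z)" for j z
 have [measurable]: "G j \<in> borel_measurable (T \<Otimes>\<^sub>M lborel)" for j unfolding G_def by measurable
 obtain w where w: "w \<in> borel_measurable (T \<Otimes>\<^sub>M lborel)" "AE z in T \<Otimes>\<^sub>M lborel. (\<lambda>j. G j z) \<longlonglongrightarrow> w z"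
  "\<And>j. (\<integral>\<^sup>+z. ennreal ((w z - G j z)\<^sup>2) \<partial>(T \<Otimes>\<^sub>M lborel)) \<le> ennreal ((1/4)^j)"
  by (rule fast_Cauchy_limit[of G "T \<Otimes>\<^sub>M lborel"]) (use Nc(2) in \<open>auto simp: G_def\<close>)
 note [measurable] = w(1)
 have wm: "w \<in> borel_measurable (borel \<Otimes>\<^sub>M borel)" using w(1) by measurable
 have "(\<integral>\<^sup>+t. (\<Sum>j. \<integral>\<^sup>+x. ennreal ((w (t, x) - G j (t, x))\<^sup>2) \<partial>lborel) \<partial>T) = (\<Sum>j. \<integral>\<^sup>+t. \<integral>\<^sup>+x. ennreal ((w (t, x) - G j (t, x))\<^sup>2) \<partial>lborel \<partial>T)"
  by (rule nn_integral_suminf) measurable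
 also have "\<dots> = (\<Sum>j. \<integral>\<^sup>+z. ennreal ((w z - G j z)\<^sup>2) \<partial>(T \<Otimes>\<^sub>M lborel))"
  by (intro suminf_cong lborel.nn_integral_fst) measurable
 also have "\<dots> \<le> (\<Sum>j. ennreal ((1/4)^j))" by (intro suminf_le w(3)) auto
 also have "\<dots> < \<infinity>" by (subst suminf_ennreal2) (auto intro!: summable_geometric)
 finally have fin: "(\<integral>\<^sup>+t. (\<Sum>j. \<integral>\<^sup>+x. ennreal ((w (t, x) - G j (t, x))\<^sup>2) \<partial>lborel) \<partial>T) \<noteq> \<infinity>" by simp
 have "AE t in T. (\<Sum>j. \<integral>\<^sup>+x. ennreal ((w (t, x) - G j (t, x))\<^sup>2) \<partial>lborel) \<noteq> \<infinity>"
  by (rule nn_integral_PInf_AE[OF _ fin]) measurable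
 then have 1: "AE t in T. (\<lambda>j. \<integral>\<^sup>+x. ennreal ((w (t, x) - G j (t, x))\<^sup>2) \<partial>lborel) \<longlonglongrightarrow> 0"
 proof eventually_elim
  case (elim t)
  define a where "a j = (\<integral>\<^sup>+x. ennreal ((w (t, x) - G j (t, x))\<^sup>2) \<partial>lborel)" for j
  have "a j \<noteq> \<infinity>" for j
  proof -
   have "a j \<le> (\<Sum>j. a j)" using sum_le_suminf[of a "{j}"] by simp
   then show ?thesis using elim unfolding a_def[symmetric] by (auto simp: top_unique)
  qed
  then have aj: "a j = ennreal (enn2real (a j))" for j by (simp add: less_top)
  have "summable (\<lambda>j. enn2real (a j))"
   by (rule summable_suminf_not_top) (use elim aj in \<open>simp_all add: a_def[symmetric]\<close>)
  then have "(\<lambda>j. ennreal (enn2real (a j))) \<longlonglongrightarrow> ennreal 0"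
   by (intro tendsto_ennrealI summable_LIMSEQ_zero)
  then show ?case using aj unfolding a_def[symmetric] by simp
 qed
 have 2: "AE t in T. AE x in lborel. (\<lambda>j. G j (t, x)) \<longlonglongrightarrow> w (t, x)"
  using TX.AE_pair[OF w(2)] by simp
 show ?thesis
 proof (rule that[of N c w])
  show "cvx j (N j) (c j)" for j by (rule Nc(1))
  show "w \<in> borel_measurable (borel \<Otimes>\<^sub>M borel)" by (rule wm)
 qed (use ae[OF 1] ae[OF 2] in \<open>simp_all add: G_def F_def\<close>)
qed

end

section \<open>Stability of the vorticity class and of its potentials\<close>

lemma integrable_mult_bounded:
 fixes f w :: "'a \<Rightarrow> real"
 assumes [measurable]: "f \<in> borel_measurable M" and f: "\<And>x. \<bar>f x\<bar> \<le> K" and w: "integrable M w"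
 shows "integrable M (\<lambda>x. f x * w x)"
proof (rule Bochner_Integration.integrable_bound[OF integrable_mult_right[OF w, of K]])
 show "(\<lambda>x. f x * w x) \<in> borel_measurable M" using borel_measurable_integrable[OF w] by measurable
 show "AE x in M. norm (f x * w x) \<le> norm (K * w x)"
 proof (rule AE_I2)
  fix x
  show "norm (f x * w x) \<le> norm (K * w x)"
   using mult_right_mono[OF order_trans[OF f abs_ge_self], of "\<bar>w x\<bar>"] by (simp add: abs_mult)
 qed
qed

lemma vort_cvx:
 assumes c: "cvx n N c" and F: "\<And>k. vort p A (F k)" and p: "p \<ge> 1" and A: "A \<ge> 0"
 shows "vort p A (\<lambda>x. \<Sum>k<N. c k * F k x)"
proof -
 note [measurable] = vortD(1)[OF F]
 have *: "(\<integral>\<^sup>+x. ennreal (\<bar>\<Sum>k<N. c k * F k x\<bar> powr q) \<partial>lborel) \<le> ennreal A"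
  if q: "q \<ge> 1" and Fq: "\<And>k. (\<integral>\<^sup>+x. ennreal (\<bar>F k x\<bar> powr q) \<partial>lborel) \<le> ennreal A" for q
 proof -
  have "(\<integral>\<^sup>+x. ennreal (\<bar>\<Sum>k<N. c k * F k x\<bar> powr q) \<partial>lborel) \<le> (\<integral>\<^sup>+x. (\<Sum>k<N. ennreal (c k) * ennreal (\<bar>F k x\<bar> powr q)) \<partial>lborel)"
  proof (rule nn_integral_mono)
   fix x
   have "\<bar>\<Sum>k<N. c k * F k x\<bar> powr q \<le> (\<Sum>k<N. c k * \<bar>F k x\<bar> powr q)"
    by (rule sum_powr_le) (use q cvxD[OF c] in auto)
   then have "ennreal (\<bar>\<Sum>k<N. c k * F k x\<bar> powr q) \<le> ennreal (\<Sum>k<N. c k * \<bar>F k x\<bar> powr q)" by (rule ennreal_leI)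
   also have "\<dots> = (\<Sum>k<N. ennreal (c k * \<bar>F k x\<bar> powr q))"
    using cvxD(1)[OF c] by (subst sum_ennreal) auto
   also have "\<dots> = (\<Sum>k<N. ennreal (c k) * ennreal (\<bar>F k x\<bar> powr q))"
    using cvxD(1)[OF c] by (intro sum.cong refl ennreal_mult) auto
   finally show "ennreal (\<bar>\<Sum>k<N. c k * F k x\<bar> powr q) \<le> (\<Sum>k<N. ennreal (c k) * ennreal (\<bar>F k x\<bar> powr q))" .
  qed
  also have "\<dots> = (\<Sum>k<N. ennreal (c k) * (\<integral>\<^sup>+x. ennreal (\<bar>F k x\<bar> powr q) \<partial>lborel))"
   by (subst nn_integral_sum, measurable, intro sum.cong refl nn_integral_cmult, measurable)
  also have "\<dots> \<le> (\<Sum>k<N. ennreal (c k) * ennreal A)" by (intro sum_mono mult_left_mono Fq) auto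
  also have "\<dots> = ennreal (\<Sum>k<N. c k * A)"
   using cvxD(1)[OF c] A by (subst sum_ennreal[symmetric]) (auto simp: ennreal_mult intro!: sum.cong)
  also have "\<dots> = ennreal A" using cvxD(4)[OF c] by (simp add: sum_distrib_right[symmetric])
  finally show ?thesis .
 qed
 show ?thesis unfolding vort_def
 proof (intro conjI)
  show "(\<integral>\<^sup>+x. ennreal \<bar>\<Sum>k<N. c k * F k x\<bar> \<partial>lborel) \<le> ennreal A"
   using *[of 1] vortD(2)[OF F] by simp
  show "(\<integral>\<^sup>+x. ennreal (\<bar>\<Sum>k<N. c k * F k x\<bar> powr p) \<partial>lborel) \<le> ennreal A"
   by (rule *[OF p vortD(3)[OF F]])
 qed measurable
qed

text \<open>Fatou's lemma.\<close>

lemma vort_limit: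
 assumes F: "\<And>j. vort p A (F j)" and [measurable]: "w \<in> borel_measurable borel"
  and lim: "AE x in lborel. (\<lambda>j. F j x) \<longlonglongrightarrow> w x" and p: "p > 0"
 shows "vort p A w"
proof -
 note [measurable] = vortD(1)[OF F]
 have *: "(\<integral>\<^sup>+x. ennreal (G (w x)) \<partial>lborel) \<le> ennreal A"
  if G: "continuous_on UNIV G" and b: "\<And>j. (\<integral>\<^sup>+x. ennreal (G (F j x)) \<partial>lborel) \<le> ennreal A" for G :: "real \<Rightarrow> real"
 proof -
  have [measurable]: "G \<in> borel_measurable borel" using G by (rule borel_measurable_continuous_onI)
  have "(\<integral>\<^sup>+x. ennreal (G (w x)) \<partial>lborel) = (\<integral>\<^sup>+x. liminf (\<lambda>j. ennreal (G (F j x))) \<partial>lborel)"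
  proof (rule nn_integral_cong_AE)
   show "AE x in lborel. ennreal (G (w x)) = liminf (\<lambda>j. ennreal (G (F j x)))"
    using lim
   proof eventually_elim
    case (elim x)
    have "(\<lambda>j. ennreal (G (F j x))) \<longlonglongrightarrow> ennreal (G (w x))"
     by (intro tendsto_ennrealI continuous_on_tendsto_compose[OF G elim]) auto
    then show ?case by (rule lim_imp_Liminf[OF trivial_limit_sequentially, symmetric])
   qed
  qed
  also have "\<dots> \<le> liminf (\<lambda>j. \<integral>\<^sup>+x. ennreal (G (F j x)) \<partial>lborel)" by (rule nn_integral_liminf) measurable
  also have "\<dots> \<le> limsup (\<lambda>j. \<integral>\<^sup>+x. ennreal (G (F j x)) \<partial>lborel)" by (rule Liminf_le_Limsup) simp
  also have "\<dots> \<le> ennreal A" by (rule Limsup_bounded) (use b in auto)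
  finally show ?thesis .
 qed
 show ?thesis unfolding vort_def
 proof (intro conjI)
  show "(\<integral>\<^sup>+x. ennreal \<bar>w x\<bar> \<partial>lborel) \<le> ennreal A"
   by (rule *[of abs]) (auto intro!: continuous_intros vortD(2)[OF F])
  show "(\<integral>\<^sup>+x. ennreal (\<bar>w x\<bar> powr p) \<partial>lborel) \<le> ennreal A"
   by (rule *[of "\<lambda>s. \<bar>s\<bar> powr p"]) (use p vortD(3)[OF F] in \<open>auto intro!: continuous_on_powr'[OF _ continuous_on_const] continuous_on_rabs continuous_on_id\<close>)
 qed measurable
qed

lemma product_tendsto_zero:
 fixes a b :: "nat \<Rightarrow> 'a \<Rightarrow> real"
 assumes [measurable]: "\<And>j. a j \<in> borel_measurable M" "\<And>j. b j \<in> borel_measurable M"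
  and K: "\<And>j. (\<integral>\<^sup>+x. ennreal ((a j x)\<^sup>2) \<partial>M) \<le> ennreal K"
  and b: "(\<lambda>j. \<integral>\<^sup>+x. ennreal ((b j x)\<^sup>2) \<partial>M) \<longlonglongrightarrow> 0"
 shows "(\<lambda>j. LINT x|M. a j x * b j x) \<longlonglongrightarrow> 0"
proof -
 define I where "I j = (\<integral>\<^sup>+x. ennreal \<bar>a j x\<bar> * ennreal \<bar>b j x\<bar> \<partial>M)" for j
 have le: "(I j)\<^sup>2 \<le> ennreal K * (\<integral>\<^sup>+x. ennreal ((b j x)\<^sup>2) \<partial>M)" for j
 proof -
  have "(I j)\<^sup>2 \<le> (\<integral>\<^sup>+x. (ennreal \<bar>a j x\<bar>)\<^sup>2 \<partial>M) * (\<integral>\<^sup>+x. (ennreal \<bar>b j x\<bar>)\<^sup>2 \<partial>M)"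
   unfolding I_def by (rule Cauchy_Schwarz_nn_integral) measurable
  also have "\<dots> \<le> ennreal K * (\<integral>\<^sup>+x. ennreal ((b j x)\<^sup>2) \<partial>M)"
   using K[of j] by (intro mult_mono) (simp_all add: ennreal_power)
  finally show ?thesis .
 qed
 have lim: "(\<lambda>j. ennreal K * (\<integral>\<^sup>+x. ennreal ((b j x)\<^sup>2) \<partial>M)) \<longlonglongrightarrow> 0"
  using ennreal_tendsto_cmult[OF _ b, of "ennreal K"] by simp
 have sq: "(LINT x|M. a j x * b j x)\<^sup>2 \<le> enn2real (ennreal K * (\<integral>\<^sup>+x. ennreal ((b j x)\<^sup>2) \<partial>M))"
  if fin: "ennreal K * (\<integral>\<^sup>+x. ennreal ((b j x)\<^sup>2) \<partial>M) < \<infinity>" for j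
 proof -
  have "ennreal ((LINT x|M. a j x * b j x)\<^sup>2) = (ennreal \<bar>LINT x|M. a j x * b j x\<bar>)\<^sup>2" by (simp add: ennreal_power)
  also have "\<dots> \<le> (I j)\<^sup>2"
  proof (rule power_mono)
   have "ennreal (norm (LINT x|M. a j x * b j x)) \<le> (\<integral>\<^sup>+x. ennreal (norm (a j x * b j x)) \<partial>M)"
   proof (cases "integrable M (\<lambda>x. a j x * b j x)")
    case True
    then show ?thesis by (rule integral_norm_bound_ennreal)
   qed (simp add: not_integrable_integral_eq)
   then show "ennreal \<bar>LINT x|M. a j x * b j x\<bar> \<le> I j"
    unfolding I_def by (simp add: abs_mult ennreal_mult)
  qed simp
  also have "\<dots> \<le> ennreal (enn2real (ennreal K * (\<integral>\<^sup>+x. ennreal ((b j x)\<^sup>2) \<partial>M)))"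
   using le[of j] fin by (simp add: less_top)
  finally show ?thesis by (simp add: ennreal_le_iff)
 qed
 have "eventually (\<lambda>j. ennreal K * (\<integral>\<^sup>+x. ennreal ((b j x)\<^sup>2) \<partial>M) < \<infinity>) sequentially"
  using order_tendstoD(2)[OF lim, of \<infinity>] by simp
 then have ev: "eventually (\<lambda>j. (LINT x|M. a j x * b j x)\<^sup>2 \<le> enn2real (ennreal K * (\<integral>\<^sup>+x. ennreal ((b j x)\<^sup>2) \<partial>M))) sequentially"
  by eventually_elim (rule sq)
 have "(\<lambda>j. ennreal K * (\<integral>\<^sup>+x. ennreal ((b j x)\<^sup>2) \<partial>M)) \<longlonglongrightarrow> ennreal 0" using lim by simp
 then have "(\<lambda>j. enn2real (ennreal K * (\<integral>\<^sup>+x. ennreal ((b j x)\<^sup>2) \<partial>M))) \<longlonglongrightarrow> 0"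
  by (rule tendsto_enn2real) simp
 then have "(\<lambda>j. (LINT x|M. a j x * b j x)\<^sup>2) \<longlonglongrightarrow> 0"
  using tendsto_sandwich[OF _ ev tendsto_const, of 0] by simp
 then show ?thesis by (simp add: tendsto_power_zero[of _ _ 2] flip: power2_eq_square)
qed

lemma L2_pairing_tendsto:
 fixes a :: "plane \<Rightarrow> real" and q :: "nat \<Rightarrow> plane \<Rightarrow> real"
 assumes [measurable]: "a \<in> borel_measurable borel" and a: "\<And>x. \<bar>a x\<bar> \<le> K" and supp: "\<And>x. norm (x - ctr) > \<rho> \<Longrightarrow> a x = 0"
  and q: "\<And>j. integrable lborel (q j)" "integrable lborel q'"
  and lim: "(\<lambda>j. \<integral>\<^sup>+x. ennreal ((q' x - q j x)\<^sup>2) \<partial>lborel) \<longlonglongrightarrow> 0"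
 shows "(\<lambda>j. LINT x|lborel. a x * q j x) \<longlonglongrightarrow> (LINT x|lborel. a x * q' x)"
proof -
 have [measurable]: "q j \<in> borel_measurable borel" "q' \<in> borel_measurable borel" for j using q by auto
 have ai: "integrable lborel (\<lambda>x. a x * f x)" if "integrable lborel f" for f
 proof (rule Bochner_Integration.integrable_bound[OF integrable_mult_right[OF that, of K]])
  show "(\<lambda>x. a x * f x) \<in> borel_measurable lborel" using that by auto
  show "AE x in lborel. norm (a x * f x) \<le> norm (K * f x)"
   by (rule AE_I2) (auto simp: abs_mult intro!: mult_right_mono order_trans[OF a])
 qed
 have "(\<lambda>j. LINT x|lborel. a x * (q' x - q j x)) \<longlonglongrightarrow> 0"
 proof (rule product_tendsto_zero[OF _ _ _ lim])
  have "(\<integral>\<^sup>+x. ennreal ((a x)\<^sup>2) \<partial>lborel) \<le> (\<integral>\<^sup>+x. ennreal (K\<^sup>2) * indicator (cball ctr \<rho>) x \<partial>lborel)"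
  proof (rule nn_integral_mono)
   fix x
   show "ennreal ((a x)\<^sup>2) \<le> ennreal (K\<^sup>2) * indicator (cball ctr \<rho>) x"
   proof (cases "x \<in> cball ctr \<rho>")
    case True
    have "(a x)\<^sup>2 \<le> K\<^sup>2" using power_mono[OF a[of x], of 2] by simp
    then show ?thesis using True by (simp add: ennreal_leI)
   next
    case False
    then show ?thesis using supp[of x] by (simp add: dist_norm norm_minus_commute)
   qed
  qed
  also have "\<dots> = ennreal (K\<^sup>2) * emeasure lborel (cball ctr \<rho>)" by (simp add: nn_integral_cmult_indicator)
  also have "\<dots> = ennreal (enn2real (ennreal (K\<^sup>2) * emeasure lborel (cball ctr \<rho>)))"
   using emeasure_lborel_cball_finite[of ctr \<rho>] by (intro ennreal_enn2real[symmetric]) (auto simp: ennreal_mult_less_top)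
  finally show "(\<integral>\<^sup>+x. ennreal ((a x)\<^sup>2) \<partial>lborel) \<le> ennreal (enn2real (ennreal (K\<^sup>2) * emeasure lborel (cball ctr \<rho>)))" .
 qed measurable
 then have "(\<lambda>j. (LINT x|lborel. a x * q' x) - (LINT x|lborel. a x * (q' x - q j x))) \<longlonglongrightarrow> (LINT x|lborel. a x * q' x) - 0"
  by (intro tendsto_intros)
 moreover have "(LINT x|lborel. a x * q' x) - (LINT x|lborel. a x * (q' x - q j x)) = (LINT x|lborel. a x * q j x)" for j
  unfolding right_diff_distrib using ai[OF q(1)] ai[OF q(2)] by simp
 ultimately show ?thesis by simp
qed

lemma cvx_tendsto:
 fixes X :: "nat \<Rightarrow> 'v::real_normed_vector"
 assumes c: "\<And>j. cvx j (N j) (c j)" and X: "X \<longlonglongrightarrow> l"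
 shows "(\<lambda>j. \<Sum>k<N j. c j k *\<^sub>R X k) \<longlonglongrightarrow> l"
proof (rule LIMSEQ_I)
 fix e :: real assume e: "e > 0"
 obtain M where M: "\<And>k. k \<ge> M \<Longrightarrow> norm (X k - l) < e / 2" using LIMSEQ_D[OF X, of "e / 2"] e by auto
 have "norm ((\<Sum>k<N j. c j k *\<^sub>R X k) - l) < e" if j: "j \<ge> M" for j
 proof -
  have "l = (\<Sum>k<N j. c j k) *\<^sub>R l" by (simp add: cvxD(4)[OF c])
  then have eq: "(\<Sum>k<N j. c j k *\<^sub>R X k) - l = (\<Sum>k<N j. c j k *\<^sub>R (X k - l))"
   by (simp add: scaleR_diff_right sum_subtractf scaleR_sum_left)
  have le: "norm (\<Sum>k<N j. c j k *\<^sub>R (X k - l)) \<le> (\<Sum>k<N j. c j k * (e / 2))"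
  proof (rule order_trans[OF norm_sum sum_mono])
   fix k
   show "norm (c j k *\<^sub>R (X k - l)) \<le> c j k * (e / 2)"
   proof (cases "k < j")
    case False
    then have "norm (X k - l) \<le> e / 2" using M[of k] j by simp
    then have "c j k * norm (X k - l) \<le> c j k * (e / 2)" using cvxD(1)[OF c] by (rule mult_left_mono)
    then show ?thesis using cvxD(1)[OF c, of j k] by simp
   qed (simp add: cvxD(2)[OF c])
  qed
  have "(\<Sum>k<N j. c j k * (e / 2)) = e / 2" unfolding sum_distrib_right[symmetric] cvxD(4)[OF c] by simp
  with le e show ?thesis unfolding eq by linarith
 qed
 then show "\<exists>M. \<forall>j\<ge>M. norm ((\<Sum>k<N j. c j k *\<^sub>R X k) - l) < e" by blast
qed

context charge
begin

lemma pot_Ke_diff_nn: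
 assumes e: "e > 0"
 shows "ennreal (norm (pot L g Y (Ke 0) x - pot L g Y (Ke e) x)) \<le> (\<integral>\<^sup>+b. ennreal (\<bar>g b\<bar> * norm (Ke 0 (x - Y b) - Ke e (x - Y b))) \<partial>L)"
proof (cases "(\<integral>\<^sup>+b. ennreal (\<bar>g b\<bar> * norm (Ke 0 (x - Y b) - Ke e (x - Y b))) \<partial>L) = \<infinity>")
 case False
 have i1: "integrable L (\<lambda>b. g b *\<^sub>R Ke e (x - Y b))" by (rule pot_integrable[OF borel_measurable_Ke norm_Ke_bound[OF e]])
 have i2: "integrable L (\<lambda>b. g b *\<^sub>R (Ke 0 (x - Y b) - Ke e (x - Y b)))"
  using False by (intro integrableI_bounded) (auto simp: less_top)
 have i0: "integrable L (\<lambda>b. g b *\<^sub>R Ke 0 (x - Y b))"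
  using Bochner_Integration.integrable_add[OF i1 i2] by (simp add: scaleR_diff_right)
 have "pot L g Y (Ke 0) x - pot L g Y (Ke e) x = (LINT b|L. g b *\<^sub>R (Ke 0 (x - Y b) - Ke e (x - Y b)))"
  unfolding pot_def scaleR_diff_right using i0 i1 by simp
 then have "ennreal (norm (pot L g Y (Ke 0) x - pot L g Y (Ke e) x)) \<le> (\<integral>\<^sup>+b. ennreal (norm (g b *\<^sub>R (Ke 0 (x - Y b) - Ke e (x - Y b)))) \<partial>L)"
  using integral_norm_bound_ennreal[OF i2] by simp
 then show ?thesis by simp
qed simp

end

context scheme
begin

text \<open>Pairing with a vorticity moves the difference of the kernels onto a potential of the vorticity,
 where it is uniformly small.\<close>

lemma P_close:
 assumes e: "e > 0"
 shows "\<exists>d>0. \<forall>c q. 0 < c \<longrightarrow> c \<le> d \<longrightarrow> vort p A q \<longrightarrow>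
  (\<integral>\<^sup>+x. ennreal (\<bar>q x\<bar> * norm (pot L g Y (Ke 0) x - pot L g Y (Ke c) x)) \<partial>lborel) \<le> ennreal e"
proof -
 define e' where "e' = e / (mass + 1)"
 have e': "e' > 0" "e' * mass \<le> e"
 proof -
  have m1: "mass + 1 > 0" by (rule add_nonneg_pos[OF mass_nonneg zero_less_one])
  then show "e' > 0" unfolding e'_def using e by (rule divide_pos_pos[rotated])
  have "e' * mass = e * (mass / (mass + 1))" by (simp add: e'_def)
  also have "mass / (mass + 1) \<le> 1" using m1 by (subst pos_divide_le_eq) simp_all
  then have "e * (mass / (mass + 1)) \<le> e * 1" using e by (intro mult_left_mono) simp_all
  finally show "e' * mass \<le> e" by simp
 qed
 obtain d where d: "d > 0" and D: "\<And>c w x. 0 < c \<Longrightarrow> c \<le> d \<Longrightarrow> vort p A w \<Longrightarrow>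
  (\<integral>\<^sup>+y. ennreal (\<bar>w y\<bar> * norm (Ke 0 (x - y) - Ke c (x - y))) \<partial>lborel) \<le> ennreal e'"
  using kernel_diff_small[OF p A e'(1)] by auto
 have odd: "Ke c (x - y) = - Ke c (y - x)" for c x y
 proof -
  have "perp (x - y) = - perp (y - x)" by (simp add: plane_eq_iff)
  then show ?thesis by (simp add: Ke_alt norm_minus_commute)
 qed
 have "(\<integral>\<^sup>+x. ennreal (\<bar>q x\<bar> * norm (pot L g Y (Ke 0) x - pot L g Y (Ke c) x)) \<partial>lborel) \<le> ennreal e"
  if c: "0 < c" "c \<le> d" and q: "vort p A q" for c q
 proof -
  note [measurable] = vortD(1)[OF q]
  have "(\<integral>\<^sup>+x. ennreal (\<bar>q x\<bar> * norm (pot L g Y (Ke 0) x - pot L g Y (Ke c) x)) \<partial>lborel) \<le>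
   (\<integral>\<^sup>+x. ennreal \<bar>q x\<bar> * (\<integral>\<^sup>+b. ennreal (\<bar>g b\<bar> * norm (Ke 0 (x - Y b) - Ke c (x - Y b))) \<partial>L) \<partial>lborel)"
  proof (rule nn_integral_mono)
   fix x
   show "ennreal (\<bar>q x\<bar> * norm (pot L g Y (Ke 0) x - pot L g Y (Ke c) x)) \<le>
    ennreal \<bar>q x\<bar> * (\<integral>\<^sup>+b. ennreal (\<bar>g b\<bar> * norm (Ke 0 (x - Y b) - Ke c (x - Y b))) \<partial>L)"
    by (subst ennreal_mult[OF abs_ge_zero norm_ge_zero]) (rule mult_left_mono[OF pot_Ke_diff_nn[OF c(1)]], simp)
  qed
  also have "\<dots> \<le> ennreal e' * ennreal mass"
  proof (rule pairing_le)
   fix y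
   have "norm (Ke 0 (x - y) - Ke c (x - y)) = norm (Ke 0 (y - x) - Ke c (y - x))" for x
    unfolding odd[of _ x y] by (simp only: minus_diff_minus norm_minus_cancel)
   then show "(\<integral>\<^sup>+x. ennreal (\<bar>q x\<bar> * norm (Ke 0 (x - y) - Ke c (x - y))) \<partial>lborel) \<le> ennreal e'"
    using D[OF c q, of y] by simp
  qed auto
  also have "\<dots> \<le> ennreal e" using e' mass_nonneg by (simp add: ennreal_mult[symmetric] ennreal_leI)
  finally show ?thesis .
 qed
 with d show ?thesis by blast
qed

lemma P_finite:
 assumes q: "vort p A q" and c: "c \<ge> 0"
 shows "(\<integral>\<^sup>+x. ennreal (\<bar>q x\<bar> * norm (pot L g Y (Ke c) x)) \<partial>lborel) \<le> ennreal (C * m)"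
proof -
 note [measurable] = vortD(1)[OF q]
 have Cm: "C * mass \<le> C * m" using C0 Am A by (intro mult_left_mono) auto
 have "(\<integral>\<^sup>+x. ennreal (\<bar>q x\<bar> * norm (pot L g Y (Ke c) x)) \<partial>lborel) \<le> (\<integral>\<^sup>+x. ennreal \<bar>q x\<bar> * (\<integral>\<^sup>+b. ennreal (\<bar>g b\<bar> * (1 / norm (x - Y b))) \<partial>L) \<partial>lborel)"
 proof (rule nn_integral_mono)
  fix x
  have "ennreal (norm (pot L g Y (Ke c) x)) \<le> (\<integral>\<^sup>+b. ennreal (\<bar>g b\<bar> * norm (Ke c (x - Y b))) \<partial>L)"
   by (rule norm_pot_le_nn) measurable
  also have "\<dots> \<le> (\<integral>\<^sup>+b. ennreal (\<bar>g b\<bar> * (1 / norm (x - Y b))) \<partial>L)"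
   by (intro nn_integral_mono ennreal_leI mult_left_mono norm_Ke_le) auto
  finally show "ennreal (\<bar>q x\<bar> * norm (pot L g Y (Ke c) x)) \<le> ennreal \<bar>q x\<bar> * (\<integral>\<^sup>+b. ennreal (\<bar>g b\<bar> * (1 / norm (x - Y b))) \<partial>L)"
   unfolding ennreal_mult[OF abs_ge_zero norm_ge_zero] by (rule mult_left_mono) simp
 qed
 also have "\<dots> \<le> ennreal C * ennreal mass"
 proof (rule pairing_le)
  show "(\<integral>\<^sup>+x. ennreal (\<bar>q x\<bar> * (1 / norm (x - y))) \<partial>lborel) \<le> ennreal C" for y
   using C[OF q, where x=y] by (simp add: norm_minus_commute)
 qed auto
 also have "\<dots> \<le> ennreal (C * m)" using Cm C0 mass_nonneg by (simp add: ennreal_mult[symmetric] ennreal_leI)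
 finally show ?thesis .
qed

lemma pot_tendsto:
 assumes q: "\<And>j. vort p A (q j)" "vort p A q'"
  and lim: "(\<lambda>j. \<integral>\<^sup>+x. ennreal ((q' x - q j x)\<^sup>2) \<partial>lborel) \<longlonglongrightarrow> 0"
 shows "(\<lambda>j. pot lborel (q j) (\<lambda>y. y) (Ke 0) x) \<longlonglongrightarrow> pot lborel q' (\<lambda>y. y) (Ke 0) x"
proof (rule vec_tendstoI, rule LIMSEQ_I)
 fix i :: 2 and e :: real assume e: "e > 0"
 let ?p = "\<lambda>w c. pot lborel w (\<lambda>y. y) (Ke c) x"
 obtain d where d: "d > 0" and cc: "\<And>a b w x. 0 \<le> a \<Longrightarrow> a \<le> d \<Longrightarrow> 0 \<le> b \<Longrightarrow> b \<le> d \<Longrightarrow> vort p A w \<Longrightarrow>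
  norm (pot lborel w (\<lambda>y. y) (Ke a) x - pot lborel w (\<lambda>y. y) (Ke b) x) \<le> e / 5"
  using pot_Ke_close[of "e / 5"] e by auto
 define \<rho> where "\<rho> = 5 * (A + 1) / e"
 have \<rho>: "\<rho> > 0" using e A by (simp add: \<rho>_def)
 define a where "a y = Ke d (x - y) $ i * indicator (cball x \<rho>) y" for y
 have [measurable]: "a \<in> borel_measurable borel" unfolding a_def by measurable
 have kb: "\<bar>Ke d z $ i\<bar> \<le> 1 / d" "\<bar>Ke d z $ i\<bar> \<le> 1 / norm z" for z
  using component_le_norm_cart[of "Ke d z" i] norm_Ke_bound[OF d, of z] norm_Ke_le[of d z] by linarith+
 have "(\<lambda>j. LINT y|lborel. a y * q j y) \<longlonglongrightarrow> (LINT y|lborel. a y * q' y)"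
 proof (rule L2_pairing_tendsto[where K="1/d" and ctr=x and \<rho>=\<rho>])
  show "\<bar>a y\<bar> \<le> 1 / d" for y using kb(1)[of "x - y"] d by (simp add: a_def indicator_def)
  show "norm (y - x) > \<rho> \<Longrightarrow> a y = 0" for y by (simp add: a_def dist_norm norm_minus_commute)
 qed (use q lim in \<open>auto intro: vort_integrable\<close>)
 then obtain M where M: "\<And>j. j \<ge> M \<Longrightarrow> \<bar>(LINT y|lborel. a y * q j y) - (LINT y|lborel. a y * q' y)\<bar> < e / 5"
  using LIMSEQ_D[where r="e / 5"] e by fastforce
 have far: "\<bar>?p w d $ i - (LINT y|lborel. a y * w y)\<bar> \<le> e / 5" if w: "vort p A w" for w
 proof -
  have [measurable]: "w \<in> borel_measurable borel" by (rule vortD(1)[OF w])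
  note wi = vort_integrable[OF w]
  have bi: "integrable lborel (\<lambda>y. f y * w y)" if "f \<in> borel_measurable borel" "\<And>y. \<bar>f y\<bar> \<le> 1 / d" for f
   by (rule integrable_mult_bounded[OF _ that(2) wi]) (use that in simp)
  have "?p w d $ i = (LINT y|lborel. Ke d (x - y) $ i * w y)"
   unfolding charge.pot_nth[OF charge_lborel[OF wi] borel_measurable_Ke norm_Ke_bound[OF d], symmetric]
   by (simp add: pot_def mult.commute)
  then have "?p w d $ i - (LINT y|lborel. a y * w y) = (LINT y|lborel. Ke d (x - y) $ i * w y - a y * w y)"
   using bi[of "\<lambda>y. Ke d (x - y) $ i"] bi[of a] kb(1) d by (simp add: a_def indicator_def)
  also have "norm \<dots> \<le> (LINT y|lborel. 1 / \<rho> * \<bar>w y\<bar>)"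
  proof (rule order_trans[OF integral_norm_bound integral_mono])
   show "integrable lborel (\<lambda>y. norm (Ke d (x - y) $ i * w y - a y * w y))"
    using bi[of "\<lambda>y. Ke d (x - y) $ i"] bi[of a] kb(1) d by (simp add: a_def indicator_def)
   show "integrable lborel (\<lambda>y. 1 / \<rho> * \<bar>w y\<bar>)" using wi by auto
   show "norm (Ke d (x - y) $ i * w y - a y * w y) \<le> 1 / \<rho> * \<bar>w y\<bar>" for y
   proof (cases "y \<in> cball x \<rho>")
    case False
    then have "1 / norm (x - y) \<le> 1 / \<rho>" using \<rho> by (intro frac_le) (auto simp: dist_norm)
    then have "\<bar>Ke d (x - y) $ i\<bar> \<le> 1 / \<rho>" using kb(2)[of "x - y"] by linarith
    then have "\<bar>Ke d (x - y) $ i\<bar> * \<bar>w y\<bar> \<le> 1 / \<rho> * \<bar>w y\<bar>" by (rule mult_right_mono) simp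
    then show ?thesis using False by (simp add: a_def abs_mult)
   qed (use \<rho> in \<open>simp add: a_def\<close>)
  qed
  also have "\<dots> = 1 / \<rho> * (LINT y|lborel. \<bar>w y\<bar>)" by simp
  also have "\<dots> \<le> 1 / \<rho> * A" using \<rho> vort_integral[OF w A] by (intro mult_left_mono) auto
  also have "\<dots> = e / 5 * (A / (A + 1))" by (simp add: \<rho>_def)
  also have "\<dots> \<le> e / 5 * 1" using e A by (intro mult_left_mono) auto
  finally show ?thesis by simp
 qed
 have near: "\<bar>?p w 0 $ i - ?p w d $ i\<bar> \<le> e / 5" if "vort p A w" for w
  using component_le_norm_cart[of "?p w 0 - ?p w d" i] cc[of 0 d w x] that d by simp
 have "\<bar>?p (q j) 0 $ i - ?p q' 0 $ i\<bar> < e" if "j \<ge> M" for j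
  using M[OF that] far[OF q(1)[of j]] far[OF q(2)] near[OF q(1)[of j]] near[OF q(2)] by linarith
 then show "\<exists>M. \<forall>j\<ge>M. norm (?p (q j) 0 $ i - ?p q' 0 $ i) < e" by (intro exI[of _ M]) simp
qed

end

section \<open>The discrete weak formulation\<close>

text \<open>What is used of a test function \<open>\<phi>\<close>: its time derivative \<open>\<phi>t\<close> and its space derivatives \<open>d i\<close>,
 extended by zero to negative times, with uniform first-order Taylor expansions.\<close>

locale tested = scheme L g Y p A C m w0 for L :: "'b measure" and g Y p A C m w0 +
 fixes \<phi> \<phi>t :: "real \<Rightarrow> plane \<Rightarrow> real" and d :: "2 \<Rightarrow> real \<Rightarrow> plane \<Rightarrow> real" and B R :: real
 assumes B: "B \<ge> 0" and R: "R > 0"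
  and phi_meas [measurable]: "\<And>t. \<phi> t \<in> borel_measurable borel"
  and pt_meas: "(\<lambda>(t, x). \<phi>t t x) \<in> borel_measurable (borel \<Otimes>\<^sub>M borel)"
  and d_meas: "\<And>i. (\<lambda>(t, x). d i t x) \<in> borel_measurable (borel \<Otimes>\<^sub>M borel)"
  and phi_b: "\<And>t x. t \<ge> 0 \<Longrightarrow> \<bar>\<phi> t x\<bar> \<le> B" and pt_b: "\<And>t x. \<bar>\<phi>t t x\<bar> \<le> B" and d_b: "\<And>i t x. \<bar>d i t x\<bar> \<le> B"
  and tay: "\<And>t x s i. t \<ge> 0 \<Longrightarrow> \<bar>\<phi> t (x + s *\<^sub>R ax i) - \<phi> t x - s * d i t x\<bar> \<le> B * s\<^sup>2"
  and tim: "\<And>t r s x. 0 \<le> t \<Longrightarrow> t \<le> r \<Longrightarrow> r \<le> s \<Longrightarrow> \<bar>\<phi> s x - \<phi> t x - (s - t) * \<phi>t r x\<bar> \<le> B * (s - t)\<^sup>2"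
  and dl: "\<And>i t s x. 0 \<le> t \<Longrightarrow> t \<le> s \<Longrightarrow> \<bar>d i s x - d i t x\<bar> \<le> B * (s - t)"
  and sup_t: "\<And>t x. t \<ge> R \<Longrightarrow> \<phi> t x = 0" "\<And>t x. t \<ge> R \<Longrightarrow> \<phi>t t x = 0" "\<And>i t x. t \<ge> R \<Longrightarrow> d i t x = 0"
  and neg_t: "\<And>t x. t < 0 \<Longrightarrow> \<phi>t t x = 0" "\<And>i t x. t < 0 \<Longrightarrow> d i t x = 0"
  and sup_x: "\<And>t x. norm x > R \<Longrightarrow> \<phi>t t x = 0" "\<And>i t x. norm x > R \<Longrightarrow> d i t x = 0"

lemma (in scheme) weighted:
 fixes a :: "plane \<Rightarrow> real" and D :: "2 \<Rightarrow> plane \<Rightarrow> real" and V :: "plane \<Rightarrow> plane"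
 assumes q: "vort p A q" and [measurable]: "a \<in> borel_measurable borel" "\<And>i. D i \<in> borel_measurable borel" "V \<in> borel_measurable borel"
  and a: "\<And>x. \<bar>a x\<bar> \<le> Ba" and D: "\<And>i x. \<bar>D i x\<bar> \<le> B"
  and K: "(\<integral>\<^sup>+x. ennreal (\<bar>q x\<bar> * norm (V x)) \<partial>lborel) \<le> ennreal K" "K \<ge> 0"
 shows "integrable lborel (\<lambda>x. q x * (a x + (\<Sum>i\<in>UNIV. D i x * V x $ i)))"
  "\<bar>LINT x|lborel. q x * (a x + (\<Sum>i\<in>UNIV. D i x * V x $ i))\<bar> \<le> Ba * m + 2 * B * K"
proof -
 note [measurable] = vortD(1)[OF q]
 have B: "B \<ge> 0" using D[of 1 0] by simp
 have Ba: "Ba \<ge> 0" using a[of 0] by simp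
 have qm: "(LINT x|lborel. \<bar>q x\<bar>) \<le> m" using vort_mass[OF q] mass_nonneg by linarith
 have i1: "integrable lborel (\<lambda>x. \<bar>q x\<bar> * norm (V x))"
  using K by (intro integrableI_bounded) (auto intro: le_less_trans)
 have I1: "(LINT x|lborel. \<bar>q x\<bar> * norm (V x)) \<le> K"
 proof -
  have "ennreal (LINT x|lborel. \<bar>q x\<bar> * norm (V x)) \<le> ennreal K"
   using K(1) i1 by (subst (asm) nn_integral_eq_integral) auto
  then show ?thesis using K(2) by (simp add: ennreal_le_iff)
 qed
 have i2: "integrable lborel (\<lambda>x. Ba * \<bar>q x\<bar> + 2 * B * (\<bar>q x\<bar> * norm (V x)))"
  using vort_integrable[OF q] i1 by auto
 have pw: "\<bar>q x * (a x + (\<Sum>i\<in>UNIV. D i x * V x $ i))\<bar> \<le> Ba * \<bar>q x\<bar> + 2 * B * (\<bar>q x\<bar> * norm (V x))" for x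
 proof -
  have "\<bar>D i x * V x $ i\<bar> \<le> B * norm (V x)" for i
   unfolding abs_mult using B by (intro mult_mono D component_le_norm_cart) auto
  from this[of 1] this[of 2] have "\<bar>\<Sum>i\<in>UNIV. D i x * V x $ i\<bar> \<le> 2 * B * norm (V x)"
   unfolding sum_2 by linarith
  then have "\<bar>a x + (\<Sum>i\<in>UNIV. D i x * V x $ i)\<bar> \<le> Ba + 2 * B * norm (V x)" using a[of x] by linarith
  then have "\<bar>q x\<bar> * \<bar>a x + (\<Sum>i\<in>UNIV. D i x * V x $ i)\<bar> \<le> \<bar>q x\<bar> * (Ba + 2 * B * norm (V x))"
   by (rule mult_left_mono) simp
  also have "\<dots> = Ba * \<bar>q x\<bar> + 2 * B * (\<bar>q x\<bar> * norm (V x))" by (simp add: algebra_simps)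
  finally show ?thesis unfolding abs_mult .
 qed
 show i3: "integrable lborel (\<lambda>x. q x * (a x + (\<Sum>i\<in>UNIV. D i x * V x $ i)))"
 proof (rule Bochner_Integration.integrable_bound[OF i2])
  show "AE x in lborel. norm (q x * (a x + (\<Sum>i\<in>UNIV. D i x * V x $ i))) \<le> norm (Ba * \<bar>q x\<bar> + 2 * B * (\<bar>q x\<bar> * norm (V x)))"
   using order_trans[OF pw abs_ge_self] by (intro AE_I2) simp
 qed measurable
 have "\<bar>LINT x|lborel. q x * (a x + (\<Sum>i\<in>UNIV. D i x * V x $ i))\<bar> \<le> (LINT x|lborel. Ba * \<bar>q x\<bar> + 2 * B * (\<bar>q x\<bar> * norm (V x)))"
  by (rule order_trans[OF integral_abs_bound integral_mono[OF integrable_abs[OF i3] i2 pw]])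
 also have "\<dots> = Ba * (LINT x|lborel. \<bar>q x\<bar>) + 2 * B * (LINT x|lborel. \<bar>q x\<bar> * norm (V x))"
  using vort_integrable[OF q] i1 by simp
 also have "\<dots> \<le> Ba * m + 2 * B * K"
  using Ba B I1 qm by (intro add_mono mult_left_mono) auto
 finally show "\<bar>LINT x|lborel. q x * (a x + (\<Sum>i\<in>UNIV. D i x * V x $ i))\<bar> \<le> Ba * m + 2 * B * K" .
qed

lemma (in scheme) vel_pair:
 assumes "vort p A q" "vort p A v"
 shows "(\<integral>\<^sup>+x. ennreal (\<bar>q x\<bar> * norm (vel (Ke c) v x)) \<partial>lborel) \<le> ennreal (C * m)"
proof (rule pair_vel[where a="\<lambda>z. 1 / norm z"])
 show "(\<integral>\<^sup>+x. ennreal (\<bar>q x\<bar> * (1 / norm (x - y))) \<partial>lborel) \<le> ennreal C" for y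
  using C[OF assms(1), where x=y] by (simp add: norm_minus_commute)
qed (use assms norm_Ke_le C0 vort_integrable vort_mass vortD(1) in auto)

context tested
begin

lemma pt_meas' [measurable (raw)]:
 assumes "f \<in> M \<rightarrow>\<^sub>M borel" "h \<in> M \<rightarrow>\<^sub>M borel"
 shows "(\<lambda>z. \<phi>t (f z) (h z)) \<in> borel_measurable M"
 using measurable_compose[OF measurable_Pair[OF assms] pt_meas] by simp

lemma d_meas' [measurable (raw)]:
 assumes "f \<in> M \<rightarrow>\<^sub>M borel" "h \<in> M \<rightarrow>\<^sub>M borel"
 shows "(\<lambda>z. d i (f z) (h z)) \<in> borel_measurable M"
 using measurable_compose[OF measurable_Pair[OF assms] d_meas] by simp

lemma U_meas' [measurable (raw)]:
 assumes "f \<in> M \<rightarrow>\<^sub>M borel" "h \<in> M \<rightarrow>\<^sub>M borel"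
 shows "(\<lambda>z. U n (f z) (h z)) \<in> borel_measurable M"
 using measurable_compose[OF measurable_Pair[OF assms] U_meas] by simp

definition hh :: "nat \<Rightarrow> real \<Rightarrow> real" where
 "hh n t = (LINT x|lborel. om n t x * (\<phi>t t x + (\<Sum>i\<in>UNIV. d i t x * vel (Ke (eps n)) (om n t) x $ i)))"

lemma hh_meas [measurable]: "hh n \<in> borel_measurable borel"
 unfolding hh_def vel_om by measurable

lemma vel_meas_om [measurable]: "vel (Ke c) (om n t) \<in> borel_measurable borel"
 by (rule vel_meas[OF borel_measurable_Ke om_int])

lemma hh_bound: "\<bar>hh n t\<bar> \<le> B * m + 2 * B * (C * m)"
 unfolding hh_def
 by (rule weighted[OF om_vort _ _ vel_meas_om]) (use vel_pair[OF om_vort om_vort] pt_b d_b C0 m in auto)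

lemma hh_zero: "t \<ge> R \<or> t < 0 \<Longrightarrow> hh n t = 0"
 unfolding hh_def using sup_t neg_t by auto

definition en :: "nat \<Rightarrow> real" where
 "en n = 7 * (m * B * eps n) * m + B * dt n * m + 2 * (B * dt n) * (C * m)"

lemma en_tendsto: "en \<longlonglongrightarrow> 0"
proof -
 have "(\<lambda>n. 7 * (m * B * eps n) * m + B * dt n * m + 2 * (B * dt n) * (C * m)) \<longlonglongrightarrow> 7 * (m * B * 0) * m + B * 0 * m + 2 * (B * 0) * (C * m)"
  by (intro tendsto_intros eps_tendsto dt_tendsto)
 then show ?thesis by (simp add: en_def[abs_def])
qed

text \<open>One time step of the scheme is the integral over one time cell up to an error proportional to the
 length of the cell, with a factor that vanishes as the mesh is refined.\<close>

lemma cell: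
 assumes s: "real k * dt n \<le> s" "s < real (Suc k) * dt n"
 shows "\<bar>(LINT x|lborel. \<phi> (real (Suc k) * dt n) x * W n (Suc k) x) - (LINT x|lborel. \<phi> (real k * dt n) x * W n k x) - dt n * hh n s\<bar> \<le> dt n * en n"
proof -
 define T where "T = real (Suc k) * dt n"
 define t where "t = real k * dt n"
 define w where "w = W n k"
 have Tt: "T - t = dt n" "0 \<le> t" "t \<le> s" "s \<le> T" "T \<ge> 0"
  using s dt[of n] by (auto simp: T_def t_def algebra_simps)
 have k: "nat \<lfloor>s / dt n\<rfloor> = k"
 proof -
  have "real k \<le> s / dt n" "s / dt n < real k + 1" using s dt[of n] by (auto simp: pos_le_divide_eq pos_divide_less_eq algebra_simps)
  then have "\<lfloor>s / dt n\<rfloor> = int k" by (intro floor_unique) auto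
  then show ?thesis by simp
 qed
 have om: "om n s = w" by (simp add: om_def k w_def)
 have wv: "vort p A w" unfolding w_def by (rule W_vort)
 note wi = vort_integrable[OF wv]
 have wm: "(LINT y|lborel. \<bar>w y\<bar>) \<le> m" using vort_mass[OF wv] mass_nonneg by linarith
 let ?u = "vel (Ke (eps n)) w"
 have um [measurable]: "?u \<in> borel_measurable borel" by (rule vel_meas[OF borel_measurable_Ke wi])
 have Cm: "0 \<le> C * m" using C0 m by simp
 have dTm: "d i r \<in> borel_measurable borel" for i r by measurable
 have tay': "\<bar>\<phi> T x - \<phi> T (x - hn n *\<^sub>R ax i) - hn n * d i T x\<bar> \<le> B * (hn n)\<^sup>2" for x i
  using tay[OF Tt(5), of x "- hn n" i] by (simp add: abs_minus_commute algebra_simps)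
 have A1: "\<bar>(LINT x|lborel. \<phi> T x * W n (Suc k) x) - (LINT x|lborel. \<phi> T x * w x) - dt n * (LINT x|lborel. w x * (\<Sum>i\<in>UNIV. d i T x * ?u x $ i))\<bar>
  \<le> dt n * (7 * (m * B * eps n)) * (LINT y|lborel. \<bar>w y\<bar>)"
  unfolding W.simps w_def[symmetric]
  by (rule step_consistency[OF eps m wi vort_mass[OF wv] hn_def Mn_def dt_def phi_meas phi_b[OF Tt(5)] dTm d_b tay[OF Tt(5)] tay'])
 also have "\<dots> \<le> dt n * (7 * (m * B * eps n)) * m"
  using wm dt[of n] m B eps[of n] by (intro mult_left_mono) auto
 finally have A1: "\<bar>(LINT x|lborel. \<phi> T x * W n (Suc k) x) - (LINT x|lborel. \<phi> T x * w x) - dt n * (LINT x|lborel. w x * (\<Sum>i\<in>UNIV. d i T x * ?u x $ i))\<bar>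
  \<le> dt n * (7 * (m * B * eps n) * m)" by (simp only: mult.assoc)
 have z0: "(\<lambda>x. 0::real) \<in> borel_measurable borel" "\<And>x::plane. \<bar>0::real\<bar> \<le> 0" by simp_all
 have I: "integrable lborel (\<lambda>x. w x * (0 + (\<Sum>i\<in>UNIV. d i r x * ?u x $ i)))" for r
  by (rule weighted[OF wv z0(1) dTm um z0(2) d_b vel_pair[OF wv wv] Cm])
 have I': "integrable lborel (\<lambda>x. w x * (\<Sum>i\<in>UNIV. d i r x * ?u x $ i))" for r using I[of r] by simp
 have Dm: "(\<lambda>x. d i T x - d i s x) \<in> borel_measurable borel" for i by measurable
 have Db: "\<bar>d i T x - d i s x\<bar> \<le> B * dt n" for i x
 proof -
  have "\<bar>d i T x - d i s x\<bar> \<le> B * (T - s)" using Tt by (intro dl) auto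
  also have "\<dots> \<le> B * dt n" using Tt B by (intro mult_left_mono) auto
  finally show ?thesis .
 qed
 have A3: "\<bar>(LINT x|lborel. w x * (\<Sum>i\<in>UNIV. d i T x * ?u x $ i)) - (LINT x|lborel. w x * (\<Sum>i\<in>UNIV. d i s x * ?u x $ i))\<bar> \<le> 2 * (B * dt n) * (C * m)"
 proof -
  have "(LINT x|lborel. w x * (\<Sum>i\<in>UNIV. d i T x * ?u x $ i)) - (LINT x|lborel. w x * (\<Sum>i\<in>UNIV. d i s x * ?u x $ i)) =
   (LINT x|lborel. w x * (0 + (\<Sum>i\<in>UNIV. (d i T x - d i s x) * ?u x $ i)))"
   using I' by (subst Bochner_Integration.integral_diff[symmetric]) (auto simp: left_diff_distrib sum_subtractf right_diff_distrib)
  then show ?thesis using weighted(2)[OF wv z0(1) Dm um z0(2) Db vel_pair[OF wv wv] Cm] by simp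
 qed
 have pI: "integrable lborel (\<lambda>x. f x * w x)" if "f \<in> borel_measurable borel" "\<And>x. \<bar>f x\<bar> \<le> K" for f K
  by (rule integrable_mult_bounded[OF _ that(2) wi]) (use that in simp)
 have pT: "integrable lborel (\<lambda>x. \<phi> T x * w x)" "integrable lborel (\<lambda>x. \<phi> t x * w x)" "integrable lborel (\<lambda>x. \<phi>t s x * w x)"
  by (rule pI[OF phi_meas phi_b[OF Tt(5)]] pI[OF phi_meas phi_b[OF Tt(2)]] pI[OF _ pt_b], measurable?)+
 have A2: "\<bar>(LINT x|lborel. \<phi> T x * w x) - (LINT x|lborel. \<phi> t x * w x) - dt n * (LINT x|lborel. \<phi>t s x * w x)\<bar> \<le> dt n * (B * dt n * m)"
 proof -
  have eq: "(LINT x|lborel. \<phi> T x * w x) - (LINT x|lborel. \<phi> t x * w x) - dt n * (LINT x|lborel. \<phi>t s x * w x) =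
   (LINT x|lborel. (\<phi> T x - \<phi> t x - dt n * \<phi>t s x) * w x)"
   using pT by (simp add: left_diff_distrib mult.assoc)
  have "\<bar>LINT x|lborel. (\<phi> T x - \<phi> t x - dt n * \<phi>t s x) * w x\<bar> \<le> (LINT x|lborel. B * (dt n)\<^sup>2 * \<bar>w x\<bar>)"
  proof (rule order_trans[OF integral_abs_bound integral_mono])
   show "integrable lborel (\<lambda>x. \<bar>(\<phi> T x - \<phi> t x - dt n * \<phi>t s x) * w x\<bar>)"
    unfolding left_diff_distrib mult.assoc using pT by (intro integrable_abs Bochner_Integration.integrable_diff integrable_mult_right)
   show "integrable lborel (\<lambda>x. B * (dt n)\<^sup>2 * \<bar>w x\<bar>)" using wi by auto
   show "\<bar>(\<phi> T x - \<phi> t x - dt n * \<phi>t s x) * w x\<bar> \<le> B * (dt n)\<^sup>2 * \<bar>w x\<bar>" for x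
    unfolding abs_mult using tim[OF Tt(2,3,4), of x] Tt(1) by (intro mult_right_mono) auto
  qed
  also have "\<dots> = B * (dt n)\<^sup>2 * (LINT y|lborel. \<bar>w y\<bar>)" by simp
  also have "\<dots> \<le> B * (dt n)\<^sup>2 * m" using B wm by (intro mult_left_mono) auto
  finally show ?thesis unfolding eq by (simp add: power2_eq_square mult_ac)
 qed
 have hs: "hh n s = (LINT x|lborel. \<phi>t s x * w x) + (LINT x|lborel. w x * (\<Sum>i\<in>UNIV. d i s x * ?u x $ i))"
  unfolding hh_def om using pT(3) I'[of s]
  by (subst Bochner_Integration.integral_add[symmetric]) (auto simp: distrib_left mult.commute)
 have dA3: "\<bar>dt n * (LINT x|lborel. w x * (\<Sum>i\<in>UNIV. d i T x * ?u x $ i)) - dt n * (LINT x|lborel. w x * (\<Sum>i\<in>UNIV. d i s x * ?u x $ i))\<bar> \<le> dt n * (2 * (B * dt n) * (C * m))"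
  unfolding right_diff_distrib[symmetric] abs_mult using dt[of n] A3 by (simp add: mult_left_mono)
 have e1: "dt n * hh n s = dt n * (LINT x|lborel. \<phi>t s x * w x) + dt n * (LINT x|lborel. w x * (\<Sum>i\<in>UNIV. d i s x * ?u x $ i))"
  unfolding hs by (rule distrib_left)
 have e2: "dt n * en n = dt n * (7 * (m * B * eps n) * m) + dt n * (B * dt n * m) + dt n * (2 * (B * dt n) * (C * m))"
  unfolding en_def by (simp only: distrib_left)
 show ?thesis
  unfolding T_def[symmetric] t_def[symmetric] w_def[symmetric] e1 e2 using A1 A2 dA3 by linarith
qed

lemma hh_integrable: "integrable lborel (hh n)" "integrable lborel (\<lambda>s. indicator {a..<b} s * hh n s)"
proof -
 have *: "integrable lborel (\<lambda>s. indicator {0..R} s * f s)" if "f \<in> borel_measurable borel" "\<And>s. \<bar>f s\<bar> \<le> B * m + 2 * B * (C * m)" for f :: "real \<Rightarrow> real"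
 proof -
  have "integrable lborel (indicator {0..R} :: real \<Rightarrow> real)" by (rule integrable_real_indicator) (auto simp: emeasure_lborel_Icc_eq)
  from integrable_mult_bounded[OF _ that(2) this] that(1) show ?thesis by (simp add: mult.commute)
 qed
 have e: "indicator {0..R} s * hh n s = hh n s" for s
  by (cases "s \<ge> R \<or> s < 0") (simp add: hh_zero, simp add: indicator_def)
 show 1: "integrable lborel (hh n)" using *[OF hh_meas hh_bound, of n] by (simp add: e)
 show "integrable lborel (\<lambda>s. indicator {a..<b} s * hh n s)"
  by (rule integrable_mult_bounded[where K=1, OF _ _ 1]) (auto simp: indicator_def)
qed

lemma cells:
 "\<bar>(LINT x|lborel. \<phi> (real N * dt n) x * W n N x) - (LINT x|lborel. \<phi> 0 x * w0 x) - (LINT s|lborel. indicator {0..<real N * dt n} s * hh n s)\<bar> \<le> real N * dt n * en n"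
proof (induction N)
 case (Suc N)
 define t where "t = real N * dt n"
 define T where "T = real (Suc N) * dt n"
 define D where "D = (LINT x|lborel. \<phi> T x * W n (Suc N) x) - (LINT x|lborel. \<phi> t x * W n N x)"
 have tT: "0 \<le> t" "t \<le> T" "T - t = dt n" using dt[of n] by (auto simp: t_def T_def algebra_simps)
 have ind: "indicator {0..<T} s * hh n s = indicator {0..<t} s * hh n s + indicator {t..<T} s * hh n s" for s
  using tT by (auto simp: indicator_def)
 have "(LINT s|lborel. indicator {0..<T} s * hh n s) = (LINT s|lborel. indicator {0..<t} s * hh n s) + (LINT s|lborel. indicator {t..<T} s * hh n s)"
  unfolding ind by (intro Bochner_Integration.integral_add hh_integrable)
 moreover have "\<bar>D - (LINT s|lborel. indicator {t..<T} s * hh n s)\<bar> \<le> dt n * en n"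
 proof -
  have i0: "integrable lborel (\<lambda>s. indicator {t..<T} s * c)" for c :: real
   using tT by simp
  have I0: "(LINT s|lborel. indicator {t..<T} s * c) = dt n * c" for c :: real
   using tT by simp
  have eq1: "D - (LINT s|lborel. indicator {t..<T} s * hh n s) = (LINT s|lborel. indicator {t..<T} s * (D / dt n)) - (LINT s|lborel. indicator {t..<T} s * hh n s)"
   unfolding I0 using dt[of n] by simp
  have eq2: "(LINT s|lborel. indicator {t..<T} s * (D / dt n)) - (LINT s|lborel. indicator {t..<T} s * hh n s) = (LINT s|lborel. indicator {t..<T} s * (D / dt n) - indicator {t..<T} s * hh n s)"
   by (rule Bochner_Integration.integral_diff[symmetric, OF i0 hh_integrable(2)])
  have "\<bar>LINT s|lborel. indicator {t..<T} s * (D / dt n) - indicator {t..<T} s * hh n s\<bar> \<le> (LINT s|lborel. indicator {t..<T} s * en n)"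
  proof (rule order_trans[OF integral_abs_bound integral_mono])
   show "integrable lborel (\<lambda>s. \<bar>indicator {t..<T} s * (D / dt n) - indicator {t..<T} s * hh n s\<bar>)"
    by (intro integrable_abs Bochner_Integration.integrable_diff i0 hh_integrable)
   show "integrable lborel (\<lambda>s. indicator {t..<T} s * en n)" by (rule i0)
   show "\<bar>indicator {t..<T} s * (D / dt n) - indicator {t..<T} s * hh n s\<bar> \<le> indicator {t..<T} s * en n" for s
   proof (cases "s \<in> {t..<T}")
    case True
    have "\<bar>D - dt n * hh n s\<bar> \<le> dt n * en n"
     unfolding D_def T_def t_def by (rule cell) (use True in \<open>auto simp: t_def T_def\<close>)
    then have "\<bar>D - dt n * hh n s\<bar> / dt n \<le> en n" using dt[of n] by (simp add: pos_divide_le_eq mult.commute)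
    moreover have "\<bar>D - dt n * hh n s\<bar> / dt n = \<bar>D / dt n - hh n s\<bar>"
    proof -
     have "D / dt n - hh n s = (D - dt n * hh n s) / dt n" using dt[of n] by (simp add: diff_divide_distrib)
     then show ?thesis using dt[of n] by simp
    qed
    ultimately show ?thesis using True by simp
   qed simp
  qed
  then show ?thesis unfolding eq1 eq2 unfolding I0 .
 qed
 moreover have "real (Suc N) * dt n * en n = real N * dt n * en n + dt n * en n" by (simp add: algebra_simps)
 ultimately show ?case using Suc unfolding t_def[symmetric] T_def[symmetric] D_def by linarith
qed simp

lemma discrete_weak: "(\<lambda>n. LINT t|lborel. hh n t) \<longlonglongrightarrow> - (LINT x|lborel. \<phi> 0 x * w0 x)"
proof -
 have bd: "\<bar>(LINT t|lborel. hh n t) - (- (LINT x|lborel. \<phi> 0 x * w0 x))\<bar> \<le> (R + dt n) * en n" for n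
 proof -
  define N where "N = nat \<lceil>R / dt n\<rceil>"
  have "R / dt n \<le> real N" "real N \<le> R / dt n + 1"
   using R dt[of n] by (auto simp: N_def)
  then have N: "R \<le> real N * dt n" "real N * dt n \<le> R + dt n"
   using dt[of n] by (auto simp: pos_divide_le_eq field_simps)
  have ind: "indicator {0..<real N * dt n} s * hh n s = hh n s" for s
   using N(1) by (cases "s \<ge> R \<or> s < 0") (simp add: hh_zero, simp add: indicator_def)
  have z: "(LINT x|lborel. \<phi> (real N * dt n) x * W n N x) = 0" using sup_t(1)[OF N(1)] by simp
  have "\<bar>0 - (LINT x|lborel. \<phi> 0 x * w0 x) - (LINT s|lborel. hh n s)\<bar> \<le> real N * dt n * en n"
   using cells[of N n] unfolding ind z .
  also have "\<dots> \<le> (R + dt n) * en n"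
   using N B m C0 eps[of n] dt[of n] by (intro mult_right_mono) (auto simp: en_def intro!: add_nonneg_nonneg mult_nonneg_nonneg)
  finally show ?thesis by linarith
 qed
 have "(\<lambda>n. (R + dt n) * en n) \<longlonglongrightarrow> (R + 0) * 0" by (intro tendsto_intros dt_tendsto en_tendsto)
 then have "(\<lambda>n. (R + dt n) * en n) \<longlonglongrightarrow> 0" by simp
 then have "(\<lambda>n. (LINT t|lborel. hh n t) - (- (LINT x|lborel. \<phi> 0 x * w0 x))) \<longlonglongrightarrow> 0"
  by (rule Lim_null_comparison[rotated]) (use bd in simp)
 then show ?thesis by (subst LIM_zero_iff[symmetric])
qed

end

section \<open>Passage to the limit\<close>

lemma (in scheme) V_bound:
 assumes "\<And>t x. (\<lambda>k. U (r k) t x) \<longlonglongrightarrow> V t x" shows "norm (V t x) \<le> C"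
 by (rule Lim_bounded[OF tendsto_norm[OF assms]]) (use U_bound in blast)

lemma (in scheme) V_meas:
 assumes "\<And>t x. (\<lambda>k. U (r k) t x) \<longlonglongrightarrow> V t x"
 shows "(\<lambda>(t, x). V t x) \<in> borel_measurable (borel \<Otimes>\<^sub>M borel)"
proof (rule borel_measurable_LIMSEQ_metric)
 show "(\<lambda>(t, x). U (r k) t x) \<in> borel_measurable (borel \<Otimes>\<^sub>M borel)" for k by (rule U_meas)
qed (use assms in auto)

text \<open>The potential is linear, so the combinations of the approximate velocities have the same limit as
 the sequence itself; strong \<open>L\<^sup>2\<close> convergence identifies this limit.\<close>

lemma (in scheme) limit_velocity:
 assumes r: "strict_mono r" and V: "\<And>t x. (\<lambda>k. U (r k) t x) \<longlonglongrightarrow> V t x"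
  and c: "\<And>j. cvx j (N j) (c j)" and q: "vort p A q"
  and L2: "(\<lambda>j. \<integral>\<^sup>+x. ennreal ((q x - (\<Sum>k<N j. c j k * om (r k) t x))\<^sup>2) \<partial>lborel) \<longlonglongrightarrow> 0"
 shows "V t x = pot lborel q (\<lambda>y. y) (Ke 0) x"
proof -
 have p1: "p \<ge> 1" using p by simp
 let ?p = "\<lambda>w. pot lborel w (\<lambda>y. y) (Ke 0) x"
 have gv: "vort p A (\<lambda>x. \<Sum>k<N j. c j k * om (r k) t x)" for j
  by (rule vort_cvx[OF c om_vort p1 A])
 have 1: "(\<lambda>j. ?p (\<lambda>x. \<Sum>k<N j. c j k * om (r k) t x)) \<longlonglongrightarrow> ?p q"
  by (rule pot_tendsto[OF gv q L2])
 have ki: "integrable lborel (\<lambda>y. w y *\<^sub>R Ke 0 (x - y))" if w: "vort p A w" for w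
 proof (rule integrableI_bounded)
  note [measurable] = vortD(1)[OF w]
  show "(\<lambda>y. w y *\<^sub>R Ke 0 (x - y)) \<in> borel_measurable lborel" by measurable
  have "(\<integral>\<^sup>+y. ennreal (norm (w y *\<^sub>R Ke 0 (x - y))) \<partial>lborel) \<le> (\<integral>\<^sup>+y. ennreal (\<bar>w y\<bar> / norm (x - y)) \<partial>lborel)"
   using mult_left_mono[OF norm_Ke_le abs_ge_zero] by (intro nn_integral_mono ennreal_leI) simp
  also have "\<dots> \<le> ennreal C" by (rule C[OF w])
  finally show "(\<integral>\<^sup>+y. ennreal (norm (w y *\<^sub>R Ke 0 (x - y))) \<partial>lborel) < \<infinity>" by (simp add: le_less_trans)
 qed
 have lin: "?p (\<lambda>x. \<Sum>k<N j. c j k * om (r k) t x) = (\<Sum>k<N j. c j k *\<^sub>R ?p (om (r k) t))" for j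
 proof -
  have "?p (\<lambda>x. \<Sum>k<N j. c j k * om (r k) t x) = (LINT y|lborel. (\<Sum>k<N j. c j k *\<^sub>R (om (r k) t y *\<^sub>R Ke 0 (x - y))))"
   by (simp only: pot_def scaleR_sum_left scaleR_scaleR)
  also have "\<dots> = (\<Sum>k<N j. LINT y|lborel. c j k *\<^sub>R (om (r k) t y *\<^sub>R Ke 0 (x - y)))"
   by (rule Bochner_Integration.integral_sum) (intro integrable_scaleR_right ki om_vort)
  finally show ?thesis by (simp only: integral_scaleR_right pot_def)
 qed
 have "(\<lambda>k. ?p (om (r k) t)) \<longlonglongrightarrow> V t x"
 proof -
  have "(\<lambda>k. ?p (om (r k) t) - U (r k) t x) \<longlonglongrightarrow> 0"
  proof (rule LIMSEQ_I)
   fix e :: real assume e: "e > 0"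
   obtain d where d: "d > 0" and cc: "\<And>a b w x. 0 \<le> a \<Longrightarrow> a \<le> d \<Longrightarrow> 0 \<le> b \<Longrightarrow> b \<le> d \<Longrightarrow> vort p A w \<Longrightarrow>
    norm (pot lborel w (\<lambda>y. y) (Ke a) x - pot lborel w (\<lambda>y. y) (Ke b) x) \<le> e / 2"
    using pot_Ke_close[of "e / 2"] e by auto
   obtain M where M: "\<And>n. n \<ge> M \<Longrightarrow> eps n < d"
    using order_tendstoD(2)[OF eps_tendsto d] unfolding eventually_sequentially by blast
   have "norm (?p (om (r k) t) - U (r k) t x - 0) < e" if "k \<ge> M" for k
   proof -
    have "eps (r k) < d" using M seq_suble[OF r, of k] that by (meson order_trans)
    then have "norm (?p (om (r k) t) - U (r k) t x) \<le> e / 2"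
     unfolding U_def using eps(1)[of "r k"] d by (intro cc om_vort) auto
    then show ?thesis using e by simp
   qed
   then show "\<exists>M. \<forall>k\<ge>M. norm (?p (om (r k) t) - U (r k) t x - 0) < e" by blast
  qed
  from tendsto_add[OF this V[of t x]] show ?thesis by simp
 qed
 from cvx_tendsto[OF c this] have 2: "(\<lambda>j. ?p (\<lambda>x. \<Sum>k<N j. c j k * om (r k) t x)) \<longlonglongrightarrow> V t x"
  unfolding lin .
 show ?thesis by (rule LIMSEQ_unique[OF 2 1])
qed

context tested
begin

text \<open>The weak formulation is affine in the vorticity once the velocity is frozen at its limit
 \<open>V + P\<close>. This is what makes convex combinations of approximate solutions useful.\<close>

definition Psi :: "(real \<Rightarrow> plane \<Rightarrow> plane) \<Rightarrow> (plane \<Rightarrow> real) \<Rightarrow> real \<Rightarrow> real" where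
 "Psi V q t = (LINT x|lborel. q x * (\<phi>t t x + (\<Sum>i\<in>UNIV. d i t x * (V t x + pot L g Y (Ke 0) x) $ i)))"

lemma VP_pair:
 assumes q: "vort p A q" and [measurable]: "v \<in> borel_measurable borel" and v: "\<And>x. norm (v x) \<le> C"
 shows "(\<integral>\<^sup>+x. ennreal (\<bar>q x\<bar> * norm (v x + pot L g Y (Ke 0) x)) \<partial>lborel) \<le> ennreal (2 * (C * m))"
proof -
 note [measurable] = vortD(1)[OF q]
 have "(\<integral>\<^sup>+x. ennreal (\<bar>q x\<bar> * norm (v x + pot L g Y (Ke 0) x)) \<partial>lborel) \<le>
  (\<integral>\<^sup>+x. ennreal C * ennreal \<bar>q x\<bar> + ennreal (\<bar>q x\<bar> * norm (pot L g Y (Ke 0) x)) \<partial>lborel)"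
 proof (rule nn_integral_mono)
  fix x
  have "\<bar>q x\<bar> * norm (v x + pot L g Y (Ke 0) x) \<le> \<bar>q x\<bar> * (C + norm (pot L g Y (Ke 0) x))"
   by (intro mult_left_mono order_trans[OF norm_triangle_ineq] add_right_mono v) auto
  also have "\<dots> = C * \<bar>q x\<bar> + \<bar>q x\<bar> * norm (pot L g Y (Ke 0) x)" by (simp add: algebra_simps)
  finally show "ennreal (\<bar>q x\<bar> * norm (v x + pot L g Y (Ke 0) x)) \<le> ennreal C * ennreal \<bar>q x\<bar> + ennreal (\<bar>q x\<bar> * norm (pot L g Y (Ke 0) x))"
   using C0 by (simp add: ennreal_mult[symmetric] ennreal_plus[symmetric] ennreal_leI del: ennreal_plus)
 qed
 also have "\<dots> = ennreal C * (\<integral>\<^sup>+x. ennreal \<bar>q x\<bar> \<partial>lborel) + (\<integral>\<^sup>+x. ennreal (\<bar>q x\<bar> * norm (pot L g Y (Ke 0) x)) \<partial>lborel)"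
  by (subst nn_integral_add) (auto simp: nn_integral_cmult)
 also have "\<dots> \<le> ennreal C * ennreal m + ennreal (C * m)"
 proof (intro add_mono mult_left_mono)
  have "A \<le> m" using Am mass_nonneg by linarith
  then show "(\<integral>\<^sup>+x. ennreal \<bar>q x\<bar> \<partial>lborel) \<le> ennreal m" using vortD(2)[OF q] by (rule order_trans[OF _ ennreal_leI, rotated])
 qed (use P_finite[OF q] in auto)
 also have "\<dots> = ennreal (2 * (C * m))" using C0 m by (simp add: ennreal_mult[symmetric] ennreal_plus[symmetric] del: ennreal_plus)
 finally show ?thesis .
qed

lemma weak_limit:
 assumes r: "strict_mono r" and V: "\<And>t x. (\<lambda>k. U (r k) t x) \<longlonglongrightarrow> V t x"
  and c: "\<And>j. cvx j (N j) (c j)" and om': "(\<lambda>(t, x). \<omega> t x) \<in> borel_measurable (borel \<Otimes>\<^sub>M borel)"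
  and ov: "\<And>t. vort p A (\<omega> t)"
  and L2: "AE t in lborel. (\<lambda>j. \<integral>\<^sup>+x. ennreal ((\<omega> t x - (\<Sum>k<N j. c j k * om (r k) t x))\<^sup>2) \<partial>lborel) \<longlonglongrightarrow> 0"
 shows "integrable lborel (\<lambda>t. LINT x|lborel. \<omega> t x * (\<phi>t t x + (\<Sum>i\<in>UNIV. d i t x * vel (Ke 0) (\<omega> t) x $ i)))"
  "(LINT t|lborel. LINT x|lborel. \<omega> t x * (\<phi>t t x + (\<Sum>i\<in>UNIV. d i t x * vel (Ke 0) (\<omega> t) x $ i))) = - (LINT x|lborel. \<phi> 0 x * w0 x)"
proof -
 define K where "K = B * m + 2 * B * (2 * (C * m))"
 have Cm: "0 \<le> C * m" "0 \<le> 2 * (C * m)" using C0 m by simp_all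
 have K: "0 \<le> K" using B Cm m by (simp add: K_def)
 have VM: "(\<lambda>z. V (f z) (h z)) \<in> borel_measurable M"
  if "f \<in> M \<rightarrow>\<^sub>M borel" "h \<in> M \<rightarrow>\<^sub>M borel" for f h and M :: "'z measure"
  using measurable_compose[OF measurable_Pair[OF that] V_meas[OF V]] by simp
 have Vm [measurable]: "V t \<in> borel_measurable borel" for t using VM[of "\<lambda>_. t" borel "\<lambda>x. x"] by simp
 have Pm [measurable]: "pot L g Y (Ke 0) \<in> borel_measurable borel" by measurable
 have VPm: "(\<lambda>x. V t x + pot L g Y (Ke 0) x) \<in> borel_measurable borel" for t by measurable
 have dm: "d i t \<in> borel_measurable borel" "\<phi>t t \<in> borel_measurable borel" for i t by measurable
 note VP = VP_pair[OF _ Vm V_bound[OF V]]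
 have PsiI: "integrable lborel (\<lambda>x. q x * (\<phi>t t x + (\<Sum>i\<in>UNIV. d i t x * (V t x + pot L g Y (Ke 0) x) $ i)))" if "vort p A q" for q t
  by (rule weighted(1)[OF that dm(2) dm(1) VPm pt_b d_b VP[OF that] Cm(2)])
 have PsiB: "\<bar>Psi V q t\<bar> \<le> K" if "vort p A q" for q t
  unfolding Psi_def K_def by (rule weighted(2)[OF that dm(2) dm(1) VPm pt_b d_b VP[OF that] Cm(2)])
 have Psi0: "Psi V q t = 0" if "t \<notin> {0..R}" for q t
  unfolding Psi_def using that sup_t[of t] neg_t[of t] by (cases "t < 0") auto
 have PsiBI: "\<bar>Psi V q t\<bar> \<le> K * indicator {0..R} t" if "vort p A q" for q t
  using PsiB[OF that, of t] Psi0[of t q] by (cases "t \<in> {0..R}") auto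
 have KI: "integrable lborel (\<lambda>t. c * indicator {0..R} t :: real)" for c
  using R by simp
 have PsiM: "(\<lambda>t. Psi V (q t) t) \<in> borel_measurable borel" if q: "(\<lambda>(t, x). q t x) \<in> borel_measurable (borel \<Otimes>\<^sub>M borel)" for q
 proof -
  have [measurable]: "(\<lambda>z. q (fst z) (snd z)) \<in> borel_measurable (borel \<Otimes>\<^sub>M lborel)" using q by (simp add: case_prod_beta')
  have [measurable]: "(\<lambda>z. V (fst z) (snd z)) \<in> borel_measurable (borel \<Otimes>\<^sub>M lborel)" by (rule VM) measurable
  have "(\<lambda>(t, x). q t x * (\<phi>t t x + (\<Sum>i\<in>UNIV. d i t x * (V t x + pot L g Y (Ke 0) x) $ i))) \<in> borel_measurable (borel \<Otimes>\<^sub>M lborel)"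
   unfolding case_prod_beta' by measurable
  then show ?thesis unfolding Psi_def by (rule lborel.borel_measurable_lebesgue_integral)
 qed
 have PsiInt: "integrable lborel (\<lambda>t. Psi V (q t) t)"
  if "(\<lambda>(t, x). q t x) \<in> borel_measurable (borel \<Otimes>\<^sub>M borel)" "\<And>t. vort p A (q t)" for q
  by (rule Bochner_Integration.integrable_bound[OF KI[of K]])
   (use PsiM[OF that(1)] order_trans[OF PsiBI[OF that(2)] abs_ge_self] in auto)
 note omM = om_meas
 \<comment> \<open>Freezing the velocity at \<open>V\<close> changes the discrete functional by an amount that tends to zero.\<close>
 have freeze: "(\<lambda>k. hh (r k) t - Psi V (om (r k) t) t) \<longlonglongrightarrow> 0" for t
 proof (rule LIMSEQ_I)
  fix e :: real assume e: "e > 0"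
  define S where "S k = (LINT x|lborel. om (r k) t x * (\<Sum>i\<in>UNIV. d i t x * (U (r k) t x - V t x) $ i))" for k
  define Z where "Z k = (LINT x|lborel. om (r k) t x * (0 + (\<Sum>i\<in>UNIV. d i t x * (pot L g Y (Ke (eps (r k))) x - pot L g Y (Ke 0) x) $ i)))" for k
  have um: "U n t \<in> borel_measurable borel" for n by measurable
  have iS: "integrable lborel (\<lambda>x. om (r k) t x * (0 + (\<Sum>i\<in>UNIV. d i t x * (U (r k) t x - V t x) $ i)))" for k
  proof (rule weighted(1)[OF om_vort _ dm(1) _ _ d_b _ Cm(2), where Ba=0])
   note [measurable] = vortD(1)[OF om_vort] um
   show "(\<lambda>x. U (r k) t x - V t x) \<in> borel_measurable borel" by measurable
   have "norm (U (r k) t x - V t x) \<le> 2 * C" for x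
    using norm_triangle_ineq4[of "U (r k) t x" "V t x"] U_bound[of "r k" t x] V_bound[OF V, of t x] by linarith
   then have "(\<integral>\<^sup>+x. ennreal (\<bar>om (r k) t x\<bar> * norm (U (r k) t x - V t x)) \<partial>lborel) \<le> (\<integral>\<^sup>+x. ennreal (2 * C) * ennreal \<bar>om (r k) t x\<bar> \<partial>lborel)"
   proof (intro nn_integral_mono)
    fix x
    have "\<bar>om (r k) t x\<bar> * norm (U (r k) t x - V t x) \<le> \<bar>om (r k) t x\<bar> * (2 * C)"
     by (rule mult_left_mono) (use \<open>\<And>x. norm (U (r k) t x - V t x) \<le> 2 * C\<close> in auto)
    then show "ennreal (\<bar>om (r k) t x\<bar> * norm (U (r k) t x - V t x)) \<le> ennreal (2 * C) * ennreal \<bar>om (r k) t x\<bar>"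
     using C0 by (subst ennreal_mult[symmetric]) (auto intro!: ennreal_leI simp: mult.commute)
   qed
   also have "\<dots> = ennreal (2 * C) * (\<integral>\<^sup>+x. ennreal \<bar>om (r k) t x\<bar> \<partial>lborel)" by (simp add: nn_integral_cmult)
   also have "\<dots> \<le> ennreal (2 * C) * ennreal m"
   proof (intro mult_left_mono order_trans[OF vortD(2)[OF om_vort]] ennreal_leI)
    show "A \<le> m" using Am mass_nonneg by linarith
   qed simp
   finally show "(\<integral>\<^sup>+x. ennreal (\<bar>om (r k) t x\<bar> * norm (U (r k) t x - V t x)) \<partial>lborel) \<le> ennreal (2 * (C * m))"
    using C0 m by (simp add: ennreal_mult[symmetric] mult.assoc)
  qed auto
  obtain dd where dd: "dd > 0" and D: "\<And>c q. 0 < c \<Longrightarrow> c \<le> dd \<Longrightarrow> vort p A q \<Longrightarrow>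
   (\<integral>\<^sup>+x. ennreal (\<bar>q x\<bar> * norm (pot L g Y (Ke 0) x - pot L g Y (Ke c) x)) \<partial>lborel) \<le> ennreal (e / (4 * (B + 1)))"
   using P_close[of "e / (4 * (B + 1))"] e B by auto
  obtain M where M: "\<And>n. n \<ge> M \<Longrightarrow> eps n < dd"
   using order_tendstoD(2)[OF eps_tendsto dd] unfolding eventually_sequentially by blast
  have Z: "integrable lborel (\<lambda>x. om (r k) t x * (0 + (\<Sum>i\<in>UNIV. d i t x * (pot L g Y (Ke (eps (r k))) x - pot L g Y (Ke 0) x) $ i)))"
   "\<bar>Z k\<bar> \<le> e / 2" if k: "k \<ge> M" for k
  proof -
   have "eps (r k) < dd" using M seq_suble[OF r, of k] k by (meson order_trans)
   then have le: "(\<integral>\<^sup>+x. ennreal (\<bar>om (r k) t x\<bar> * norm (pot L g Y (Ke (eps (r k))) x - pot L g Y (Ke 0) x)) \<partial>lborel) \<le> ennreal (e / (4 * (B + 1)))"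
    using D[OF eps(1)[of "r k"] _ om_vort[of "r k" t]] by (simp add: norm_minus_commute)
   have pm: "(\<lambda>x. pot L g Y (Ke (eps (r k))) x - pot L g Y (Ke 0) x) \<in> borel_measurable borel" by measurable
   have e0: "0 \<le> e / (4 * (B + 1))" using e B by simp
   note w = weighted[OF om_vort _ dm(1) pm _ d_b le e0, where a="\<lambda>_. 0" and Ba=0]
   show "integrable lborel (\<lambda>x. om (r k) t x * (0 + (\<Sum>i\<in>UNIV. d i t x * (pot L g Y (Ke (eps (r k))) x - pot L g Y (Ke 0) x) $ i)))"
    by (rule w(1)) auto
   have "\<bar>Z k\<bar> \<le> 0 * m + 2 * B * (e / (4 * (B + 1)))" unfolding Z_def by (rule w(2)) auto
   also have "\<dots> = e / 2 * (B / (B + 1))"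
   proof -
    have "2 * b * (e / (4 * z)) = e / 2 * (b / z)" for b z :: real
     by (cases "z = 0") (simp_all add: field_simps)
    from this[of B "B + 1"] show ?thesis by simp
   qed
   also have "\<dots> \<le> e / 2 * 1" using e B by (intro mult_left_mono) auto
   finally show "\<bar>Z k\<bar> \<le> e / 2" by simp
  qed
  have SZ: "hh (r k) t - Psi V (om (r k) t) t = S k + Z k" if k: "k \<ge> M" for k
  proof -
   have i1: "integrable lborel (\<lambda>x. om (r k) t x * (\<phi>t t x + (\<Sum>i\<in>UNIV. d i t x * vel (Ke (eps (r k))) (om (r k) t) x $ i)))"
    by (rule weighted(1)[OF om_vort dm(2) dm(1) vel_meas_om pt_b d_b vel_pair[OF om_vort om_vort] Cm(1)])
   have "hh (r k) t - Psi V (om (r k) t) t = (LINT x|lborel. om (r k) t x * (0 + (\<Sum>i\<in>UNIV. d i t x * (U (r k) t x - V t x) $ i)) +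
    om (r k) t x * (0 + (\<Sum>i\<in>UNIV. d i t x * (pot L g Y (Ke (eps (r k))) x - pot L g Y (Ke 0) x) $ i)))"
    unfolding hh_def Psi_def vel_om Bochner_Integration.integral_diff[OF i1[unfolded vel_om] PsiI[OF om_vort], symmetric]
    by (intro Bochner_Integration.integral_cong refl) (simp add: sum_2 algebra_simps)
   also have "\<dots> = S k + Z k"
    unfolding S_def Z_def using iS[of k] Z(1)[OF k] by (subst Bochner_Integration.integral_add) auto
   finally show ?thesis .
  qed
  have comp: "(\<lambda>k. LINT x|lborel. om (r k) t x * (d i t x * (U (r k) t x - V t x) $ i)) \<longlonglongrightarrow> 0" for i
  proof (rule product_tendsto_zero[where K="2 * A"])
   note [measurable] = vortD(1)[OF om_vort] um dm
   show "om (r k) t \<in> borel_measurable lborel" for k by measurable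
   show "(\<lambda>x. d i t x * (U (r k) t x - V t x) $ i) \<in> borel_measurable lborel" for k by measurable
   show "(\<integral>\<^sup>+x. ennreal ((om (r k) t x)\<^sup>2) \<partial>lborel) \<le> ennreal (2 * A)" for k
    using p by (intro vort_square[OF _ A om_vort]) auto
   have b: "\<bar>d i t x * (U (r k) t x - V t x) $ i\<bar> \<le> B * (2 * C) * indicator (cball 0 R) x" for x k
   proof (cases "norm x \<le> R")
    case True
    have "\<bar>(U (r k) t x - V t x) $ i\<bar> \<le> 2 * C"
     using component_le_norm_cart[of "U (r k) t x - V t x" i] norm_triangle_ineq4[of "U (r k) t x" "V t x"] U_bound[of "r k" t x] V_bound[OF V, of t x] by linarith
    then have "\<bar>d i t x\<bar> * \<bar>(U (r k) t x - V t x) $ i\<bar> \<le> B * (2 * C)" using B by (intro mult_mono d_b) auto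
    then show ?thesis using True unfolding abs_mult by simp
   qed (use sup_x in simp)
   have "(\<lambda>k. \<integral>\<^sup>+x. ennreal ((d i t x * (U (r k) t x - V t x) $ i)\<^sup>2) \<partial>lborel) \<longlonglongrightarrow> (\<integral>\<^sup>+x. 0 \<partial>(lborel :: plane measure))"
   proof (rule nn_integral_dominated_convergence[where w="\<lambda>x. ennreal ((B * (2 * C))\<^sup>2) * indicator (cball 0 R) x"])
    show "(\<integral>\<^sup>+x. ennreal ((B * (2 * C))\<^sup>2) * indicator (cball 0 R) (x::plane) \<partial>lborel) < \<infinity>"
     using emeasure_lborel_cball_finite[of "0::plane" R] by (simp add: nn_integral_cmult_indicator ennreal_mult_less_top)
    show "AE x in lborel. ennreal ((d i t x * (U (r k) t x - V t x) $ i)\<^sup>2) \<le> ennreal ((B * (2 * C))\<^sup>2) * indicator (cball 0 R) x" for k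
    proof (rule AE_I2)
     fix x
     have "\<bar>d i t x * (U (r k) t x - V t x) $ i\<bar>\<^sup>2 \<le> (B * (2 * C) * indicator (cball 0 R) x)\<^sup>2"
      by (rule power_mono[OF b]) simp
     then show "ennreal ((d i t x * (U (r k) t x - V t x) $ i)\<^sup>2) \<le> ennreal ((B * (2 * C))\<^sup>2) * indicator (cball 0 R) x"
      by (cases "x \<in> cball 0 R") (simp_all add: ennreal_leI)
    qed
    show "AE x in lborel. (\<lambda>k. ennreal ((d i t x * (U (r k) t x - V t x) $ i)\<^sup>2)) \<longlonglongrightarrow> 0"
    proof (rule AE_I2)
     fix x
     have "(\<lambda>k. (d i t x * (U (r k) t x - V t x) $ i)\<^sup>2) \<longlonglongrightarrow> (d i t x * (V t x - V t x) $ i)\<^sup>2"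
      by (intro tendsto_intros V)
     from tendsto_ennrealI[OF this] show "(\<lambda>k. ennreal ((d i t x * (U (r k) t x - V t x) $ i)\<^sup>2)) \<longlonglongrightarrow> 0" by simp
    qed
   qed measurable
   then show "(\<lambda>k. \<integral>\<^sup>+x. ennreal ((d i t x * (U (r k) t x - V t x) $ i)\<^sup>2) \<partial>lborel) \<longlonglongrightarrow> 0" by simp
  qed
  have Slim: "S \<longlonglongrightarrow> 0"
  proof -
   have ci: "integrable lborel (\<lambda>x. om (r k) t x * (d i t x * (U (r k) t x - V t x) $ i))" for k i
   proof -
    have fm: "(\<lambda>x. d i t x * (U (r k) t x - V t x) $ i) \<in> borel_measurable lborel" using um dm by measurable
    have fb: "\<bar>d i t x * (U (r k) t x - V t x) $ i\<bar> \<le> B * (2 * C)" for x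
    proof -
     have "\<bar>(U (r k) t x - V t x) $ i\<bar> \<le> 2 * C"
      using component_le_norm_cart[of "U (r k) t x - V t x" i] norm_triangle_ineq4[of "U (r k) t x" "V t x"] U_bound[of "r k" t x] V_bound[OF V, of t x] by linarith
     then show ?thesis unfolding abs_mult using B by (intro mult_mono d_b) auto
    qed
    show ?thesis using integrable_mult_bounded[OF fm fb om_int[of "r k" t]] by (simp add: mult.commute)
   qed
   have Seq: "S k = (LINT x|lborel. om (r k) t x * (d 1 t x * (U (r k) t x - V t x) $ 1)) + (LINT x|lborel. om (r k) t x * (d 2 t x * (U (r k) t x - V t x) $ 2))" for k
    unfolding S_def sum_2 distrib_left by (rule Bochner_Integration.integral_add[OF ci ci])
   show ?thesis unfolding Seq using tendsto_add[OF comp[of 1] comp[of 2]] by simp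
  qed
  then obtain M' where M': "\<And>k. k \<ge> M' \<Longrightarrow> \<bar>S k\<bar> < e / 2" using LIMSEQ_D[OF Slim, of "e / 2"] e by auto
  have "norm (hh (r k) t - Psi V (om (r k) t) t - 0) < e" if "k \<ge> max M M'" for k
  proof -
   have kM: "k \<ge> M" "k \<ge> M'" using that by auto
   have "\<bar>S k + Z k\<bar> < e" using Z(2)[OF kM(1)] M'[OF kM(2)] by linarith
   then show ?thesis unfolding SZ[OF kM(1)] by simp
  qed
  then show "\<exists>no. \<forall>k\<ge>no. norm (hh (r k) t - Psi V (om (r k) t) t - 0) < e" by blast
 qed
 \<comment> \<open>So the frozen functional of the approximations has the limit given by the scheme.\<close>
 define X where "X k = (LINT t|lborel. Psi V (om (r k) t) t)" for k
 have Xlim: "X \<longlonglongrightarrow> - (LINT x|lborel. \<phi> 0 x * w0 x)"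
 proof -
  have "(\<lambda>k. LINT t|lborel. hh (r k) t - Psi V (om (r k) t) t) \<longlonglongrightarrow> (LINT t|(lborel::real measure). 0)"
  proof (rule integral_dominated_convergence[where w="\<lambda>t. (K + K) * indicator {0..R} t"])
   show "AE t in lborel. (\<lambda>k. hh (r k) t - Psi V (om (r k) t) t) \<longlonglongrightarrow> 0" using freeze by simp
   show "AE t in lborel. norm (hh (r k) t - Psi V (om (r k) t) t) \<le> (K + K) * indicator {0..R} t" for k
   proof (rule AE_I2)
    fix t
    have hK: "\<bar>hh (r k) t\<bar> \<le> K"
    proof -
     have "B * m + 2 * B * (C * m) \<le> K" unfolding K_def using B Cm by (intro add_left_mono mult_left_mono) auto
     with hh_bound[of "r k" t] show ?thesis by linarith
    qed
    show "norm (hh (r k) t - Psi V (om (r k) t) t) \<le> (K + K) * indicator {0..R} t"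
    proof (cases "t \<in> {0..R}")
     case True
     then show ?thesis using hK PsiB[OF om_vort, of "r k" t t] by simp
    next
     case False
     then have "t \<ge> R \<or> t < 0" by auto
     then show ?thesis using Psi0[OF False] hh_zero[of t "r k"] False by simp
    qed
   qed
   show "integrable lborel (\<lambda>t. (K + K) * indicator {0..R} t)" by (rule KI)
   show "(\<lambda>t. hh (r k) t - Psi V (om (r k) t) t) \<in> borel_measurable lborel" for k
    using PsiM[OF omM, of "r k"] by measurable
  qed simp
  moreover have "(LINT t|lborel. hh (r k) t - Psi V (om (r k) t) t) = (LINT t|lborel. hh (r k) t) - X k" for k
   unfolding X_def by (rule Bochner_Integration.integral_diff[OF hh_integrable(1) PsiInt[OF omM om_vort]])
  ultimately have "(\<lambda>k. (LINT t|lborel. hh (r k) t) - X k) \<longlonglongrightarrow> 0" by simp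
  from tendsto_diff[OF LIMSEQ_subseq_LIMSEQ[OF discrete_weak r, unfolded o_def] this] show ?thesis by simp
 qed
 \<comment> \<open>Affinity carries this limit over to the convex combinations.\<close>
 define G where "G j t x = (\<Sum>k<N j. c j k * om (r k) t x)" for j t x
 have GV: "vort p A (G j t)" for j t
  unfolding G_def[abs_def] using p by (intro vort_cvx[OF c om_vort _ A]) simp
 have GM: "(\<lambda>(t, x). G j t x) \<in> borel_measurable (borel \<Otimes>\<^sub>M borel)" for j
  unfolding G_def case_prod_beta' by measurable
 have lin: "Psi V (G j t) t = (\<Sum>k<N j. c j k * Psi V (om (r k) t) t)" for j t
 proof -
  have "Psi V (G j t) t = (LINT x|lborel. (\<Sum>k<N j. c j k * (om (r k) t x * (\<phi>t t x + (\<Sum>i\<in>UNIV. d i t x * (V t x + pot L g Y (Ke 0) x) $ i)))))"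
   unfolding Psi_def G_def by (intro Bochner_Integration.integral_cong refl) (simp only: sum_distrib_right mult.assoc)
  also have "\<dots> = (\<Sum>k<N j. LINT x|lborel. c j k * (om (r k) t x * (\<phi>t t x + (\<Sum>i\<in>UNIV. d i t x * (V t x + pot L g Y (Ke 0) x) $ i))))"
   by (rule Bochner_Integration.integral_sum) (intro integrable_mult_right PsiI om_vort)
  finally show ?thesis by (simp add: Psi_def)
 qed
 have "(LINT t|lborel. Psi V (G j t) t) = (\<Sum>k<N j. c j k *\<^sub>R X k)" for j
 proof -
  have "(LINT t|lborel. Psi V (G j t) t) = (\<Sum>k<N j. LINT t|lborel. c j k * Psi V (om (r k) t) t)"
   unfolding lin by (rule Bochner_Integration.integral_sum) (intro integrable_mult_right PsiInt omM om_vort)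
  then show ?thesis by (simp add: X_def)
 qed
 with cvx_tendsto[OF c Xlim] have Glim: "(\<lambda>j. LINT t|lborel. Psi V (G j t) t) \<longlonglongrightarrow> - (LINT x|lborel. \<phi> 0 x * w0 x)" by simp
 \<comment> \<open>Strong \<open>L\<^sup>2\<close> convergence evaluates the frozen functional at the limit vorticity.\<close>
 have slice: "(\<lambda>j. Psi V (G j t) t) \<longlonglongrightarrow> Psi V (\<omega> t) t"
  if L2t: "(\<lambda>j. \<integral>\<^sup>+x. ennreal ((\<omega> t x - G j t x)\<^sup>2) \<partial>lborel) \<longlonglongrightarrow> 0" for t
 proof (rule LIMSEQ_I)
  fix e :: real assume e: "e > 0"
  define e' where "e' = e / (8 * (B + 1))"
  have e': "e' > 0" using e B by (simp add: e'_def)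
  obtain dd where dd: "dd > 0" and D: "\<And>c q. 0 < c \<Longrightarrow> c \<le> dd \<Longrightarrow> vort p A q \<Longrightarrow>
   (\<integral>\<^sup>+x. ennreal (\<bar>q x\<bar> * norm (pot L g Y (Ke 0) x - pot L g Y (Ke c) x)) \<partial>lborel) \<le> ennreal e'"
   using P_close[OF e'] by auto
  define a where "a x = \<phi>t t x + (\<Sum>i\<in>UNIV. d i t x * (V t x + pot L g Y (Ke dd) x) $ i)" for x
  have am: "a \<in> borel_measurable borel" unfolding a_def using dm by measurable
  then have aml: "a \<in> borel_measurable lborel" by simp
  have ab: "\<bar>a x\<bar> \<le> B + 2 * (B * (C + 1 / dd * mass))" for x
  proof -
   have n: "norm (V t x + pot L g Y (Ke dd) x) \<le> C + 1 / dd * mass"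
    by (rule order_trans[OF norm_triangle_ineq add_mono[OF V_bound[OF V] norm_pot_le[OF borel_measurable_Ke norm_Ke_bound[OF dd]]]])
   have "\<bar>d i t x * (V t x + pot L g Y (Ke dd) x) $ i\<bar> \<le> B * (C + 1 / dd * mass)" for i
    unfolding abs_mult using B by (intro mult_mono d_b order_trans[OF component_le_norm_cart n]) auto
   from this[of 1] this[of 2] pt_b[of t x] show ?thesis unfolding a_def sum_2 by linarith
  qed
  have as: "norm (x - 0) > R \<Longrightarrow> a x = 0" for x using sup_x by (simp add: a_def)
  have "(\<lambda>j. LINT x|lborel. a x * G j t x) \<longlonglongrightarrow> (LINT x|lborel. a x * \<omega> t x)"
   by (rule L2_pairing_tendsto[OF am ab as vort_integrable[OF GV] vort_integrable[OF ov] L2t])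
  then obtain M where M: "\<And>j. j \<ge> M \<Longrightarrow> \<bar>(LINT x|lborel. a x * G j t x) - (LINT x|lborel. a x * \<omega> t x)\<bar> < e / 4"
   using LIMSEQ_D[where r="e / 4"] e by fastforce
  have near: "\<bar>Psi V q t - (LINT x|lborel. a x * q x)\<bar> \<le> e / 4" if q: "vort p A q" for q
  proof -
   have pm: "(\<lambda>x. pot L g Y (Ke 0) x - pot L g Y (Ke dd) x) \<in> borel_measurable borel" by measurable
   note w = weighted[OF q _ dm(1) pm _ d_b D[OF dd order_refl q] less_imp_le[OF e'], where a="\<lambda>_. 0" and Ba=0]
   have "Psi V q t - (LINT x|lborel. a x * q x) = (LINT x|lborel. q x * (0 + (\<Sum>i\<in>UNIV. d i t x * (pot L g Y (Ke 0) x - pot L g Y (Ke dd) x) $ i)))"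
    unfolding Psi_def Bochner_Integration.integral_diff[OF PsiI[OF q] integrable_mult_bounded[OF aml ab vort_integrable[OF q]], symmetric]
    by (intro Bochner_Integration.integral_cong refl) (simp add: a_def sum_2 algebra_simps)
   then have "\<bar>Psi V q t - (LINT x|lborel. a x * q x)\<bar> \<le> 0 * m + 2 * B * e'"
    using w(2) by simp
   also have "\<dots> = e / 4 * (B / (B + 1))"
   proof -
    have "2 * b * (e / (8 * z)) = e / 4 * (b / z)" for b z :: real
     by (cases "z = 0") (simp_all add: field_simps)
    from this[of B "B + 1"] show ?thesis by (simp add: e'_def)
   qed
   also have "\<dots> \<le> e / 4 * 1" using e B by (intro mult_left_mono) auto
   finally show ?thesis by simp
  qed
  have "norm (Psi V (G j t) t - Psi V (\<omega> t) t) < e" if "j \<ge> M" for j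
  proof -
   have "\<bar>Psi V (G j t) t - Psi V (\<omega> t) t\<bar> < e" using M[OF that] near[OF GV[of j t]] near[OF ov[of t]] e by linarith
   then show ?thesis by simp
  qed
  then show "\<exists>M. \<forall>j\<ge>M. norm (Psi V (G j t) t - Psi V (\<omega> t) t) < e" by blast
 qed
 have "(\<lambda>j. LINT t|lborel. Psi V (G j t) t) \<longlonglongrightarrow> (LINT t|lborel. Psi V (\<omega> t) t)"
 proof (rule integral_dominated_convergence[where w="\<lambda>t. K * indicator {0..R} t"])
  show "AE t in lborel. (\<lambda>j. Psi V (G j t) t) \<longlonglongrightarrow> Psi V (\<omega> t) t"
   using L2 by eventually_elim (rule slice, simp add: G_def)
  show "AE t in lborel. norm (Psi V (G j t) t) \<le> K * indicator {0..R} t" for j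
   using PsiBI[OF GV] by simp
  show "integrable lborel (\<lambda>t. K * indicator {0..R} t)" by (rule KI)
 qed (use PsiM[OF GM] PsiM[OF om'] in auto)
 then have main: "(LINT t|lborel. Psi V (\<omega> t) t) = - (LINT x|lborel. \<phi> 0 x * w0 x)"
  by (rule LIMSEQ_unique[OF _ Glim])
 \<comment> \<open>The frozen velocity is the velocity of the limit vorticity.\<close>
 define H where "H t = (LINT x|lborel. \<omega> t x * (\<phi>t t x + (\<Sum>i\<in>UNIV. d i t x * vel (Ke 0) (\<omega> t) x $ i)))" for t
 have ae: "AE t in lborel. Psi V (\<omega> t) t = H t"
  using L2
 proof eventually_elim
  case (elim t)
  have "V t x + pot L g Y (Ke 0) x = vel (Ke 0) (\<omega> t) x" for x
   unfolding vel_def limit_velocity[OF r V c ov elim] ..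
  then show ?case unfolding Psi_def H_def by simp
 qed
 have Hm: "H \<in> borel_measurable borel"
 proof -
  have oM: "(\<lambda>z. \<omega> (f z) (h z)) \<in> borel_measurable M"
   if "f \<in> M \<rightarrow>\<^sub>M borel" "h \<in> M \<rightarrow>\<^sub>M borel" for f h and M :: "'z measure"
   using measurable_compose[OF measurable_Pair[OF that] om'] by simp
  have [measurable]: "(\<lambda>z. \<omega> (fst (fst z)) (snd z)) \<in> borel_measurable ((borel \<Otimes>\<^sub>M lborel) \<Otimes>\<^sub>M lborel)" by (rule oM) measurable
  have [measurable]: "(\<lambda>z. \<omega> (fst z) (snd z)) \<in> borel_measurable (borel \<Otimes>\<^sub>M lborel)" by (rule oM) measurable
  have [measurable]: "(\<lambda>z. pot lborel (\<omega> (fst z)) (\<lambda>y. y) (Ke 0) (snd z)) \<in> borel_measurable (borel \<Otimes>\<^sub>M lborel)"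
   unfolding pot_def by (rule lborel.borel_measurable_lebesgue_integral) (simp add: case_prod_beta')
  have "(\<lambda>(t, x). \<omega> t x * (\<phi>t t x + (\<Sum>i\<in>UNIV. d i t x * vel (Ke 0) (\<omega> t) x $ i))) \<in> borel_measurable (borel \<Otimes>\<^sub>M lborel)"
   unfolding vel_def case_prod_beta' by measurable
  then show ?thesis unfolding H_def[abs_def] by (rule lborel.borel_measurable_lebesgue_integral)
 qed
 show "integrable lborel (\<lambda>t. LINT x|lborel. \<omega> t x * (\<phi>t t x + (\<Sum>i\<in>UNIV. d i t x * vel (Ke 0) (\<omega> t) x $ i)))"
  unfolding H_def[symmetric] using PsiInt[OF om' ov] Hm ae PsiM[OF om'] by (subst integrable_cong_AE[of _ _ "\<lambda>t. Psi V (\<omega> t) t"]) auto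
 show "(LINT t|lborel. LINT x|lborel. \<omega> t x * (\<phi>t t x + (\<Sum>i\<in>UNIV. d i t x * vel (Ke 0) (\<omega> t) x $ i))) = - (LINT x|lborel. \<phi> 0 x * w0 x)"
  unfolding H_def[symmetric] main[symmetric] using Hm ae PsiM[OF om'] by (intro integral_cong_AE) auto
qed

end

section \<open>Partial derivatives of test functions\<close>

lemma partial_line:
 fixes f :: "'a::euclidean_space \<Rightarrow> real"
 assumes D: "\<And>x. x \<in> S \<Longrightarrow> (f has_derivative (\<lambda>h. \<Sum>b\<in>Basis. (h \<bullet> b) * f' b x)) (at x within S)"
  and b: "b \<in> Basis" and T: "\<And>s. s \<in> T \<Longrightarrow> x + s *\<^sub>R b \<in> S" and s: "s \<in> T"
 shows "((\<lambda>s. f (x + s *\<^sub>R b)) has_real_derivative f' b (x + s *\<^sub>R b)) (at s within T)"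
proof -
 have g: "((\<lambda>s. x + s *\<^sub>R b) has_derivative (\<lambda>h. h *\<^sub>R b)) (at s within T)"
  by (auto intro!: derivative_eq_intros)
 have sum: "(\<Sum>c\<in>Basis. (h *\<^sub>R b \<bullet> c) * F c) = h * F b" for h :: real and F :: "'a \<Rightarrow> real"
 proof -
  have "(\<Sum>c\<in>Basis. (h *\<^sub>R b \<bullet> c) * F c) = (\<Sum>c\<in>Basis. if c = b then h * F b else 0)"
   using b by (intro sum.cong) (auto simp: inner_Basis)
  then show ?thesis using b by simp
 qed
 have "((\<lambda>s. f (x + s *\<^sub>R b)) has_derivative (\<lambda>h. \<Sum>c\<in>Basis. (h *\<^sub>R b \<bullet> c) * f' c (x + s *\<^sub>R b))) (at s within T)"
  by (rule has_derivative_in_compose2[where t=S and g=f, OF D _ s g]) (use T in auto)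
 then show ?thesis unfolding sum has_field_derivative_def by (simp add: mult_commute_abs)
qed

text \<open>Only forward translations are assumed to stay in the domain, since spacetime has the boundary
 \<open>t = 0\<close>; the one-sided derivatives still determine the partial derivatives.\<close>

lemma test_partial:
 fixes f :: "'a::euclidean_space \<Rightarrow> real"
 assumes D: "\<And>x. x \<in> S \<Longrightarrow> (f has_derivative (\<lambda>h. \<Sum>b\<in>Basis. (h \<bullet> b) * f' b x)) (at x within S)"
  and cont: "\<And>b. b \<in> Basis \<Longrightarrow> continuous_on S (f' b)"
  and K: "compact K" "K \<subseteq> S" "\<And>x. x \<in> S - K \<Longrightarrow> f x = 0"
  and b: "b \<in> Basis" and fw: "\<And>x s. x \<in> S \<Longrightarrow> s \<ge> 0 \<Longrightarrow> x + s *\<^sub>R b \<in> S"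
 shows "x \<in> S - K \<Longrightarrow> f' b x = 0"
  and "\<exists>B\<ge>0. (\<forall>x\<in>S. \<bar>f' b x\<bar> \<le> B) \<and> (\<forall>x\<in>S. \<forall>s\<ge>0. \<bar>f (x + s *\<^sub>R b) - f x\<bar> \<le> B * s)"
proof -
 have zero: "f' b x = 0" if x: "x \<in> S - K" for x
 proof -
  have "open (- K)" using K(1) by (simp add: compact_imp_closed open_Compl)
  then obtain r where r: "r > 0" "ball x r \<subseteq> - K" using x by (auto simp: open_contains_ball)
  have d: "((\<lambda>s. f (x + s *\<^sub>R b)) has_real_derivative f' b (x + 0 *\<^sub>R b)) (at 0 within {0..<r})"
   by (rule partial_line[OF D b, where T="{0..<r}"]) (use fw x r in auto)
  have d1: "((\<lambda>s. 0::real) has_real_derivative f' b (x + 0 *\<^sub>R b)) (at 0 within {0..<r})"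
  proof (rule has_field_derivative_transform_within[OF d zero_less_one])
   fix s assume s: "s \<in> {0..<r}"
   then have "x + s *\<^sub>R b \<in> ball x r" using b by (simp add: dist_norm)
   then show "f (x + s *\<^sub>R b) = 0" using r fw[of x s] x s by (intro K(3)) auto
  qed (use r in auto)
  have d2: "((\<lambda>s. 0::real) has_real_derivative 0) (at 0 within {0..<r})" by simp
  have nb: "at (0::real) within {0..<r} \<noteq> bot"
  proof -
   have "{0..<r} - {0} = {0<..<r}" by auto
   then show ?thesis using r by (simp add: at_within_eq_bot_iff closure_greaterThanLessThan)
  qed
  show ?thesis using has_field_derivative_unique[OF d1 d2 nb] by simp
 qed
 then show "x \<in> S - K \<Longrightarrow> f' b x = 0" .
 have "compact (f' b ` K)" using K cont[OF b] by (intro compact_continuous_image) (auto intro: continuous_on_subset)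
 then obtain B0 where B0: "\<And>y. y \<in> f' b ` K \<Longrightarrow> norm y \<le> B0" using compact_imp_bounded bounded_iff by metis
 define B where "B = max B0 0"
 have B: "\<bar>f' b x\<bar> \<le> B" if "x \<in> S" for x
  using B0[of "f' b x"] zero[of x] that by (cases "x \<in> K") (auto simp: B_def)
 have "\<bar>f (x + s *\<^sub>R b) - f x\<bar> \<le> B * s" if x: "x \<in> S" and s: "s \<ge> 0" for x s
 proof -
  have "norm ((\<lambda>s. f (x + s *\<^sub>R b)) s - (\<lambda>s. f (x + s *\<^sub>R b)) 0) \<le> B * norm (s - 0)"
  proof (rule field_differentiable_bound[where S="{0..s}" and f'="\<lambda>s. f' b (x + s *\<^sub>R b)"])
   show "((\<lambda>s. f (x + s *\<^sub>R b)) has_real_derivative f' b (x + r *\<^sub>R b)) (at r within {0..s})" if "r \<in> {0..s}" for r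
    by (rule partial_line[OF D b, where T="{0..s}"]) (use fw x that in auto)
   show "norm (f' b (x + r *\<^sub>R b)) \<le> B" if "r \<in> {0..s}" for r using B[OF fw[OF x]] that by simp
  qed (use s in auto)
  then show ?thesis using s by simp
 qed
 moreover have "B \<ge> 0" by (simp add: B_def)
 ultimately show "\<exists>B\<ge>0. (\<forall>x\<in>S. \<bar>f' b x\<bar> \<le> B) \<and> (\<forall>x\<in>S. \<forall>s\<ge>0. \<bar>f (x + s *\<^sub>R b) - f x\<bar> \<le> B * s)"
  using B by blast
qed

lemma ax_Basis: "ax i \<in> Basis"
 by (simp add: axis_in_Basis_iff)

lemma Ck_on_continuous: "Ck_on k S f \<Longrightarrow> continuous_on S f"
proof (cases k)
 case (Suc j)
 moreover assume "Ck_on k S f"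
 ultimately obtain f' where "\<And>x. x \<in> S \<Longrightarrow> (f has_derivative (\<lambda>h. \<Sum>b\<in>Basis. (h \<bullet> b) * f' b x)) (at x within S)" by auto
 then show ?thesis by (meson continuous_on_eq_continuous_within has_derivative_continuous)
qed simp

lemma test_plane:
 assumes \<psi>: "\<psi> \<in> test_functions UNIV"
 obtains D R B where "continuous_on UNIV \<psi>" "\<And>i. continuous_on UNIV (D i)" "R > 0" "B \<ge> 0"
  "\<And>x i. ((\<lambda>s. \<psi> (x + s *\<^sub>R ax i)) has_real_derivative D i x) (at 0)"
  "\<And>x i. grad \<psi> x $ i = D i x"
  "\<And>x. norm x > R \<Longrightarrow> \<psi> x = 0" "\<And>x i. norm x > R \<Longrightarrow> D i x = 0"
  "\<And>x. \<bar>\<psi> x\<bar> \<le> B" "\<And>x i. \<bar>D i x\<bar> \<le> B"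
proof -
 obtain K where K: "compact K" "\<And>x. x \<notin> K \<Longrightarrow> \<psi> x = 0" using \<psi> by (auto simp: test_functions_def)
 have C: "Ck_on (Suc 0) UNIV \<psi>" using \<psi> unfolding test_functions_def by blast
 then obtain f' where f': "\<And>x. (\<psi> has_derivative (\<lambda>h. \<Sum>b\<in>Basis. (h \<bullet> b) * f' b x)) (at x)" "\<And>b. b \<in> Basis \<Longrightarrow> continuous_on UNIV (f' b)"
  by auto
 define D where "D i = f' (ax i)" for i
 have tp: "(\<forall>x\<in>UNIV - K. D i x = 0) \<and> (\<exists>B\<ge>0. (\<forall>x\<in>UNIV. \<bar>D i x\<bar> \<le> B) \<and> (\<forall>x\<in>UNIV. \<forall>s\<ge>0. \<bar>\<psi> (x + s *\<^sub>R ax i) - \<psi> x\<bar> \<le> B * s))" for i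
  unfolding D_def using test_partial[of UNIV \<psi> f' K "ax i", OF f'(1) f'(2) K(1) _ K(2) ax_Basis] by auto
 have Dz: "x \<notin> K \<Longrightarrow> D i x = 0" for x i using tp by auto
 have "\<exists>B\<ge>0. \<forall>x. \<bar>D i x\<bar> \<le> B" for i using tp[of i] by auto
 then obtain Bf where Bf: "\<And>i. Bf i \<ge> 0" "\<And>i x. \<bar>D i x\<bar> \<le> Bf i" by metis
 have c\<psi>: "continuous_on UNIV \<psi>" by (rule Ck_on_continuous[OF C])
 have "compact (\<psi> ` K)" using K c\<psi> by (intro compact_continuous_image) (auto intro: continuous_on_subset)
 then obtain B0 where B0: "\<And>y. y \<in> \<psi> ` K \<Longrightarrow> norm y \<le> B0" using compact_imp_bounded bounded_iff by metis
 define B where "B = max B0 0 + Bf 1 + Bf 2"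
 obtain R0 where R0: "\<And>x. x \<in> K \<Longrightarrow> norm x \<le> R0" using compact_imp_bounded[OF K(1)] bounded_iff by metis
 define R where "R = max R0 0 + 1"
 have out: "x \<notin> K" if "norm x > R" for x using R0[of x] that by (auto simp: R_def)
 have der: "((\<lambda>s. \<psi> (x + s *\<^sub>R ax i)) has_real_derivative D i x) (at 0)" for x i
  using partial_line[of UNIV \<psi> f' "ax i" UNIV x 0, OF f'(1) ax_Basis] by (simp add: D_def)
 show ?thesis
 proof (rule that[of D R B])
  show "continuous_on UNIV (D i)" for i unfolding D_def by (rule f'(2)[OF ax_Basis])
  show "grad \<psi> x $ i = D i x" for x i
   using der[of x i] by (simp add: grad_def DERIV_imp_deriv)
  show "\<bar>\<psi> x\<bar> \<le> B" for x
   using B0[of "\<psi> x"] K(2)[of x] Bf(1)[of 1] Bf(1)[of 2] by (cases "x \<in> K") (auto simp: B_def)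
  show "\<bar>D i x\<bar> \<le> B" for i x
   using Bf(1)[of 1] Bf(1)[of 2] Bf(2)[of i x] exhaust_2[of i] by (auto simp: B_def)
  show "R > 0" by (simp add: R_def)
  show "B \<ge> 0" using Bf(1)[of 1] Bf(1)[of 2] by (simp add: B_def)
 qed (use der c\<psi> out K(2) Dz in auto)
qed

section \<open>The distributional divergence and curl of the kernel\<close>

text \<open>The integral of a partial derivative vanishes because the integral is translation invariant.\<close>

lemma integral_partial_zero:
 fixes F G :: "plane \<Rightarrow> real"
 assumes D: "\<And>x. ((\<lambda>s. F (x + s *\<^sub>R ax i)) has_real_derivative G x) (at 0)"
  and F: "continuous_on UNIV F" and G: "continuous_on UNIV G"
  and supp: "\<And>x. norm x > R \<Longrightarrow> F x = 0" "\<And>x. norm x > R \<Longrightarrow> G x = 0" and R: "R > 0"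
 shows "(LINT x|lborel. G x) = 0"
proof -
 have Fm [measurable]: "F \<in> borel_measurable borel" using F by (rule borel_measurable_continuous_onI)
 have Gm [measurable]: "G \<in> borel_measurable borel" using G by (rule borel_measurable_continuous_onI)
 have bd: "\<exists>B\<ge>0. \<forall>x. \<bar>H x\<bar> \<le> B" if H: "continuous_on UNIV H" "\<And>x. norm x > R \<Longrightarrow> H x = 0" for H :: "plane \<Rightarrow> real"
 proof -
  have "compact (H ` cball 0 R)" using H by (intro compact_continuous_image) (auto intro: continuous_on_subset)
  then obtain B0 where B0: "\<And>y. y \<in> H ` cball 0 R \<Longrightarrow> norm y \<le> B0" using compact_imp_bounded bounded_iff by metis
  have "\<bar>H x\<bar> \<le> max B0 0" for x using B0[of "H x"] H(2)[of x] by (cases "norm x \<le> R") auto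
  then show ?thesis by (intro exI[of _ "max B0 0"]) auto
 qed
 obtain BF where BF: "\<And>x. \<bar>F x\<bar> \<le> BF" using bd[OF F supp(1)] by auto
 obtain BG where BG: "BG \<ge> 0" "\<And>x. \<bar>G x\<bar> \<le> BG" using bd[OF G supp(2)] by auto
 have ind: "integrable lborel (\<lambda>x. c * indicator (cball (0::plane) \<rho>) x :: real)" for c \<rho>
  using emeasure_lborel_cball_finite[of "0::plane" \<rho>] by (intro integrable_mult_right integrable_real_indicator) auto
 have iF: "integrable lborel F"
 proof (rule Bochner_Integration.integrable_bound[OF ind[of BF R]])
  show "AE x in lborel. norm (F x) \<le> norm (BF * indicator (cball 0 R) x)"
  proof (rule AE_I2)
   show "norm (F x) \<le> norm (BF * indicator (cball 0 R) x)" for x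
    using order_trans[OF BF abs_ge_self, of x] supp(1)[of x] by (cases "norm x \<le> R") auto
  qed
 qed measurable
 have Dx: "((\<lambda>s. F (x + s *\<^sub>R ax i)) has_real_derivative G (x + t *\<^sub>R ax i)) (at t)" for x t
  using DERIV_shift[of "\<lambda>s. F (x + s *\<^sub>R ax i)" "G (x + t *\<^sub>R ax i)" 0 t] D[of "x + t *\<^sub>R ax i"]
  by (simp add: algebra_simps)
 define Q where "Q n x = (F (x + (1 / real (Suc n)) *\<^sub>R ax i) - F x) / (1 / real (Suc n))" for n x
 have Qb: "\<bar>Q n x\<bar> \<le> BG * indicator (cball 0 (R + 1)) x" for n x
 proof (cases "norm x \<le> R + 1")
  case True
  have h: "1 / real (Suc n) > 0" by simp
  obtain z where "F (x + (1 / real (Suc n)) *\<^sub>R ax i) - F (x + 0 *\<^sub>R ax i) = (1 / real (Suc n) - 0) * G (x + z *\<^sub>R ax i)"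
   using MVT2[OF h Dx] by blast
  then have "Q n x = G (x + z *\<^sub>R ax i)" unfolding Q_def using h by simp
  then show ?thesis using BG True by simp
 next
  case False
  have "norm (x + (1 / real (Suc n)) *\<^sub>R ax i) \<ge> norm x - norm ((1 / real (Suc n)) *\<^sub>R ax i)"
   by (rule norm_diff_ineq)
  moreover have "norm ((1 / real (Suc n)) *\<^sub>R ax i) \<le> 1" by simp
  ultimately have "norm (x + (1 / real (Suc n)) *\<^sub>R ax i) > R" using False by linarith
  then show ?thesis using supp(1) False by (simp add: Q_def)
 qed
 have Q0: "(LINT x|lborel. Q n x) = 0" for n
  unfolding Q_def using integrable_shift[OF iF] iF integral_shift[OF Fm] by simp
 have "(\<lambda>n. LINT x|lborel. Q n x) \<longlonglongrightarrow> (LINT x|lborel. G x)"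
 proof (rule integral_dominated_convergence[OF _ _ ind])
  show "AE x in lborel. (\<lambda>n. Q n x) \<longlonglongrightarrow> G x"
  proof (rule AE_I2)
   fix x
   have "((\<lambda>h. (F (x + h *\<^sub>R ax i) - F x) / h) \<longlongrightarrow> G x) (at 0)"
    using D[of x] by (simp add: DERIV_def)
   moreover have "filterlim (\<lambda>n. 1 / real (Suc n)) (at 0) sequentially"
   proof -
    have "(\<lambda>n. 1 / real (Suc n)) \<longlonglongrightarrow> 0" using LIMSEQ_inverse_real_of_nat by (simp add: inverse_eq_divide)
    then show ?thesis by (simp add: filterlim_at)
   qed
   ultimately show "(\<lambda>n. Q n x) \<longlonglongrightarrow> G x" unfolding Q_def by (rule filterlim_compose)
  qed
  show "AE x in lborel. norm (Q n x) \<le> BG * indicator (cball 0 (R + 1)) x" for n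
   using Qb by simp
  show "(\<lambda>x. Q n x) \<in> borel_measurable lborel" for n unfolding Q_def by measurable
 qed measurable
 then show ?thesis using LIMSEQ_unique[of "\<lambda>n. LINT x|lborel. Q n x" "LINT x|lborel. G x" 0] by (simp add: Q0)
qed

text \<open>The curl of the regularised kernel: an approximate identity, obtained by scaling one
 profile of integral one.\<close>

definition rho :: "real \<Rightarrow> plane \<Rightarrow> real" where
 "rho e z = e\<^sup>2 / (pi * ((norm z)\<^sup>2 + e\<^sup>2)\<^sup>2)"

definition dKe :: "real \<Rightarrow> 2 \<Rightarrow> 2 \<Rightarrow> plane \<Rightarrow> real" where
 "dKe e i j z = (perp (ax j) $ i * ((norm z)\<^sup>2 + e\<^sup>2) - perp z $ i * (2 * z $ j)) / (2 * pi * ((norm z)\<^sup>2 + e\<^sup>2)\<^sup>2)"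

lemma Ke_derivative:
 assumes e: "e > 0"
 shows "((\<lambda>s. Ke e (z + s *\<^sub>R ax j) $ i) has_real_derivative dKe e i j z) (at 0)"
proof -
 define E where "E s = (norm (z + s *\<^sub>R ax j))\<^sup>2 + e\<^sup>2" for s :: real
 have Epos: "E s > 0" for s using e by (simp add: E_def add_nonneg_pos)
 have Eeq: "E = (\<lambda>s. (norm z)\<^sup>2 + 2 * s * z $ j + s\<^sup>2 + e\<^sup>2)"
  unfolding E_def norm_plane fun_eq_iff using exhaust_2[of j] by (auto simp: ax_nth power2_eq_square algebra_simps)
 have E': "(E has_real_derivative (2 * z $ j)) (at 0)"
  unfolding Eeq by (auto intro!: derivative_eq_intros)
 have P: "perp (z + s *\<^sub>R ax j) $ i = perp z $ i + s * perp (ax j) $ i" for s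
  using exhaust_2[of i] by auto
 have P': "((\<lambda>s. perp z $ i + s * perp (ax j) $ i) has_real_derivative perp (ax j) $ i) (at 0)"
  by (auto intro!: derivative_eq_intros)
 have K: "(\<lambda>s. Ke e (z + s *\<^sub>R ax j) $ i) = (\<lambda>s. (perp z $ i + s * perp (ax j) $ i) / E s / (2 * pi))"
  unfolding Ke_alt E_def[symmetric] by (simp add: fun_eq_iff P[symmetric])
 have "((\<lambda>s. (perp z $ i + s * perp (ax j) $ i) / E s) has_real_derivative
  ((perp (ax j) $ i * E 0 - (perp z $ i + 0 * perp (ax j) $ i) * (2 * z $ j)) / (E 0 * E 0))) (at 0)"
  by (rule DERIV_divide[OF P' E']) (use Epos[of 0] in simp)
 from DERIV_cdivide[OF this, of "2 * pi"] show ?thesis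
  unfolding K dKe_def E_def by (simp add: power2_eq_square mult.commute)
qed

lemma dKe_div: "dKe e 1 1 z + dKe e 2 2 z = 0"
 by (simp add: dKe_def ax_nth add_divide_distrib[symmetric])

lemma dKe_curl:
 assumes e: "e > 0" shows "dKe e 2 1 z - dKe e 1 2 z = rho e z"
proof -
 define E where "E = (norm z)\<^sup>2 + e\<^sup>2"
 have E: "E > 0" using e by (simp add: E_def add_nonneg_pos)
 have "dKe e 2 1 z - dKe e 1 2 z = ((E - z $ 1 * (2 * z $ 1)) - (- E + z $ 2 * (2 * z $ 2))) / (2 * pi * E\<^sup>2)"
  by (simp add: dKe_def ax_nth E_def[symmetric] diff_divide_distrib[symmetric])
 also have "(E - z $ 1 * (2 * z $ 1)) - (- E + z $ 2 * (2 * z $ 2)) = 2 * e\<^sup>2"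
  unfolding E_def norm_plane by (simp add: power2_eq_square)
 also have "2 * e\<^sup>2 / (2 * pi * E\<^sup>2) = rho e z" by (simp add: rho_def E_def)
 finally show ?thesis .
qed

lemma continuous_dKe: "e > 0 \<Longrightarrow> continuous_on S (dKe e i j)"
 unfolding dKe_def using exhaust_2[of i]
 by (auto intro!: continuous_intros simp: add_nonneg_eq_0_iff)

lemma Ke_by_parts:
 assumes e: "e > 0" and \<psi>: "continuous_on UNIV \<psi>" "continuous_on UNIV D" "R > 0"
  and der: "\<And>x. ((\<lambda>s. \<psi> (x + s *\<^sub>R ax j)) has_real_derivative D x) (at 0)"
  and supp: "\<And>x. norm x > R \<Longrightarrow> \<psi> x = 0" "\<And>x. norm x > R \<Longrightarrow> D x = 0"
 shows "(LINT x|lborel. Ke e (x - y) $ i * D x) = - (LINT x|lborel. dKe e i j (x - y) * \<psi> x)"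
  "integrable lborel (\<lambda>x. Ke e (x - y) $ i * D x)" "integrable lborel (\<lambda>x. dKe e i j (x - y) * \<psi> x)"
proof -
 have c1: "continuous_on UNIV (\<lambda>x. Ke e (x - y) $ i)"
  by (intro continuous_intros continuous_on_compose2[OF continuous_on_Ke[OF e, of UNIV]]) auto
 have c2: "continuous_on UNIV (\<lambda>x. dKe e i j (x - y))"
  by (intro continuous_on_compose2[OF continuous_dKe[OF e, of UNIV]] continuous_intros) auto
 have int: "integrable lborel f" if f: "continuous_on UNIV f" "\<And>x. norm x > R \<Longrightarrow> f x = 0" for f :: "plane \<Rightarrow> real"
 proof -
  have "integrable lborel (\<lambda>x. indicator (cball 0 R) x *\<^sub>R f x)"
   by (rule borel_integrable_compact) (use f in \<open>auto intro: continuous_on_subset\<close>)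
  moreover have "(\<lambda>x. indicator (cball 0 R) x *\<^sub>R f x) = f" using f(2) by (auto simp: fun_eq_iff indicator_def)
  ultimately show ?thesis by simp
 qed
 show i1: "integrable lborel (\<lambda>x. Ke e (x - y) $ i * D x)" by (rule int) (use c1 \<psi> supp in \<open>auto intro!: continuous_intros\<close>)
 show i2: "integrable lborel (\<lambda>x. dKe e i j (x - y) * \<psi> x)" by (rule int) (use c2 \<psi> supp in \<open>auto intro!: continuous_intros\<close>)
 have "(LINT x|lborel. dKe e i j (x - y) * \<psi> x + Ke e (x - y) $ i * D x) = 0"
 proof (rule integral_partial_zero[where F="\<lambda>x. Ke e (x - y) $ i * \<psi> x" and i=j and R=R])
  fix x
  have a: "x + s *\<^sub>R ax j - y = (x - y) + s *\<^sub>R ax j" for s by simp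
  show "((\<lambda>s. Ke e (x + s *\<^sub>R ax j - y) $ i * \<psi> (x + s *\<^sub>R ax j)) has_real_derivative dKe e i j (x - y) * \<psi> x + Ke e (x - y) $ i * D x) (at 0)"
   using DERIV_mult[OF Ke_derivative[OF e, of "x - y" j i] der[of x]] unfolding a by (simp add: mult.commute)
 qed (use c1 c2 \<psi> supp in \<open>auto intro!: continuous_intros\<close>)
 then show "(LINT x|lborel. Ke e (x - y) $ i * D x) = - (LINT x|lborel. dKe e i j (x - y) * \<psi> x)"
  using i1 i2 by simp
qed

lemma rho_1_integral: "(\<integral>\<^sup>+z. ennreal (rho 1 z) \<partial>lborel) = 1"
proof -
 define f where "f s = ennreal (1 / pi * (inverse (s + 1) * inverse (s + 1)))" for s :: real
 have [measurable]: "f \<in> borel_measurable borel" unfolding f_def by measurable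
 have "(\<integral>\<^sup>+z. ennreal (rho 1 z) \<partial>lborel) = (\<integral>\<^sup>+z. f ((norm (z::plane))\<^sup>2) \<partial>lborel)" by (simp add: rho_def f_def divide_inverse power2_eq_square mult_ac)
 also have "\<dots> = ennreal pi * (\<integral>\<^sup>+s. f s * indicator {0..} s \<partial>lborel)" by (rule nn_integral_radial) measurable
 also have "(\<integral>\<^sup>+s. f s * indicator {0..} s \<partial>lborel) = ennreal (0 - (- (1 / pi * inverse (0 + 1))))"
  unfolding f_def
 proof (rule nn_integral_FTC_atLeast)
  show "((\<lambda>s. - (1 / pi * inverse (s + 1))) has_real_derivative 1 / pi * (inverse (s + 1) * inverse (s + 1))) (at s)" if "0 \<le> s" for s
   using that by (auto intro!: derivative_eq_intros)
  show "((\<lambda>s. - (1 / pi * inverse (s + 1))) \<longlongrightarrow> 0) at_top" by real_asymp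
 qed auto
 also have "ennreal pi * ennreal (0 - (- (1 / pi * inverse (0 + 1)))) = 1" by (simp add: ennreal_mult[symmetric])
 finally show ?thesis .
qed

lemma rho_tendsto:
 fixes \<psi> :: "plane \<Rightarrow> real"
 assumes \<psi>: "continuous_on UNIV \<psi>" "\<And>x. \<bar>\<psi> x\<bar> \<le> B" and e: "\<And>n. e n > 0" "e \<longlonglongrightarrow> 0"
 shows "(\<lambda>n. LINT x|lborel. rho (e n) (x - y) * \<psi> x) \<longlonglongrightarrow> \<psi> y"
proof -
 have [measurable]: "\<psi> \<in> borel_measurable borel" using \<psi>(1) by (rule borel_measurable_continuous_onI)
 have [measurable]: "rho c \<in> borel_measurable borel" for c unfolding rho_def by measurable
 have r0: "rho 1 z \<ge> 0" for z by (simp add: rho_def)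
 have ri: "integrable lborel (rho 1)" using rho_1_integral r0 by (intro integrableI_bounded) auto
 have r1: "(LINT z|lborel. rho 1 z) = 1" using rho_1_integral r0 ri by (subst (asm) nn_integral_eq_integral) auto
 have eq: "(LINT x|lborel. rho (e n) (x - y) * \<psi> x) = (LINT z|lborel. rho 1 z * \<psi> (y + e n *\<^sub>R z))" for n
 proof -
  have en: "e n \<noteq> 0" "e n > 0" using e(1)[of n] by auto
  define F where "F x = rho (e n) (x - y) * \<psi> x" for x
  have [measurable]: "F \<in> borel_measurable borel" unfolding F_def by measurable
  have "(LINT x|lborel. F x) = (LINT x|density (distr lborel borel (\<lambda>x. y + e n *\<^sub>R x)) (\<lambda>_. ennreal (\<bar>e n\<bar>^DIM(plane))). F x)"
   using lborel_affine[OF en(1), of y] by simp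
  also have "\<dots> = (LINT x|distr lborel borel (\<lambda>x. y + e n *\<^sub>R x). (\<bar>e n\<bar>^DIM(plane)) *\<^sub>R F x)"
   by (rule integral_density) auto
  also have "\<dots> = (LINT z|lborel. (\<bar>e n\<bar>^DIM(plane)) *\<^sub>R F (y + e n *\<^sub>R z))"
   by (rule integral_distr) measurable
  finally have "(LINT x|lborel. rho (e n) (x - y) * \<psi> x) = (LINT z|lborel. (e n)\<^sup>2 * (rho (e n) (e n *\<^sub>R z) * \<psi> (y + e n *\<^sub>R z)))"
   by (simp add: F_def)
  also have "\<dots> = (LINT z|lborel. rho 1 z * \<psi> (y + e n *\<^sub>R z))"
  proof (intro Bochner_Integration.integral_cong refl)
   fix z :: plane
   have "(norm (e n *\<^sub>R z))\<^sup>2 + (e n)\<^sup>2 = (e n)\<^sup>2 * ((norm z)\<^sup>2 + 1)" by (simp add: power_mult_distrib algebra_simps)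
   then have "(e n)\<^sup>2 * rho (e n) (e n *\<^sub>R z) = rho 1 z"
    unfolding rho_def using en by (simp add: power_mult_distrib power2_eq_square)
   then show "(e n)\<^sup>2 * (rho (e n) (e n *\<^sub>R z) * \<psi> (y + e n *\<^sub>R z)) = rho 1 z * \<psi> (y + e n *\<^sub>R z)"
    by (simp add: mult.assoc[symmetric])
  qed
  finally show ?thesis .
 qed
 have "(\<lambda>n. LINT z|lborel. rho 1 z * \<psi> (y + e n *\<^sub>R z)) \<longlonglongrightarrow> (LINT z|lborel. rho 1 z * \<psi> y)"
 proof (rule integral_dominated_convergence[where w="\<lambda>z. rho 1 z * B"])
  show "AE z in lborel. (\<lambda>n. rho 1 z * \<psi> (y + e n *\<^sub>R z)) \<longlonglongrightarrow> rho 1 z * \<psi> y"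
  proof (rule AE_I2)
   fix z
   have "(\<lambda>n. y + e n *\<^sub>R z) \<longlonglongrightarrow> y + 0 *\<^sub>R z" by (intro tendsto_intros e(2))
   then have "(\<lambda>n. \<psi> (y + e n *\<^sub>R z)) \<longlonglongrightarrow> \<psi> y"
    using continuous_on_tendsto_compose[OF \<psi>(1), of "\<lambda>n. y + e n *\<^sub>R z" y sequentially] by simp
   then show "(\<lambda>n. rho 1 z * \<psi> (y + e n *\<^sub>R z)) \<longlonglongrightarrow> rho 1 z * \<psi> y" by (intro tendsto_intros)
  qed
  show "AE z in lborel. norm (rho 1 z * \<psi> (y + e n *\<^sub>R z)) \<le> rho 1 z * B" for n
   using r0 \<psi>(2) by (intro AE_I2) (simp add: abs_mult mult_left_mono)
 qed (use ri in auto)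
 then show ?thesis unfolding eq by (simp add: r1)
qed

section \<open>Sums of measures and the Jordan decomposition\<close>

definition add_measure :: "'a measure \<Rightarrow> 'a measure \<Rightarrow> 'a measure" where
 "add_measure M N = measure_of (space M) (sets M) (\<lambda>A. emeasure M A + emeasure N A)"

lemma sets_add_measure [simp, measurable_cong]: "sets (add_measure M N) = sets M"
 by (simp add: add_measure_def)

lemma space_add_measure [simp]: "space (add_measure M N) = space M"
 by (simp add: add_measure_def)

lemma emeasure_add_measure:
 assumes N: "sets N = sets M" and A: "A \<in> sets M"
 shows "emeasure (add_measure M N) A = emeasure M A + emeasure N A"
proof (rule emeasure_measure_of[OF add_measure_def])
 show "countably_additive (sets (add_measure M N)) (\<lambda>A. emeasure M A + emeasure N A)"
 proof (rule countably_additiveI)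
  fix A :: "nat \<Rightarrow> _"
  assume "range A \<subseteq> sets (add_measure M N)" "disjoint_family A"
  then show "(\<Sum>i. emeasure M (A i) + emeasure N (A i)) = emeasure M (\<Union>i. A i) + emeasure N (\<Union>i. A i)"
   using N by (subst suminf_add[symmetric]) (simp_all add: suminf_emeasure)
 qed
qed (use A sets.space_closed in \<open>auto simp: positive_def\<close>)

lemma nn_integral_add_measure:
 assumes N: "sets N = sets M" and f: "f \<in> borel_measurable M"
 shows "(\<integral>\<^sup>+x. f x \<partial>add_measure M N) = (\<integral>\<^sup>+x. f x \<partial>M) + (\<integral>\<^sup>+x. f x \<partial>N)"
 using f
proof (induction rule: borel_measurable_induct)
 case (cong f g)
 then have "\<And>x. x \<in> space N \<Longrightarrow> f x = g x" using sets_eq_imp_space_eq[OF N] by simp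
 with cong show ?case by (simp cong: nn_integral_cong_simp)
next
 case (set A)
 then show ?case using N by (simp add: emeasure_add_measure)
next
 case (mult u c)
 moreover have "u \<in> borel_measurable (add_measure M N)" "u \<in> borel_measurable N"
  using mult N by (simp_all cong: measurable_cong_sets)
 ultimately show ?case by (simp add: nn_integral_cmult distrib_left)
next
 case (add u v)
 moreover have "u \<in> borel_measurable (add_measure M N)" "u \<in> borel_measurable N" "v \<in> borel_measurable (add_measure M N)" "v \<in> borel_measurable N"
  using add N by (simp_all cong: measurable_cong_sets)
 ultimately show ?case by (simp add: nn_integral_add ac_simps)
next
 case (seq U)
 have m: "U i \<in> borel_measurable (add_measure M N)" "U i \<in> borel_measurable N" for i
  using seq(1)[of i] N by (simp_all cong: measurable_cong_sets)
 have inc: "incseq (\<lambda>i. \<integral>\<^sup>+x. U i x \<partial>M)" "incseq (\<lambda>i. \<integral>\<^sup>+x. U i x \<partial>N)"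
  using seq(3) by (auto simp: incseq_def le_fun_def intro!: nn_integral_mono)
 have "(\<integral>\<^sup>+x. (SUP i. U i) x \<partial>add_measure M N) = (SUP i. \<integral>\<^sup>+x. U i x \<partial>add_measure M N)"
  unfolding SUP_apply by (rule nn_integral_monotone_convergence_SUP[OF seq(3) m(1)])
 also have "\<dots> = (SUP i. (\<integral>\<^sup>+x. U i x \<partial>M) + (\<integral>\<^sup>+x. U i x \<partial>N))" using seq by simp
 also have "\<dots> = (SUP i. (\<integral>\<^sup>+x. U i x \<partial>M)) + (SUP i. (\<integral>\<^sup>+x. U i x \<partial>N))"
  by (rule ennreal_SUP_add[OF inc])
 also have "(SUP i. (\<integral>\<^sup>+x. U i x \<partial>M)) = (\<integral>\<^sup>+x. (SUP i. U i) x \<partial>M)"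
  unfolding SUP_apply by (rule nn_integral_monotone_convergence_SUP[OF seq(3) seq(1), symmetric])
 also have "(SUP i. (\<integral>\<^sup>+x. U i x \<partial>N)) = (\<integral>\<^sup>+x. (SUP i. U i) x \<partial>N)"
  unfolding SUP_apply by (rule nn_integral_monotone_convergence_SUP[OF seq(3) m(2), symmetric])
 finally show ?case by (simp add: image_comp)
qed

lemma integrable_add_measure:
 fixes f :: "'a \<Rightarrow> 'b::{banach, second_countable_topology}"
 assumes N: "sets N = sets M"
 shows "integrable (add_measure M N) f \<longleftrightarrow> integrable M f \<and> integrable N f"
proof -
 have m: "f \<in> borel_measurable (add_measure M N) \<longleftrightarrow> f \<in> borel_measurable M" "f \<in> borel_measurable N \<longleftrightarrow> f \<in> borel_measurable M"
  using N by (simp_all cong: measurable_cong_sets)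
 show ?thesis unfolding integrable_iff_bounded m
  by (auto simp: nn_integral_add_measure[OF N])
qed

lemma integral_add_measure:
 fixes f :: "'a \<Rightarrow> 'b::{banach, second_countable_topology}"
 assumes N: "sets N = sets M" and f: "integrable M f" "integrable N f"
 shows "(LINT x|add_measure M N. f x) = (LINT x|M. f x) + (LINT x|N. f x)"
proof -
 have "integrable (add_measure M N) f" using f by (simp add: integrable_add_measure[OF N])
 then show ?thesis
 proof (induction rule: integrable_induct)
  case (base A c)
  then have "emeasure M A < \<infinity>" "emeasure N A < \<infinity>" by (auto simp: emeasure_add_measure[OF N])
  then have "measure (add_measure M N) A = measure M A + measure N A"
   using base N by (simp add: measure_def emeasure_add_measure[OF N] enn2real_plus)
  moreover have "A \<inter> space M = A" "A \<inter> space N = A" using base(1) N sets.sets_into_space[of A M] sets_eq_imp_space_eq[OF N] by auto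
  moreover have "(LINT x|P. indicator A x *\<^sub>R c) = measure P A *\<^sub>R c" if "A \<in> sets P" "emeasure P A < \<infinity>" "A \<inter> space P = A" for P
   using that integrable_real_indicator[OF that(1,2)] by simp
  ultimately show ?case using base N \<open>emeasure M A < \<infinity>\<close> \<open>emeasure N A < \<infinity>\<close> by (simp add: scaleR_add_left)
 next
  case (add f g)
  then show ?case by (simp add: integrable_add_measure[OF N])
 next
  case (lim f s)
  have i: "integrable M f" "integrable N f" "\<And>i. integrable M (s i)" "\<And>i. integrable N (s i)"
   using lim by (auto simp: integrable_add_measure[OF N])
  have sp: "space N = space M" by (rule sets_eq_imp_space_eq[OF N])
  have c: "(\<lambda>i. integral\<^sup>L P (s i)) \<longlonglongrightarrow> integral\<^sup>L P f" if "integrable P f" "\<And>i. integrable P (s i)" "space P = space M" for P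
  proof (rule integral_dominated_convergence[where w="\<lambda>x. 2 * norm (f x)"])
   show "AE x in P. (\<lambda>i. s i x) \<longlonglongrightarrow> f x" using lim that(3) by (intro AE_I2) simp
   show "AE x in P. norm (s i x) \<le> 2 * norm (f x)" for i using lim that(3) by (intro AE_I2) simp
  qed (use that in auto)
  have "(\<lambda>i. integral\<^sup>L M (s i) + integral\<^sup>L N (s i)) \<longlonglongrightarrow> integral\<^sup>L M f + integral\<^sup>L N f"
   by (intro tendsto_add c i sp refl)
  moreover have "(\<lambda>i. integral\<^sup>L M (s i) + integral\<^sup>L N (s i)) \<longlonglongrightarrow> integral\<^sup>L (add_measure M N) f"
   using c[OF lim(4) lim(1) space_add_measure] lim(5) by simp
  ultimately show ?case by (rule LIMSEQ_unique[rotated])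
 qed
qed

lemma sets_pos_part [simp, measurable_cong]: "sets (pos_part \<nu>) = sets borel"
 unfolding pos_part_def using sets.sigma_sets_eq[of borel] by (simp add: sets_measure_of)

lemma space_pos_part [simp]: "space (pos_part \<nu>) = UNIV"
 using sets_eq_imp_space_eq[OF sets_pos_part] by simp

lemma neg_bounded_measures: "\<nu> \<in> bounded_measures \<Longrightarrow> (\<lambda>A. - \<nu> A) \<in> bounded_measures"
 unfolding bounded_measures_def by (auto intro: sums_minus)

lemma bounded_measures_Un:
 assumes \<nu>: "\<nu> \<in> bounded_measures" and AB: "A \<in> sets borel" "B \<in> sets borel" "A \<inter> B = {}"
 shows "\<nu> (A \<union> B) = \<nu> A + \<nu> B"
proof -
 define S where "S = binaryset A B"
 have r: "range S \<subseteq> sets borel" "disjoint_family S" "(\<Union>i. S i) = A \<union> B"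
  using AB by (auto simp: S_def range_binaryset_eq disjoint_family_on_def binaryset_def UN_binaryset_eq)
 have "(\<lambda>n. \<nu> (S n)) sums \<nu> (A \<union> B)" using bounded_measures_sums[OF \<nu> r(1,2)] r(3) by simp
 moreover have "(\<lambda>n. \<nu> (S n)) sums (\<nu> A + \<nu> B)"
  unfolding S_def by (rule binaryset_sums) (rule bounded_measures_empty[OF \<nu>])
 ultimately show ?thesis by (rule sums_unique2)
qed

text \<open>If the positive variation were infinite, one could split off infinitely many disjoint pieces of
 measure at least one in absolute value, against countable additivity.\<close>

lemma pos_part_finite:
 assumes \<nu>: "\<nu> \<in> bounded_measures"
 shows "emeasure (pos_part \<nu>) UNIV < \<infinity>"
proof (rule ccontr)
 assume "\<not> ?thesis"
 then have inf: "emeasure (pos_part \<nu>) UNIV = \<infinity>" by (simp add: less_top[symmetric])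
 have split: "\<exists>F. F \<in> sets borel \<and> F \<subseteq> E \<and> emeasure (pos_part \<nu>) F = \<infinity> \<and> \<bar>\<nu> (E - F)\<bar> \<ge> 1"
  if E: "E \<in> sets borel" "emeasure (pos_part \<nu>) E = \<infinity>" for E
 proof -
  have "ennreal (1 + \<bar>\<nu> E\<bar>) < (SUP B\<in>{B \<in> sets borel. B \<subseteq> E}. ennreal (\<nu> B))"
   using E(2) unfolding emeasure_pos_part[OF \<nu> E(1)] by (simp only: infinity_ennreal_def ennreal_less_top)
  then obtain B where B: "B \<in> sets borel" "B \<subseteq> E" "ennreal (1 + \<bar>\<nu> E\<bar>) < ennreal (\<nu> B)"
   by (auto simp: less_SUP_iff)
  then have b: "1 + \<bar>\<nu> E\<bar> < \<nu> B" using ennreal_less_iff[of "1 + \<bar>\<nu> E\<bar>" "\<nu> B"] by (simp del: ennreal_plus)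
  have EB: "E - B \<in> sets borel" using E B by auto
  have "\<nu> E = \<nu> B + \<nu> (E - B)"
   using bounded_measures_Un[OF \<nu> B(1) EB] B(2) by (simp add: Un_absorb1)
  then have d: "\<bar>\<nu> (E - B)\<bar> \<ge> 1" using b by linarith
  have "emeasure (pos_part \<nu>) E = emeasure (pos_part \<nu>) B + emeasure (pos_part \<nu>) (E - B)"
   using plus_emeasure[of B "pos_part \<nu>" "E - B"] B EB by (simp add: Un_absorb1)
  then consider "emeasure (pos_part \<nu>) B = \<infinity>" | "emeasure (pos_part \<nu>) (E - B) = \<infinity>"
   using E(2) by (metis ennreal_add_eq_top infinity_ennreal_def)
  then show ?thesis
  proof cases
   case 1
   then show ?thesis using B d by blast
  next
   case 2
   have "E - (E - B) = B" using B(2) by auto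
   then show ?thesis using 2 EB b by (intro exI[of _ "E - B"]) auto
  qed
 qed
 define nxt where "nxt E = (SOME F. F \<in> sets borel \<and> F \<subseteq> E \<and> emeasure (pos_part \<nu>) F = \<infinity> \<and> \<bar>\<nu> (E - F)\<bar> \<ge> 1)" for E
 have nxt: "nxt E \<in> sets borel \<and> nxt E \<subseteq> E \<and> emeasure (pos_part \<nu>) (nxt E) = \<infinity> \<and> \<bar>\<nu> (E - nxt E)\<bar> \<ge> 1"
  if "E \<in> sets borel" "emeasure (pos_part \<nu>) E = \<infinity>" for E
  unfolding nxt_def by (rule someI_ex[OF split[OF that]])
 define S where "S n = (nxt ^^ n) UNIV" for n
 have S: "S n \<in> sets borel \<and> emeasure (pos_part \<nu>) (S n) = \<infinity>" for n
  by (induction n) (use inf nxt in \<open>auto simp: S_def\<close>)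
 have Ss: "S (Suc n) = nxt (S n)" for n by (simp add: S_def)
 have dec: "S (Suc n) \<subseteq> S n" "\<bar>\<nu> (S n - S (Suc n))\<bar> \<ge> 1" for n
  using nxt[of "S n"] S[of n] by (auto simp: Ss)
 define D where "D n = S n - S (Suc n)" for n
 have anti: "S n \<subseteq> S k" if "k \<le> n" for k n
  using lift_Suc_antimono_le[of S, OF dec(1) that] .
 have "D i \<inter> D j = {}" if "i < j" for i j
  using anti[of "Suc i" j] that by (auto simp: D_def)
 then have "disjoint_family D" unfolding disjoint_family_on_def by (metis inf_commute linorder_neqE_nat)
 moreover have "range D \<subseteq> sets borel" using S by (auto simp: D_def)
 ultimately have "(\<lambda>n. \<nu> (D n)) sums \<nu> (\<Union>n. D n)" by (intro bounded_measures_sums[OF \<nu>])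
 then have "(\<lambda>n. \<nu> (D n)) \<longlonglongrightarrow> 0" by (intro summable_LIMSEQ_zero) (rule sums_summable)
 then obtain n where "\<bar>\<nu> (D n)\<bar> < 1" using LIMSEQ_D[of "\<lambda>n. \<nu> (D n)" 0 1] by auto
 with dec(2)[of n] show False by (simp add: D_def)
qed

lemma finite_pos_part: "\<nu> \<in> bounded_measures \<Longrightarrow> finite_measure (pos_part \<nu>)"
 by (intro finite_measureI) (use pos_part_finite in \<open>auto simp: less_top[symmetric]\<close>)

text \<open>Passing from a subset of \<open>A\<close> to its complement in \<open>A\<close> exchanges large values of \<open>\<nu>\<close> and of \<open>-\<nu>\<close>.\<close>

lemma jordan:
 assumes \<nu>: "\<nu> \<in> bounded_measures" and A: "A \<in> sets borel"
 shows "\<nu> A = measure (pos_part \<nu>) A - measure (neg_part \<nu>) A"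
proof -
 note \<nu>' = neg_bounded_measures[OF \<nu>]
 interpret P: finite_measure "pos_part \<nu>" by (rule finite_pos_part[OF \<nu>])
 interpret N: finite_measure "neg_part \<nu>" unfolding neg_part_def by (rule finite_pos_part[OF \<nu>'])
 have up: "\<sigma> B \<le> measure (pos_part \<sigma>) A" if "\<sigma> \<in> bounded_measures" "B \<in> sets borel" "B \<subseteq> A" for \<sigma> :: "'a set \<Rightarrow> real" and B
 proof -
  interpret F: finite_measure "pos_part \<sigma>" by (rule finite_pos_part[OF that(1)])
  have "ennreal (\<sigma> B) \<le> emeasure (pos_part \<sigma>) A"
   unfolding emeasure_pos_part[OF that(1) A] using that by (intro SUP_upper) auto
  then show ?thesis by (simp add: F.emeasure_eq_measure ennreal_le_iff)
 qed
 have le: "measure (pos_part \<sigma>) A \<le> c" if "\<sigma> \<in> bounded_measures" "c \<ge> 0" "\<And>B. B \<in> sets borel \<Longrightarrow> B \<subseteq> A \<Longrightarrow> \<sigma> B \<le> c" for \<sigma> :: "'a set \<Rightarrow> real" and c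
 proof -
  interpret F: finite_measure "pos_part \<sigma>" by (rule finite_pos_part[OF that(1)])
  have "emeasure (pos_part \<sigma>) A \<le> ennreal c"
   unfolding emeasure_pos_part[OF that(1) A] using that(3) by (intro SUP_least ennreal_leI) auto
  then show ?thesis using that(2) by (simp add: F.emeasure_eq_measure ennreal_le_iff)
 qed
 have c: "\<nu> B = \<nu> A - \<nu> (A - B)" if "B \<in> sets borel" "B \<subseteq> A" for B
  using bounded_measures_Un[OF \<nu> that(1), of "A - B"] A that by (auto simp: Un_absorb1)
 have e: "\<nu> {} = 0" by (rule bounded_measures_empty[OF \<nu>])
 have "measure (pos_part \<nu>) A \<le> \<nu> A + measure (neg_part \<nu>) A"
 proof (rule le[OF \<nu>])
  have n: "- \<nu> B \<le> measure (neg_part \<nu>) A" if "B \<in> sets borel" "B \<subseteq> A" for B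
   unfolding neg_part_def using up[OF \<nu>' that] by simp
  show "0 \<le> \<nu> A + measure (neg_part \<nu>) A" using n[OF A] by simp
  show "\<nu> B \<le> \<nu> A + measure (neg_part \<nu>) A" if "B \<in> sets borel" "B \<subseteq> A" for B
   using n[of "A - B"] c[OF that] A that by auto
 qed
 moreover have "measure (neg_part \<nu>) A \<le> measure (pos_part \<nu>) A - \<nu> A"
  unfolding neg_part_def
 proof (rule le[OF \<nu>'])
  show "0 \<le> measure (pos_part \<nu>) A - \<nu> A" using up[OF \<nu> A] by simp
  show "- \<nu> B \<le> measure (pos_part \<nu>) A - \<nu> A" if "B \<in> sets borel" "B \<subseteq> A" for B
   using up[OF \<nu>, of "A - B"] c[OF that] A that by auto
 qed
 ultimately show ?thesis by linarith
qed

text \<open>The Jordan decomposition is minimal, and any two decompositions give the same integrals.\<close>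

lemma signed_integral_difference:
 fixes f :: "'a::euclidean_space \<Rightarrow> 'b::euclidean_space"
 assumes fin: "finite_measure M" "finite_measure N" and sets: "sets M = sets borel" "sets N = sets borel"
  and \<nu>: "\<And>A. A \<in> sets borel \<Longrightarrow> \<nu> A = measure M A - measure N A"
  and f: "integrable M f" "integrable N f"
 shows "signed_integrable \<nu> f" "signed_integral \<nu> f = (LINT x|M. f x) - (LINT x|N. f x)"
proof -
 interpret M: finite_measure M by (rule fin)
 interpret N: finite_measure N by (rule fin)
 have bm: "\<nu> \<in> bounded_measures"
  unfolding bounded_measures_def
 proof (intro CollectI allI impI)
  fix A :: "nat \<Rightarrow> 'a set" assume A: "range A \<subseteq> sets borel \<and> disjoint_family A"
  then have U: "(\<Union>i. A i) \<in> sets borel" "\<And>i. A i \<in> sets borel" by auto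
  have "(\<lambda>n. measure M (A n) - measure N (A n)) sums (measure M (\<Union>i. A i) - measure N (\<Union>i. A i))"
   using A sets by (intro sums_diff M.finite_measure_UNION N.finite_measure_UNION) auto
  then show "(\<lambda>n. \<nu> (A n)) sums \<nu> (\<Union>n. A n)" using \<nu> U by simp
 qed
 note bm' = neg_bounded_measures[OF bm]
 interpret P: finite_measure "pos_part \<nu>" by (rule finite_pos_part[OF bm])
 interpret Q: finite_measure "neg_part \<nu>" unfolding neg_part_def by (rule finite_pos_part[OF bm'])
 have sQ: "sets (neg_part \<nu>) = sets borel" by (simp add: neg_part_def)
 have le: "emeasure (pos_part \<sigma>) A \<le> emeasure K A"
  if "\<sigma> \<in> bounded_measures" "A \<in> sets borel" "finite_measure K" "sets K = sets borel" "\<And>B. B \<in> sets borel \<Longrightarrow> \<sigma> B \<le> measure K B" for \<sigma> K A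
 proof -
  interpret K: finite_measure K by (rule that)
  show ?thesis unfolding emeasure_pos_part[OF that(1,2)]
  proof (rule SUP_least)
   fix B assume B: "B \<in> {B \<in> sets borel. B \<subseteq> A}"
   have "ennreal (\<sigma> B) \<le> ennreal (measure K B)" using that(5) B by (intro ennreal_leI) auto
   also have "\<dots> = emeasure K B" by (rule K.emeasure_eq_measure[symmetric])
   also have "\<dots> \<le> emeasure K A" using B that(2,4) by (intro emeasure_mono) auto
   finally show "ennreal (\<sigma> B) \<le> emeasure K A" .
  qed
 qed
 have leP: "pos_part \<nu> \<le> M"
 proof (subst le_measure)
  show "\<forall>A\<in>sets (pos_part \<nu>). emeasure (pos_part \<nu>) A \<le> emeasure M A"
   using le[OF bm _ fin(1) sets(1)] \<nu> by auto
 qed (simp add: sets)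
 have leN: "neg_part \<nu> \<le> N"
 proof (subst le_measure)
  show "\<forall>A\<in>sets (neg_part \<nu>). emeasure (neg_part \<nu>) A \<le> emeasure N A"
   unfolding neg_part_def using le[OF bm' _ fin(2) sets(2)] \<nu> by auto
 qed (simp add: sets sQ)
 have i: "integrable K' f" if "integrable K f" "K' \<le> K" "sets K' = sets K" for K K'
  using that nn_integral_mono_measure[OF that(3) that(2), of "\<lambda>x. ennreal (norm (f x))"]
  unfolding integrable_iff_bounded by (auto cong: measurable_cong_sets intro: le_less_trans)
 have iP: "integrable (pos_part \<nu>) f" by (rule i[OF f(1) leP]) (simp add: sets)
 have iN: "integrable (neg_part \<nu>) f" by (rule i[OF f(2) leN]) (simp add: sets sQ)
 then show "signed_integrable \<nu> f" using iP by (simp add: signed_integrable_def)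
 have "add_measure (pos_part \<nu>) N = add_measure (neg_part \<nu>) M"
 proof (rule measure_eqI)
  fix A assume "A \<in> sets (add_measure (pos_part \<nu>) N)"
  then have A: "A \<in> sets borel" by simp
  have "measure (pos_part \<nu>) A + measure N A = measure (neg_part \<nu>) A + measure M A"
   using jordan[OF bm A] \<nu>[OF A] by simp
  then show "emeasure (add_measure (pos_part \<nu>) N) A = emeasure (add_measure (neg_part \<nu>) M) A"
   using A sets sQ by (simp add: emeasure_add_measure P.emeasure_eq_measure Q.emeasure_eq_measure M.emeasure_eq_measure N.emeasure_eq_measure ennreal_plus[symmetric] del: ennreal_plus)
 qed (simp add: sQ)
 then have "(LINT x|pos_part \<nu>. f x) + (LINT x|N. f x) = (LINT x|neg_part \<nu>. f x) + (LINT x|M. f x)"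
  using integral_add_measure[of N "pos_part \<nu>" f] integral_add_measure[of M "neg_part \<nu>" f] sets sQ iP iN f by simp
 then show "signed_integral \<nu> f = (LINT x|M. f x) - (LINT x|N. f x)"
  unfolding signed_integral_def by (simp add: algebra_simps)
qed

section \<open>Local integrability, divergence and curl of potentials\<close>

lemma ball_kernel:
 assumes q: "0 < q" "q < 2"
 shows "\<exists>\<kappa>\<ge>0. \<forall>y. (\<integral>\<^sup>+x. ennreal (norm (x - y) powr (- q)) * indicator (cball (0::plane) R) x \<partial>lborel) \<le> ennreal \<kappa>"
proof -
 define a where "a z = ennreal (norm z powr (- q)) * indicator (cball 0 1) z" for z :: plane
 have am [measurable]: "a \<in> borel_measurable borel" unfolding a_def by measurable
 define \<kappa>1 where "\<kappa>1 = pi * (1 powr (2 - q) / (1 - q / 2))"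
 have k1: "\<kappa>1 \<ge> 0" using q by (simp add: \<kappa>1_def)
 define \<kappa>2 where "\<kappa>2 = measure lborel (cball (0::plane) R)"
 have k2: "emeasure lborel (cball (0::plane) R) = ennreal \<kappa>2"
  unfolding \<kappa>2_def using emeasure_lborel_cball_finite[of "0::plane" R] by (intro emeasure_eq_ennreal_measure) auto
 have "(\<integral>\<^sup>+x. ennreal (norm (x - y) powr (- q)) * indicator (cball (0::plane) R) x \<partial>lborel) \<le> ennreal (\<kappa>1 + \<kappa>2)" for y
 proof -
  have "(\<integral>\<^sup>+x. ennreal (norm (x - y) powr (- q)) * indicator (cball (0::plane) R) x \<partial>lborel) \<le> (\<integral>\<^sup>+x. a (x + (- y)) + indicator (cball 0 R) x \<partial>lborel)"
  proof (rule nn_integral_mono)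
   fix x :: plane
   show "ennreal (norm (x - y) powr (- q)) * indicator (cball 0 R) x \<le> a (x + (- y)) + indicator (cball 0 R) x"
   proof (cases "norm (x - y) \<le> 1")
    case True
    then show ?thesis by (auto simp: a_def indicator_def)
   next
    case False
    then have "norm (x - y) powr (- q) \<le> 1" using q powr_mono[of "-q" 0 "norm (x - y)"] by (auto split: if_splits)
    then have "ennreal (norm (x - y) powr (- q)) \<le> 1" using ennreal_leI[of _ 1] by simp
    then show ?thesis using False by (auto simp: a_def indicator_def)
   qed
  qed
  also have "\<dots> = (\<integral>\<^sup>+x. a (x + (- y)) \<partial>lborel) + (\<integral>\<^sup>+x. indicator (cball (0::plane) R) x \<partial>lborel)"
   by (rule nn_integral_add) measurable
  also have "(\<integral>\<^sup>+x. a (x + (- y)) \<partial>lborel) = ennreal \<kappa>1"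
   unfolding nn_integral_shift[OF am] unfolding a_def \<kappa>1_def by (rule nn_integral_inverse_power_cball[OF q]) simp
  also have "(\<integral>\<^sup>+x. indicator (cball (0::plane) R) x \<partial>lborel) = ennreal \<kappa>2" by (simp add: k2)
  also have "ennreal \<kappa>1 + ennreal \<kappa>2 = ennreal (\<kappa>1 + \<kappa>2)" using k1 by (simp add: \<kappa>2_def)
  finally show ?thesis .
 qed
 then show ?thesis using k1 by (intro exI[of _ "\<kappa>1 + \<kappa>2"]) (auto simp: \<kappa>2_def)
qed

lemma norm_Ke_powr: "q > 0 \<Longrightarrow> norm (Ke e z) powr q \<le> norm z powr (- q)"
 using powr_mono2[OF _ _ norm_Ke_le[of e z], of q] 
 by (cases "z = 0") (auto simp: powr_minus_divide powr_divide)

lemma kernel_tested: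
 assumes D: "D \<in> borel_measurable borel" "\<And>x. \<bar>D x\<bar> \<le> B" "\<And>x. norm x > R \<Longrightarrow> D x = 0"
 shows "(\<lambda>n. LINT x|lborel. Ke (1 / real (Suc n)) (x - y) $ i * D x) \<longlonglongrightarrow> (LINT x|lborel. Ke 0 (x - y) $ i * D x)"
  "integrable lborel (\<lambda>x. Ke 0 (x - y) $ i * D x)"
proof -
 note [measurable] = D(1)
 obtain \<kappa> where k: "\<kappa> \<ge> 0" "\<And>y. (\<integral>\<^sup>+x. ennreal (norm (x - y) powr (- 1)) * indicator (cball (0::plane) R) x \<partial>lborel) \<le> ennreal \<kappa>"
  using ball_kernel[of 1 R] by auto
 define w where "w x = B * (norm (x - y) powr (- 1) * indicator (cball 0 R) x)" for x
 have B: "B \<ge> 0" using order_trans[OF abs_ge_zero D(2)] .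
 have wi: "integrable lborel w"
  unfolding w_def
 proof (intro integrable_mult_right integrableI_bounded)
  have "(\<integral>\<^sup>+x. ennreal (norm (norm (x - y) powr (- 1) * indicator (cball 0 R) x)) \<partial>lborel) = (\<integral>\<^sup>+x. ennreal (norm (x - y) powr (- 1)) * indicator (cball (0::plane) R) x \<partial>lborel)"
   by (intro nn_integral_cong) (auto split: split_indicator)
  then show "(\<integral>\<^sup>+x. ennreal (norm (norm (x - y) powr (- 1) * indicator (cball 0 R) x)) \<partial>lborel) < \<infinity>"
   using k(2)[of y] by (auto intro: le_less_trans)
 qed measurable
 have dom: "norm (Ke e (x - y) $ i * D x) \<le> w x" for e x
 proof (cases "norm x \<le> R")
  case True
  have "\<bar>Ke e (x - y) $ i\<bar> \<le> norm (x - y) powr (- 1)"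
   using component_le_norm_cart[of "Ke e (x - y)" i] norm_Ke_powr[of 1 e "x - y"] by simp
  then have "\<bar>Ke e (x - y) $ i\<bar> * \<bar>D x\<bar> \<le> norm (x - y) powr (- 1) * B" using D(2) by (intro mult_mono) auto
  then show ?thesis using True by (simp add: w_def abs_mult mult.commute)
 qed (use D(3) in \<open>simp add: w_def\<close>)
 show "(\<lambda>n. LINT x|lborel. Ke (1 / real (Suc n)) (x - y) $ i * D x) \<longlonglongrightarrow> (LINT x|lborel. Ke 0 (x - y) $ i * D x)"
 proof (rule integral_dominated_convergence[OF _ _ wi])
  show "AE x in lborel. (\<lambda>n. Ke (1 / real (Suc n)) (x - y) $ i * D x) \<longlonglongrightarrow> Ke 0 (x - y) $ i * D x"
  proof (rule AE_I2)
   fix x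
   have l0: "(\<lambda>n. 1 / real (Suc n)) \<longlonglongrightarrow> 0" using LIMSEQ_inverse_real_of_nat by (simp add: inverse_eq_divide)
   have "(\<lambda>n. (1 / real (Suc n))\<^sup>2 / norm (x - y) ^ 3) \<longlonglongrightarrow> 0"
    using tendsto_mult_left_zero[OF tendsto_null_power[OF l0, of 2], of "1 / norm (x - y) ^ 3"] by (simp only: times_divide_eq_right mult_1_right zero_less_numeral simp_thms)
   then have "(\<lambda>n. Ke 0 (x - y) - Ke (1 / real (Suc n)) (x - y)) \<longlonglongrightarrow> 0"
    by (rule Lim_null_comparison[rotated]) (use norm_Ke_diff(1) in \<open>intro always_eventually allI\<close>)
   from tendsto_diff[OF tendsto_const[of "Ke 0 (x - y)"] this]
   have "(\<lambda>n. Ke (1 / real (Suc n)) (x - y)) \<longlonglongrightarrow> Ke 0 (x - y)" by simp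
   then show "(\<lambda>n. Ke (1 / real (Suc n)) (x - y) $ i * D x) \<longlonglongrightarrow> Ke 0 (x - y) $ i * D x" by (intro tendsto_intros)
  qed
  show "AE x in lborel. norm (Ke (1 / real (Suc n)) (x - y) $ i * D x) \<le> w x" for n using dom by (intro AE_I2)
 qed measurable
 show "integrable lborel (\<lambda>x. Ke 0 (x - y) $ i * D x)"
  by (rule Bochner_Integration.integrable_bound[OF wi]) (use dom order_trans[OF dom abs_ge_self] in \<open>auto intro!: AE_I2\<close>)
qed

lemma kernel_div_curl:
 assumes \<psi>: "continuous_on UNIV \<psi>" "\<And>i. continuous_on UNIV (D i)" "R > 0"
  and der: "\<And>x i. ((\<lambda>s. \<psi> (x + s *\<^sub>R ax i)) has_real_derivative D i x) (at 0)"
  and supp: "\<And>x. norm x > R \<Longrightarrow> \<psi> x = 0" "\<And>x i. norm x > R \<Longrightarrow> D i x = 0"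
  and B: "\<And>x. \<bar>\<psi> x\<bar> \<le> B" "\<And>x i. \<bar>D i x\<bar> \<le> B"
 shows "(LINT x|lborel. Ke 0 (x - y) $ 1 * D 1 x) + (LINT x|lborel. Ke 0 (x - y) $ 2 * D 2 x) = 0"
  "(LINT x|lborel. Ke 0 (x - y) $ 2 * D 1 x) - (LINT x|lborel. Ke 0 (x - y) $ 1 * D 2 x) = - \<psi> y"
proof -
 define e where "e n = 1 / real (Suc n)" for n
 have e: "e n > 0" for n by (simp add: e_def)
 have e0: "e \<longlonglongrightarrow> 0" unfolding e_def using LIMSEQ_inverse_real_of_nat by (simp add: inverse_eq_divide)
 have Dm: "D i \<in> borel_measurable borel" for i using \<psi>(2) by (rule borel_measurable_continuous_onI)
 have lim: "(\<lambda>n. LINT x|lborel. Ke (e n) (x - y) $ i * D j x) \<longlonglongrightarrow> (LINT x|lborel. Ke 0 (x - y) $ i * D j x)" for y :: plane and i j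
  unfolding e_def by (rule kernel_tested(1)[where B=B and R=R]) (use Dm B supp in auto)
 have bp: "(LINT x|lborel. Ke (e n) (x - y) $ i * D j x) = - (LINT x|lborel. dKe (e n) i j (x - y) * \<psi> x)" "integrable lborel (\<lambda>x. dKe (e n) i j (x - y) * \<psi> x)" for n i j
  using Ke_by_parts(1,3)[OF e \<psi>(1) \<psi>(2) \<psi>(3) der supp] by blast+
 have "(LINT x|lborel. Ke (e n) (x - y) $ 1 * D 1 x) + (LINT x|lborel. Ke (e n) (x - y) $ 2 * D 2 x) = 0" for n
 proof -
  have "(LINT x|lborel. dKe (e n) 1 1 (x - y) * \<psi> x) + (LINT x|lborel. dKe (e n) 2 2 (x - y) * \<psi> x) = (LINT x|lborel. (dKe (e n) 1 1 (x - y) + dKe (e n) 2 2 (x - y)) * \<psi> x)"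
   using bp(2) by (simp add: distrib_right)
  then show ?thesis unfolding bp dKe_div by simp
 qed
 with tendsto_add[OF lim[of y 1 1] lim[of y 2 2]] show "(LINT x|lborel. Ke 0 (x - y) $ 1 * D 1 x) + (LINT x|lborel. Ke 0 (x - y) $ 2 * D 2 x) = 0"
  by (simp add: LIMSEQ_const_iff)
 have r: "(LINT x|lborel. Ke (e n) (x - y) $ 2 * D 1 x) - (LINT x|lborel. Ke (e n) (x - y) $ 1 * D 2 x) = - (LINT x|lborel. rho (e n) (x - y) * \<psi> x)" for n
 proof -
  have "(LINT x|lborel. dKe (e n) 2 1 (x - y) * \<psi> x) - (LINT x|lborel. dKe (e n) 1 2 (x - y) * \<psi> x) = (LINT x|lborel. (dKe (e n) 2 1 (x - y) - dKe (e n) 1 2 (x - y)) * \<psi> x)"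
   using bp(2) by (simp add: left_diff_distrib)
  then show ?thesis unfolding bp dKe_curl[OF e] by simp
 qed
 have "(\<lambda>n. - (LINT x|lborel. rho (e n) (x - y) * \<psi> x)) \<longlonglongrightarrow> - \<psi> y"
  by (intro tendsto_minus rho_tendsto[OF \<psi>(1) B(1) e e0])
 with tendsto_diff[OF lim[of y 2 1] lim[of y 1 2]] show "(LINT x|lborel. Ke 0 (x - y) $ 2 * D 1 x) - (LINT x|lborel. Ke 0 (x - y) $ 1 * D 2 x) = - \<psi> y"
  unfolding r by (rule LIMSEQ_unique)
qed

context charge
begin

text \<open>Averaging over a disc first, the singularity of the kernel is integrable whatever the charge.\<close>

lemma potential_local:
 assumes q: "0 < q" "q < 2"
 shows "\<exists>\<kappa>\<ge>0. (\<integral>\<^sup>+x. (\<integral>\<^sup>+b. ennreal (\<bar>g b\<bar> * norm (x - Y b) powr (- q)) \<partial>L) * indicator (cball 0 R) x \<partial>lborel) \<le> ennreal \<kappa>"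
proof -
 interpret P: pair_sigma_finite lborel L ..
 obtain \<kappa> where k: "\<kappa> \<ge> 0" "\<And>y. (\<integral>\<^sup>+x. ennreal (norm (x - y) powr (- q)) * indicator (cball (0::plane) R) x \<partial>lborel) \<le> ennreal \<kappa>"
  using ball_kernel[OF q, of R] by auto
 have [measurable]: "cball (0::plane) R \<in> sets borel" by simp
 have "(\<integral>\<^sup>+x. (\<integral>\<^sup>+b. ennreal (\<bar>g b\<bar> * norm (x - Y b) powr (- q)) \<partial>L) * indicator (cball 0 R) x \<partial>lborel) =
  (\<integral>\<^sup>+x. (\<integral>\<^sup>+b. ennreal (\<bar>g b\<bar> * norm (x - Y b) powr (- q)) * indicator (cball 0 R) x \<partial>L) \<partial>lborel)"
  by (intro nn_integral_cong nn_integral_multc[symmetric]) measurable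
 also have "\<dots> = (\<integral>\<^sup>+b. (\<integral>\<^sup>+x. ennreal (\<bar>g b\<bar> * norm (x - Y b) powr (- q)) * indicator (cball 0 R) x \<partial>lborel) \<partial>L)"
  by (rule P.Fubini'[symmetric]) measurable
 also have "\<dots> = (\<integral>\<^sup>+b. ennreal \<bar>g b\<bar> * (\<integral>\<^sup>+x. ennreal (norm (x - Y b) powr (- q)) * indicator (cball 0 R) x \<partial>lborel) \<partial>L)"
  by (intro nn_integral_cong) (subst nn_integral_cmult[symmetric], auto simp: ennreal_mult mult.assoc)
 also have "\<dots> \<le> (\<integral>\<^sup>+b. ennreal \<bar>g b\<bar> * ennreal \<kappa> \<partial>L)" by (intro nn_integral_mono mult_left_mono k) auto
 also have "\<dots> = ennreal (mass * \<kappa>)" using k(1) mass_nonneg by (simp add: nn_integral_multc mass_nn ennreal_mult)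
 finally show ?thesis using k(1) mass_nonneg by (intro exI[of _ "mass * \<kappa>"]) auto
qed

lemma pot_AE: "AE x in lborel. integrable L (\<lambda>b. g b *\<^sub>R Ke 0 (x - Y b))"
proof -
 have "AE x in lborel. x \<in> cball 0 (real n) \<longrightarrow> integrable L (\<lambda>b. g b *\<^sub>R Ke 0 (x - Y b))" for n
 proof -
  obtain \<kappa> where "(\<integral>\<^sup>+x. (\<integral>\<^sup>+b. ennreal (\<bar>g b\<bar> * norm (x - Y b) powr (- 1)) \<partial>L) * indicator (cball 0 (real n)) x \<partial>lborel) \<le> ennreal \<kappa>"
   using potential_local[of 1 "real n"] by auto
  then have f: "(\<integral>\<^sup>+x. (\<integral>\<^sup>+b. ennreal (\<bar>g b\<bar> * norm (x - Y b) powr (- 1)) \<partial>L) * indicator (cball 0 (real n)) x \<partial>lborel) \<noteq> \<infinity>"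
   by (auto simp: top_unique)
  have "AE x in lborel. (\<integral>\<^sup>+b. ennreal (\<bar>g b\<bar> * norm (x - Y b) powr (- 1)) \<partial>L) * indicator (cball 0 (real n)) x \<noteq> \<infinity>"
   by (rule nn_integral_PInf_AE[OF _ f]) measurable
  then show ?thesis
  proof eventually_elim
   case (elim x)
   show ?case
   proof
    assume "x \<in> cball 0 (real n)"
    with elim have fin: "(\<integral>\<^sup>+b. ennreal (\<bar>g b\<bar> * norm (x - Y b) powr (- 1)) \<partial>L) < \<infinity>" by (simp add: less_top[symmetric])
    have "norm (g b *\<^sub>R Ke 0 (x - Y b)) \<le> \<bar>g b\<bar> * norm (x - Y b) powr (- 1)" for b
     using mult_left_mono[OF norm_Ke_powr[of 1 0 "x - Y b"], of "\<bar>g b\<bar>"] by simp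
    then have "(\<integral>\<^sup>+b. ennreal (norm (g b *\<^sub>R Ke 0 (x - Y b))) \<partial>L) \<le> (\<integral>\<^sup>+b. ennreal (\<bar>g b\<bar> * norm (x - Y b) powr (- 1)) \<partial>L)"
     by (intro nn_integral_mono ennreal_leI)
    also note fin
    finally show "integrable L (\<lambda>b. g b *\<^sub>R Ke 0 (x - Y b))" by (intro integrableI_bounded) simp_all
   qed
  qed
 qed
 then have "AE x in lborel. \<forall>n. x \<in> cball 0 (real n) \<longrightarrow> integrable L (\<lambda>b. g b *\<^sub>R Ke 0 (x - Y b))"
  by (simp only: AE_all_countable) simp
 then show ?thesis
 proof eventually_elim
  case (elim x)
  obtain n where "norm x \<le> real n" using real_arch_simple by blast
  with elim show ?case by auto
 qed
qed

text \<open>Jensen's inequality for the finite measure \<open>|g| dL\<close>, in the form of Young's inequality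
 at the optimal scale.\<close>

lemma pot_powr:
 assumes q: "1 \<le> q" and i: "integrable L (\<lambda>b. g b *\<^sub>R Ke 0 (x - Y b))"
 shows "ennreal (norm (pot L g Y (Ke 0) x) powr q) \<le> ennreal ((mass + 1) powr (q - 1)) * (\<integral>\<^sup>+b. ennreal (\<bar>g b\<bar> * norm (x - Y b) powr (- q)) \<partial>L)"
proof (cases "q = 1 \<or> pot L g Y (Ke 0) x = 0")
 case True
 then show ?thesis
 proof
  assume "q = 1"
  have "mass + 1 > 0" by (rule add_nonneg_pos[OF mass_nonneg zero_less_one])
  moreover have "ennreal (norm (pot L g Y (Ke 0) x)) \<le> (\<integral>\<^sup>+b. ennreal (\<bar>g b\<bar> * norm (x - Y b) powr (- 1)) \<partial>L)"
   using order_trans[OF norm_pot_le_nn[OF borel_measurable_Ke, of 0 x] nn_integral_mono[OF ennreal_leI[OF mult_left_mono[OF norm_Ke_powr[of 1 0, simplified] abs_ge_zero]]]] by simp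
  ultimately show ?thesis using \<open>q = 1\<close> by simp
 qed simp
next
 case False
 then have q1: "q > 1" using q by simp
 define S where "S = norm (pot L g Y (Ke 0) x)"
 define M where "M = mass + 1"
 have S: "S > 0" using False by (simp add: S_def)
 have M: "M > 0" "mass \<le> M" unfolding M_def by (rule add_nonneg_pos[OF mass_nonneg zero_less_one]) simp
 define s where "s = S / M"
 have s: "s > 0" using S M by (simp add: s_def)
 define k where "k b = norm (Ke 0 (x - Y b))" for b
 have [measurable]: "k \<in> borel_measurable L" unfolding k_def by measurable
 have ik: "integrable L (\<lambda>b. \<bar>g b\<bar> * k b)" using integrable_norm[OF i] by (simp add: k_def)
 have Sk: "S \<le> (LINT b|L. \<bar>g b\<bar> * k b)"
  unfolding S_def pot_def k_def using integral_norm_bound[of L "\<lambda>b. g b *\<^sub>R Ke 0 (x - Y b)"] by simp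
 have y: "q * s powr (q - 1) * t \<le> t powr q + (q - 1) * s powr q" if "t \<ge> 0" for t
 proof -
  have "t * s powr (q - 1) \<le> t powr q / q + (s powr (q - 1)) powr (q / (q - 1)) / (q / (q - 1))"
   using q1 that s by (intro Youngs_inequality) (auto simp: field_simps)
  also have "(s powr (q - 1)) powr (q / (q - 1)) = s powr q" using q1 by (simp add: powr_powr)
  finally have "q * (t * s powr (q - 1)) \<le> q * (t powr q / q + s powr q / (q / (q - 1)))" using q1 by (intro mult_left_mono) auto
  also have "\<dots> = t powr q + (q - 1) * s powr q" using q1 by (simp add: field_simps)
  finally show ?thesis by (simp add: mult_ac)
 qed
 show ?thesis
 proof (cases "(\<integral>\<^sup>+b. ennreal (\<bar>g b\<bar> * k b powr q) \<partial>L) = \<infinity>")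
  case inf: True
  have "(\<integral>\<^sup>+b. ennreal (\<bar>g b\<bar> * k b powr q) \<partial>L) \<le> (\<integral>\<^sup>+b. ennreal (\<bar>g b\<bar> * norm (x - Y b) powr (- q)) \<partial>L)"
   using q1 by (intro nn_integral_mono ennreal_leI mult_left_mono) (auto simp: k_def intro: norm_Ke_powr)
  then have t: "(\<integral>\<^sup>+b. ennreal (\<bar>g b\<bar> * norm (x - Y b) powr (- q)) \<partial>L) = \<infinity>" using inf by (simp add: top_unique)
  have "ennreal ((mass + 1) powr (q - 1)) \<noteq> 0" using M(1) by (simp add: M_def[symmetric])
  then show ?thesis unfolding t by (simp add: ennreal_mult_top)
 next
  case fin: False
  have iq: "integrable L (\<lambda>b. \<bar>g b\<bar> * k b powr q)"
   using fin by (intro integrableI_bounded) (auto simp: less_top)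
  have "q * s powr (q - 1) * S \<le> q * s powr (q - 1) * (LINT b|L. \<bar>g b\<bar> * k b)"
   using Sk q1 by (intro mult_left_mono) auto
  also have "\<dots> = (LINT b|L. q * s powr (q - 1) * (\<bar>g b\<bar> * k b))" by simp
  also have "\<dots> \<le> (LINT b|L. \<bar>g b\<bar> * k b powr q + (q - 1) * s powr q * \<bar>g b\<bar>)"
  proof (rule integral_mono)
   show "integrable L (\<lambda>b. q * s powr (q - 1) * (\<bar>g b\<bar> * k b))" using ik by simp
   show "integrable L (\<lambda>b. \<bar>g b\<bar> * k b powr q + (q - 1) * s powr q * \<bar>g b\<bar>)" using iq g_int by auto
   show "q * s powr (q - 1) * (\<bar>g b\<bar> * k b) \<le> \<bar>g b\<bar> * k b powr q + (q - 1) * s powr q * \<bar>g b\<bar>" for b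
    using mult_left_mono[OF y[of "k b"], of "\<bar>g b\<bar>"] by (simp add: k_def algebra_simps)
  qed
  also have "\<dots> = (LINT b|L. \<bar>g b\<bar> * k b powr q) + (q - 1) * s powr q * mass" using iq g_int by simp
  also have "\<dots> \<le> (LINT b|L. \<bar>g b\<bar> * k b powr q) + (q - 1) * s powr q * M"
   using M q1 by (intro add_left_mono mult_left_mono) auto
  finally have le: "q * s powr (q - 1) * S \<le> (LINT b|L. \<bar>g b\<bar> * k b powr q) + (q - 1) * s powr q * M" .
  have sS: "s powr q * M = s powr (q - 1) * S"
  proof -
   have "s powr q = s powr (q - 1) * s" using s powr_add[of s "q - 1" 1] by simp
   then show ?thesis using M by (simp add: s_def)
  qed
  have "s powr (q - 1) * S \<le> (LINT b|L. \<bar>g b\<bar> * k b powr q)"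
  proof -
   have 1: "(q - 1) * s powr q * M = (q - 1) * (s powr (q - 1) * S)" using sS by (simp only: mult.assoc)
   have 2: "q * s powr (q - 1) * S = (q - 1) * (s powr (q - 1) * S) + s powr (q - 1) * S" by (simp add: algebra_simps)
   show ?thesis using le unfolding 1 2 by linarith
  qed
  then have "M powr (q - 1) * (s powr (q - 1) * S) \<le> M powr (q - 1) * (LINT b|L. \<bar>g b\<bar> * k b powr q)"
   by (rule mult_left_mono) simp
  moreover have "M powr (q - 1) * (s powr (q - 1) * S) = S powr q"
  proof -
   have "M powr (q - 1) * s powr (q - 1) = S powr (q - 1)" using M S by (simp add: powr_mult[symmetric] s_def)
   then have "M powr (q - 1) * (s powr (q - 1) * S) = S powr (q - 1) * S" by (simp add: mult.assoc[symmetric])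
   also have "\<dots> = S powr q" using S powr_add[of S "q - 1" 1] by simp
   finally show ?thesis .
  qed
  ultimately have "ennreal (S powr q) \<le> ennreal (M powr (q - 1) * (LINT b|L. \<bar>g b\<bar> * k b powr q))" by (intro ennreal_leI) simp
  also have "\<dots> = ennreal (M powr (q - 1)) * (\<integral>\<^sup>+b. ennreal (\<bar>g b\<bar> * k b powr q) \<partial>L)"
   using nn_integral_eq_integral[OF iq] by (simp add: ennreal_mult'[symmetric] del: ennreal_mult'')
  also have "\<dots> \<le> ennreal (M powr (q - 1)) * (\<integral>\<^sup>+b. ennreal (\<bar>g b\<bar> * norm (x - Y b) powr (- q)) \<partial>L)"
   using q1 by (intro mult_left_mono nn_integral_mono ennreal_leI) (auto simp: k_def intro: norm_Ke_powr)
  finally show ?thesis by (simp add: S_def M_def)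
 qed
qed

lemma pot_Lq:
 assumes q: "1 \<le> q" "q < 2"
 shows "(\<integral>\<^sup>+x. ennreal (norm (pot L g Y (Ke 0) x) powr q) * indicator (cball 0 R) x \<partial>lborel) < \<infinity>"
proof -
 obtain \<kappa> where k: "(\<integral>\<^sup>+x. (\<integral>\<^sup>+b. ennreal (\<bar>g b\<bar> * norm (x - Y b) powr (- q)) \<partial>L) * indicator (cball 0 R) x \<partial>lborel) \<le> ennreal \<kappa>"
  using potential_local[of q R] q by auto
 have [measurable]: "cball (0::plane) R \<in> sets borel" by simp
 have "(\<integral>\<^sup>+x. ennreal (norm (pot L g Y (Ke 0) x) powr q) * indicator (cball 0 R) x \<partial>lborel) \<le>
  (\<integral>\<^sup>+x. ennreal ((mass + 1) powr (q - 1)) * ((\<integral>\<^sup>+b. ennreal (\<bar>g b\<bar> * norm (x - Y b) powr (- q)) \<partial>L) * indicator (cball 0 R) x) \<partial>lborel)"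
 proof (rule nn_integral_mono_AE)
  show "AE x in lborel. ennreal (norm (pot L g Y (Ke 0) x) powr q) * indicator (cball 0 R) x \<le> ennreal ((mass + 1) powr (q - 1)) * ((\<integral>\<^sup>+b. ennreal (\<bar>g b\<bar> * norm (x - Y b) powr (- q)) \<partial>L) * indicator (cball 0 R) x)"
   using pot_AE
  proof eventually_elim
   case (elim x)
   from mult_right_mono[OF pot_powr[OF q(1) elim], of "indicator (cball 0 R) x"] show ?case by (simp add: mult.assoc)
  qed
 qed
 also have "\<dots> = ennreal ((mass + 1) powr (q - 1)) * (\<integral>\<^sup>+x. (\<integral>\<^sup>+b. ennreal (\<bar>g b\<bar> * norm (x - Y b) powr (- q)) \<partial>L) * indicator (cball 0 R) x \<partial>lborel)"
  by (rule nn_integral_cmult) measurable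
 also have "\<dots> < \<infinity>" using k by (auto simp: ennreal_mult_less_top intro: le_less_trans)
 finally show ?thesis .
qed

text \<open>Fubini reduces a tested potential to the tested kernel.\<close>

lemma pot_tested:
 assumes D [measurable]: "D \<in> borel_measurable borel" and DB: "\<And>x. \<bar>D x\<bar> \<le> B" "\<And>x. norm x > R \<Longrightarrow> D x = 0"
 shows "integrable lborel (\<lambda>x. pot L g Y (Ke 0) x $ i * D x)"
  "integrable L (\<lambda>b. g b * (LINT x|lborel. Ke 0 (x - Y b) $ i * D x))"
  "(LINT x|lborel. pot L g Y (Ke 0) x $ i * D x) = (LINT b|L. g b * (LINT x|lborel. Ke 0 (x - Y b) $ i * D x))"
proof -
 interpret P: pair_sigma_finite lborel L ..
 have B: "B \<ge> 0" using order_trans[OF abs_ge_zero DB(1)] .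
 have [measurable]: "cball (0::plane) R \<in> sets borel" by simp
 define F where "F x b = g b * Ke 0 (x - Y b) $ i * D x" for x b
 have [measurable]: "(\<lambda>(x, b). F x b) \<in> borel_measurable (lborel \<Otimes>\<^sub>M L)" unfolding F_def case_prod_beta' by measurable
 obtain \<kappa> where k: "(\<integral>\<^sup>+x. (\<integral>\<^sup>+b. ennreal (\<bar>g b\<bar> * norm (x - Y b) powr (- 1)) \<partial>L) * indicator (cball 0 R) x \<partial>lborel) \<le> ennreal \<kappa>"
  using potential_local[of 1 R] by auto
 have FI: "integrable (lborel \<Otimes>\<^sub>M L) (\<lambda>(x, b). F x b)"
 proof (rule integrableI_bounded)
  have "(\<integral>\<^sup>+z. ennreal (norm (case z of (x, b) \<Rightarrow> F x b)) \<partial>(lborel \<Otimes>\<^sub>M L)) = (\<integral>\<^sup>+x. (\<integral>\<^sup>+b. ennreal \<bar>F x b\<bar> \<partial>L) \<partial>lborel)"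
   by (subst nn_integral_fst[symmetric]) (simp_all add: case_prod_beta')
  also have "\<dots> \<le> (\<integral>\<^sup>+x. ennreal B * ((\<integral>\<^sup>+b. ennreal (\<bar>g b\<bar> * norm (x - Y b) powr (- 1)) \<partial>L) * indicator (cball 0 R) x) \<partial>lborel)"
  proof (rule nn_integral_mono)
   fix x
   show "(\<integral>\<^sup>+b. ennreal \<bar>F x b\<bar> \<partial>L) \<le> ennreal B * ((\<integral>\<^sup>+b. ennreal (\<bar>g b\<bar> * norm (x - Y b) powr (- 1)) \<partial>L) * indicator (cball 0 R) x)"
   proof (cases "norm x \<le> R")
    case True
    have "(\<integral>\<^sup>+b. ennreal \<bar>F x b\<bar> \<partial>L) \<le> (\<integral>\<^sup>+b. ennreal B * ennreal (\<bar>g b\<bar> * norm (x - Y b) powr (- 1)) \<partial>L)"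
    proof (rule nn_integral_mono)
     fix b
     have "\<bar>Ke 0 (x - Y b) $ i\<bar> \<le> norm (x - Y b) powr (- 1)"
      using component_le_norm_cart[of "Ke 0 (x - Y b)" i] norm_Ke_powr[of 1 0 "x - Y b"] by simp
     then have "\<bar>g b\<bar> * \<bar>Ke 0 (x - Y b) $ i\<bar> * \<bar>D x\<bar> \<le> \<bar>g b\<bar> * norm (x - Y b) powr (- 1) * B"
      by (intro mult_mono DB) auto
     then show "ennreal \<bar>F x b\<bar> \<le> ennreal B * ennreal (\<bar>g b\<bar> * norm (x - Y b) powr (- 1))"
      unfolding F_def abs_mult using B by (subst ennreal_mult[symmetric]) (auto intro!: ennreal_leI simp: mult.commute)
    qed
    also have "\<dots> = ennreal B * (\<integral>\<^sup>+b. ennreal (\<bar>g b\<bar> * norm (x - Y b) powr (- 1)) \<partial>L)" by (rule nn_integral_cmult) measurable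
    finally show ?thesis using True by simp
   qed (simp add: F_def DB)
  qed
  also have "\<dots> = ennreal B * (\<integral>\<^sup>+x. (\<integral>\<^sup>+b. ennreal (\<bar>g b\<bar> * norm (x - Y b) powr (- 1)) \<partial>L) * indicator (cball 0 R) x \<partial>lborel)"
   by (rule nn_integral_cmult) measurable
  also have "\<dots> < \<infinity>" using k by (auto simp: ennreal_mult_less_top intro: le_less_trans)
  finally show "(\<integral>\<^sup>+z. ennreal (norm (case z of (x, b) \<Rightarrow> F x b)) \<partial>(lborel \<Otimes>\<^sub>M L)) < \<infinity>" .
 qed measurable
 have ae: "AE x in lborel. (LINT b|L. F x b) = pot L g Y (Ke 0) x $ i * D x"
  using pot_AE
 proof eventually_elim
  case (elim x)
  have "pot L g Y (Ke 0) x $ i = (LINT b|L. g b * Ke 0 (x - Y b) $ i)"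
   unfolding pot_def using integral_bounded_linear[OF bounded_linear_vec_nth elim, of i] by simp
  then show ?case by (simp add: F_def)
 qed
 have m: "(\<lambda>x. pot L g Y (Ke 0) x $ i * D x) \<in> borel_measurable lborel" by measurable
 have m': "(\<lambda>x. LINT b|L. F x b) \<in> borel_measurable lborel" by measurable
 show "integrable lborel (\<lambda>x. pot L g Y (Ke 0) x $ i * D x)"
  using P.integrable_fst'[OF FI] integrable_cong_AE[OF m' m ae] by simp
 have eqb: "(LINT x|lborel. F x b) = g b * (LINT x|lborel. Ke 0 (x - Y b) $ i * D x)" for b
  unfolding F_def by (simp add: mult.assoc)
 show "integrable L (\<lambda>b. g b * (LINT x|lborel. Ke 0 (x - Y b) $ i * D x))"
  using P.integrable_snd[OF FI] unfolding eqb .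
 have "(LINT x|lborel. pot L g Y (Ke 0) x $ i * D x) = (LINT x|lborel. LINT b|L. F x b)"
  by (rule integral_cong_AE[OF m m']) (use ae in auto)
 also have "\<dots> = (LINT b|L. LINT x|lborel. F x b)" by (rule P.Fubini_integral[OF FI, symmetric])
 finally show "(LINT x|lborel. pot L g Y (Ke 0) x $ i * D x) = (LINT b|L. g b * (LINT x|lborel. Ke 0 (x - Y b) $ i * D x))"
  unfolding eqb .
qed

lemma pot_div_curl:
 assumes \<psi>: "continuous_on UNIV \<psi>" "\<And>i. continuous_on UNIV (D i)" "R > 0"
  and der: "\<And>x i. ((\<lambda>s. \<psi> (x + s *\<^sub>R ax i)) has_real_derivative D i x) (at 0)"
  and supp: "\<And>x. norm x > R \<Longrightarrow> \<psi> x = 0" "\<And>x i. norm x > R \<Longrightarrow> D i x = 0"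
  and B: "\<And>x. \<bar>\<psi> x\<bar> \<le> B" "\<And>x i. \<bar>D i x\<bar> \<le> B"
 shows "(LINT x|lborel. pot L g Y (Ke 0) x $ 1 * D 1 x) + (LINT x|lborel. pot L g Y (Ke 0) x $ 2 * D 2 x) = 0"
  "(LINT x|lborel. pot L g Y (Ke 0) x $ 2 * D 1 x) - (LINT x|lborel. pot L g Y (Ke 0) x $ 1 * D 2 x) = - (LINT b|L. g b * \<psi> (Y b))"
proof -
 have Dm: "D i \<in> borel_measurable borel" for i using \<psi>(2) by (rule borel_measurable_continuous_onI)
 have t2: "integrable L (\<lambda>b. g b * (LINT x|lborel. Ke 0 (x - Y b) $ i * D j x))" for i j
  by (rule pot_tested(2)[where B=B and R=R]) (use Dm B supp in auto)
 have t3: "(LINT x|lborel. pot L g Y (Ke 0) x $ i * D j x) = (LINT b|L. g b * (LINT x|lborel. Ke 0 (x - Y b) $ i * D j x))" for i j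
  by (rule pot_tested(3)[where B=B and R=R]) (use Dm B supp in auto)
 have k: "(LINT x|lborel. Ke 0 (x - y) $ 1 * D 1 x) + (LINT x|lborel. Ke 0 (x - y) $ 2 * D 2 x) = 0"
  "(LINT x|lborel. Ke 0 (x - y) $ 2 * D 1 x) - (LINT x|lborel. Ke 0 (x - y) $ 1 * D 2 x) = - \<psi> y" for y
  by (rule kernel_div_curl(1)[where B=B and R=R and \<psi>=\<psi>], use assms in auto)
   (rule kernel_div_curl(2)[where B=B and R=R], use assms in auto)
 have "(LINT x|lborel. pot L g Y (Ke 0) x $ 1 * D 1 x) + (LINT x|lborel. pot L g Y (Ke 0) x $ 2 * D 2 x) =
  (LINT b|L. g b * ((LINT x|lborel. Ke 0 (x - Y b) $ 1 * D 1 x) + (LINT x|lborel. Ke 0 (x - Y b) $ 2 * D 2 x)))"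
  unfolding t3 distrib_left by (rule Bochner_Integration.integral_add[OF t2 t2, symmetric])
 then show "(LINT x|lborel. pot L g Y (Ke 0) x $ 1 * D 1 x) + (LINT x|lborel. pot L g Y (Ke 0) x $ 2 * D 2 x) = 0"
  unfolding k(1) by simp
 have "(LINT x|lborel. pot L g Y (Ke 0) x $ 2 * D 1 x) - (LINT x|lborel. pot L g Y (Ke 0) x $ 1 * D 2 x) =
  (LINT b|L. g b * ((LINT x|lborel. Ke 0 (x - Y b) $ 2 * D 1 x) - (LINT x|lborel. Ke 0 (x - Y b) $ 1 * D 2 x)))"
  unfolding t3 right_diff_distrib by (rule Bochner_Integration.integral_diff[OF t2 t2, symmetric])
 then show "(LINT x|lborel. pot L g Y (Ke 0) x $ 2 * D 1 x) - (LINT x|lborel. pot L g Y (Ke 0) x $ 1 * D 2 x) = - (LINT b|L. g b * \<psi> (Y b))"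
  unfolding k(2) by simp
qed

end

section \<open>Test functions on spacetime\<close>

lemma partial_mvt:
 fixes f :: "'a::euclidean_space \<Rightarrow> real"
 assumes D: "\<And>x. x \<in> S \<Longrightarrow> (f has_derivative (\<lambda>h. \<Sum>b\<in>Basis. (h \<bullet> b) * f' b x)) (at x within S)"
  and b: "b \<in> Basis" and fw: "\<And>s. s \<ge> 0 \<Longrightarrow> x + s *\<^sub>R b \<in> S" and s: "0 \<le> s"
 obtains \<xi> where "0 \<le> \<xi>" "\<xi> \<le> s" "f (x + s *\<^sub>R b) - f x = s * f' b (x + \<xi> *\<^sub>R b)"
proof -
 have "\<exists>\<xi>\<in>{0..s}. (\<lambda>s. f (x + s *\<^sub>R b)) s - (\<lambda>s. f (x + s *\<^sub>R b)) 0 = (\<lambda>h. f' b (x + \<xi> *\<^sub>R b) * h) (s - 0)"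
 proof (rule mvt_very_simple[OF s])
  fix \<xi> :: real assume "0 \<le> \<xi>" "\<xi> \<le> s"
  then have "((\<lambda>s. f (x + s *\<^sub>R b)) has_real_derivative f' b (x + \<xi> *\<^sub>R b)) (at \<xi> within {0..s})"
   by (intro partial_line[OF D b fw]) auto
  then show "((\<lambda>s. f (x + s *\<^sub>R b)) has_derivative (\<lambda>h. f' b (x + \<xi> *\<^sub>R b) * h)) (at \<xi> within {0..s})"
   by (simp add: has_field_derivative_def)
 qed
 then show ?thesis using that by (auto simp: mult.commute)
qed

text \<open>Two derivatives suffice: the second partial derivatives bound the Taylor remainders in space and
 time. Negative times carry the value \<open>0\<close>.\<close>

lemma (in scheme) test_spacetime:
 assumes \<phi>: "\<phi> \<in> test_functions spacetime"
 obtains \<phi>t d B R where "tested L g Y p A C m w0 (\<lambda>t x. if 0 \<le> t then \<phi> (t, x) else 0) \<phi>t d B R"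
  "\<And>t x. t > 0 \<Longrightarrow> deriv (\<lambda>s. \<phi> (s, x)) t = \<phi>t t x"
  "\<And>t x i. t \<ge> 0 \<Longrightarrow> grad (\<lambda>y. \<phi> (t, y)) x $ i = d i t x"
proof -
 define S where "S = spacetime"
 have "Ck_on (Suc (Suc 0)) S \<phi>" using \<phi> by (simp add: test_functions_def S_def del: Ck_on.simps)
 then obtain f' where f': "\<And>x. x \<in> S \<Longrightarrow> (\<phi> has_derivative (\<lambda>h. \<Sum>b\<in>Basis. (h \<bullet> b) * f' b x)) (at x within S)"
  and "\<forall>b\<in>Basis. Ck_on (Suc 0) S (f' b)" unfolding Ck_on.simps(2)[of "Suc 0"] by blast
 then have "\<forall>b\<in>Basis. \<exists>f''. (\<forall>x\<in>S. (f' b has_derivative (\<lambda>h. \<Sum>c\<in>Basis. (h \<bullet> c) * f'' c x)) (at x within S)) \<and> (\<forall>c\<in>Basis. continuous_on S (f'' c))"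
  by simp
 from bchoice[OF this] obtain f'' where "\<forall>b\<in>Basis. (\<forall>x\<in>S. (f' b has_derivative (\<lambda>h. \<Sum>c\<in>Basis. (h \<bullet> c) * f'' b c x)) (at x within S)) \<and> (\<forall>c\<in>Basis. continuous_on S (f'' b c))" ..
 then have f'': "\<And>b x. b \<in> Basis \<Longrightarrow> x \<in> S \<Longrightarrow> (f' b has_derivative (\<lambda>h. \<Sum>c\<in>Basis. (h \<bullet> c) * f'' b c x)) (at x within S)"
  "\<And>b c. b \<in> Basis \<Longrightarrow> c \<in> Basis \<Longrightarrow> continuous_on S (f'' b c)" by blast+
 have c\<phi>: "continuous_on S \<phi>" using f' by (rule has_derivative_continuous_on)
 have cf: "continuous_on S (f' b)" if "b \<in> Basis" for b using f''(1)[OF that] by (rule has_derivative_continuous_on)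
 obtain K where K: "compact K" "K \<subseteq> S" "\<And>x. x \<in> S - K \<Longrightarrow> \<phi> x = 0" using \<phi> by (auto simp: test_functions_def S_def)
 define et where "et = (1::real, 0::plane)"
 define ex where "ex i = (0::real, ax i)" for i
 have et: "et \<in> Basis" and ex: "ex i \<in> Basis" for i using ax_Basis by (auto simp: et_def ex_def Basis_prod_def)
 have fw: "x + s *\<^sub>R et \<in> S" if "x \<in> S" "s \<ge> 0" for x s using that by (auto simp: S_def et_def)
 have fx: "x + s *\<^sub>R ex i \<in> S" if "x \<in> S" for x s i using that by (auto simp: S_def ex_def)
 define T where "T = insert et (range ex)"
 have T: "finite T" "\<And>b. b \<in> T \<Longrightarrow> b \<in> Basis" using et ex by (auto simp: T_def)
 have TS: "x + s *\<^sub>R b \<in> S" if "b \<in> T" "x \<in> S" "s \<ge> 0" for b x s using that(1) fw[OF that(2,3)] fx[OF that(2), of s] unfolding T_def by (elim insertE rangeE) simp_all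
 have z1: "f' b x = 0" if "b \<in> T" "x \<in> S - K" for b x
  by (rule test_partial(1)[OF f' cf K T(2)[OF that(1)] TS[OF that(1)] that(2)])
 have "\<forall>b\<in>T. \<exists>B. B \<ge> 0 \<and> (\<forall>x\<in>S. \<bar>f' b x\<bar> \<le> B) \<and> (\<forall>c\<in>T. \<forall>x\<in>S. \<forall>s\<ge>0. \<bar>f' b (x + s *\<^sub>R c) - f' b x\<bar> \<le> B * s)"
 proof
  fix b assume b: "b \<in> T"
  obtain B0 where B0: "B0 \<ge> 0" "\<forall>x\<in>S. \<bar>f' b x\<bar> \<le> B0"
   using test_partial(2)[OF f' cf K T(2)[OF b] TS[OF b]] by blast
  have "\<forall>c\<in>T. \<exists>B. B \<ge> 0 \<and> (\<forall>x\<in>S. \<forall>s\<ge>0. \<bar>f' b (x + s *\<^sub>R c) - f' b x\<bar> \<le> B * s)"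
  proof
   fix c assume c: "c \<in> T"
   show "\<exists>B. B \<ge> 0 \<and> (\<forall>x\<in>S. \<forall>s\<ge>0. \<bar>f' b (x + s *\<^sub>R c) - f' b x\<bar> \<le> B * s)"
    using test_partial(2)[OF f''(1)[OF T(2)[OF b]] f''(2)[OF T(2)[OF b]] K(1,2) z1[OF b] T(2)[OF c] TS[OF c]] by blast
  qed
  from bchoice[OF this] obtain B1 where "\<forall>c\<in>T. B1 c \<ge> 0 \<and> (\<forall>x\<in>S. \<forall>s\<ge>0. \<bar>f' b (x + s *\<^sub>R c) - f' b x\<bar> \<le> B1 c * s)" by blast
  then have B1: "\<And>c. c \<in> T \<Longrightarrow> B1 c \<ge> 0 \<and> (\<forall>x\<in>S. \<forall>s\<ge>0. \<bar>f' b (x + s *\<^sub>R c) - f' b x\<bar> \<le> B1 c * s)" by blast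
  have le: "B1 c \<le> B0 + (\<Sum>c\<in>T. B1 c)" if "c \<in> T" for c
   using member_le_sum[of c T B1] that T(1) B1 B0(1) by auto
  show "\<exists>B. B \<ge> 0 \<and> (\<forall>x\<in>S. \<bar>f' b x\<bar> \<le> B) \<and> (\<forall>c\<in>T. \<forall>x\<in>S. \<forall>s\<ge>0. \<bar>f' b (x + s *\<^sub>R c) - f' b x\<bar> \<le> B * s)"
  proof (intro exI[of _ "B0 + (\<Sum>c\<in>T. B1 c)"] conjI ballI allI impI)
   have nn: "(\<Sum>c\<in>T. B1 c) \<ge> 0" using B1 by (intro sum_nonneg) auto
   then show "0 \<le> B0 + (\<Sum>c\<in>T. B1 c)" using B0(1) by simp
   show "\<bar>f' b x\<bar> \<le> B0 + (\<Sum>c\<in>T. B1 c)" if "x \<in> S" for x using order_trans[OF bspec[OF B0(2) that], of "B0 + (\<Sum>c\<in>T. B1 c)"] nn by simp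
   fix c x and s :: real assume c: "c \<in> T" and x: "x \<in> S" and s: "0 \<le> s"
   have "\<bar>f' b (x + s *\<^sub>R c) - f' b x\<bar> \<le> B1 c * s" using B1[OF c] x s by blast
   with mult_right_mono[OF le[OF c] s] show "\<bar>f' b (x + s *\<^sub>R c) - f' b x\<bar> \<le> (B0 + (\<Sum>c\<in>T. B1 c)) * s" by linarith
  qed
 qed
 from bchoice[OF this] obtain B2 where "\<forall>b\<in>T. B2 b \<ge> 0 \<and> (\<forall>x\<in>S. \<bar>f' b x\<bar> \<le> B2 b) \<and> (\<forall>c\<in>T. \<forall>x\<in>S. \<forall>s\<ge>0. \<bar>f' b (x + s *\<^sub>R c) - f' b x\<bar> \<le> B2 b * s)" ..
 then have B2: "\<And>b. b \<in> T \<Longrightarrow> B2 b \<ge> 0" "\<And>b x. b \<in> T \<Longrightarrow> x \<in> S \<Longrightarrow> \<bar>f' b x\<bar> \<le> B2 b"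
  "\<And>b c x s. b \<in> T \<Longrightarrow> c \<in> T \<Longrightarrow> x \<in> S \<Longrightarrow> s \<ge> 0 \<Longrightarrow> \<bar>f' b (x + s *\<^sub>R c) - f' b x\<bar> \<le> B2 b * s" by blast+
 obtain B3 where B3: "\<And>x. x \<in> S \<Longrightarrow> \<bar>\<phi> x\<bar> \<le> B3" "B3 \<ge> 0"
 proof -
  have "bounded (\<phi> ` K)" using compact_continuous_image[OF continuous_on_subset[OF c\<phi> K(2)] K(1)] by (rule compact_imp_bounded)
  then obtain b where b: "\<And>x. x \<in> K \<Longrightarrow> \<bar>\<phi> x\<bar> \<le> b" by (auto simp: bounded_iff)
  have "\<bar>\<phi> x\<bar> \<le> max b 0" if "x \<in> S" for x
  proof (cases "x \<in> K")
   case True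
   then show ?thesis using b[of x] by simp
  qed (use K(3) that in auto)
  then show ?thesis using that[of "max b 0"] by auto
 qed
 define B1 where "B1 = B3 + (\<Sum>b\<in>T. B2 b)"
 have nn: "(\<Sum>b\<in>T. B2 b) \<ge> 0" using B2(1) by (intro sum_nonneg) auto
 have B1: "B1 \<ge> 0" "B3 \<le> B1" "\<And>b. b \<in> T \<Longrightarrow> B2 b \<le> B1"
  using member_le_sum[of _ T B2] nn B2(1) B3(2) T(1) by (auto simp: B1_def add_increasing)
 have fb: "\<bar>f' b x\<bar> \<le> B1" if "b \<in> T" "x \<in> S" for b x using order_trans[OF B2(2)[OF that] B1(3)[OF that(1)]] .
 have fl: "\<bar>f' b (x + s *\<^sub>R c) - f' b x\<bar> \<le> B1 * s" if "b \<in> T" "c \<in> T" "x \<in> S" "s \<ge> 0" for b c x s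
  using order_trans[OF B2(3)[OF that] mult_right_mono[OF B1(3)[OF that(1)] that(4)]] .
 define B where "B = 2 * B1"
 have B1B: "B1 \<le> B" using B1 by (simp add: B_def)
 obtain R0 where R0: "\<And>z. z \<in> K \<Longrightarrow> norm z \<le> R0" using compact_imp_bounded[OF K(1)] by (auto simp: bounded_iff)
 define R where "R = \<bar>R0\<bar> + 1"
 have far: "(t, x) \<notin> K" if "t \<ge> R \<or> norm x > R" for t x
 proof
  assume "(t, x) \<in> K"
  then have "norm (t, x) \<le> R0" by (rule R0)
  moreover have "\<bar>t\<bar> \<le> norm (t, x)" "norm x \<le> norm (t, x)" using norm_fst_le[of t x] norm_snd_le[of x t] by auto
  ultimately show False using that by (auto simp: R_def)
 qed
 have eT: "et \<in> T" "ex i \<in> T" for i by (auto simp: T_def)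
 have SI: "(t, x) \<in> S" if "t \<ge> 0" for t x using that by (simp add: S_def)
 define \<phi>t where "\<phi>t t x = (if 0 \<le> t then f' et (t, x) else 0)" for t x
 define d where "d i t x = (if 0 \<le> t then f' (ex i) (t, x) else 0)" for i t x
 have Sm: "S \<in> sets borel" unfolding S_def by (simp add: closed_Times)
 have meas: "(\<lambda>(t, x). if 0 \<le> t then f (t, x) else 0) \<in> borel_measurable (borel \<Otimes>\<^sub>M borel)" if "continuous_on S f" for f :: "real \<times> plane \<Rightarrow> real"
 proof -
  have "(\<lambda>z. indicator S z *\<^sub>R f z) \<in> borel_measurable borel"
   by (rule borel_measurable_continuous_on_indicator[OF Sm that])
  moreover have "(\<lambda>z. indicator S z *\<^sub>R f z) = (\<lambda>(t, x). if 0 \<le> t then f (t, x) else 0)"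
   by (auto simp: fun_eq_iff S_def)
  ultimately show ?thesis by (simp add: borel_prod)
 qed
 have lip: "\<bar>f' b (x + s *\<^sub>R ex i) - f' b x\<bar> \<le> B1 * \<bar>s\<bar>" if "b \<in> T" "x \<in> S" for b x s i
 proof (cases "s \<ge> 0")
  case False
  then show ?thesis using fl[OF that(1) eT(2)[of i] fx[OF that(2), of s i], of "- s"] by simp
 qed (use fl[OF that(1) eT(2) that(2)] in simp)
 have tay0: "\<bar>\<phi> (x + s *\<^sub>R ex i) - \<phi> x - s * f' (ex i) x\<bar> \<le> B1 * s\<^sup>2" if x: "x \<in> S" and s: "s \<ge> 0" for x s i
 proof -
  obtain \<xi> where xi: "0 \<le> \<xi>" "\<xi> \<le> s" and e: "\<phi> (x + s *\<^sub>R ex i) - \<phi> x = s * f' (ex i) (x + \<xi> *\<^sub>R ex i)"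
   by (rule partial_mvt[OF f' ex fx[OF x] s])
  have 1: "B1 * \<bar>\<xi>\<bar> \<le> B1 * s" using xi B1(1) by (intro mult_left_mono) auto
  have "\<bar>f' (ex i) (x + \<xi> *\<^sub>R ex i) - f' (ex i) x\<bar> \<le> B1 * s" using order_trans[OF lip[OF eT(2) x] 1] .
  then have 2: "s * \<bar>f' (ex i) (x + \<xi> *\<^sub>R ex i) - f' (ex i) x\<bar> \<le> s * (B1 * s)" using s by (rule mult_left_mono)
  have 3: "\<phi> (x + s *\<^sub>R ex i) - \<phi> x - s * f' (ex i) x = s * (f' (ex i) (x + \<xi> *\<^sub>R ex i) - f' (ex i) x)"
   unfolding e by (simp add: right_diff_distrib)
  show ?thesis unfolding 3 abs_mult using 2 s by (simp add: power2_eq_square mult_ac)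
 qed
 have tay: "\<bar>\<phi> (x + s *\<^sub>R ex i) - \<phi> x - s * f' (ex i) x\<bar> \<le> B * s\<^sup>2" if x: "x \<in> S" for x s i
 proof (cases "s \<ge> 0")
  case True
  show ?thesis using order_trans[OF tay0[OF x True] mult_right_mono[OF B1B zero_le_power2]] .
 next
  case False
  define y where "y = x + s *\<^sub>R ex i"
  have y: "y \<in> S" "y + (- s) *\<^sub>R ex i = x" using fx[OF x] by (auto simp: y_def)
  have 1: "\<bar>\<phi> x - \<phi> y - (- s) * f' (ex i) y\<bar> \<le> B1 * s\<^sup>2" using tay0[OF y(1), of "- s" i] False y(2) by simp
  have "\<bar>f' (ex i) y - f' (ex i) x\<bar> \<le> B1 * \<bar>s\<bar>" unfolding y_def by (rule lip[OF eT(2) x])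
  then have "\<bar>s\<bar> * \<bar>f' (ex i) y - f' (ex i) x\<bar> \<le> \<bar>s\<bar> * (B1 * \<bar>s\<bar>)" by (rule mult_left_mono) simp
  then have 2: "\<bar>s * f' (ex i) y - s * f' (ex i) x\<bar> \<le> B1 * s\<^sup>2"
   unfolding right_diff_distrib[symmetric] abs_mult by (simp add: power2_eq_square mult_ac)
  have "\<bar>\<phi> y - \<phi> x - s * f' (ex i) x\<bar> \<le> B1 * s\<^sup>2 + B1 * s\<^sup>2" using 1 2 by (simp only: abs_le_iff) linarith
  then show ?thesis by (simp add: y_def B_def)
 qed
 have et_add: "(t, x) + s *\<^sub>R et = (t + s, x)" for t s x by (simp add: et_def)
 have ex_add: "(t, x) + s *\<^sub>R ex i = (t, x + s *\<^sub>R ax i)" for t s x i by (simp add: ex_def)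
 show ?thesis
 proof (rule that[of \<phi>t d B R])
  show "tested L g Y p A C m w0 (\<lambda>t x. if 0 \<le> t then \<phi> (t, x) else 0) \<phi>t d B R"
  proof (intro tested.intro tested_axioms.intro scheme_axioms)
   show "0 \<le> B" "0 < R" using B1 by (auto simp: B_def R_def)
   show "(\<lambda>x. if 0 \<le> t then \<phi> (t, x) else 0) \<in> borel_measurable borel" for t
    using measurable_compose_Pair1[OF _ meas[OF c\<phi>], of t] by simp
   show "(\<lambda>(t, x). \<phi>t t x) \<in> borel_measurable (borel \<Otimes>\<^sub>M borel)" unfolding \<phi>t_def by (rule meas[OF cf[OF et]])
   show "(\<lambda>(t, x). d i t x) \<in> borel_measurable (borel \<Otimes>\<^sub>M borel)" for i unfolding d_def by (rule meas[OF cf[OF ex]])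
   show "\<bar>if 0 \<le> t then \<phi> (t, x) else 0\<bar> \<le> B" if "0 \<le> t" for t x
    using order_trans[OF order_trans[OF B3(1)[OF SI[OF that]] B1(2)] B1B] that by simp
   show "\<bar>\<phi>t t x\<bar> \<le> B" for t x
    using order_trans[OF fb[OF eT(1) SI] B1B] B1 by (auto simp: \<phi>t_def B_def)
   show "\<bar>d i t x\<bar> \<le> B" for i t x
    using order_trans[OF fb[OF eT(2) SI] B1B] B1 by (auto simp: d_def B_def)
   show "\<bar>(if 0 \<le> t then \<phi> (t, x + s *\<^sub>R ax i) else 0) - (if 0 \<le> t then \<phi> (t, x) else 0) - s * d i t x\<bar> \<le> B * s\<^sup>2" if "0 \<le> t" for t x s i
    using tay[OF SI[OF that, of x], of s i] that by (simp add: d_def ex_add)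
   show "\<bar>(if 0 \<le> s then \<phi> (s, x) else 0) - (if 0 \<le> t then \<phi> (t, x) else 0) - (s - t) * \<phi>t r x\<bar> \<le> B * (s - t)\<^sup>2"
    if "0 \<le> t" "t \<le> r" "r \<le> s" for t r s x
   proof -
    have st: "0 \<le> s - t" using that by simp
    note fwt = fw[OF SI[OF that(1)]]
    obtain \<xi> where xi: "0 \<le> \<xi>" "\<xi> \<le> s - t" and e: "\<phi> ((t, x) + (s - t) *\<^sub>R et) - \<phi> (t, x) = (s - t) * f' et ((t, x) + \<xi> *\<^sub>R et)"
     by (rule partial_mvt[OF f' et fwt st])
    have tl: "\<bar>f' et (t + \<xi>, x) - f' et (r, x)\<bar> \<le> B1 * (s - t)"
    proof (cases "r \<le> t + \<xi>")
     case True
     have "\<bar>f' et ((r, x) + (t + \<xi> - r) *\<^sub>R et) - f' et (r, x)\<bar> \<le> B1 * (t + \<xi> - r)"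
      using True that by (intro fl eT SI) auto
     moreover have "B1 * (t + \<xi> - r) \<le> B1 * (s - t)" using xi that B1(1) by (intro mult_left_mono) auto
     ultimately show ?thesis by (simp add: et_add)
    next
     case False
     have "\<bar>f' et ((t + \<xi>, x) + (r - (t + \<xi>)) *\<^sub>R et) - f' et (t + \<xi>, x)\<bar> \<le> B1 * (r - (t + \<xi>))"
      using False that xi by (intro fl eT SI) auto
     moreover have "B1 * (r - (t + \<xi>)) \<le> B1 * (s - t)" using xi that B1(1) by (intro mult_left_mono) auto
     ultimately show ?thesis by (simp add: et_add abs_minus_commute)
    qed
    have 3: "\<phi> (s, x) - \<phi> (t, x) - (s - t) * f' et (r, x) = (s - t) * (f' et (t + \<xi>, x) - f' et (r, x))"
     using e by (simp add: et_add right_diff_distrib)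
    have "\<bar>\<phi> (s, x) - \<phi> (t, x) - (s - t) * f' et (r, x)\<bar> \<le> B1 * (s - t)\<^sup>2"
     unfolding 3 abs_mult using mult_left_mono[OF tl st] st by (simp add: power2_eq_square mult_ac)
    with mult_right_mono[OF B1B zero_le_power2, of "s - t"]
    have "\<bar>\<phi> (s, x) - \<phi> (t, x) - (s - t) * f' et (r, x)\<bar> \<le> B * (s - t)\<^sup>2" by linarith
    then show ?thesis using that by (simp add: \<phi>t_def)
   qed
   show "\<bar>d i s x - d i t x\<bar> \<le> B * (s - t)" if "0 \<le> t" "t \<le> s" for i t s x
   proof -
    have "\<bar>f' (ex i) ((t, x) + (s - t) *\<^sub>R et) - f' (ex i) (t, x)\<bar> \<le> B1 * (s - t)" using that by (intro fl eT SI) auto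
    moreover have "B1 * (s - t) \<le> B * (s - t)" using that by (intro mult_right_mono[OF B1B]) auto
    ultimately show ?thesis using that by (simp add: d_def et_add)
   qed
   show "(if 0 \<le> t then \<phi> (t, x) else 0) = 0" if "R \<le> t" for t x using K(3)[of "(t, x)"] SI far that by auto
   show "\<phi>t t x = 0" if "R \<le> t" for t x using z1[OF eT(1), of "(t, x)"] SI far that by (auto simp: \<phi>t_def)
   show "d i t x = 0" if "R \<le> t" for i t x using z1[OF eT(2), of "(t, x)"] SI far that by (auto simp: d_def)
   show "\<phi>t t x = 0" if "t < 0" for t x using that by (simp add: \<phi>t_def)
   show "d i t x = 0" if "t < 0" for i t x using that by (simp add: d_def)
   show "\<phi>t t x = 0" if "R < norm x" for t x using z1[OF eT(1), of "(t, x)"] SI far that by (auto simp: \<phi>t_def)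
   show "d i t x = 0" if "R < norm x" for i t x using z1[OF eT(2), of "(t, x)"] SI far that by (auto simp: d_def)
  qed
  show "deriv (\<lambda>s. \<phi> (s, x)) t = \<phi>t t x" if "t > 0" for t x
  proof -
   have "((\<lambda>s. \<phi> ((0, x) + s *\<^sub>R et)) has_real_derivative f' et ((0, x) + t *\<^sub>R et)) (at t within {0<..})"
    by (rule partial_line[OF f' et]) (use that in \<open>auto simp: et_add S_def\<close>)
   then have "((\<lambda>s. \<phi> (s, x)) has_real_derivative f' et (t, x)) (at t)"
    using that at_within_open[of t "{0<..}"] by (simp add: et_add)
   then show ?thesis using that by (simp add: DERIV_imp_deriv \<phi>t_def)
  qed
  show "grad (\<lambda>y. \<phi> (t, y)) x $ i = d i t x" if "t \<ge> 0" for t x i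
  proof -
   have "((\<lambda>s. \<phi> ((t, x) + s *\<^sub>R ex i)) has_real_derivative f' (ex i) ((t, x) + 0 *\<^sub>R ex i)) (at 0 within UNIV)"
    by (rule partial_line[OF f' ex]) (use that in \<open>auto simp: ex_add S_def\<close>)
   then have "((\<lambda>s. \<phi> (t, x + s *\<^sub>R axis i 1)) has_real_derivative f' (ex i) (t, x)) (at 0)"
    by (simp add: ex_add)
   then show ?thesis using that by (simp add: DERIV_imp_deriv d_def grad_def)
  qed
 qed
qed

section \<open>Vorticity plus a bounded measure\<close>

text \<open>A signed measure becomes a charge on two copies of the plane, one for each part of its Jordan
 decomposition.\<close>

definition jm :: "(plane set \<Rightarrow> real) \<Rightarrow> (plane \<times> bool) measure" where
 "jm \<mu> = add_measure (distr (pos_part \<mu>) (borel \<Otimes>\<^sub>M count_space UNIV) (\<lambda>y. (y, True)))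
  (distr (neg_part \<mu>) (borel \<Otimes>\<^sub>M count_space UNIV) (\<lambda>y. (y, False)))"

definition sg :: "plane \<times> bool \<Rightarrow> real" where "sg z = (if snd z then 1 else - 1)"

lemma sets_neg_part [simp, measurable_cong]: "sets (neg_part \<nu>) = sets borel"
 by (simp add: neg_part_def)

lemma finite_neg_part: "\<nu> \<in> bounded_measures \<Longrightarrow> finite_measure (neg_part \<nu>)"
 unfolding neg_part_def by (intro finite_pos_part neg_bounded_measures)

lemma space_neg_part [simp]: "space (neg_part \<nu>) = UNIV"
 by (simp add: neg_part_def)

lemma sets_jm [simp, measurable_cong]: "sets (jm \<mu>) = sets (borel \<Otimes>\<^sub>M count_space UNIV)"
 by (simp add: jm_def)

lemma space_jm [simp]: "space (jm \<mu>) = UNIV"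
 using sets_eq_imp_space_eq[OF sets_jm] by (simp add: space_pair_measure)

lemma sg_meas [measurable]: "sg \<in> borel_measurable (borel \<Otimes>\<^sub>M count_space UNIV)"
 unfolding sg_def by measurable

lemma finite_jm:
 assumes \<mu>: "\<mu> \<in> bounded_measures" shows "finite_measure (jm \<mu>)"
proof (rule finite_measureI)
 interpret P: finite_measure "pos_part \<mu>" by (rule finite_pos_part[OF \<mu>])
 interpret N: finite_measure "neg_part \<mu>" by (rule finite_neg_part[OF \<mu>])
 have "UNIV \<in> sets (borel \<Otimes>\<^sub>M count_space (UNIV::bool set) :: (plane \<times> bool) measure)"
  using sets.top[of "borel \<Otimes>\<^sub>M count_space (UNIV::bool set) :: (plane \<times> bool) measure"] by (simp add: space_pair_measure)
 then show "emeasure (jm \<mu>) (space (jm \<mu>)) \<noteq> \<infinity>"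
  unfolding space_jm unfolding jm_def
  by (subst emeasure_add_measure) (simp_all add: emeasure_distr P.emeasure_eq_measure N.emeasure_eq_measure)
qed

lemma jm_charge:
 assumes \<mu>: "\<mu> \<in> bounded_measures" shows "charge (jm \<mu>) sg fst"
proof (intro charge.intro charge_axioms.intro)
 interpret J: finite_measure "jm \<mu>" by (rule finite_jm[OF \<mu>])
 show "sigma_finite_measure (jm \<mu>)" ..
 show "integrable (jm \<mu>) sg" by (rule J.integrable_const_bound[where B=1]) (auto simp: sg_def)
 show "fst \<in> jm \<mu> \<rightarrow>\<^sub>M borel" by measurable
qed

lemma jm_integral:
 fixes F :: "plane \<Rightarrow> 'v::euclidean_space"
 assumes [measurable]: "F \<in> borel_measurable borel"
 shows "integrable (jm \<mu>) (\<lambda>b. sg b *\<^sub>R F (fst b)) \<longleftrightarrow> integrable (pos_part \<mu>) F \<and> integrable (neg_part \<mu>) F"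
  "integrable (pos_part \<mu>) F \<Longrightarrow> integrable (neg_part \<mu>) F \<Longrightarrow>
   (LINT b|jm \<mu>. sg b *\<^sub>R F (fst b)) = (LINT y|pos_part \<mu>. F y) - (LINT y|neg_part \<mu>. F y)"
proof -
 let ?Q = "borel \<Otimes>\<^sub>M count_space UNIV :: (plane \<times> bool) measure"
 have f [measurable]: "(\<lambda>b. sg b *\<^sub>R F (fst b)) \<in> borel_measurable ?Q" by measurable
 have i: "integrable (distr (pos_part \<mu>) ?Q (\<lambda>y. (y, True))) (\<lambda>b. sg b *\<^sub>R F (fst b)) \<longleftrightarrow> integrable (pos_part \<mu>) F"
  "integrable (distr (neg_part \<mu>) ?Q (\<lambda>y. (y, False))) (\<lambda>b. sg b *\<^sub>R F (fst b)) \<longleftrightarrow> integrable (neg_part \<mu>) F"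
  by (simp_all add: integrable_distr_eq sg_def)
 show "integrable (jm \<mu>) (\<lambda>b. sg b *\<^sub>R F (fst b)) \<longleftrightarrow> integrable (pos_part \<mu>) F \<and> integrable (neg_part \<mu>) F"
  unfolding jm_def by (subst integrable_add_measure) (simp_all add: i)
 assume F: "integrable (pos_part \<mu>) F" "integrable (neg_part \<mu>) F"
 have "(LINT b|jm \<mu>. sg b *\<^sub>R F (fst b)) = (LINT b|distr (pos_part \<mu>) ?Q (\<lambda>y. (y, True)). sg b *\<^sub>R F (fst b)) + (LINT b|distr (neg_part \<mu>) ?Q (\<lambda>y. (y, False)). sg b *\<^sub>R F (fst b))"
  unfolding jm_def by (rule integral_add_measure) (simp_all add: i F)
 then show "(LINT b|jm \<mu>. sg b *\<^sub>R F (fst b)) = (LINT y|pos_part \<mu>. F y) - (LINT y|neg_part \<mu>. F y)"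
  by (simp add: integral_distr sg_def)
qed

text \<open>The positive and negative parts of the density, added to the Jordan parts of \<open>\<mu>\<close>, decompose the sum
 as a difference of finite measures, though not minimally.\<close>

lemma density_plus_integral:
 fixes F :: "plane \<Rightarrow> 'v::euclidean_space"
 assumes w: "integrable lborel w" and \<mu>: "\<mu> \<in> bounded_measures"
  and F [measurable]: "F \<in> borel_measurable borel"
  and i: "integrable lborel (\<lambda>y. w y *\<^sub>R F y)" "integrable (jm \<mu>) (\<lambda>b. sg b *\<^sub>R F (fst b))"
 shows "signed_integrable (density_plus w \<mu>) F"
  "signed_integral (density_plus w \<mu>) F = (LINT y|lborel. w y *\<^sub>R F y) + (LINT b|jm \<mu>. sg b *\<^sub>R F (fst b))"
proof -
 interpret P: finite_measure "pos_part \<mu>" by (rule finite_pos_part[OF \<mu>])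
 interpret N: finite_measure "neg_part \<mu>" by (rule finite_neg_part[OF \<mu>])
 have iPN: "integrable (pos_part \<mu>) F" "integrable (neg_part \<mu>) F" using i(2) jm_integral(1)[OF F] by auto
 have wm [measurable]: "w \<in> borel_measurable borel" using w by simp
 define D where "D s = density lborel (\<lambda>x. ennreal (max 0 (s * w x)))" for s
 have sD [simp]: "sets (D s) = sets borel" for s by (simp add: D_def)
 have fD: "finite_measure (D s)" for s
 proof (rule finite_measureI)
  have "emeasure (D s) (space (D s)) = (\<integral>\<^sup>+x. ennreal (max 0 (s * w x)) \<partial>lborel)"
   by (simp add: D_def emeasure_density cong: nn_integral_cong)
  also have "\<dots> = ennreal (LINT x|lborel. max 0 (s * w x))"
   using w by (intro nn_integral_eq_integral integrable_max) auto
  finally show "emeasure (D s) (space (D s)) \<noteq> \<infinity>" by simp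
 qed
 have mi: "max 0 (s * w x) \<le> \<bar>s\<bar> * \<bar>w x\<bar>" for s x by (auto simp: abs_mult[symmetric])
 have iD: "integrable (D s) G \<and> (LINT x|D s. G x) = (LINT x|lborel. max 0 (s * w x) *\<^sub>R G x) \<and> integrable lborel (\<lambda>x. max 0 (s * w x) *\<^sub>R G x)"
  if [measurable]: "G \<in> borel_measurable borel" and G: "integrable lborel (\<lambda>y. w y *\<^sub>R G y)" for s and G :: "plane \<Rightarrow> 'w::euclidean_space"
 proof -
  have "integrable lborel (\<lambda>y. s *\<^sub>R (w y *\<^sub>R G y))" by (intro integrable_scaleR_right G)
  then have 1: "integrable lborel (\<lambda>x. max 0 (s * w x) *\<^sub>R G x)"
   by (rule Bochner_Integration.integrable_bound) (auto intro!: AE_I2 mult_right_mono mi simp: mult.assoc[symmetric])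
  then show ?thesis unfolding D_def by (simp add: integrable_density integral_density)
 qed
 have sp: "max 0 (1 * w x) *\<^sub>R z - max 0 (- 1 * w x) *\<^sub>R z = w x *\<^sub>R z" for x and z :: "'w::euclidean_space"
  by (auto simp: max_def)
 define M where "M = add_measure (D 1) (pos_part \<mu>)"
 define N where "N = add_measure (D (- 1)) (neg_part \<mu>)"
 have fin: "finite_measure (add_measure K K')" if "finite_measure K" "finite_measure K'" "sets K = sets K'" for K K' :: "plane measure"
 proof (rule finite_measureI)
  interpret K: finite_measure K by (rule that)
  interpret K': finite_measure K' by (rule that)
  show "emeasure (add_measure K K') (space (add_measure K K')) \<noteq> \<infinity>"
   using that(3) sets.top[of K] by (simp add: emeasure_add_measure K.emeasure_eq_measure K'.emeasure_eq_measure)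
 qed
 have ms: "measure (add_measure K K') A = measure K A + measure K' A" if "finite_measure K" "finite_measure K'" "sets K = sets borel" "sets K' = sets borel" "A \<in> sets borel" for K K' :: "plane measure" and A
 proof -
  interpret K: finite_measure K by (rule that)
  interpret K': finite_measure K' by (rule that)
  show ?thesis using that unfolding measure_def
   by (simp add: emeasure_add_measure enn2real_plus less_top[symmetric])
 qed
 have val: "density_plus w \<mu> A = measure M A - measure N A" if A: "A \<in> sets borel" for A
 proof -
  have mA: "indicat_real A \<in> borel_measurable borel" using A by simp
  have iw: "integrable lborel (\<lambda>y. w y *\<^sub>R indicat_real A y)"
   using integrable_mult_indicator[OF _ w, of A] A by (simp add: mult.commute)
  have sAD: "measure (D s) A = (LINT x|lborel. max 0 (s * w x) *\<^sub>R indicat_real A x)" for s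
   using iD[OF mA iw, of s] sets_eq_imp_space_eq[OF sD[of s]] by simp
  have "(LINT x:A|lebesgue. w x) = (LINT x|lborel. w x *\<^sub>R indicat_real A x)"
   unfolding set_lebesgue_integral_def by (subst integral_completion) (use A in \<open>simp_all add: mult.commute\<close>)
  also have "\<dots> = (LINT x|lborel. max 0 (1 * w x) *\<^sub>R indicat_real A x - max 0 (- 1 * w x) *\<^sub>R indicat_real A x)"
   unfolding sp ..
  also have "\<dots> = measure (D 1) A - measure (D (- 1)) A"
   unfolding sAD by (rule Bochner_Integration.integral_diff) (rule iD[OF mA iw, THEN conjunct2, THEN conjunct2])+
  finally have e: "(LINT x:A|lebesgue. w x) = measure (D 1) A - measure (D (- 1)) A" .
  have "measure M A = measure (D 1) A + measure (pos_part \<mu>) A" "measure N A = measure (D (- 1)) A + measure (neg_part \<mu>) A"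
   unfolding M_def N_def by (rule ms; simp add: fD A P.finite_measure_axioms N.finite_measure_axioms)+
  then show ?thesis unfolding density_plus_def e jordan[OF \<mu> A] by simp
 qed
 have iM: "integrable M F" "integrable N F"
  unfolding M_def N_def using iD[OF F i(1)] iPN by (simp_all add: integrable_add_measure)
 have LM: "(LINT x|M. F x) = (LINT x|lborel. max 0 (1 * w x) *\<^sub>R F x) + (LINT x|pos_part \<mu>. F x)"
  "(LINT x|N. F x) = (LINT x|lborel. max 0 (- 1 * w x) *\<^sub>R F x) + (LINT x|neg_part \<mu>. F x)"
  unfolding M_def N_def using iD[OF F i(1)] iPN by (simp_all add: integral_add_measure)
 have dw: "(LINT x|lborel. max 0 (1 * w x) *\<^sub>R F x) - (LINT x|lborel. max 0 (- 1 * w x) *\<^sub>R F x) = (LINT x|lborel. w x *\<^sub>R F x)"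
  unfolding sp[symmetric] by (rule Bochner_Integration.integral_diff[symmetric]) (rule iD[OF F i(1), THEN conjunct2, THEN conjunct2])+
 have fMN: "finite_measure M" "finite_measure N" "sets M = sets borel" "sets N = sets borel"
  unfolding M_def N_def by (auto intro!: fin fD P.finite_measure_axioms N.finite_measure_axioms)
 show "signed_integrable (density_plus w \<mu>) F" by (rule signed_integral_difference(1)[OF fMN _ iM]) (rule val)
 have s: "signed_integral (density_plus w \<mu>) F = (LINT x|M. F x) - (LINT x|N. F x)"
  by (rule signed_integral_difference(2)[OF fMN _ iM]) (rule val)
 show "signed_integral (density_plus w \<mu>) F = (LINT y|lborel. w y *\<^sub>R F y) + (LINT b|jm \<mu>. sg b *\<^sub>R F (fst b))"
  unfolding s LM jm_integral(2)[OF F iPN] using dw by (simp add: algebra_simps)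
qed

text \<open>Near \<open>x\<close> the potential is small uniformly in \<open>x\<close>; the vorticity far from the origin has little mass;
 the remaining vorticity is at a large distance from \<open>x\<close>.\<close>

lemma vort_decay:
 assumes w: "vort p A w" and p: "p > 2" and A: "A \<ge> 0"
 shows "((\<lambda>x. pot lborel w (\<lambda>y. y) (Ke 0) x) \<longlongrightarrow> 0) at_infinity"
 unfolding Lim_at_infinity
proof (intro allI impI)
 fix e0 :: real assume e0: "e0 > 0"
 define e where "e = e0 / 4"
 have e: "e > 0" using e0 by (simp add: e_def)
 note [measurable] = vortD(1)[OF w]
 interpret charge lborel w "\<lambda>y. y" by (rule charge_lborel[OF vort_integrable[OF w]])
 obtain r where r: "r > 0" "\<And>x. (\<integral>\<^sup>+y. ennreal (\<bar>w y\<bar> / norm (x - y)) * indicator (cball x r) y \<partial>lborel) \<le> ennreal e"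
  using potential_small[OF p e, of A] vortD[OF w] by blast
 obtain \<rho> where rho: "\<rho> \<ge> 0" "(\<integral>\<^sup>+y. ennreal \<bar>w y\<bar> * indicator {y. norm y > \<rho>} y \<partial>lborel) \<le> ennreal (e * r)"
 proof -
  have i: "integrable lborel (\<lambda>y. \<bar>w y\<bar>)" using vort_integrable[OF w] by simp
  have "(\<lambda>n. LINT y|lborel. \<bar>w y\<bar> * indicator {y. norm y > real n} y) \<longlonglongrightarrow> (LINT y|(lborel::plane measure). 0)"
  proof (rule integral_dominated_convergence[OF _ _ i])
   show "AE y in lborel. (\<lambda>n. \<bar>w y\<bar> * indicator {y. norm y > real n} y) \<longlonglongrightarrow> 0"
   proof (rule AE_I2)
    fix y :: plane
    obtain k where "norm y \<le> real k" using real_arch_simple by blast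
    then have "\<forall>\<^sub>F n in sequentially. \<bar>w y\<bar> * indicator {y. norm y > real n} y = 0"
     by (intro eventually_sequentiallyI[of k]) (auto simp: indicator_def)
    then show "(\<lambda>n. \<bar>w y\<bar> * indicator {y. norm y > real n} y) \<longlonglongrightarrow> 0" by (rule tendsto_eventually)
   qed
  qed (auto intro!: AE_I2 simp: indicator_def)
  then have "(\<lambda>n. LINT y|lborel. \<bar>w y\<bar> * indicator {y. norm y > real n} y) \<longlonglongrightarrow> 0" by simp
  from LIMSEQ_D[OF this mult_pos_pos[OF e r(1)]] obtain n where "norm ((LINT y|lborel. \<bar>w y\<bar> * indicator {y. norm y > real n} y) - 0) < e * r" by blast
  then have n: "(LINT y|lborel. \<bar>w y\<bar> * indicator {y. norm y > real n} y) \<le> e * r" by (simp only: real_norm_def diff_zero abs_less_iff less_imp_le)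
  have "integrable lborel (\<lambda>y. \<bar>w y\<bar> * indicator {y. norm y > real n} y)"
   by (rule Bochner_Integration.integrable_bound[OF i]) (auto simp: indicator_def)
  from nn_integral_eq_integral[OF this] n have "(\<integral>\<^sup>+y. ennreal (\<bar>w y\<bar> * indicator {y. norm y > real n} y) \<partial>lborel) \<le> ennreal (e * r)"
   by (simp add: ennreal_leI)
  also have "(\<integral>\<^sup>+y. ennreal (\<bar>w y\<bar> * indicator {y. norm y > real n} y) \<partial>lborel) = (\<integral>\<^sup>+y. ennreal \<bar>w y\<bar> * indicator {y. norm y > real n} y \<partial>lborel)"
   by (intro nn_integral_cong) (auto split: split_indicator)
  finally show ?thesis using that[of "real n"] by simp
 qed
 define c where "c = A / e + 1"
 have c: "c > 0" using A e by (simp add: c_def add_nonneg_pos)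
 have Ac: "A / c \<le> e"
 proof -
  have "A \<le> e * c" using e by (simp add: c_def field_simps)
  then show ?thesis using c by (simp add: divide_le_eq mult.commute)
 qed
 show "\<exists>b. \<forall>x. b \<le> norm x \<longrightarrow> dist (pot lborel w (\<lambda>y. y) (Ke 0) x) 0 < e0"
 proof (intro exI[of _ "\<rho> + c"] allI impI)
  fix x :: plane assume x: "\<rho> + c \<le> norm x"
  have pw: "\<bar>w y\<bar> * norm (Ke 0 (x - y)) \<le> \<bar>w y\<bar> / norm (x - y)" for y
   using mult_left_mono[OF norm_Ke_le[of 0 "x - y"], of "\<bar>w y\<bar>"] by simp
  have "ennreal (norm (pot lborel w (\<lambda>y. y) (Ke 0) x)) \<le> (\<integral>\<^sup>+y. ennreal (\<bar>w y\<bar> * norm (Ke 0 (x - y))) \<partial>lborel)"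
   by (rule norm_pot_le_nn) measurable
  also have "\<dots> \<le> (\<integral>\<^sup>+y. ennreal (\<bar>w y\<bar> / norm (x - y)) * indicator (cball x r) y + ((ennreal \<bar>w y\<bar> * indicator {y. norm y > \<rho>} y) * ennreal (1 / r) + ennreal \<bar>w y\<bar> * ennreal (1 / c)) \<partial>lborel)"
  proof (rule nn_integral_mono)
   fix y :: plane
   show "ennreal (\<bar>w y\<bar> * norm (Ke 0 (x - y))) \<le> ennreal (\<bar>w y\<bar> / norm (x - y)) * indicator (cball x r) y + ((ennreal \<bar>w y\<bar> * indicator {y. norm y > \<rho>} y) * ennreal (1 / r) + ennreal \<bar>w y\<bar> * ennreal (1 / c))"
    (is "_ \<le> ?a + (?b + ?c)")
   proof -
    have l: "ennreal (\<bar>w y\<bar> * norm (Ke 0 (x - y))) \<le> ennreal (\<bar>w y\<bar> / norm (x - y))" by (rule ennreal_leI[OF pw])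
    consider "norm (x - y) \<le> r" | "norm (x - y) > r" "norm y > \<rho>" | "norm y \<le> \<rho>" by linarith
    then show ?thesis
    proof cases
     case 1
     then have "ennreal (\<bar>w y\<bar> / norm (x - y)) \<le> ?a" by (simp add: dist_norm)
     then show ?thesis using l by (meson add_increasing2 order_trans zero_le)
    next
     case 2
     have "\<bar>w y\<bar> / norm (x - y) \<le> \<bar>w y\<bar> * (1 / r)" using 2(1) r(1) by (simp add: frac_le)
     then have "ennreal (\<bar>w y\<bar> / norm (x - y)) \<le> ?b" using 2(2) r(1) ennreal_leI by (simp add: ennreal_mult[symmetric])
     then show ?thesis using l by (meson add_increasing add_increasing2 order_trans zero_le)
    next
     case 3
     have "norm x \<le> norm (x - y) + norm y" using norm_triangle_ineq[of "x - y" y] by simp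
     then have "c \<le> norm (x - y)" using 3 x by linarith
     then have "\<bar>w y\<bar> / norm (x - y) \<le> \<bar>w y\<bar> * (1 / c)" using c by (simp add: frac_le)
     then have "ennreal (\<bar>w y\<bar> / norm (x - y)) \<le> ?c" using c ennreal_leI by (simp add: ennreal_mult[symmetric])
     then show ?thesis using l by (meson add_increasing order_trans zero_le)
    qed
   qed
  qed
  also have "\<dots> = (\<integral>\<^sup>+y. ennreal (\<bar>w y\<bar> / norm (x - y)) * indicator (cball x r) y \<partial>lborel) +
    ((\<integral>\<^sup>+y. ennreal \<bar>w y\<bar> * indicator {y. norm y > \<rho>} y \<partial>lborel) * ennreal (1 / r) + (\<integral>\<^sup>+y. ennreal \<bar>w y\<bar> \<partial>lborel) * ennreal (1 / c))"
   by (simp add: nn_integral_add nn_integral_multc)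
  also have "\<dots> \<le> ennreal e + (ennreal (e * r) * ennreal (1 / r) + ennreal A * ennreal (1 / c))"
   by (intro add_mono mult_right_mono r rho vortD(2)[OF w]) auto
  also have "\<dots> = ennreal (e + (e + A / c))"
   using r(1) e c A by (simp add: ennreal_mult[symmetric] ennreal_plus[symmetric] del: ennreal_plus)
  also have "\<dots> \<le> ennreal (3 * e)" using Ac by (intro ennreal_leI) simp
  finally have "norm (pot lborel w (\<lambda>y. y) (Ke 0) x) \<le> 3 * e" using e by (simp add: ennreal_le_iff)
  then show "dist (pot lborel w (\<lambda>y. y) (Ke 0) x) 0 < e0" using e0 by (simp add: e_def)
 qed
qed

context charge
begin

text \<open>At distance \<open>c\<close> from the support the kernel is at most \<open>1/c\<close>.\<close>

lemma pot_decay: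
 assumes R: "AE b in L. norm (Y b) \<le> R"
 shows "((\<lambda>x. pot L g Y (Ke 0) x) \<longlongrightarrow> 0) at_infinity"
 unfolding Lim_at_infinity
proof (intro allI impI)
 fix e :: real assume e: "e > 0"
 define c where "c = mass / e + 1"
 have c: "c > 0" using mass_nonneg e by (simp add: c_def add_nonneg_pos)
 have mc: "mass / c < e"
 proof -
  have "mass < e * c" using e by (simp add: c_def field_simps)
  then show ?thesis using c by (simp add: divide_less_eq)
 qed
 show "\<exists>b. \<forall>x. b \<le> norm x \<longrightarrow> dist (pot L g Y (Ke 0) x) 0 < e"
 proof (intro exI[of _ "R + c"] allI impI)
  fix x :: plane assume x: "R + c \<le> norm x"
  have "ennreal (norm (pot L g Y (Ke 0) x)) \<le> (\<integral>\<^sup>+b. ennreal (\<bar>g b\<bar> * norm (Ke 0 (x - Y b))) \<partial>L)"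
   by (rule norm_pot_le_nn) measurable
  also have "\<dots> \<le> (\<integral>\<^sup>+b. ennreal \<bar>g b\<bar> * ennreal (1 / c) \<partial>L)"
  proof (rule nn_integral_mono_AE)
   show "AE b in L. ennreal (\<bar>g b\<bar> * norm (Ke 0 (x - Y b))) \<le> ennreal \<bar>g b\<bar> * ennreal (1 / c)"
    using R
   proof eventually_elim
    case (elim b)
    have "norm x \<le> norm (x - Y b) + norm (Y b)" using norm_triangle_ineq[of "x - Y b" "Y b"] by simp
    then have "c \<le> norm (x - Y b)" using elim x by linarith
    then have "1 / norm (x - Y b) \<le> 1 / c" using c by (intro divide_left_mono mult_pos_pos) linarith+
    then have "norm (Ke 0 (x - Y b)) \<le> 1 / c" using norm_Ke_le[of 0 "x - Y b"] by linarith
    then have "\<bar>g b\<bar> * norm (Ke 0 (x - Y b)) \<le> \<bar>g b\<bar> * (1 / c)" by (rule mult_left_mono) simp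
    then show ?case using c ennreal_leI by (simp add: ennreal_mult[symmetric])
   qed
  qed
  also have "\<dots> = ennreal mass * ennreal (1 / c)" unfolding mass_nn[symmetric] by (rule nn_integral_multc) measurable
  also have "\<dots> = ennreal (mass / c)" using c mass_nonneg by (simp add: ennreal_mult[symmetric])
  finally have "norm (pot L g Y (Ke 0) x) \<le> mass / c" using c mass_nonneg by (simp add: ennreal_le_iff)
  then show "dist (pot L g Y (Ke 0) x) 0 < e" using mc by simp
 qed
qed

lemma pot_ball_integrable: "set_integrable lborel (cball 0 R) (pot L g Y (Ke 0))"
 unfolding set_integrable_def
proof (rule integrableI_bounded)
 have "(\<integral>\<^sup>+x. ennreal (norm (indicat_real (cball 0 R) x *\<^sub>R pot L g Y (Ke 0) x)) \<partial>lborel) =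
  (\<integral>\<^sup>+x. ennreal (norm (pot L g Y (Ke 0) x) powr 1) * indicator (cball 0 R) x \<partial>lborel)"
  by (intro nn_integral_cong) (auto split: split_indicator)
 with pot_Lq[of 1 R] show "(\<integral>\<^sup>+x. ennreal (norm (indicat_real (cball 0 R) x *\<^sub>R pot L g Y (Ke 0) x)) \<partial>lborel) < \<infinity>" by simp
qed measurable

lemma vel_locally_integrable:
 assumes w: "integrable lborel w"
 shows "locally_integrable_on (vel (Ke 0) w) UNIV"
 unfolding locally_integrable_on_def
proof (intro allI impI)
 fix K :: "plane set" assume K: "compact K \<and> K \<subseteq> UNIV"
 interpret W: charge lborel w "\<lambda>y. y" by (rule charge_lborel[OF w])
 obtain R where R: "K \<subseteq> cball 0 R" using K compact_imp_bounded[of K] by (auto simp: bounded_iff subset_eq)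
 have Kb: "K \<in> sets borel" using K compact_imp_closed borel_closed by blast
 have "set_integrable lborel (cball 0 R) (vel (Ke 0) w)"
  unfolding vel_def by (intro set_integral_add W.pot_ball_integrable pot_ball_integrable)
 then have "set_integrable lborel K (vel (Ke 0) w)" by (rule set_integrable_subset) (use Kb R in auto)
 then show "set_integrable lebesgue K (vel (Ke 0) w)"
  unfolding set_integrable_def by (subst integrable_completion) (auto simp: vel_meas[OF borel_measurable_Ke w] Kb intro: borel_measurable_integrable)
qed

lemma vel_div_curl:
 assumes w: "integrable lborel w"
  and \<psi>: "continuous_on UNIV \<psi>" "\<And>i. continuous_on UNIV (D i)" "R > 0"
  and der: "\<And>x i. ((\<lambda>s. \<psi> (x + s *\<^sub>R ax i)) has_real_derivative D i x) (at 0)"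
  and supp: "\<And>x. norm x > R \<Longrightarrow> \<psi> x = 0" "\<And>x i. norm x > R \<Longrightarrow> D i x = 0"
  and B: "\<And>x. \<bar>\<psi> x\<bar> \<le> B" "\<And>x i. \<bar>D i x\<bar> \<le> B"
 shows "(LINT x|lborel. vel (Ke 0) w x $ 1 * D 1 x + vel (Ke 0) w x $ 2 * D 2 x) = 0"
  "- (LINT x|lborel. vel (Ke 0) w x $ 2 * D 1 x - vel (Ke 0) w x $ 1 * D 2 x) = (LINT x|lborel. w x * \<psi> x) + (LINT b|L. g b * \<psi> (Y b))"
proof -
 interpret W: charge lborel w "\<lambda>y. y" by (rule charge_lborel[OF w])
 have Dm: "D i \<in> borel_measurable borel" for i using \<psi>(2) by (rule borel_measurable_continuous_onI)
 have t: "integrable lborel (\<lambda>x. pot L g Y (Ke 0) x $ i * D j x)" for i j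
  by (rule pot_tested(1)[where B=B and R=R]) (use Dm B supp in auto)
 have tw: "integrable lborel (\<lambda>x. pot lborel w (\<lambda>y. y) (Ke 0) x $ i * D j x)" for i j
  by (rule W.pot_tested(1)[where B=B and R=R]) (use Dm B supp in auto)
 have iv: "integrable lborel (\<lambda>x. vel (Ke 0) w x $ i * D j x)" for i j
  unfolding vel_def using t tw by (simp add: distrib_right)
 have v: "(LINT x|lborel. vel (Ke 0) w x $ i * D j x) = (LINT x|lborel. pot lborel w (\<lambda>y. y) (Ke 0) x $ i * D j x) + (LINT x|lborel. pot L g Y (Ke 0) x $ i * D j x)" for i j
  unfolding vel_def using t tw by (simp add: distrib_right)
 have P: "(LINT x|lborel. pot L g Y (Ke 0) x $ 1 * D 1 x) + (LINT x|lborel. pot L g Y (Ke 0) x $ 2 * D 2 x) = 0"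
  by (rule pot_div_curl(1)[where R=R and B=B and \<psi>=\<psi>]) (use assms in auto)
 have Q: "(LINT x|lborel. pot L g Y (Ke 0) x $ 2 * D 1 x) - (LINT x|lborel. pot L g Y (Ke 0) x $ 1 * D 2 x) = - (LINT b|L. g b * \<psi> (Y b))"
  by (rule pot_div_curl(2)[where R=R and B=B and \<psi>=\<psi>]) (use assms in auto)
 have PW: "(LINT x|lborel. pot lborel w (\<lambda>y. y) (Ke 0) x $ 1 * D 1 x) + (LINT x|lborel. pot lborel w (\<lambda>y. y) (Ke 0) x $ 2 * D 2 x) = 0"
  by (rule W.pot_div_curl(1)[where R=R and B=B and \<psi>=\<psi>]) (use assms in auto)
 have QW: "(LINT x|lborel. pot lborel w (\<lambda>y. y) (Ke 0) x $ 2 * D 1 x) - (LINT x|lborel. pot lborel w (\<lambda>y. y) (Ke 0) x $ 1 * D 2 x) = - (LINT x|lborel. w x * \<psi> x)"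
  by (rule W.pot_div_curl(2)[where R=R and B=B and \<psi>=\<psi>]) (use assms in auto)
 show "(LINT x|lborel. vel (Ke 0) w x $ 1 * D 1 x + vel (Ke 0) w x $ 2 * D 2 x) = 0"
  unfolding Bochner_Integration.integral_add[OF iv iv] v using P PW by linarith
 show "- (LINT x|lborel. vel (Ke 0) w x $ 2 * D 1 x - vel (Ke 0) w x $ 1 * D 2 x) = (LINT x|lborel. w x * \<psi> x) + (LINT b|L. g b * \<psi> (Y b))"
  unfolding Bochner_Integration.integral_diff[OF iv iv] v using Q QW by linarith
qed

end

lemma vel_constraints:
 assumes \<mu>: "\<mu> \<in> bounded_measures" and w: "integrable lborel w"
 shows "is_biot_savart (charge.vel (jm \<mu>) sg fst (Ke 0) w) (density_plus w \<mu>)"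
  "distr_div_free (charge.vel (jm \<mu>) sg fst (Ke 0) w)"
  "distr_curl_eq (charge.vel (jm \<mu>) sg fst (Ke 0) w) (density_plus w \<mu>)"
proof -
 interpret J: charge "jm \<mu>" sg fst by (rule jm_charge[OF \<mu>])
 interpret W: charge lborel w "\<lambda>y. y" by (rule charge_lborel[OF w])
 have wm [measurable]: "w \<in> borel_measurable borel" using w by simp
 have vm: "J.vel (Ke 0) w \<in> borel_measurable borel" by (rule J.vel_meas[OF borel_measurable_Ke w])
 have vi: "(\<lambda>x. J.vel (Ke 0) w x $ i) \<in> borel_measurable borel" for i by (rule borel_measurable_plane_nth[OF vm])
 have "AE x in lborel. signed_integrable (density_plus w \<mu>) (\<lambda>y. biot_savart_kernel (x - y)) \<and> J.vel (Ke 0) w x = biot_savart (density_plus w \<mu>) x"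
  using J.pot_AE W.pot_AE
 proof eventually_elim
  case (elim x)
  have m: "(\<lambda>y. Ke 0 (x - y)) \<in> borel_measurable borel" by measurable
  show ?case using density_plus_integral[OF w \<mu> m elim(2,1)]
   by (simp add: biot_savart_def Ke_0[symmetric] J.vel_def pot_def)
 qed
 then show "is_biot_savart (J.vel (Ke 0) w) (density_plus w \<mu>)"
  unfolding is_biot_savart_def by (rule AE_completion)
 show "distr_div_free (J.vel (Ke 0) w)"
  unfolding distr_div_free_def
 proof (intro conjI ballI J.vel_locally_integrable[OF w])
  fix \<psi> :: "plane \<Rightarrow> real" assume "\<psi> \<in> test_functions UNIV"
  then obtain D R B where D: "continuous_on UNIV \<psi>" "\<And>i. continuous_on UNIV (D i)" "R > 0" "B \<ge> 0"
   "\<And>x i. ((\<lambda>s. \<psi> (x + s *\<^sub>R ax i)) has_real_derivative D i x) (at 0)" "\<And>x i. grad \<psi> x $ i = D i x"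
   "\<And>x. norm x > R \<Longrightarrow> \<psi> x = 0" "\<And>x i. norm x > R \<Longrightarrow> D i x = 0" "\<And>x. \<bar>\<psi> x\<bar> \<le> B" "\<And>x i. \<bar>D i x\<bar> \<le> B"
   by (rule test_plane) blast
  have Dm: "D i \<in> borel_measurable borel" for i using D(2) by (rule borel_measurable_continuous_onI)
  have "(LINT x|lborel. J.vel (Ke 0) w x $ 1 * D 1 x + J.vel (Ke 0) w x $ 2 * D 2 x) = 0"
   by (rule J.vel_div_curl(1)[where R=R and B=B and \<psi>=\<psi> and D=D]) (fact w D)+
  moreover have "(\<lambda>x. J.vel (Ke 0) w x \<bullet> grad \<psi> x) = (\<lambda>x. J.vel (Ke 0) w x $ 1 * D 1 x + J.vel (Ke 0) w x $ 2 * D 2 x)"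
   by (rule ext, subst inner_plane, subst D(6)[of _ 1], subst D(6)[of _ 2], rule refl)
  moreover have "(\<lambda>x. J.vel (Ke 0) w x $ 1 * D 1 x + J.vel (Ke 0) w x $ 2 * D 2 x) \<in> borel_measurable lborel"
   unfolding measurable_lborel1 measurable_lborel2 by (intro borel_measurable_add borel_measurable_times vi Dm)
  ultimately show "(LINT x|lebesgue. J.vel (Ke 0) w x \<bullet> grad \<psi> x) = 0" by (simp only: integral_completion)
 qed
 show "distr_curl_eq (J.vel (Ke 0) w) (density_plus w \<mu>)"
  unfolding distr_curl_eq_def
 proof (intro conjI ballI J.vel_locally_integrable[OF w])
  fix \<psi> :: "plane \<Rightarrow> real" assume "\<psi> \<in> test_functions UNIV"
  then obtain D R B where D: "continuous_on UNIV \<psi>" "\<And>i. continuous_on UNIV (D i)" "R > 0" "B \<ge> 0"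
   "\<And>x i. ((\<lambda>s. \<psi> (x + s *\<^sub>R ax i)) has_real_derivative D i x) (at 0)" "\<And>x i. grad \<psi> x $ i = D i x"
   "\<And>x. norm x > R \<Longrightarrow> \<psi> x = 0" "\<And>x i. norm x > R \<Longrightarrow> D i x = 0" "\<And>x. \<bar>\<psi> x\<bar> \<le> B" "\<And>x i. \<bar>D i x\<bar> \<le> B"
   by (rule test_plane) blast
  have Dm: "D i \<in> borel_measurable borel" for i using D(2) by (rule borel_measurable_continuous_onI)
  have [measurable]: "\<psi> \<in> borel_measurable borel" using D(1) by (rule borel_measurable_continuous_onI)
  have "- (LINT x|lborel. J.vel (Ke 0) w x $ 2 * D 1 x - J.vel (Ke 0) w x $ 1 * D 2 x) = (LINT x|lborel. w x * \<psi> x) + (LINT b|jm \<mu>. sg b * \<psi> (fst b))"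
   by (rule J.vel_div_curl(2)[where R=R and B=B and \<psi>=\<psi> and D=D]) (fact w D)+
  moreover have "signed_integral (density_plus w \<mu>) \<psi> = (LINT y|lborel. w y *\<^sub>R \<psi> y) + (LINT b|jm \<mu>. sg b *\<^sub>R \<psi> (fst b))"
  proof (rule density_plus_integral(2)[OF w \<mu>])
   show "integrable lborel (\<lambda>y. w y *\<^sub>R \<psi> y)"
    using integrable_mult_bounded[of \<psi> lborel B w] D(9) w by (simp add: mult.commute)
   show "integrable (jm \<mu>) (\<lambda>b. sg b *\<^sub>R \<psi> (fst b))"
    using integrable_mult_bounded[of "\<lambda>b. \<psi> (fst b)" "jm \<mu>" B sg] D(9) J.g_int by (simp add: mult.commute)
  qed measurable
  moreover have "(\<lambda>x. J.vel (Ke 0) w x $ 2 * D 1 x - J.vel (Ke 0) w x $ 1 * D 2 x) \<in> borel_measurable lborel"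
   unfolding measurable_lborel1 measurable_lborel2 by (intro borel_measurable_diff borel_measurable_times vi Dm)
  ultimately show "- (LINT x|lebesgue. J.vel (Ke 0) w x $ 2 * grad \<psi> x $ 1 - J.vel (Ke 0) w x $ 1 * grad \<psi> x $ 2) = signed_integral (density_plus w \<mu>) \<psi>"
   by (simp only: D(6) integral_completion real_scaleR_def)
 qed
qed

lemma jm_compact:
 assumes \<mu>: "\<mu> \<in> bounded_measures_compact"
 obtains R where "AE b in jm \<mu>. norm (fst b) \<le> R"
proof -
 obtain K where K: "compact K" "\<And>A. A \<in> sets borel \<Longrightarrow> A \<inter> K = {} \<Longrightarrow> \<mu> A = 0" and b: "\<mu> \<in> bounded_measures"
  using \<mu> by (auto simp: bounded_measures_compact_def)
 obtain R where R: "K \<subseteq> cball 0 R" using compact_imp_bounded[OF K(1)] by (auto simp: bounded_iff subset_eq)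
 have [measurable]: "cball (0::plane) R \<in> sets borel" by simp
 have z: "emeasure (pos_part \<nu>) (- cball 0 R) = 0" if n1: "\<nu> \<in> bounded_measures" and n0: "\<And>A. A \<in> sets borel \<Longrightarrow> A \<inter> K = {} \<Longrightarrow> \<nu> A = 0" for \<nu>
 proof -
  have m: "- cball (0::plane) R \<in> sets borel" by (intro borel_comp) simp
  have "ennreal (\<nu> B) = 0" if "B \<in> sets borel" "B \<subseteq> - cball 0 R" for B
  proof -
   have "B \<inter> K = {}" using that(2) R by blast
   then show ?thesis using n0[of B] that(1) by simp
  qed
  then have "(SUP B\<in>{B \<in> sets borel. B \<subseteq> - cball 0 R}. ennreal (\<nu> B)) \<le> 0" by (intro SUP_least) simp
  then show ?thesis unfolding emeasure_pos_part[OF n1 m] by simp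
 qed
 have S: "{b. norm (fst b) > R} = (- cball (0::plane) R) \<times> (UNIV::bool set)" by auto
 have m: "(- cball (0::plane) R) \<times> (UNIV::bool set) \<in> sets (borel \<Otimes>\<^sub>M count_space UNIV)"
  by (intro pair_measureI borel_comp) simp_all
 have v: "(\<lambda>y::plane. (y, c)) -` ((- cball (0::plane) R) \<times> (UNIV::bool set)) = - cball 0 R" for c by auto
 have "emeasure (jm \<mu>) {b. norm (fst b) > R} = 0"
  unfolding S jm_def
  by (subst emeasure_add_measure) (simp_all add: m emeasure_distr v z[OF b K(2)] neg_part_def z[OF neg_bounded_measures[OF b]] K(2))
 then have "AE b in jm \<mu>. norm (fst b) \<le> R"
  using S m by (intro AE_I[where N="{b. norm (fst b) > R}"]) auto
 then show ?thesis using that by blast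
qed

section \<open>The weak solution\<close>

lemma joint_slice:
 fixes f :: "real \<Rightarrow> plane \<Rightarrow> 'v::euclidean_space"
 assumes "(\<lambda>(t, x). f t x) \<in> borel_measurable (borel \<Otimes>\<^sub>M borel)" "a \<in> M \<rightarrow>\<^sub>M borel" "b \<in> M \<rightarrow>\<^sub>M borel"
 shows "(\<lambda>z. f (a z) (b z)) \<in> borel_measurable M"
 using measurable_compose[OF measurable_Pair[OF assms(2,3)] assms(1)] by simp

lemma spacetime_local:
 fixes h :: "real \<times> plane \<Rightarrow> ennreal"
 assumes h: "h \<in> borel_measurable borel" and K: "compact K"
  and b: "\<And>R. \<exists>c<\<infinity>. \<forall>t. (\<integral>\<^sup>+x. h (t, x) * indicator (cball 0 R) x \<partial>lborel) \<le> c"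
 shows "(\<integral>\<^sup>+z. h z * indicator K z \<partial>lborel) < \<infinity>"
proof -
 obtain R where R: "\<And>z. z \<in> K \<Longrightarrow> norm z \<le> R" using compact_imp_bounded[OF K] by (auto simp: bounded_iff)
 obtain c where c: "c < \<infinity>" "\<And>t. (\<integral>\<^sup>+x. h (t, x) * indicator (cball 0 R) x \<partial>lborel) \<le> c" using b[of R] by auto
 have hm [measurable]: "(\<lambda>(t, x). h (t, x)) \<in> borel_measurable (borel \<Otimes>\<^sub>M borel)" using h by (simp add: borel_prod)
 have [measurable]: "cball (0::plane) R \<in> sets borel" by simp
 have m: "(\<lambda>z. indicator {-R..R} (fst z) * (h (fst z, snd z) * indicator (cball 0 R) (snd z))) \<in> borel_measurable (lborel \<Otimes>\<^sub>M lborel :: (real \<times> plane) measure)"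
  using hm unfolding case_prod_beta' by measurable
 have "(\<integral>\<^sup>+z. h z * indicator K z \<partial>lborel) \<le> (\<integral>\<^sup>+z. indicator {-R..R} (fst z) * (h (fst z, snd z) * indicator (cball 0 R) (snd z)) \<partial>(lborel \<Otimes>\<^sub>M lborel))"
  unfolding lborel_prod
 proof (rule nn_integral_mono)
  fix z :: "real \<times> plane"
  show "h z * indicator K z \<le> indicator {-R..R} (fst z) * (h (fst z, snd z) * indicator (cball 0 R) (snd z))"
  proof (cases "z \<in> K")
   case True
   have "norm z \<le> R" by (rule R[OF True])
   then have "\<bar>fst z\<bar> \<le> R" "norm (snd z) \<le> R"
    using norm_fst_le[of "fst z" "snd z"] norm_snd_le[of "snd z" "fst z"] by auto
   then show ?thesis using True by (auto simp: abs_le_iff)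
  qed simp
 qed
 also have "\<dots> = (\<integral>\<^sup>+t. (\<integral>\<^sup>+x. indicator {-R..R} t * (h (t, x) * indicator (cball 0 R) x) \<partial>lborel) \<partial>lborel)"
  using lborel.nn_integral_fst[OF m] by simp
 also have "\<dots> = (\<integral>\<^sup>+t. indicator {-R..R} t * (\<integral>\<^sup>+x. h (t, x) * indicator (cball 0 R) x \<partial>lborel) \<partial>lborel)"
 proof (rule nn_integral_cong)
  fix t :: real
  have "(\<lambda>x::plane. (t, x)) \<in> borel \<rightarrow>\<^sub>M (borel \<Otimes>\<^sub>M borel)" by measurable
  from measurable_compose[OF this hm] have "(\<lambda>x. h (t, x) * indicator (cball 0 R) x) \<in> borel_measurable lborel" by simp
  then show "(\<integral>\<^sup>+x. indicator {-R..R} t * (h (t, x) * indicator (cball 0 R) x) \<partial>lborel) = indicator {-R..R} t * (\<integral>\<^sup>+x. h (t, x) * indicator (cball 0 R) x \<partial>lborel)"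
   by (rule nn_integral_cmult)
 qed
 also have "\<dots> \<le> (\<integral>\<^sup>+t. c * indicator {-R..R} t \<partial>lborel)"
  by (intro nn_integral_mono) (use c in \<open>auto split: split_indicator\<close>)
 also have "\<dots> = c * emeasure lborel {-R..R}" by (subst nn_integral_cmult_indicator) auto
 also have "\<dots> < \<infinity>" using c by (auto simp: ennreal_mult_less_top emeasure_lborel_Icc_eq)
 finally show ?thesis .
qed

lemma spacetime_locally_integrable:
 fixes f :: "real \<times> plane \<Rightarrow> 'v::euclidean_space"
 assumes f: "f \<in> borel_measurable borel"
  and b: "\<And>R. \<exists>c<\<infinity>. \<forall>t. (\<integral>\<^sup>+x. ennreal (norm (f (t, x))) * indicator (cball 0 R) x \<partial>lborel) \<le> c"
 shows "locally_integrable_on f S"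
 unfolding locally_integrable_on_def
proof (intro allI impI)
 fix K assume K: "compact K \<and> K \<subseteq> S"
 then have Kb: "K \<in> sets borel" using compact_imp_closed borel_closed by blast
 have "(\<integral>\<^sup>+z. ennreal (norm (f z)) * indicator K z \<partial>lborel) < \<infinity>"
  by (rule spacetime_local) (use f K b in auto)
 moreover have "(\<integral>\<^sup>+z. ennreal (norm (f z)) * indicator K z \<partial>lborel) = (\<integral>\<^sup>+z. ennreal (norm (indicat_real K z *\<^sub>R f z)) \<partial>lborel)"
  by (intro nn_integral_cong) (auto split: split_indicator)
 moreover have m: "(\<lambda>z. indicat_real K z *\<^sub>R f z) \<in> borel_measurable lborel" using f Kb by simp
 ultimately have "integrable lborel (\<lambda>z. indicat_real K z *\<^sub>R f z)" by (intro integrableI_bounded) auto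
 then show "set_integrable lebesgue K f" unfolding set_integrable_def using m by (simp only: integrable_completion)
qed

lemma spacetime_Lp_loc:
 fixes f :: "real \<times> plane \<Rightarrow> 'v::euclidean_space"
 assumes f: "f \<in> borel_measurable borel" and q: "q > 0"
  and b: "\<And>R. \<exists>c<\<infinity>. \<forall>t. (\<integral>\<^sup>+x. ennreal (norm (f (t, x)) powr q) * indicator (cball 0 R) x \<partial>lborel) \<le> c"
 shows "f \<in> Lp_loc (ennreal q) S"
 unfolding Lp_loc_def
proof (intro CollectI allI impI)
 fix K assume K: "compact K \<and> K \<subseteq> S"
 then have Kb: "K \<in> sets borel" using compact_imp_closed borel_closed by blast
 have Kl: "K \<inter> space lebesgue \<in> sets lebesgue" using Kb by (simp add: sets_completionI_sets)
 have "(\<integral>\<^sup>+z. ennreal (norm (f z) powr q) * indicator K z \<partial>lborel) < \<infinity>"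
  by (rule spacetime_local) (use f K b in auto)
 then have "(\<integral>\<^sup>+z. ennreal (norm (f z) powr q) \<partial>lebesgue_on K) < \<infinity>"
  by (simp add: nn_integral_restrict_space[OF Kl] nn_integral_completion)
 then have "Lp_norm (ennreal q) (lebesgue_on K) f < \<infinity>" using q by (simp add: Lp_norm_def Let_def less_top[symmetric])
 moreover have "f \<in> borel_measurable lebesgue" using f by (intro measurable_completion) simp
 then have "f \<in> borel_measurable (lebesgue_on K)" by (rule measurable_restrict_space1)
 ultimately show "f \<in> Lp (ennreal q) (lebesgue_on K)" by (simp add: Lp_def)
qed

lemma Lp_norm_bound:
 fixes f :: "plane \<Rightarrow> real"
 assumes f: "f \<in> borel_measurable borel" and q: "q > 0" and A: "A \<ge> 0" "(\<integral>\<^sup>+x. ennreal (\<bar>f x\<bar> powr q) \<partial>lborel) \<le> ennreal A"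
 shows "f \<in> Lp (ennreal q) lebesgue \<and> Lp_norm (ennreal q) lebesgue f \<le> ennreal (A powr (1 / q))"
proof -
 define I where "I = (\<integral>\<^sup>+x. ennreal (\<bar>f x\<bar> powr q) \<partial>lborel)"
 have I: "I \<noteq> \<infinity>" "I \<le> ennreal A" using A(2) by (auto simp: I_def top_unique)
 have "enn2real I \<le> A" using enn2real_mono[OF I(2)] A(1) by simp
 then have "enn2real I powr (1 / q) \<le> A powr (1 / q)" using q by (intro powr_mono2) auto
 moreover have "Lp_norm (ennreal q) lebesgue f = ennreal (enn2real I powr (1 / q))"
  using I(1) q by (simp add: Lp_norm_def Let_def nn_integral_completion I_def)
 ultimately have "Lp_norm (ennreal q) lebesgue f \<le> ennreal (A powr (1 / q))" by (simp add: ennreal_leI)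
 moreover have "f \<in> borel_measurable lebesgue" using f by (intro measurable_completion) simp
 ultimately show ?thesis by (auto simp: Lp_def intro: le_less_trans)
qed

text \<open>For a bounded vorticity the scheme runs with the finite exponent \<open>3\<close>, and the bound is carried
 by the maximum principle instead.\<close>

lemma initial_vorticity:
 assumes p0: "2 < p0" and w: "\<omega>0 \<in> Lp_compact p0"
 obtains p A w0 where "p > 2" "A \<ge> 0" "vort p A w0" "\<omega>0 \<in> borel_measurable lebesgue" "AE x in lborel. \<omega>0 x = w0 x"
  "p0 = ennreal p \<or> (p0 = \<infinity> \<and> (\<exists>M. \<forall>x. \<bar>w0 x\<bar> \<le> M))"
proof -
 have wm: "\<omega>0 \<in> borel_measurable lebesgue" and fin: "Lp_norm p0 lebesgue \<omega>0 < \<infinity>" using w by (auto simp: Lp_compact_def Lp_def)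
 obtain K where K: "compact K" "AE x in lebesgue. x \<notin> K \<longrightarrow> \<omega>0 x = 0" using w by (auto simp: Lp_compact_def)
 have Kb [measurable]: "K \<in> sets borel" using compact_imp_closed[OF K(1)] borel_closed by blast
 have Kf: "emeasure lborel K < \<infinity>" by (rule emeasure_compact_finite[OF K(1)])
 obtain w1 where w1: "w1 \<in> borel_measurable lborel" "AE x in lborel. \<omega>0 x = w1 x"
  using completion_ex_borel_measurable_real[OF wm] by blast
 then have w1m [measurable]: "w1 \<in> borel_measurable borel" by simp
 have K1: "AE x in lborel. x \<notin> K \<longrightarrow> \<omega>0 x = 0" using K(2) by (simp only: AE_completion_iff)
 have fin_vort: "\<exists>A\<ge>0. vort p A v" if [measurable]: "v \<in> borel_measurable borel" and ae: "AE x in lborel. \<omega>0 x = v x" and f: "(\<integral>\<^sup>+x. ennreal (\<bar>v x\<bar> powr p) \<partial>lborel) < \<infinity>" and p: "p > 2" for p v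
 proof -
  have "(\<integral>\<^sup>+x. ennreal \<bar>v x\<bar> \<partial>lborel) \<le> (\<integral>\<^sup>+x. indicator K x + ennreal (\<bar>v x\<bar> powr p) \<partial>lborel)"
  proof (rule nn_integral_mono_AE)
   show "AE x in lborel. ennreal \<bar>v x\<bar> \<le> indicator K x + ennreal (\<bar>v x\<bar> powr p)"
    using ae K1
   proof eventually_elim
    case (elim x)
    show ?case
    proof (cases "\<bar>v x\<bar> \<le> 1")
     case True
     show ?thesis
     proof (cases "x \<in> K")
      case inK: True
      have "ennreal \<bar>v x\<bar> \<le> 1" using ennreal_leI[OF True] by simp
      then show ?thesis using inK by (simp add: add_increasing2)
     qed (use elim in simp)
    next
     case False
     then have "\<bar>v x\<bar> powr 1 \<le> \<bar>v x\<bar> powr p" using p by (intro powr_mono) auto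
     then have "ennreal \<bar>v x\<bar> \<le> ennreal (\<bar>v x\<bar> powr p)" by (intro ennreal_leI) simp
     then show ?thesis by (simp add: add_increasing)
    qed
   qed
  qed
  also have "\<dots> = emeasure lborel K + (\<integral>\<^sup>+x. ennreal (\<bar>v x\<bar> powr p) \<partial>lborel)"
   by (subst nn_integral_add) simp_all
  finally have le: "(\<integral>\<^sup>+x. ennreal \<bar>v x\<bar> \<partial>lborel) \<le> emeasure lborel K + (\<integral>\<^sup>+x. ennreal (\<bar>v x\<bar> powr p) \<partial>lborel)" .
  define A where "A = enn2real (emeasure lborel K + (\<integral>\<^sup>+x. ennreal (\<bar>v x\<bar> powr p) \<partial>lborel))"
  have "emeasure lborel K + (\<integral>\<^sup>+x. ennreal (\<bar>v x\<bar> powr p) \<partial>lborel) < \<infinity>" using Kf f by simp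
  then have A: "ennreal A = emeasure lborel K + (\<integral>\<^sup>+x. ennreal (\<bar>v x\<bar> powr p) \<partial>lborel)" unfolding A_def by (intro ennreal_enn2real) simp
  have "vort p A v" unfolding vort_def A using le that(1) by (auto simp: add_increasing)
  then show ?thesis by (intro exI[of _ A]) (simp add: A_def)
 qed
 show ?thesis
 proof (cases "p0 = \<infinity>")
  case False
  define p where "p = enn2real p0"
  have pp: "p0 = ennreal p" unfolding p_def using False by (intro ennreal_enn2real[symmetric]) (simp add: less_top)
  have p: "p > 2" using p0 unfolding pp by simp
  have f0: "(\<integral>\<^sup>+x. ennreal (\<bar>\<omega>0 x\<bar> powr p) \<partial>lborel) < \<infinity>"
  proof (rule ccontr)
   assume "\<not> ?thesis"
   then have "(\<integral>\<^sup>+x. ennreal (\<bar>\<omega>0 x\<bar> powr p) \<partial>lborel) = \<infinity>" by (simp add: less_top[symmetric])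
   then show False using fin p unfolding pp by (simp add: Lp_norm_def Let_def nn_integral_completion)
  qed
  have "(\<integral>\<^sup>+x. ennreal (\<bar>w1 x\<bar> powr p) \<partial>lborel) = (\<integral>\<^sup>+x. ennreal (\<bar>\<omega>0 x\<bar> powr p) \<partial>lborel)"
   by (rule nn_integral_cong_AE) (use w1(2) in \<open>eventually_elim, simp\<close>)
  with f0 obtain A where "A \<ge> 0" "vort p A w1" using fin_vort[OF w1m w1(2) _ p] by auto
  then show ?thesis using that[of p A w1] p wm w1(2) pp by blast
 next
  case True
  have "Lp_norm p0 lebesgue \<omega>0 = esssup lebesgue (\<lambda>x. ennreal (norm (\<omega>0 x)))" using True by (simp add: Lp_norm_def)
  with fin have ef: "esssup lebesgue (\<lambda>x. ennreal (norm (\<omega>0 x))) < \<infinity>" by simp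
  define M where "M = enn2real (esssup lebesgue (\<lambda>x. ennreal (norm (\<omega>0 x))))"
  have M0: "M \<ge> 0" by (simp add: M_def)
  have eM: "ennreal M = esssup lebesgue (\<lambda>x. ennreal (norm (\<omega>0 x)))" unfolding M_def using ef by (intro ennreal_enn2real) simp
  have "AE x in lebesgue. ennreal (norm (\<omega>0 x)) \<le> ennreal M" unfolding eM by (rule esssup_AE)
  then have ae: "AE x in lborel. \<bar>\<omega>0 x\<bar> \<le> M" using M0 by (simp add: AE_completion_iff)
  define w2 where "w2 x = (if \<bar>w1 x\<bar> \<le> M then w1 x else 0)" for x
  have w2m [measurable]: "w2 \<in> borel_measurable borel" unfolding w2_def by measurable
  have w2M: "\<bar>w2 x\<bar> \<le> M" for x using M0 by (simp add: w2_def)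
  have w2ae: "AE x in lborel. \<omega>0 x = w2 x" using ae w1(2) by eventually_elim (simp add: w2_def)
  have "(\<integral>\<^sup>+x. ennreal (\<bar>w2 x\<bar> powr 3) \<partial>lborel) \<le> (\<integral>\<^sup>+x. ennreal (M powr 3) * indicator K x \<partial>lborel)"
  proof (rule nn_integral_mono_AE)
   show "AE x in lborel. ennreal (\<bar>w2 x\<bar> powr 3) \<le> ennreal (M powr 3) * indicator K x"
    using w2ae K1
   proof eventually_elim
    case (elim x)
    have "\<bar>w2 x\<bar> powr 3 \<le> M powr 3" using w2M[of x] by (intro powr_mono2) auto
    then show ?case using elim by (cases "x \<in> K") (auto intro: ennreal_leI)
   qed
  qed
  also have "\<dots> = ennreal (M powr 3) * emeasure lborel K" by (rule nn_integral_cmult_indicator) simp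
  also have "\<dots> < \<infinity>" using Kf by (auto simp: ennreal_mult_less_top)
  finally obtain A where "A \<ge> 0" "vort 3 A w2" using fin_vort[OF w2m w2ae, of 3] by auto
  then show ?thesis using that[of 3 A w2] wm w2ae True w2M by auto
 qed
qed

context scheme
begin

lemma vel_joint:
 fixes \<omega> :: "real \<Rightarrow> plane \<Rightarrow> real"
 assumes om: "(\<lambda>(t, x). \<omega> t x) \<in> borel_measurable (borel \<Otimes>\<^sub>M borel)"
 shows "(\<lambda>(t, x). vel (Ke 0) (\<omega> t) x) \<in> borel_measurable (borel \<Otimes>\<^sub>M borel)"
proof -
 have "(\<lambda>z. \<omega> (fst (fst z)) (snd z)) \<in> borel_measurable ((borel \<Otimes>\<^sub>M borel) \<Otimes>\<^sub>M lborel)"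
  by (rule joint_slice[OF om]) measurable
 then have "(\<lambda>(a, y). \<omega> (fst a) y *\<^sub>R Ke 0 (snd a - y)) \<in> borel_measurable ((borel \<Otimes>\<^sub>M borel) \<Otimes>\<^sub>M lborel)"
  unfolding case_prod_beta' by measurable
 then have 1: "(\<lambda>a. LINT y|lborel. \<omega> (fst a) y *\<^sub>R Ke 0 (snd a - y)) \<in> borel_measurable (borel \<Otimes>\<^sub>M borel)"
  by (rule lborel.borel_measurable_lebesgue_integral)
 have "pot L g Y (Ke 0) \<in> borel_measurable borel" by measurable
 then have 2: "(\<lambda>a. pot L g Y (Ke 0) (snd a)) \<in> borel_measurable (borel \<Otimes>\<^sub>M borel)"
  using measurable_compose[OF measurable_snd] by blast
 have "(\<lambda>(t, x). vel (Ke 0) (\<omega> t) x) = (\<lambda>a. (LINT y|lborel. \<omega> (fst a) y *\<^sub>R Ke 0 (snd a - y)) + pot L g Y (Ke 0) (snd a))"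
  by (auto simp: fun_eq_iff vel_def pot_def[of lborel])
 then show ?thesis using borel_measurable_add[OF 1 2] by (simp only:)
qed

text \<open>The bounds of the class pass to the limit only at almost every time. The vorticity is set to \<open>0\<close> at
 the exceptional times, since the constraints are required at every time.\<close>

lemma limit_solution:
 obtains \<omega> where "(\<lambda>(t, x). \<omega> t x) \<in> borel_measurable (borel \<Otimes>\<^sub>M borel)" "\<And>t. vort p A (\<omega> t)"
  "\<And>B. (\<And>x. \<bar>w0 x\<bar> \<le> B) \<Longrightarrow> AE t in lborel. AE x in lborel. \<bar>\<omega> t x\<bar> \<le> B"
  "\<And>\<phi> \<phi>t d B R. tested L g Y p A C m w0 \<phi> \<phi>t d B R \<Longrightarrow>
   (LINT t|lborel. LINT x|lborel. \<omega> t x * (\<phi>t t x + (\<Sum>i\<in>UNIV. d i t x * vel (Ke 0) (\<omega> t) x $ i))) = - (LINT x|lborel. \<phi> 0 x * w0 x)"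
proof -
 obtain r V where r: "strict_mono (r :: nat \<Rightarrow> nat)" and V: "\<And>t x. (\<lambda>n. U (r n) t x) \<longlonglongrightarrow> V t x" by (rule U_subsequence) blast
 obtain N c w where c: "\<And>j. cvx j (N j) (c j)" and wm: "w \<in> borel_measurable (borel \<Otimes>\<^sub>M borel)"
  and L2: "AE t in lborel. (\<lambda>j. \<integral>\<^sup>+x. ennreal ((w (t, x) - (\<Sum>k<N j. c j k * om (r k) t x))\<^sup>2) \<partial>lborel) \<longlonglongrightarrow> 0"
  and pt: "AE t in lborel. AE x in lborel. (\<lambda>j. \<Sum>k<N j. c j k * om (r k) t x) \<longlonglongrightarrow> w (t, x)"
  using om_limit[of r thesis] by blast
 define G where "G t \<longleftrightarrow> (\<integral>\<^sup>+x. ennreal \<bar>w (t, x)\<bar> \<partial>lborel) \<le> ennreal A \<and> (\<integral>\<^sup>+x. ennreal (\<bar>w (t, x)\<bar> powr p) \<partial>lborel) \<le> ennreal A" for t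
 define \<omega> where "\<omega> t x = (if G t then w (t, x) else 0)" for t x
 have wM: "(\<lambda>(t, x). w (t, x)) \<in> borel_measurable (borel \<Otimes>\<^sub>M borel)" using wm by simp
 have wt: "(\<lambda>x. w (t, x)) \<in> borel_measurable borel" for t
  using joint_slice[OF wM measurable_const[of t borel borel] measurable_ident] by simp
 have wl [measurable]: "(\<lambda>(t, x). w (t, x)) \<in> borel_measurable (borel \<Otimes>\<^sub>M lborel)" using wM by simp
 have g1: "(\<lambda>t. \<integral>\<^sup>+x. ennreal \<bar>w (t, x)\<bar> \<partial>lborel) \<in> borel_measurable borel"
  by (rule lborel.borel_measurable_nn_integral) (use wl in \<open>simp add: case_prod_beta'\<close>)
 have g2: "(\<lambda>t. \<integral>\<^sup>+x. ennreal (\<bar>w (t, x)\<bar> powr p) \<partial>lborel) \<in> borel_measurable borel"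
  by (rule lborel.borel_measurable_nn_integral) (use wl in \<open>simp add: case_prod_beta'\<close>)
 have Gm: "Measurable.pred borel G" unfolding G_def using g1 g2 by measurable
 have om: "(\<lambda>(t, x). \<omega> t x) \<in> borel_measurable (borel \<Otimes>\<^sub>M borel)"
 proof -
  have "Measurable.pred (borel \<Otimes>\<^sub>M borel :: (real \<times> plane) measure) (\<lambda>z. G (fst z))" using measurable_compose[OF measurable_fst Gm] .
  then have "(\<lambda>z. if G (fst z) then w z else 0) \<in> borel_measurable (borel \<Otimes>\<^sub>M borel)" using wm by measurable
  then show ?thesis unfolding \<omega>_def case_prod_beta' prod.collapse .
 qed
 have p0: "p > 0" "p \<ge> 1" using p by auto
 have ov: "vort p A (\<omega> t)" for t
 proof (cases "G t")
  case True
  then have e: "\<omega> t = (\<lambda>x. w (t, x))" by (simp add: \<omega>_def fun_eq_iff)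
  show ?thesis using True wt unfolding e vort_def G_def by blast
 next
  case False
  then have e: "\<omega> t = (\<lambda>x. 0)" by (simp add: \<omega>_def fun_eq_iff)
  show ?thesis unfolding e vort_def by simp
 qed
 have AG: "AE t in lborel. \<omega> t = (\<lambda>x. w (t, x))"
  using pt
 proof eventually_elim
  case (elim t)
  have "vort p A (\<lambda>x. w (t, x))"
   by (rule vort_limit[OF vort_cvx[OF c om_vort p0(2) A] wt elim p0(1)])
  then have "G t" by (auto simp: G_def vort_def)
  then show ?case by (simp add: \<omega>_def fun_eq_iff)
 qed
 have L2': "AE t in lborel. (\<lambda>j. \<integral>\<^sup>+x. ennreal ((\<omega> t x - (\<Sum>k<N j. c j k * om (r k) t x))\<^sup>2) \<partial>lborel) \<longlonglongrightarrow> 0"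
  using AG L2 by eventually_elim simp
 have sup: "AE t in lborel. AE x in lborel. \<bar>\<omega> t x\<bar> \<le> B" if B: "\<And>x. \<bar>w0 x\<bar> \<le> B" for B
  using AG pt
 proof eventually_elim
  case (elim t)
  have b: "\<bar>\<Sum>k<N j. c j k * om (r k) t x\<bar> \<le> B" for j x
  proof -
   have "\<bar>\<Sum>k<N j. c j k * om (r k) t x\<bar> \<le> (\<Sum>k<N j. \<bar>c j k * om (r k) t x\<bar>)" by (rule sum_abs)
   moreover have "(\<Sum>k<N j. \<bar>c j k * om (r k) t x\<bar>) \<le> (\<Sum>k<N j. c j k * B)"
   proof (rule sum_mono)
    fix k
    have "\<bar>om (r k) t x\<bar> \<le> B" unfolding om_def by (rule W_sup[OF B])
    then show "\<bar>c j k * om (r k) t x\<bar> \<le> c j k * B" using cvxD(1)[OF c, of j k] by (simp add: abs_mult mult_left_mono)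
   qed
   moreover have "(\<Sum>k<N j. c j k * B) = B" using cvxD(4)[OF c, of j] by (simp add: sum_distrib_right[symmetric])
   ultimately show ?thesis by linarith
  qed
  from elim(2) show ?case
  proof eventually_elim
   case (elim x)
   have "\<bar>w (t, x)\<bar> \<le> B" using tendsto_rabs[OF elim] by (rule LIMSEQ_le_const2) (use b in blast)
   then show ?case using \<open>\<omega> t = (\<lambda>x. w (t, x))\<close> by simp
  qed
 qed
 show ?thesis
 proof (rule that[OF om ov])
  show "AE t in lborel. AE x in lborel. \<bar>\<omega> t x\<bar> \<le> B" if "\<And>x. \<bar>w0 x\<bar> \<le> B" for B by (rule sup[OF that])
  show "(LINT t|lborel. LINT x|lborel. \<omega> t x * (\<phi>t t x + (\<Sum>i\<in>UNIV. d i t x * vel (Ke 0) (\<omega> t) x $ i))) = - (LINT x|lborel. \<phi> 0 x * w0 x)"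
   if "tested L g Y p A C m w0 \<phi> \<phi>t d B R" for \<phi> \<phi>t d B R
   by (rule tested.weak_limit(2)[OF that r V c om ov L2'])
 qed
qed

text \<open>The limit equation holds for one combined integrand. Its two parts are separately bounded in time
 and supported in a bounded time interval, so they can be integrated one by one.\<close>

lemma transport:
 assumes om: "(\<lambda>(t, x). \<omega> t x) \<in> borel_measurable (borel \<Otimes>\<^sub>M borel)" and ov: "\<And>t. vort p A (\<omega> t)"
  and weak: "\<And>\<phi> \<phi>t d B R. tested L g Y p A C m w0 \<phi> \<phi>t d B R \<Longrightarrow>
   (LINT t|lborel. LINT x|lborel. \<omega> t x * (\<phi>t t x + (\<Sum>i\<in>UNIV. d i t x * vel (Ke 0) (\<omega> t) x $ i))) = - (LINT x|lborel. \<phi> 0 x * w0 x)"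
  and init: "\<omega>0 \<in> borel_measurable lebesgue" "AE x in lborel. \<omega>0 x = w0 x"
 shows "weak_transport \<omega>0 (\<lambda>t. vel (Ke 0) (\<omega> t)) \<omega>"
 unfolding weak_transport_def
proof (intro conjI ballI)
 define u where "u t = vel (Ke 0) (\<omega> t)" for t
 have uj: "(\<lambda>(t, x). u t x) \<in> borel_measurable (borel \<Otimes>\<^sub>M borel)" unfolding u_def by (rule vel_joint[OF om])
 have CM: "C * m \<ge> 0" using C0 m by simp
 have up: "(\<integral>\<^sup>+x. ennreal (\<bar>\<omega> t x\<bar> * norm (u t x)) \<partial>lborel) \<le> ennreal (C * m)" for t
  unfolding u_def by (rule vel_pair[OF ov ov])
 have ind: "(\<integral>\<^sup>+x. f x * indicator (cball (0::plane) R) x \<partial>lborel) \<le> (\<integral>\<^sup>+x. f x \<partial>lborel)" for f R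
  by (intro nn_integral_mono) (auto split: split_indicator)
 show "locally_integrable_on (\<lambda>(t, x). \<omega> t x) spacetime"
 proof (rule spacetime_locally_integrable)
  show "(\<lambda>(t, x). \<omega> t x) \<in> borel_measurable borel" using om by (simp add: borel_prod)
  show "\<exists>c<\<infinity>. \<forall>t. (\<integral>\<^sup>+x. ennreal (norm (case (t, x) of (t, x) \<Rightarrow> \<omega> t x)) * indicator (cball 0 R) x \<partial>lborel) \<le> c" for R
   using order_trans[OF ind vortD(2)[OF ov]] by (intro exI[of _ "ennreal A"]) simp
 qed
 show "locally_integrable_on (\<lambda>(t, x). \<omega> t x *\<^sub>R vel (Ke 0) (\<omega> t) x) spacetime"
  unfolding u_def[symmetric]
 proof (rule spacetime_locally_integrable)
  have "(\<lambda>(t, x). \<omega> t x *\<^sub>R u t x) \<in> borel_measurable (borel \<Otimes>\<^sub>M borel)"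
   using borel_measurable_scaleR[OF om[unfolded case_prod_beta'] uj[unfolded case_prod_beta']] by (simp add: case_prod_beta')
  then show "(\<lambda>(t, x). \<omega> t x *\<^sub>R u t x) \<in> borel_measurable borel" by (simp add: borel_prod)
  show "\<exists>c<\<infinity>. \<forall>t. (\<integral>\<^sup>+x. ennreal (norm (case (t, x) of (t, x) \<Rightarrow> \<omega> t x *\<^sub>R u t x)) * indicator (cball 0 R) x \<partial>lborel) \<le> c" for R
   using order_trans[OF ind up] by (intro exI[of _ "ennreal (C * m)"]) simp
 qed
 fix \<phi> :: "real \<times> plane \<Rightarrow> real" assume "\<phi> \<in> test_functions spacetime"
 then obtain \<phi>t d B R where T: "tested L g Y p A C m w0 (\<lambda>t x. if 0 \<le> t then \<phi> (t, x) else 0) \<phi>t d B R"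
  and dt: "\<And>t x. t > 0 \<Longrightarrow> deriv (\<lambda>s. \<phi> (s, x)) t = \<phi>t t x"
  and dx: "\<And>t x i. t \<ge> 0 \<Longrightarrow> grad (\<lambda>y. \<phi> (t, y)) x $ i = d i t x" by (rule test_spacetime) blast
 interpret T: tested L g Y p A C m w0 "\<lambda>t x. if 0 \<le> t then \<phi> (t, x) else 0" \<phi>t d B R by (rule T)
 have pm: "\<phi>t t \<in> borel_measurable borel" for t using joint_slice[OF T.pt_meas measurable_const[of t borel borel] measurable_ident] by simp
 have dm: "d i t \<in> borel_measurable borel" for i t using joint_slice[OF T.d_meas measurable_const[of t borel borel] measurable_ident] by simp
 have um: "u t \<in> borel_measurable borel" for t using joint_slice[OF uj measurable_const[of t borel borel] measurable_ident] by simp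
 have omm: "\<omega> t \<in> borel_measurable borel" for t by (rule vortD(1)[OF ov])
 define s where "s t x = (\<Sum>i\<in>UNIV. d i t x * u t x $ i)" for t x
 define a where "a t = (LINT x|lborel. \<omega> t x * \<phi>t t x)" for t
 define b where "b t = (LINT x|lborel. \<omega> t x * s t x)" for t
 have ia: "integrable lborel (\<lambda>x. \<omega> t x * \<phi>t t x)" and ba: "\<bar>a t\<bar> \<le> B * m" for t
  using weighted[where a="\<phi>t t" and D="\<lambda>i x. 0" and B=0 and Ba=B, OF ov pm _ um T.pt_b _ up CM, of t] unfolding a_def by simp_all
 have ib: "integrable lborel (\<lambda>x. \<omega> t x * s t x)" and bb: "\<bar>b t\<bar> \<le> 2 * B * (C * m)" for t
  using weighted[where a="\<lambda>x. 0" and D="\<lambda>i. d i t" and B=B and Ba=0, OF ov _ dm um _ T.d_b up CM, of t] unfolding b_def s_def by simp_all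
 have om': "(\<lambda>z. \<omega> (fst z) (snd z)) \<in> borel_measurable (borel \<Otimes>\<^sub>M lborel)" by (rule joint_slice[OF om]) measurable
 have pm': "(\<lambda>z. \<phi>t (fst z) (snd z)) \<in> borel_measurable (borel \<Otimes>\<^sub>M lborel)" by (rule joint_slice[OF T.pt_meas]) measurable
 have dm': "(\<lambda>z. d i (fst z) (snd z)) \<in> borel_measurable (borel \<Otimes>\<^sub>M lborel)" for i by (rule joint_slice[OF T.d_meas]) measurable
 have um': "(\<lambda>z. u (fst z) (snd z)) \<in> borel_measurable (borel \<Otimes>\<^sub>M lborel)" by (rule joint_slice[OF uj]) measurable
 have am: "a \<in> borel_measurable borel"
  unfolding a_def by (rule lborel.borel_measurable_lebesgue_integral) (unfold case_prod_beta', intro borel_measurable_times om' pm')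
 have bm: "b \<in> borel_measurable borel"
  unfolding b_def s_def by (rule lborel.borel_measurable_lebesgue_integral)
   (unfold case_prod_beta', intro borel_measurable_times borel_measurable_sum om' dm' borel_measurable_plane_nth um')
 have a0: "a t = 0" if "t < 0 \<or> t \<ge> R" for t using that T.neg_t(1) T.sup_t(2) by (auto simp: a_def)
 have b0: "b t = 0" if "t < 0 \<or> t \<ge> R" for t using that T.neg_t(2) T.sup_t(3) by (auto simp: b_def s_def)
 have int: "integrable lborel f" if f: "f \<in> borel_measurable borel" "\<And>t. \<bar>f t\<bar> \<le> k" "\<And>t. t < 0 \<or> t \<ge> R \<Longrightarrow> f t = 0" for f :: "real \<Rightarrow> real" and k
 proof (rule Bochner_Integration.integrable_bound[where f="\<lambda>t. indicator {0..R} t * k"])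
  show "integrable lborel (\<lambda>t. indicator {0..R} t * k)" by (intro integrable_mult_left integrable_real_indicator) (auto simp: emeasure_lborel_Icc_eq)
  show "AE t in lborel. norm (f t) \<le> norm (indicator {0..R} t * k)"
  proof (rule AE_I2)
   fix t
   have "k \<ge> 0" using order_trans[OF abs_ge_zero f(2)] .
   then show "norm (f t) \<le> norm (indicator {0..R} t * k)" using f(2)[of t] f(3)[of t] by (auto simp: indicator_def)
  qed
 qed (use f in simp)
 have Ia: "integrable lborel a" by (rule int[OF am ba a0])
 have Ib: "integrable lborel b" by (rule int[OF bm bb b0])
 have wk: "(LINT t|lborel. LINT x|lborel. \<omega> t x * (\<phi>t t x + s t x)) = - (LINT x|lborel. \<phi> (0, x) * w0 x)"
  using weak[OF T] unfolding s_def u_def by simp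
 have "(LINT x|lborel. \<omega> t x * (\<phi>t t x + s t x)) = a t + b t" for t
  unfolding a_def b_def distrib_left by (rule Bochner_Integration.integral_add[OF ia ib])
 with wk have ab: "(LINT t|lborel. a t) + (LINT t|lborel. b t) = - (LINT x|lborel. \<phi> (0, x) * w0 x)"
  using Bochner_Integration.integral_add[OF Ia Ib] by simp
 define X where "X t = (LINT x|lebesgue. deriv (\<lambda>s. \<phi> (s, x)) t * \<omega> t x)" for t
 have Xa: "X t = a t" if "t > 0" for t
 proof -
  have "(\<lambda>x. \<phi>t t x * \<omega> t x) \<in> borel_measurable lborel" using borel_measurable_times[OF pm omm] by simp
  then show ?thesis unfolding X_def a_def dt[OF that] by (subst integral_completion) (simp_all add: mult.commute)
 qed
 \<comment> \<open>At \<open>t = 0\<close> the two-sided derivative may fail to exist.\<close>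
 have "(LINT t:{0..}|lebesgue. X t) = (LINT t|lebesgue. a t + indicator {0} t * (X 0 - a 0))"
  unfolding set_lebesgue_integral_def
 proof (rule Bochner_Integration.integral_cong[OF refl])
  fix t :: real
  consider "t < 0" | "t = 0" | "t > 0" by linarith
  then show "indicator {0..} t *\<^sub>R X t = a t + indicator {0} t * (X 0 - a 0)"
   by cases (use a0[of t] Xa[of t] in auto)
 qed
 also have "\<dots> = (LINT t|lborel. a t + indicator {0} t * (X 0 - a 0))"
  by (rule integral_completion) (use am in simp)
 also have "\<dots> = (LINT t|lborel. a t)"
 proof (rule integral_cong_AE)
  show "AE t in lborel. a t + indicator {0} t * (X 0 - a 0) = a t" using AE_lborel_singleton[of "0::real"] by eventually_elim simp
 qed (use am in simp_all)
 finally have 1: "(LINT t:{0..}|lebesgue. LINT x|lebesgue. deriv (\<lambda>s. \<phi> (s, x)) t * \<omega> t x) = (LINT t|lborel. a t)" by (simp only: X_def)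
 have Zb: "(LINT x|lebesgue. (grad (\<lambda>y. \<phi> (t, y)) x \<bullet> u t x) * \<omega> t x) = b t" if "t \<ge> 0" for t
 proof -
  have e: "(\<lambda>x. (grad (\<lambda>y. \<phi> (t, y)) x \<bullet> u t x) * \<omega> t x) = (\<lambda>x. \<omega> t x * s t x)"
   by (rule ext) (simp add: inner_vec_def dx[OF that] s_def mult.commute)
  show ?thesis unfolding e b_def by (rule integral_completion) (use ib in auto)
 qed
 have "(LINT t:{0..}|lebesgue. LINT x|lebesgue. (grad (\<lambda>y. \<phi> (t, y)) x \<bullet> u t x) * \<omega> t x) = (LINT t|lebesgue. b t)"
  unfolding set_lebesgue_integral_def
 proof (rule Bochner_Integration.integral_cong[OF refl])
  fix t :: real
  show "indicator {0..} t *\<^sub>R (LINT x|lebesgue. (grad (\<lambda>y. \<phi> (t, y)) x \<bullet> u t x) * \<omega> t x) = b t"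
   using Zb[of t] b0[of t] by (cases "t \<ge> 0") auto
 qed
 also have "\<dots> = (LINT t|lborel. b t)" by (rule integral_completion) (use bm in simp)
 finally have 2: "(LINT t:{0..}|lebesgue. LINT x|lebesgue. (grad (\<lambda>y. \<phi> (t, y)) x \<bullet> u t x) * \<omega> t x) = (LINT t|lborel. b t)" .
 have fm: "(\<lambda>x. \<phi> (0, x)) \<in> borel_measurable lborel" using T.phi_meas[of 0] by simp
 have "(LINT x|lebesgue. \<phi> (0, x) * \<omega>0 x) = (LINT x|lebesgue. \<phi> (0, x) * w0 x)"
 proof (rule integral_cong_AE)
  show "(\<lambda>x. \<phi> (0, x) * \<omega>0 x) \<in> borel_measurable lebesgue" by (rule borel_measurable_times[OF measurable_completion[OF fm] init(1)])
  show "(\<lambda>x. \<phi> (0, x) * w0 x) \<in> borel_measurable lebesgue"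
   by (rule borel_measurable_times[OF measurable_completion[OF fm] measurable_completion]) (use vortD(1)[OF w0] in simp)
  show "AE x in lebesgue. \<phi> (0, x) * \<omega>0 x = \<phi> (0, x) * w0 x"
   by (rule AE_completion) (use init(2) in \<open>eventually_elim, simp\<close>)
 qed
 also have "\<dots> = (LINT x|lborel. \<phi> (0, x) * w0 x)"
  by (rule integral_completion) (use borel_measurable_times[OF fm, of w0] vortD(1)[OF w0] in simp)
 finally have 3: "(LINT x|lebesgue. \<phi> (0, x) * \<omega>0 x) = (LINT x|lborel. \<phi> (0, x) * w0 x)" .
 show "(LINT t:{0..}|lebesgue. LINT x|lebesgue. deriv (\<lambda>s. \<phi> (s, x)) t * \<omega> t x) +
  (LINT t:{0..}|lebesgue. LINT x|lebesgue. (grad (\<lambda>y. \<phi> (t, y)) x \<bullet> vel (Ke 0) (\<omega> t) x) * \<omega> t x) +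
  (LINT x|lebesgue. \<phi> (0, x) * \<omega>0 x) = 0"
  unfolding u_def[symmetric] 1 2 3 using ab by linarith
qed

text \<open>The part of the velocity that comes from the vorticity is bounded; the other part does not depend
 on time and lies locally in \<open>L\<^sup>q\<close>.\<close>

lemma vel_Lp_loc:
 fixes \<omega> :: "real \<Rightarrow> plane \<Rightarrow> real"
 assumes om: "(\<lambda>(t, x). \<omega> t x) \<in> borel_measurable (borel \<Otimes>\<^sub>M borel)" and ov: "\<And>t. vort p A (\<omega> t)"
  and q: "1 \<le> q" "q < 2"
 shows "(\<lambda>(t, x). vel (Ke 0) (\<omega> t) x) \<in> Lp_loc (ennreal q) S"
proof (rule spacetime_Lp_loc)
 show "(\<lambda>(t, x). vel (Ke 0) (\<omega> t) x) \<in> borel_measurable borel" using vel_joint[OF om] by (simp add: borel_prod)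
 show "q > 0" using q by simp
 fix R :: real
 let ?P = "\<lambda>x. norm (pot L g Y (Ke 0) x)"
 have [measurable]: "cball (0::plane) R \<in> sets borel" by simp
 have [measurable]: "pot L g Y (Ke 0) \<in> borel_measurable borel" by measurable
 define c where "c = ennreal ((2 * C) powr q) * emeasure lborel (cball (0::plane) R) + ennreal (2 powr q) * (\<integral>\<^sup>+x. ennreal (?P x powr q) * indicator (cball 0 R) x \<partial>lborel)"
 have cf: "c < \<infinity>" unfolding c_def using pot_Lq[OF q, of R] emeasure_lborel_cball_finite[of "0::plane" R] by (auto simp: ennreal_mult_less_top)
 have pw: "norm (vel (Ke 0) (\<omega> t) x) powr q \<le> (2 * C) powr q + 2 powr q * ?P x powr q" for t x
 proof -
  have "norm (pot lborel (\<omega> t) (\<lambda>y. y) (Ke 0) x) \<le> C" by (rule pot_le_C[OF ov borel_measurable_Ke norm_Ke_le])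
  then have n: "norm (vel (Ke 0) (\<omega> t) x) \<le> C + ?P x" unfolding vel_def by (rule order_trans[OF norm_triangle_ineq add_right_mono])
  show ?thesis
  proof (cases "?P x \<le> C")
   case True
   then have "norm (vel (Ke 0) (\<omega> t) x) powr q \<le> (2 * C) powr q" using n q by (intro powr_mono2) auto
   then show ?thesis by (simp add: add_increasing2)
  next
   case False
   then have "norm (vel (Ke 0) (\<omega> t) x) powr q \<le> (2 * ?P x) powr q" using n q by (intro powr_mono2) auto
   then show ?thesis by (simp add: powr_mult add_increasing)
  qed
 qed
 have "(\<integral>\<^sup>+x. ennreal (norm (vel (Ke 0) (\<omega> t) x) powr q) * indicator (cball 0 R) x \<partial>lborel) \<le> c" for t
 proof -
  have "(\<integral>\<^sup>+x. ennreal (norm (vel (Ke 0) (\<omega> t) x) powr q) * indicator (cball 0 R) x \<partial>lborel) \<le>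
   (\<integral>\<^sup>+x. ennreal ((2 * C) powr q) * indicator (cball 0 R) x + ennreal (2 powr q) * (ennreal (?P x powr q) * indicator (cball 0 R) x) \<partial>lborel)"
  proof (rule nn_integral_mono)
   fix x :: plane
   have "ennreal (norm (vel (Ke 0) (\<omega> t) x) powr q) \<le> ennreal ((2 * C) powr q + 2 powr q * ?P x powr q)" by (rule ennreal_leI[OF pw])
   also have "\<dots> = ennreal ((2 * C) powr q) + ennreal (2 powr q) * ennreal (?P x powr q)" by (simp add: ennreal_mult)
   finally show "ennreal (norm (vel (Ke 0) (\<omega> t) x) powr q) * indicator (cball 0 R) x \<le> ennreal ((2 * C) powr q) * indicator (cball 0 R) x + ennreal (2 powr q) * (ennreal (?P x powr q) * indicator (cball 0 R) x)"
    by (auto split: split_indicator)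
  qed
  also have "\<dots> = (\<integral>\<^sup>+x. ennreal ((2 * C) powr q) * indicator (cball (0::plane) R) x \<partial>lborel) + (\<integral>\<^sup>+x. ennreal (2 powr q) * (ennreal (?P x powr q) * indicator (cball 0 R) x) \<partial>lborel)"
   by (rule nn_integral_add) measurable
  also have "(\<integral>\<^sup>+x. ennreal ((2 * C) powr q) * indicator (cball (0::plane) R) x \<partial>lborel) = ennreal ((2 * C) powr q) * emeasure lborel (cball (0::plane) R)"
   by (rule nn_integral_cmult_indicator) simp
  also have "(\<integral>\<^sup>+x. ennreal (2 powr q) * (ennreal (?P x powr q) * indicator (cball 0 R) x) \<partial>lborel) = ennreal (2 powr q) * (\<integral>\<^sup>+x. ennreal (?P x powr q) * indicator (cball 0 R) x \<partial>lborel)"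
   by (rule nn_integral_cmult) measurable
  finally show ?thesis unfolding c_def .
 qed
 then show "\<exists>c<\<infinity>. \<forall>t. (\<integral>\<^sup>+x. ennreal (norm (case (t, x) of (t, x) \<Rightarrow> vel (Ke 0) (\<omega> t) x) powr q) * indicator (cball 0 R) x \<partial>lborel) \<le> c"
  using cf by (intro exI[of _ c]) simp
qed

end


theorem mainTheorem2:
  fixes p0 :: ennreal and \<omega>0 :: "plane \<Rightarrow> real" and \<mu> :: "plane set \<Rightarrow> real"
  assumes "2 < p0"
    and "\<omega>0 \<in> Lp_compact p0"
    and "\<mu> \<in> bounded_measures_compact"
  shows "\<exists>(u :: real \<Rightarrow> plane \<Rightarrow> plane) (\<omega> :: real \<Rightarrow> plane \<Rightarrow> real).
    weak_solution \<omega>0 \<mu> u \<omega> \<and>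
    \<omega> \<in> Linf_time_Lp 1 \<inter> Linf_time_Lp p0 \<and>
    (\<forall>t\<ge>0. is_biot_savart (u t) (density_plus (\<omega> t) \<mu>)) \<and>
    (\<forall>p::real. 1 \<le> p \<and> p < 2 \<longrightarrow> (\<lambda>(t, x). u t x) \<in> Lp_loc (ennreal p) spacetime)"
proof -
  have \<mu>: "\<mu> \<in> bounded_measures" using assms(3) by (simp add: bounded_measures_compact_def)
  obtain p A w0 where p: "p > 2" and A: "A \<ge> 0" and w0: "vort p A w0" and init: "\<omega>0 \<in> borel_measurable lebesgue" "AE x in lborel. \<omega>0 x = w0 x"
    and pp: "p0 = ennreal p \<or> (p0 = \<infinity> \<and> (\<exists>M. \<forall>x. \<bar>w0 x\<bar> \<le> M))"
    by (rule initial_vorticity[OF assms(1,2)])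
  obtain C where C0: "C \<ge> 0" and C: "\<And>w x. vort p A w \<Longrightarrow> (\<integral>\<^sup>+y. ennreal (\<bar>w y\<bar> / norm (x - y)) \<partial>lborel) \<le> ennreal C"
    using potential_bound[OF p A] by blast
  interpret J: charge "jm \<mu>" sg fst by (rule jm_charge[OF \<mu>])
  define m where "m = A + J.mass + 1"
  have m: "m > 0" "A + J.mass \<le> m"
    unfolding m_def by (rule add_nonneg_pos[OF add_nonneg_nonneg[OF A J.mass_nonneg] zero_less_one]) simp
  interpret S: scheme "jm \<mu>" sg fst p A C m w0
    by (intro scheme.intro J.charge_axioms scheme_axioms.intro p A w0 m C0 C)
  obtain \<omega> where om: "(\<lambda>(t, x). \<omega> t x) \<in> borel_measurable (borel \<Otimes>\<^sub>M borel)" and ov: "\<And>t. vort p A (\<omega> t)"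
    and sup: "\<And>B. (\<And>x. \<bar>w0 x\<bar> \<le> B) \<Longrightarrow> AE t in lborel. AE x in lborel. \<bar>\<omega> t x\<bar> \<le> B"
    and weak: "\<And>\<phi> \<phi>t d B R. tested (jm \<mu>) sg fst p A C m w0 \<phi> \<phi>t d B R \<Longrightarrow>
      (LINT t|lborel. LINT x|lborel. \<omega> t x * (\<phi>t t x + (\<Sum>i\<in>UNIV. d i t x * J.vel (Ke 0) (\<omega> t) x $ i))) = - (LINT x|lborel. \<phi> 0 x * w0 x)"
    by (rule S.limit_solution) blast
  define u where "u t = J.vel (Ke 0) (\<omega> t)" for t
  have oi: "integrable lborel (\<omega> t)" for t by (rule vort_integrable[OF ov])
  have om1: "\<omega> t \<in> borel_measurable borel" for t by (rule vortD(1)[OF ov])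
  obtain R where R: "AE b in jm \<mu>. norm (fst b) \<le> R" by (rule jm_compact[OF assms(3)])
  have decay: "((\<lambda>x. norm (u t x)) \<longlongrightarrow> 0) at_infinity" for t
    using tendsto_norm_zero[OF tendsto_add_zero[OF vort_decay[OF ov p A, of t] J.pot_decay[OF R]]]
    by (simp add: u_def J.vel_def)
  have oleb: "integrable lebesgue (\<omega> t)" for t
    using oi[of t] om1[of t] by (simp add: integrable_completion)
  have "weak_solution \<omega>0 \<mu> u \<omega>"
    unfolding weak_solution_def u_def
  proof (intro conjI allI impI)
    show "weak_transport \<omega>0 (\<lambda>t. J.vel (Ke 0) (\<omega> t)) \<omega>" by (rule S.transport[OF om ov _ init]) (rule weak)
    show "integrable lebesgue (\<omega> t)" for t by (rule oleb)
    show "distr_div_free (J.vel (Ke 0) (\<omega> t))" for t by (rule vel_constraints[OF \<mu> oi])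
    show "distr_curl_eq (J.vel (Ke 0) (\<omega> t)) (density_plus (\<omega> t) \<mu>)" for t by (rule vel_constraints[OF \<mu> oi])
    show "((\<lambda>x. norm (J.vel (Ke 0) (\<omega> t) x)) \<longlongrightarrow> 0) at_infinity" for t using decay[of t] by (simp only: u_def)
  qed
  moreover have jl: "(\<lambda>(t, x). \<omega> t x) \<in> borel_measurable (lebesgue_on spacetime)"
  proof (rule measurable_restrict_space1)
    show "(\<lambda>(t, x). \<omega> t x) \<in> borel_measurable lebesgue" using om by (intro measurable_completion) (simp add: borel_prod)
  qed
  have fin: "\<omega> \<in> Linf_time_Lp (ennreal q)" if q: "q = 1 \<or> q = p" for q
  proof -
    have q0: "q > 0" using q p by auto
    have "(\<integral>\<^sup>+x. ennreal (\<bar>\<omega> t x\<bar> powr q) \<partial>lborel) \<le> ennreal A" for t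
      using q vortD(2,3)[OF ov, of t] by auto
    from Lp_norm_bound[OF om1 q0 A this] show ?thesis
      unfolding Linf_time_Lp_def using jl by (auto intro!: exI[of _ "ennreal (A powr (1 / q))"])
  qed
  have "\<omega> \<in> Linf_time_Lp 1" using fin[of 1] by simp
  moreover have "\<omega> \<in> Linf_time_Lp p0"
    using pp
  proof
    assume "p0 = ennreal p" then show ?thesis using fin[of p] by simp
  next
    assume inf: "p0 = \<infinity> \<and> (\<exists>M. \<forall>x. \<bar>w0 x\<bar> \<le> M)"
    then obtain M where M: "\<And>x. \<bar>w0 x\<bar> \<le> M" by blast
    have "AE t in lebesgue. 0 \<le> t \<longrightarrow> \<omega> t \<in> Lp \<infinity> lebesgue \<and> Lp_norm \<infinity> lebesgue (\<omega> t) \<le> ennreal M"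
    proof (rule AE_completion, use sup[OF M] in eventually_elim)
      case (elim t)
      have ml: "\<omega> t \<in> borel_measurable lebesgue" using om1[of t] by (intro measurable_completion) simp
      have "AE x in lebesgue. ennreal (norm (\<omega> t x)) \<le> ennreal M"
        by (rule AE_completion) (use elim in \<open>eventually_elim, simp add: ennreal_leI\<close>)
      then have "esssup lebesgue (\<lambda>x. ennreal (norm (\<omega> t x))) \<le> ennreal M" using ml by (intro esssup_I) simp_all
      then have "Lp_norm \<infinity> lebesgue (\<omega> t) \<le> ennreal M" by (simp add: Lp_norm_def)
      then show ?case using ml by (auto simp: Lp_def intro: le_less_trans)
    qed
    then show ?thesis using inf jl unfolding Linf_time_Lp_def by (auto intro!: exI[of _ "ennreal M"])
  qed
  moreover have "is_biot_savart (u t) (density_plus (\<omega> t) \<mu>)" for t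
    unfolding u_def by (rule vel_constraints[OF \<mu> oi])
  moreover have "(\<lambda>(t, x). u t x) \<in> Lp_loc (ennreal q) spacetime" if "1 \<le> q" "q < 2" for q
    unfolding u_def by (rule S.vel_Lp_loc[OF om ov that])
  ultimately show ?thesis by blast
qed

end
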